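(* Let $G$ be a second countable locally compact Hausdorff groupoid with a left Haar system. Assume: (i) $G$ is locally a product; (ii) if $x\in G$, then there exists a bisection $a\in\Gamma$ such that $x\in a$. Then the map $\zeta: a\mapsto(\alpha^{a},\beta_{a})$ is a homeomorphism from $\Gamma$ to $\Phi_{A(G)}$, where $\Gamma$ and $\Phi_{A(G)}$ carry their pointwise topologies.
   Context: Conventions. Locally compact spaces are Hausdorff and second countable, Hilbert spaces are separable, and inner products are conjugate linear in the first variable. $C(X)$ denotes bounded continuous complex functions on $X$; $C_0(X)$, $C_c(X)$ those vanishing at infinity, resp. with compact support. $G$ has unit space $G^0$, range and source maps $r,s$, $G^u=r^{-1}(u)$, $G_u=s^{-1}(u)$, and a fixed left Haar system $\{\lambda^u\}_{u\in G^0}$. Put $D=C_0(G^0)$. For $f,g\in C_c(G)$: $(f*g)(x)=\int f(t)g(t^{-1}x)\,d\lambda^{r(x)}(t)$, $f^*(x)=\overline{f(x^{-1})}$, $f^\vee(x)=f(x^{-1})$. $D$ acts on functions $F$ on $G$ by $(Fb)(x)=F(x)b(r(x))$ (right action) and $(bF)(x)=b(s(x))F(x)$ (left action). $B(G)$. A $G$-Hilbert bundle is a continuous Hilbert bundle $\mathfrak H=\{\mathfrak H^u\}$ over $G^0$ (a continuous field of Hilbert spaces in Dixmier's sense) with, for each $x\in G$, a linear isometry $L_x$ of $\mathfrak H^{s(x)}$ onto $\mathfrak H^{r(x)}$ such that $x\mapsto L_x$ is a groupoid homomorphism and, for all bounded continuous sections $\xi,\eta$, the function $(\xi,\eta):x\mapsto(L_x\xi(s(x)),\eta(r(x)))$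 is continuous on $G$. $B(G)$ is the set of all such functions (coefficients) $(\xi,\eta)$, over all $G$-Hilbert bundles and bounded continuous sections $\xi,\eta$; it is a Banach algebra under pointwise operations with norm $\|\phi\|=\inf\|\xi\|\|\eta\|$ over all representations $\phi=(\xi,\eta)$, where $\|\xi\|=\sup_u\|\xi(u)\|$. $E^2$, $A(G)$, $\mathcal A(G)$. $E^2$ is the space of continuous sections vanishing at infinity of the $G$-Hilbert bundle $L^2(G)=\{L^2(G^u,\lambda^u)\}_{u\in G^0}$, whose continuous structure is the one determined by the sections $u\mapsto f^u=f|_{G^u}$, $f\in C_c(G)$, with action $(L_x\xi)(t)=\xi(x^{-1}t)$. It is a Hilbert $D$-module with norm $\sup_u\|\xi^u\|$, right action $(\xi b)(t)=\xi(t)b(r(t))$ and inner product $\langle\xi,\eta\rangle(u)=(\xi^u,\eta^u)$. $A_{cf}(G)$ is the set of coefficients $(f,g)$ of $L^2(G)$ with $f,g\in C_c(G)$. The Fourier algebra $A(G)$ is the closure in $B(G)$ of the algebra (pointwise product) generated by $A_{cf}(G)$; it is contained in $C_0(G)$. The map $f\otimes g\mapsto g*f^\vee$ ($f,g\in C_c(G)$) extends to a norm-decreasing linear map $\theta:E^2\widehat\otimes E^2\to C_0(G)$ (projective tensor product), and $\mathcal A(G)$ is $(E^2\widehat\otimes E^2)/\ker\theta$ with quotient norm $\|\cdot\|_1$, regarded as a subspace of $C_0(G)$; one has $\mathcal A(G)\subset A(G)$. $\mathcal A^r_K(G)'$. Let $\mathfrak B_D(\mathcal A(G),D)$ be the bounded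 linear right $D$-module maps $\alpha:\mathcal A(G)\to D$. For such $\alpha$ and $f\in C_c(G)$, the map $g\mapsto\alpha(g*f)$ ($g\in C_c(G)$) extends to a bounded module map $f\alpha:E^2\to D$. $\mathcal A_K^r(G)'$ is the set of $\alpha\in\mathfrak B_D(\mathcal A(G),D)$ such that $f\alpha\in\mathfrak K(E^2,D)$ for all $f\in C_c(G)$, where $\mathfrak K(E^2,D)$ denotes the compact operators between Hilbert $D$-modules (closed span of the maps $\eta\mapsto b\langle\xi,\eta\rangle$, $b\in D$, $\xi\in E^2$). $\Phi_{A(G)}$. A multiplicative module map on $A(G)$ is a pair $(\alpha,\beta)$ of bounded linear maps $A(G)\to D$ such that: (1) $\alpha$ is a right $D$-module map and $\beta$ is a left $D$-module map; (2) for each $u\in G^0$ there is $\phi\in A(G)$ with $\alpha(\phi)(u)\neq0$; (3) there is a homeomorphism $J$ of $G^0$ such that $\beta(\phi)\circ J=\alpha(\phi)$ for all $\phi\in A(G)$; (4) $\alpha|_{\mathcal A(G)}\in\mathcal A^r_K(G)'$; (5) $\alpha(\phi\psi)=\alpha(\phi)\alpha(\psi)$ for all $\phi,\psi\in A(G)$. $\Phi_{A(G)}$ is the set of these pairs. Its pointwise topology is that of pointwise convergence on $A(G)\times G^0$ of the functions $(\phi,u)\mapsto(\alpha(\phi)(u),\beta(\phi)(u))\in\mathbb C^2$. $\Gamma$. A bisection is a subset $a\subset G$ such that $r|_a:a\to G^0$ and $s|_a:a\to G^0$ are homeomorphisms; for $u\in G^0$ write $a\cap G^u=\{a^u\}$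 and $a\cap G_u=\{a_u\}$. $\Gamma$ is the set (a group under setwise product and inversion) of bisections of $G$. Its pointwise topology is that of pointwise convergence on $G^0$ of the functions $u\mapsto(a_u,a^u)\in G\times G$. For $a\in\Gamma$, $\alpha^a,\beta_a:A(G)\to D$ are defined by $\alpha^a(\phi)(u)=\phi(a^u)$, $\beta_a(\phi)(u)=\phi(a_u)$. Locally a product. $G$ is locally a product if for each $x_0\in G$ there exist an open neighborhood $U$ of $x_0$ in $G$, a locally compact Hausdorff space $Y$, a positive regular Borel measure $\mu$ on $Y$ and a homeomorphism $\Phi$ of $U$ onto $r(U)\times Y$ such that the first coordinate of $\Phi(x)$ is $r(x)$ for all $x\in U$, and for each $u\in r(U)$ the restriction $\Phi^u$ of $\Phi$ to $U\cap G^u$ (a homeomorphism onto $\{u\}\times Y\cong Y$) carries $\lambda^u|_{U\cap G^u}$ to $\mu$. *)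

theory Defs
  imports "HOL-Analysis.Analysis"
begin

section \<open>Locally compact groupoids with a left Haar system\<close>

text \<open>
  The elements of the groupoid form a whole type, whose class topology is the topology of the
  groupoid. The unit space is a subset of that type. Values of the multiplication at pairs that
  are not composable are irrelevant.
\<close>

record 'g haar_groupoid =
  gmul :: "'g \<Rightarrow> 'g \<Rightarrow> 'g" (infixl "\<cdot>\<index>" 70)
  ginv :: "'g \<Rightarrow> 'g"
  haar :: "'g \<Rightarrow> 'g measure"

definition rng :: "('g, 'z) haar_groupoid_scheme \<Rightarrow> 'g \<Rightarrow> 'g" where
  "rng G x = x \<cdot>\<^bsub>G\<^esub> ginv G x"

definition src :: "('g, 'z) haar_groupoid_scheme \<Rightarrow> 'g \<Rightarrow> 'g" where
  "src G x = ginv G x \<cdot>\<^bsub>G\<^esub> x"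

definition units :: "('g, 'z) haar_groupoid_scheme \<Rightarrow> 'g set" where
  "units G = range (rng G)"

definition is_groupoid :: "('g, 'z) haar_groupoid_scheme \<Rightarrow> bool" where
  "is_groupoid G \<longleftrightarrow>
     (\<forall>x. ginv G (ginv G x) = x) \<and>
     (\<forall>x y. src G x = rng G y \<longrightarrow>
        rng G (x \<cdot>\<^bsub>G\<^esub> y) = rng G x \<and> src G (x \<cdot>\<^bsub>G\<^esub> y) = src G y) \<and>
     (\<forall>x y z. src G x = rng G y \<and> src G y = rng G z \<longrightarrow>
        (x \<cdot>\<^bsub>G\<^esub> y) \<cdot>\<^bsub>G\<^esub> z = x \<cdot>\<^bsub>G\<^esub> (y \<cdot>\<^bsub>G\<^esub> z)) \<and>
     (\<forall>x. rng G x \<cdot>\<^bsub>G\<^esub> x = x \<and> x \<cdot>\<^bsub>G\<^esub> src G x = x)"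

definition regular_borel_measure :: "'a topology \<Rightarrow> 'a measure \<Rightarrow> bool" where
  "regular_borel_measure X M \<longleftrightarrow>
     space M = topspace X \<and>
     sets M = sigma_sets (topspace X) {V. openin X V} \<and>
     (\<forall>K. compactin X K \<longrightarrow> emeasure M K < \<infinity>) \<and>
     (\<forall>A\<in>sets M. emeasure M A = (INF V\<in>{V. openin X V \<and> A \<subseteq> V}. emeasure M V)) \<and>
     (\<forall>V. openin X V \<longrightarrow>
        emeasure M V = (SUP K\<in>{K. compactin X K \<and> K \<subseteq> V}. emeasure M K))"

definition Cc :: "('g::topological_space \<Rightarrow> complex) set" where
  "Cc = {f. continuous_on UNIV f \<and> compact (closure {x. f x \<noteq> 0})}"

text \<open>
  Functions in \<open>C0 S\<close> are extended by \<open>0\<close> outside \<open>S\<close>, so that equality in \<open>C0 S\<close> is equality on \<open>S\<close>.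
\<close>

definition C0 :: "'g::topological_space set \<Rightarrow> ('g \<Rightarrow> complex) set" where
  "C0 S = {f. continuous_on S f \<and>
     (\<forall>e>0. \<exists>K. compact K \<and> K \<subseteq> S \<and> (\<forall>x\<in>S - K. cmod (f x) < e)) \<and>
     (\<forall>x. x \<notin> S \<longrightarrow> f x = 0)}"

definition left_haar_system :: "('g::topological_space, 'z) haar_groupoid_scheme \<Rightarrow> bool" where
  "left_haar_system G \<longleftrightarrow>
     (\<forall>u\<in>units G. regular_borel_measure (top_of_set {x. rng G x = u}) (haar G u)) \<and>
     (\<forall>u\<in>units G. \<forall>V. open V \<and> V \<inter> {x. rng G x = u} \<noteq> {} \<longrightarrow>
        emeasure (haar G u) (V \<inter> {x. rng G x = u}) > 0) \<and>
     (\<forall>f\<in>Cc. continuous_on (units G) (\<lambda>u. \<integral>t. f t \<partial>haar G u)) \<and>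
     (\<forall>f\<in>Cc. \<forall>x. (\<integral>t. f (x \<cdot>\<^bsub>G\<^esub> t) \<partial>haar G (src G x)) = (\<integral>t. f t \<partial>haar G (rng G x)))"

definition lc_haar_groupoid :: "('g::t2_space, 'z) haar_groupoid_scheme \<Rightarrow> bool" where
  "lc_haar_groupoid G \<longleftrightarrow>
     is_groupoid G \<and>
     locally_compact_space (euclidean :: 'g topology) \<and>
     continuous_on {(x, y). src G x = rng G y} (\<lambda>(x, y). x \<cdot>\<^bsub>G\<^esub> y) \<and>
     continuous_on UNIV (ginv G) \<and>
     left_haar_system G"

text \<open>
  The space \<open>Y\<close> may be taken to have its points in \<^typ>\<open>'g\<close>: it is homeomorphic to
  the subspace of \<open>U\<close> on which \<open>r\<close> takes the value \<open>r x0\<close>.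
\<close>

definition locally_a_product :: "('g::topological_space, 'z) haar_groupoid_scheme \<Rightarrow> bool" where
  "locally_a_product G \<longleftrightarrow>
     (\<forall>x0. \<exists>U (Y :: 'g topology) \<mu> \<Phi>.
        open U \<and> x0 \<in> U \<and>
        locally_compact_space Y \<and> Hausdorff_space Y \<and> regular_borel_measure Y \<mu> \<and>
        homeomorphic_map (top_of_set U) (prod_topology (top_of_set (rng G ` U)) Y) \<Phi> \<and>
        (\<forall>x\<in>U. fst (\<Phi> x) = rng G x) \<and>
        (\<forall>u\<in>rng G ` U. distr (restrict_space (haar G u) U) \<mu> (snd \<circ> \<Phi>) = \<mu>))"


section \<open>Spaces of complex functions\<close>

text \<open>
  All spaces below are subspaces \<open>E\<close> of \<^typ>\<open>'a \<Rightarrow> complex\<close> with a (semi)norm \<open>nE\<close>.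
\<close>

definition sup_norm :: "'a set \<Rightarrow> ('a \<Rightarrow> complex) \<Rightarrow> real" where
  "sup_norm S f = (SUP x\<in>S. cmod (f x))"

definition bounded_linear_map ::
  "('a \<Rightarrow> complex) set \<Rightarrow> (('a \<Rightarrow> complex) \<Rightarrow> real) \<Rightarrow>
   ('b \<Rightarrow> complex) set \<Rightarrow> (('b \<Rightarrow> complex) \<Rightarrow> real) \<Rightarrow>
   (('a \<Rightarrow> complex) \<Rightarrow> ('b \<Rightarrow> complex)) \<Rightarrow> bool" where
  "bounded_linear_map E nE F nF T \<longleftrightarrow>
     (\<forall>x\<in>E. T x \<in> F) \<and>
     (\<forall>x\<in>E. \<forall>y\<in>E. T (\<lambda>t. x t + y t) = (\<lambda>t. T x t + T y t)) \<and>
     (\<forall>c. \<forall>x\<in>E. T (\<lambda>t. c * x t) = (\<lambda>t. c * T x t)) \<and>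
     (\<exists>C. \<forall>x\<in>E. nF (T x) \<le> C * nE x)"

text \<open>
  A finite list of pairs stands for the sum of the corresponding elementary tensors. Two lists are
  equal in the algebraic tensor product of \<open>E\<close> with itself iff every bilinear form takes the same
  value on them. Bilinear forms on the normed space associated with the seminorm \<open>nE\<close> are those
  that vanish as soon as one argument has seminorm \<open>0\<close>.
\<close>

definition bilinear_form ::
  "('a \<Rightarrow> complex) set \<Rightarrow> (('a \<Rightarrow> complex) \<Rightarrow> real) \<Rightarrow>
   (('a \<Rightarrow> complex) \<Rightarrow> ('a \<Rightarrow> complex) \<Rightarrow> complex) \<Rightarrow> bool" where
  "bilinear_form E nE B \<longleftrightarrow>
     (\<forall>x\<in>E. \<forall>y\<in>E. \<forall>z\<in>E. B (\<lambda>t. x t + y t) z = B x z + B y z \<and>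
                        B z (\<lambda>t. x t + y t) = B z x + B z y) \<and>
     (\<forall>c. \<forall>x\<in>E. \<forall>y\<in>E. B (\<lambda>t. c * x t) y = c * B x y \<and> B x (\<lambda>t. c * y t) = c * B x y) \<and>
     (\<forall>x\<in>E. \<forall>y\<in>E. nE x = 0 \<or> nE y = 0 \<longrightarrow> B x y = 0)"

type_synonym 'a ftensor = "(('a \<Rightarrow> complex) \<times> ('a \<Rightarrow> complex)) list"

definition tensor_eq ::
  "('a \<Rightarrow> complex) set \<Rightarrow> (('a \<Rightarrow> complex) \<Rightarrow> real) \<Rightarrow> 'a ftensor \<Rightarrow> 'a ftensor \<Rightarrow> bool" where
  "tensor_eq E nE zs ws \<longleftrightarrow>
     (\<forall>B. bilinear_form E nE B \<longrightarrow> (\<Sum>(x, y)\<leftarrow>zs. B x y) = (\<Sum>(x, y)\<leftarrow>ws. B x y))"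

definition proj_norm ::
  "('a \<Rightarrow> complex) set \<Rightarrow> (('a \<Rightarrow> complex) \<Rightarrow> real) \<Rightarrow> 'a ftensor \<Rightarrow> real" where
  "proj_norm E nE zs =
     Inf {(\<Sum>(x, y)\<leftarrow>ws. nE x * nE y) | ws. set ws \<subseteq> E \<times> E \<and> tensor_eq E nE ws zs}"

definition tensor_diff :: "'a ftensor \<Rightarrow> 'a ftensor \<Rightarrow> 'a ftensor" where
  "tensor_diff zs ws = zs @ map (\<lambda>(x, y). (\<lambda>t. - x t, y)) ws"

text \<open>
  Points of the completed projective tensor product are given by Cauchy sequences \<open>Z\<close>; the norm
  of such a point is \<^term>\<open>lim (\<lambda>n. proj_norm E nE (Z n))\<close>.
\<close>

definition proj_Cauchy ::
  "('a \<Rightarrow> complex) set \<Rightarrow> (('a \<Rightarrow> complex) \<Rightarrow> real) \<Rightarrow> (nat \<Rightarrow> 'a ftensor) \<Rightarrow> bool" where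
  "proj_Cauchy E nE Z \<longleftrightarrow>
     (\<forall>n. set (Z n) \<subseteq> E \<times> E) \<and>
     (\<forall>e>0. \<exists>N. \<forall>m\<ge>N. \<forall>n\<ge>N. proj_norm E nE (tensor_diff (Z m) (Z n)) < e)"


section \<open>The Fourier-Stieltjes algebra\<close>

text \<open>
  Hilbert spaces are separable, hence unitarily equivalent to closed subspaces of the space of square
  summable sequences. Since coefficients and norms of sections are preserved by
  fibrewise unitaries, it suffices to consider bundles whose fibres are such subspaces.
\<close>

definition ell2 :: "(nat \<Rightarrow> complex) set" where
  "ell2 = {x. summable (\<lambda>n. (cmod (x n))\<^sup>2)}"

definition ell2_inner :: "(nat \<Rightarrow> complex) \<Rightarrow> (nat \<Rightarrow> complex) \<Rightarrow> complex" where
  "ell2_inner x y = (\<Sum>n. cnj (x n) * y n)"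

definition ell2_norm :: "(nat \<Rightarrow> complex) \<Rightarrow> real" where
  "ell2_norm x = sqrt (\<Sum>n. (cmod (x n))\<^sup>2)"

definition ell2_closed_subspace :: "(nat \<Rightarrow> complex) set \<Rightarrow> bool" where
  "ell2_closed_subspace H \<longleftrightarrow>
     H \<subseteq> ell2 \<and> (\<lambda>n. 0) \<in> H \<and>
     (\<forall>x\<in>H. \<forall>y\<in>H. (\<lambda>n. x n + y n) \<in> H) \<and>
     (\<forall>c. \<forall>x\<in>H. (\<lambda>n. c * x n) \<in> H) \<and>
     (\<forall>x\<in>ell2. (\<forall>e>0. \<exists>y\<in>H. ell2_norm (\<lambda>n. x n - y n) < e) \<longrightarrow> x \<in> H)"

text \<open>
  A continuous field of Hilbert spaces over \<open>S\<close>, with fibres \<open>H u\<close> and continuous sections \<open>\<S>\<close>.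
  Values of sections outside \<open>S\<close> are irrelevant: by the last condition \<open>\<S>\<close> does not depend on them.
\<close>

definition continuous_hilbert_field ::
  "'g::topological_space set \<Rightarrow> ('g \<Rightarrow> (nat \<Rightarrow> complex) set) \<Rightarrow> ('g \<Rightarrow> nat \<Rightarrow> complex) set \<Rightarrow> bool" where
  "continuous_hilbert_field S H \<S> \<longleftrightarrow>
     (\<forall>u\<in>S. ell2_closed_subspace (H u)) \<and>
     \<S> \<subseteq> Pi S H \<and>
     (\<lambda>u n. 0) \<in> \<S> \<and>
     (\<forall>\<xi>\<in>\<S>. \<forall>\<eta>\<in>\<S>. (\<lambda>u n. \<xi> u n + \<eta> u n) \<in> \<S>) \<and>
     (\<forall>c. \<forall>\<xi>\<in>\<S>. (\<lambda>u n. c * \<xi> u n) \<in> \<S>) \<and>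
     (\<forall>u\<in>S. \<forall>h\<in>H u. \<forall>e>0. \<exists>\<xi>\<in>\<S>. ell2_norm (\<lambda>n. \<xi> u n - h n) < e) \<and>
     (\<forall>\<xi>\<in>\<S>. continuous_on S (\<lambda>u. ell2_norm (\<xi> u))) \<and>
     (\<forall>\<xi>\<in>Pi S H.
        (\<forall>u\<in>S. \<forall>e>0. \<exists>\<eta>\<in>\<S>. \<exists>V. open V \<and> u \<in> V \<and>
           (\<forall>v\<in>V \<inter> S. ell2_norm (\<lambda>n. \<xi> v n - \<eta> v n) \<le> e)) \<longrightarrow> \<xi> \<in> \<S>)"

definition bounded_sections ::
  "'g set \<Rightarrow> ('g \<Rightarrow> nat \<Rightarrow> complex) set \<Rightarrow> ('g \<Rightarrow> nat \<Rightarrow> complex) set" where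
  "bounded_sections S \<S> = {\<xi>\<in>\<S>. bdd_above ((\<lambda>u. ell2_norm (\<xi> u)) ` S)}"

definition coefficient ::
  "('g, 'z) haar_groupoid_scheme \<Rightarrow> ('g \<Rightarrow> (nat \<Rightarrow> complex) \<Rightarrow> (nat \<Rightarrow> complex)) \<Rightarrow>
   ('g \<Rightarrow> nat \<Rightarrow> complex) \<Rightarrow> ('g \<Rightarrow> nat \<Rightarrow> complex) \<Rightarrow> 'g \<Rightarrow> complex" where
  "coefficient G L \<xi> \<eta> = (\<lambda>x. ell2_inner (L x (\<xi> (src G x))) (\<eta> (rng G x)))"

definition G_hilbert_bundle ::
  "('g::topological_space, 'z) haar_groupoid_scheme \<Rightarrow> ('g \<Rightarrow> (nat \<Rightarrow> complex) set) \<Rightarrow>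
   ('g \<Rightarrow> nat \<Rightarrow> complex) set \<Rightarrow> ('g \<Rightarrow> (nat \<Rightarrow> complex) \<Rightarrow> (nat \<Rightarrow> complex)) \<Rightarrow> bool" where
  "G_hilbert_bundle G H \<S> L \<longleftrightarrow>
     continuous_hilbert_field (units G) H \<S> \<and>
     (\<forall>x. L x ` H (src G x) = H (rng G x) \<and>
        (\<forall>h\<in>H (src G x). \<forall>k\<in>H (src G x). L x (\<lambda>n. h n + k n) = (\<lambda>n. L x h n + L x k n)) \<and>
        (\<forall>c. \<forall>h\<in>H (src G x). L x (\<lambda>n. c * h n) = (\<lambda>n. c * L x h n)) \<and>
        (\<forall>h\<in>H (src G x). ell2_norm (L x h) = ell2_norm h)) \<and>
     (\<forall>x y. src G x = rng G y \<longrightarrow> (\<forall>h\<in>H (src G y). L (x \<cdot>\<^bsub>G\<^esub> y) h = L x (L y h))) \<and>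
     (\<forall>\<xi>\<in>bounded_sections (units G) \<S>. \<forall>\<eta>\<in>bounded_sections (units G) \<S>.
        continuous_on UNIV (coefficient G L \<xi> \<eta>))"

definition section_norm :: "'g set \<Rightarrow> ('g \<Rightarrow> nat \<Rightarrow> complex) \<Rightarrow> real" where
  "section_norm S \<xi> = (SUP u\<in>S. ell2_norm (\<xi> u))"

definition B_alg :: "('g::topological_space, 'z) haar_groupoid_scheme \<Rightarrow> ('g \<Rightarrow> complex) set" where
  "B_alg G = {coefficient G L \<xi> \<eta> | H \<S> L \<xi> \<eta>. G_hilbert_bundle G H \<S> L \<and>
     \<xi> \<in> bounded_sections (units G) \<S> \<and> \<eta> \<in> bounded_sections (units G) \<S>}"

definition B_norm :: "('g::topological_space, 'z) haar_groupoid_scheme \<Rightarrow> ('g \<Rightarrow> complex) \<Rightarrow> real" where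
  "B_norm G \<phi> = Inf {section_norm (units G) \<xi> * section_norm (units G) \<eta> | H \<S> L \<xi> \<eta>.
     G_hilbert_bundle G H \<S> L \<and>
     \<xi> \<in> bounded_sections (units G) \<S> \<and> \<eta> \<in> bounded_sections (units G) \<S> \<and>
     \<phi> = coefficient G L \<xi> \<eta>}"


section \<open>The Hilbert module \<open>E\<^sup>2\<close> and the Fourier algebras\<close>

text \<open>
  A section of the bundle of the spaces \<open>L\<^sup>2(G\<^sup>u, \<lambda>\<^sup>u)\<close> is given by a single function \<open>\<xi>\<close> on the
  groupoid, whose value at \<open>u\<close> is the class of the restriction of \<open>\<xi>\<close> to \<open>G\<^sup>u\<close>. Functions are
  not identified when they agree almost everywhere on each \<open>G\<^sup>u\<close>; thus \<open>E2_norm\<close> is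
  a seminorm, and \<open>E2\<close> stands for the associated normed space.
\<close>

definition L2_inner ::
  "('g, 'z) haar_groupoid_scheme \<Rightarrow> 'g \<Rightarrow> ('g \<Rightarrow> complex) \<Rightarrow> ('g \<Rightarrow> complex) \<Rightarrow> complex" where
  "L2_inner G u \<xi> \<eta> = (\<integral>t. cnj (\<xi> t) * \<eta> t \<partial>haar G u)"

definition L2_norm :: "('g, 'z) haar_groupoid_scheme \<Rightarrow> 'g \<Rightarrow> ('g \<Rightarrow> complex) \<Rightarrow> real" where
  "L2_norm G u \<xi> = sqrt (\<integral>t. (cmod (\<xi> t))\<^sup>2 \<partial>haar G u)"

text \<open>
  The second condition says that \<open>\<xi>\<close> belongs to the continuous field generated by \<open>Cc\<close>,
  i.e. it is locally a uniform limit of sections given by functions in \<open>Cc\<close>.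
\<close>

definition E2 :: "('g::topological_space, 'z) haar_groupoid_scheme \<Rightarrow> ('g \<Rightarrow> complex) set" where
  "E2 G = {\<xi>.
     (\<forall>u\<in>units G. \<xi> \<in> borel_measurable (haar G u) \<and> integrable (haar G u) (\<lambda>t. (cmod (\<xi> t))\<^sup>2)) \<and>
     (\<forall>u\<in>units G. \<forall>e>0. \<exists>f\<in>Cc. \<exists>V. open V \<and> u \<in> V \<and>
        (\<forall>v\<in>V \<inter> units G. L2_norm G v (\<lambda>t. \<xi> t - f t) \<le> e)) \<and>
     (\<forall>e>0. \<exists>K. compact K \<and> K \<subseteq> units G \<and> (\<forall>u\<in>units G - K. L2_norm G u \<xi> < e))}"

definition E2_norm :: "('g, 'z) haar_groupoid_scheme \<Rightarrow> ('g \<Rightarrow> complex) \<Rightarrow> real" where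
  "E2_norm G \<xi> = (SUP u\<in>units G. L2_norm G u \<xi>)"

definition conv ::
  "('g, 'z) haar_groupoid_scheme \<Rightarrow> ('g \<Rightarrow> complex) \<Rightarrow> ('g \<Rightarrow> complex) \<Rightarrow> 'g \<Rightarrow> complex" where
  "conv G f g = (\<lambda>x. \<integral>t. f t * g (ginv G t \<cdot>\<^bsub>G\<^esub> x) \<partial>haar G (rng G x))"

definition check :: "('g, 'z) haar_groupoid_scheme \<Rightarrow> ('g \<Rightarrow> complex) \<Rightarrow> 'g \<Rightarrow> complex" where
  "check G f = (\<lambda>x. f (ginv G x))"

text \<open>The coefficients of the left regular bundle given by functions in \<open>Cc\<close>.\<close>

definition A_cf :: "('g::topological_space, 'z) haar_groupoid_scheme \<Rightarrow> ('g \<Rightarrow> complex) set" where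
  "A_cf G = {(\<lambda>x. L2_inner G (rng G x) (\<lambda>t. f (ginv G x \<cdot>\<^bsub>G\<^esub> t)) g) | f g. f \<in> Cc \<and> g \<in> Cc}"

inductive_set A_cf_alg :: "('g::topological_space, 'z) haar_groupoid_scheme \<Rightarrow> ('g \<Rightarrow> complex) set"
  for G :: "('g::topological_space, 'z) haar_groupoid_scheme" where
  gen: "\<phi> \<in> A_cf G \<Longrightarrow> \<phi> \<in> A_cf_alg G"
| add: "\<phi> \<in> A_cf_alg G \<Longrightarrow> \<psi> \<in> A_cf_alg G \<Longrightarrow> (\<lambda>x. \<phi> x + \<psi> x) \<in> A_cf_alg G"
| scale: "\<phi> \<in> A_cf_alg G \<Longrightarrow> (\<lambda>x. c * \<phi> x) \<in> A_cf_alg G"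
| mult: "\<phi> \<in> A_cf_alg G \<Longrightarrow> \<psi> \<in> A_cf_alg G \<Longrightarrow> (\<lambda>x. \<phi> x * \<psi> x) \<in> A_cf_alg G"

definition fourier_alg :: "('g::topological_space, 'z) haar_groupoid_scheme \<Rightarrow> ('g \<Rightarrow> complex) set" where
  "fourier_alg G = {\<phi>\<in>B_alg G. \<forall>e>0. \<exists>\<psi>\<in>A_cf_alg G. B_norm G (\<lambda>x. \<phi> x - \<psi> x) < e}"

text \<open>
  On an elementary tensor \<open>f \<otimes> g\<close> with \<open>f\<close> and \<open>g\<close> in \<open>E2\<close>, the extension of \<open>\<theta>\<close> is still given by
  the convolution integral, which converges by the Cauchy-Schwarz inequality. On the completed tensor
  product it is given by uniform limits, as \<open>\<theta>\<close> is norm-decreasing.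
\<close>

definition theta :: "('g, 'z) haar_groupoid_scheme \<Rightarrow> 'g ftensor \<Rightarrow> 'g \<Rightarrow> complex" where
  "theta G zs = (\<lambda>x. \<Sum>(f, g)\<leftarrow>zs. conv G g (check G f) x)"

definition theta_preimage ::
  "('g::topological_space, 'z) haar_groupoid_scheme \<Rightarrow> ('g \<Rightarrow> complex) \<Rightarrow> (nat \<Rightarrow> 'g ftensor) set" where
  "theta_preimage G \<phi> =
     {Z. proj_Cauchy (E2 G) (E2_norm G) Z \<and> uniform_limit UNIV (\<lambda>n. theta G (Z n)) \<phi> sequentially}"

definition calA :: "('g::topological_space, 'z) haar_groupoid_scheme \<Rightarrow> ('g \<Rightarrow> complex) set" where
  "calA G = {\<phi>. theta_preimage G \<phi> \<noteq> {}}"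

definition calA_norm :: "('g::topological_space, 'z) haar_groupoid_scheme \<Rightarrow> ('g \<Rightarrow> complex) \<Rightarrow> real" where
  "calA_norm G \<phi> =
     Inf ((\<lambda>Z. lim (\<lambda>n. proj_norm (E2 G) (E2_norm G) (Z n))) ` theta_preimage G \<phi>)"


section \<open>Multiplicative module maps\<close>

abbreviation D :: "('g::topological_space, 'z) haar_groupoid_scheme \<Rightarrow> ('g \<Rightarrow> complex) set" where
  "D G \<equiv> C0 (units G)"

abbreviation D_norm :: "('g, 'z) haar_groupoid_scheme \<Rightarrow> ('g \<Rightarrow> complex) \<Rightarrow> real" where
  "D_norm G \<equiv> sup_norm (units G)"

definition right_module_map ::
  "('g::topological_space, 'z) haar_groupoid_scheme \<Rightarrow> ('g \<Rightarrow> complex) set \<Rightarrow>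
   (('g \<Rightarrow> complex) \<Rightarrow> ('g \<Rightarrow> complex)) \<Rightarrow> bool" where
  "right_module_map G E T \<longleftrightarrow>
     (\<forall>F\<in>E. \<forall>b\<in>D G. T (\<lambda>x. F x * b (rng G x)) = (\<lambda>u. T F u * b u))"

definition left_module_map ::
  "('g::topological_space, 'z) haar_groupoid_scheme \<Rightarrow> ('g \<Rightarrow> complex) set \<Rightarrow>
   (('g \<Rightarrow> complex) \<Rightarrow> ('g \<Rightarrow> complex)) \<Rightarrow> bool" where
  "left_module_map G E T \<longleftrightarrow>
     (\<forall>F\<in>E. \<forall>b\<in>D G. T (\<lambda>x. b (src G x) * F x) = (\<lambda>u. b u * T F u))"

text \<open>
  Compact operators from \<open>E2\<close> to \<open>D\<close>: operator norm limits of finite sums of the maps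
  taking \<open>\<eta>\<close> to \<open>b\<langle>\<xi>,\<eta>\<rangle>\<close>.
\<close>

definition compact_module_map ::
  "('g::topological_space, 'z) haar_groupoid_scheme \<Rightarrow> (('g \<Rightarrow> complex) \<Rightarrow> ('g \<Rightarrow> complex)) \<Rightarrow> bool" where
  "compact_module_map G T \<longleftrightarrow>
     bounded_linear_map (E2 G) (E2_norm G) (D G) (D_norm G) T \<and>
     right_module_map G (E2 G) T \<and>
     (\<forall>e>0. \<exists>(n::nat) b \<xi>. (\<forall>i<n. b i \<in> D G \<and> \<xi> i \<in> E2 G) \<and>
        (\<forall>\<eta>\<in>E2 G. D_norm G (\<lambda>u. T \<eta> u - (\<Sum>i<n. b i u * L2_inner G u (\<xi> i) \<eta>)) \<le> e * E2_norm G \<eta>))"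

text \<open>
  The map \<open>T\<close> below is the unique bounded extension to \<open>E2\<close> of the map taking \<open>g\<close> to \<open>\<alpha> (g * f)\<close>.
\<close>

definition calA_K_dual ::
  "('g::topological_space, 'z) haar_groupoid_scheme \<Rightarrow> (('g \<Rightarrow> complex) \<Rightarrow> ('g \<Rightarrow> complex)) set" where
  "calA_K_dual G = {\<alpha>.
     bounded_linear_map (calA G) (calA_norm G) (D G) (D_norm G) \<alpha> \<and>
     right_module_map G (calA G) \<alpha> \<and>
     (\<forall>f\<in>Cc. \<exists>T. compact_module_map G T \<and> (\<forall>g\<in>Cc. T g = \<alpha> (conv G g f)))}"

definition mult_module_maps ::
  "('g::topological_space, 'z) haar_groupoid_scheme \<Rightarrow>
   ((('g \<Rightarrow> complex) \<Rightarrow> ('g \<Rightarrow> complex)) \<times> (('g \<Rightarrow> complex) \<Rightarrow> ('g \<Rightarrow> complex))) set" where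
  "mult_module_maps G = {(\<alpha>, \<beta>).
     \<alpha> \<in> extensional (fourier_alg G) \<and> \<beta> \<in> extensional (fourier_alg G) \<and>
     bounded_linear_map (fourier_alg G) (B_norm G) (D G) (D_norm G) \<alpha> \<and>
     bounded_linear_map (fourier_alg G) (B_norm G) (D G) (D_norm G) \<beta> \<and>
     right_module_map G (fourier_alg G) \<alpha> \<and>
     left_module_map G (fourier_alg G) \<beta> \<and>
     (\<forall>u\<in>units G. \<exists>\<phi>\<in>fourier_alg G. \<alpha> \<phi> u \<noteq> 0) \<and>
     (\<exists>J. homeomorphic_map (top_of_set (units G)) (top_of_set (units G)) J \<and>
        (\<forall>\<phi>\<in>fourier_alg G. \<forall>u\<in>units G. \<beta> \<phi> (J u) = \<alpha> \<phi> u)) \<and>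
     restrict \<alpha> (calA G) \<in> calA_K_dual G \<and>
     (\<forall>\<phi>\<in>fourier_alg G. \<forall>\<psi>\<in>fourier_alg G. \<alpha> (\<lambda>x. \<phi> x * \<psi> x) = (\<lambda>u. \<alpha> \<phi> u * \<alpha> \<psi> u))}"

definition mult_module_maps_topology ::
  "('g::topological_space, 'z) haar_groupoid_scheme \<Rightarrow>
   ((('g \<Rightarrow> complex) \<Rightarrow> ('g \<Rightarrow> complex)) \<times> (('g \<Rightarrow> complex) \<Rightarrow> ('g \<Rightarrow> complex))) topology" where
  "mult_module_maps_topology G =
     pullback_topology (mult_module_maps G)
       (\<lambda>(\<alpha>, \<beta>). \<lambda>(\<phi>, u)\<in>fourier_alg G \<times> units G. (\<alpha> \<phi> u, \<beta> \<phi> u))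
       (product_topology (\<lambda>_. euclidean) (fourier_alg G \<times> units G))"


section \<open>Bisections\<close>

definition bisections :: "('g::topological_space, 'z) haar_groupoid_scheme \<Rightarrow> 'g set set" where
  "bisections G = {a. homeomorphic_map (top_of_set a) (top_of_set (units G)) (rng G) \<and>
     homeomorphic_map (top_of_set a) (top_of_set (units G)) (src G)}"

definition at_rng :: "('g, 'z) haar_groupoid_scheme \<Rightarrow> 'g set \<Rightarrow> 'g \<Rightarrow> 'g" where
  "at_rng G a u = (THE x. x \<in> a \<and> rng G x = u)"

definition at_src :: "('g, 'z) haar_groupoid_scheme \<Rightarrow> 'g set \<Rightarrow> 'g \<Rightarrow> 'g" where
  "at_src G a u = (THE x. x \<in> a \<and> src G x = u)"

definition bisections_topology :: "('g::topological_space, 'z) haar_groupoid_scheme \<Rightarrow> 'g set topology" where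
  "bisections_topology G =
     pullback_topology (bisections G)
       (\<lambda>a. \<lambda>u\<in>units G. (at_src G a u, at_rng G a u))
       (product_topology (\<lambda>_. euclidean) (units G))"

definition zeta ::
  "('g::topological_space, 'z) haar_groupoid_scheme \<Rightarrow> 'g set \<Rightarrow>
   (('g \<Rightarrow> complex) \<Rightarrow> ('g \<Rightarrow> complex)) \<times> (('g \<Rightarrow> complex) \<Rightarrow> ('g \<Rightarrow> complex))" where
  "zeta G a =
     ((\<lambda>\<phi>\<in>fourier_alg G. \<lambda>u. if u \<in> units G then \<phi> (at_rng G a u) else 0),
      (\<lambda>\<phi>\<in>fourier_alg G. \<lambda>u. if u \<in> units G then \<phi> (at_src G a u) else 0))"

end

theory Submission
  imports Defs
begin

text \<open>
  The main point is surjectivity. Given \<open>(\<alpha>, \<beta>)\<close> and a unit \<open>u\<close>, the functional \<open>\<chi> \<phi> = \<alpha> \<phi> u\<close> is a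
  bounded character of the Fourier algebra with \<open>\<chi> (\<phi> b) = \<chi> \<phi> b(u)\<close> for \<open>b\<close> in \<open>D\<close>. Since compactly supported
  functions are dense, compactness of the support and multiplicativity give a point \<open>x\<close> over \<open>u\<close> such that \<open>\<chi>\<close> kills
  every function vanishing near \<open>x\<close>. Let \<open>\<phi>\<close> be a coefficient of the regular bundle and let \<open>\<psi>\<close> be
  another one that equals \<open>1\<close> near \<open>x\<close>, with bounded norm and supported close to \<open>x\<close>. Then
  \<open>\<chi> \<psi> = 1\<close>, and the product \<open>\<phi> \<psi>\<close> is a coefficient of the \<open>L\<^sup>2\<close> bundle of the composable pairs, in which it
  can be compared with \<open>\<phi>(x) \<psi>\<close>; hence \<open>\<chi> \<phi> = \<chi> (\<phi> \<psi>) = \<phi>(x)\<close>.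
  The point \<open>x\<close> depends continuously on \<open>u\<close>, because coefficients separate points from closed sets, and
  the left module property of \<open>\<beta>\<close> identifies its source with \<open>J u\<close>. So these points form a bisection.
  Separation also yields injectivity and the continuity of the inverse.

  Conversely, for a bisection \<open>a\<close> the value of \<open>\<eta> * f\<close> at the point of \<open>a\<close> over \<open>u\<close> is the inner product of \<open>\<eta>\<close>
  with the conjugate of \<open>t \<mapsto> f(t\<^sup>-\<^sup>1 a\<^sup>r\<^sup>(\<^sup>t\<^sup>))\<close>, a function of compact support; this gives compactness.
\<close>

section \<open>Functions with compact support\<close>

text \<open>The norm of B(G) is an infimum over all bundles, so each property of it must be
  witnessed by a bundle: tensor products for submultiplicativity, direct sums for the triangle
  inequality. Completeness is what places coefficients of elements of \<open>E2 G\<close> and the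
  limits that make up \<open>calA G\<close> inside the Fourier algebra. Fibres have to be subspaces
  of \<open>ell2\<close>, but a continuous choice of coordinates never has to be made: continuity of
  a bundle is expressed by inner products alone.

  In the evaluation of a character, the difference of \<phi> \<psi> and \<phi>(x) \<psi> has to be
  small in the norm of B(G), not just uniformly. It is a small factor times the norms of the two
  functions that define the peak function \<psi>, and these vary without bound as the supports
  shrink. Only a bound on their product that is the same for all neighbourhoods, here 16, keeps the
  difference small.\<close>

lemma Cc_iff:
  fixes f :: "'a::t2_space \<Rightarrow> complex"
  shows "f \<in> Cc \<longleftrightarrow> continuous_on UNIV f \<and> (\<exists>K. compact K \<and> (\<forall>x. x \<notin> K \<longrightarrow> f x = 0))"
proof
  assume "f \<in> Cc"
  then show "continuous_on UNIV f \<and> (\<exists>K. compact K \<and> (\<forall>x. x \<notin> K \<longrightarrow> f x = 0))"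
    unfolding Cc_def using closure_subset[of "{x. f x \<noteq> 0}"] by blast
next
  assume A: "continuous_on UNIV f \<and> (\<exists>K. compact K \<and> (\<forall>x. x \<notin> K \<longrightarrow> f x = 0))"
  then obtain K where K: "compact K" "\<forall>x. x \<notin> K \<longrightarrow> f x = 0" by blast
  have "closure {x. f x \<noteq> 0} \<subseteq> K"
    using K by (intro closure_minimal compact_imp_closed) auto
  then have "compact (closure {x. f x \<noteq> 0})"
    using compact_Int_closed[OF K(1), of "closure {x. f x \<noteq> 0}"] by (simp add: Int_absorb1)
  then show "f \<in> Cc" using A by (simp add: Cc_def)
qed

lemma CcI:
  fixes f :: "'a::t2_space \<Rightarrow> complex"
  assumes "continuous_on UNIV f" "compact K" "\<And>x. x \<notin> K \<Longrightarrow> f x = 0"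
  shows "f \<in> Cc"
  using assms Cc_iff by blast

lemma CcE:
  fixes f :: "'a::t2_space \<Rightarrow> complex"
  assumes "f \<in> Cc"
  obtains K where "compact K" "\<And>x. x \<notin> K \<Longrightarrow> f x = 0"
  using assms Cc_iff by blast

lemma Cc_cont: "f \<in> Cc \<Longrightarrow> continuous_on A f"
  using continuous_on_subset unfolding Cc_def by blast

lemma Cc_mult_cont:
  fixes f :: "'a::t2_space \<Rightarrow> complex"
  assumes "f \<in> Cc" "continuous_on UNIV g"
  shows "(\<lambda>x. f x * g x) \<in> Cc" "(\<lambda>x. g x * f x) \<in> Cc"
proof -
  obtain K where "compact K" "\<And>x. x \<notin> K \<Longrightarrow> f x = 0" using CcE[OF assms(1)] by blast
  then show "(\<lambda>x. f x * g x) \<in> Cc" "(\<lambda>x. g x * f x) \<in> Cc"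
    using assms Cc_cont by (auto intro!: CcI[of _ K] continuous_intros)
qed

lemma Cc_add:
  fixes f :: "'a::t2_space \<Rightarrow> complex"
  assumes "f \<in> Cc" "g \<in> Cc"
  shows "(\<lambda>x. f x + g x) \<in> Cc"
proof -
  obtain K where "compact K" "\<And>x. x \<notin> K \<Longrightarrow> f x = 0" using CcE[OF assms(1)] by blast
  moreover obtain L where "compact L" "\<And>x. x \<notin> L \<Longrightarrow> g x = 0" using CcE[OF assms(2)] by blast
  moreover have "continuous_on UNIV (\<lambda>x. f x + g x)"
    by (intro continuous_intros Cc_cont assms)
  ultimately show ?thesis
    by (intro CcI[of _ "K \<union> L"]) auto
qed

lemma Cc_zero: "(\<lambda>x::'a::t2_space. 0) \<in> Cc"
  by (rule CcI[of _ "{}"]) auto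

lemma Cc_scale:
  fixes f :: "'a::t2_space \<Rightarrow> complex"
  shows "f \<in> Cc \<Longrightarrow> (\<lambda>x. c * f x) \<in> Cc"
  by (rule Cc_mult_cont) auto

lemma Cc_uminus:
  fixes f :: "'a::t2_space \<Rightarrow> complex"
  shows "f \<in> Cc \<Longrightarrow> (\<lambda>x. - f x) \<in> Cc"
  using Cc_scale[of f "-1"] by simp

lemma Cc_diff:
  fixes f :: "'a::t2_space \<Rightarrow> complex"
  shows "f \<in> Cc \<Longrightarrow> g \<in> Cc \<Longrightarrow> (\<lambda>x. f x - g x) \<in> Cc"
  using Cc_add[of f "\<lambda>x. - g x"] Cc_uminus[of g] by simp

lemma Cc_mult:
  fixes f :: "'a::t2_space \<Rightarrow> complex"
  shows "f \<in> Cc \<Longrightarrow> g \<in> Cc \<Longrightarrow> (\<lambda>x. f x * g x) \<in> Cc"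
  by (rule Cc_mult_cont(1)) (auto intro: Cc_cont)

lemma Cc_post:
  fixes f :: "'a::t2_space \<Rightarrow> complex"
  assumes "f \<in> Cc" "continuous_on UNIV h" "h 0 = 0"
  shows "(\<lambda>x. h (f x)) \<in> Cc"
proof -
  obtain K where "compact K" "\<And>x. x \<notin> K \<Longrightarrow> f x = 0" using CcE[OF assms(1)] by blast
  moreover have "continuous_on UNIV (h \<circ> f)"
    by (rule continuous_on_compose[OF Cc_cont[OF assms(1)]])
       (rule continuous_on_subset[OF assms(2)], simp)
  ultimately show ?thesis using assms by (auto intro!: CcI[of _ K] simp: o_def)
qed

lemma Cc_cnj:
  fixes f :: "'a::t2_space \<Rightarrow> complex"
  shows "f \<in> Cc \<Longrightarrow> (\<lambda>x. cnj (f x)) \<in> Cc"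
  by (rule Cc_post) (auto intro: continuous_intros)

lemma Cc_sum_list:
  fixes f :: "'b \<Rightarrow> 'a::t2_space \<Rightarrow> complex"
  shows "(\<And>z. z \<in> set zs \<Longrightarrow> f z \<in> Cc) \<Longrightarrow> (\<lambda>x. \<Sum>z\<leftarrow>zs. f z x) \<in> Cc"
  by (induction zs) (auto intro: Cc_zero Cc_add)

context
  assumes lc: "locally_compact_space (euclidean :: 'a::{second_countable_topology, t2_space} topology)"
begin

lemma lc_nbhd:
  obtains U K where "open U" "compact K" "(x::'a) \<in> U" "U \<subseteq> K"
  using lc unfolding locally_compact_space_def by (auto, metis)

lemma lc_regular: "regular_space (euclidean :: 'a topology)"
proof (rule locally_compact_Hausdorff_imp_regular_space[OF lc])
  show "Hausdorff_space (euclidean :: 'a topology)"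
    unfolding Hausdorff_space_def using hausdorff by (auto simp: disjnt_def)
qed

text \<open>Urysohn's lemma and Tietze's theorem need a normal space. Second countability enters
  through the Lindelof property, under which a regular space is normal.\<close>

lemma lc_normal: "normal_space (euclidean :: 'a topology)"
proof (rule regular_Lindelof_imp_normal_space[OF lc_regular])
  have "second_countable (euclidean :: 'a topology)"
    unfolding second_countable_def
  proof -
    obtain B :: "'a set set" where B: "countable B" "\<And>C. C \<in> B \<Longrightarrow> open C" "\<And>S. open S \<Longrightarrow> \<exists>U. U \<subseteq> B \<and> S = \<Union>U"
      using univ_second_countable by metis
    show "\<exists>\<B>. countable \<B> \<and> (\<forall>V\<in>\<B>. openin euclidean V) \<and> (\<forall>U x. openin euclidean U \<and> (x::'a) \<in> U \<longrightarrow> (\<exists>V\<in>\<B>. x \<in> V \<and> V \<subseteq> U))"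
    proof (intro exI[of _ B] conjI allI impI)
      fix U and x :: 'a
      assume "openin euclidean U \<and> x \<in> U"
      then obtain W where "W \<subseteq> B" "U = \<Union>W" "x \<in> U" using B(3)[of U] by auto
      then show "\<exists>V\<in>B. x \<in> V \<and> V \<subseteq> U" by blast
    qed (use B in auto)
  qed
  then show "Lindelof_space (euclidean :: 'a topology)" by (rule second_countable_imp_Lindelof_space)
qed

text \<open>Regularity and local compactness give such a neighbourhood at each point; compactness of
  C leaves finitely many of them, and the closure of a finite union is the union of the
  closures.\<close>

lemma lc_between:
  assumes "compact (C::'a set)" "open V" "C \<subseteq> V"
  obtains U where "open U" "C \<subseteq> U" "compact (closure U)" "closure U \<subseteq> V"
proof -
  have "\<exists>U. open U \<and> x \<in> U \<and> compact (closure U) \<and> closure U \<subseteq> V" if "x \<in> V" for x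
  proof -
    obtain W K where W: "open W" "compact K" "x \<in> W" "W \<subseteq> K" using lc_nbhd by blast
    have "openin euclidean (V \<inter> W)" "x \<in> V \<inter> W" using assms W that by auto
    moreover have "\<forall>W x. openin euclidean W \<and> (x::'a) \<in> W \<longrightarrow>
        (\<exists>U L. openin euclidean U \<and> closedin euclidean L \<and> x \<in> U \<and> U \<subseteq> L \<and> L \<subseteq> W)"
      using lc_regular unfolding neighbourhood_base_of_closedin[symmetric] neighbourhood_base_of .
    ultimately obtain U L where "openin euclidean U" "closedin euclidean L" "x \<in> U" "U \<subseteq> L" "L \<subseteq> V \<inter> W"
      by meson
    then have U: "open U" "closed L" "x \<in> U" "U \<subseteq> L" "L \<subseteq> V \<inter> W" by auto
    have cl: "closure U \<subseteq> L" using U by (simp add: closure_minimal)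
    have "closure U \<subseteq> K" using cl U W by blast
    then have "compact (closure U)"
      using compact_Int_closed[OF W(2), of "closure U"] by (simp add: Int_absorb1)
    then show ?thesis using U cl by blast
  qed
  then obtain N where N: "\<And>x. x \<in> V \<Longrightarrow> open (N x) \<and> x \<in> N x \<and> compact (closure (N x)) \<and> closure (N x) \<subseteq> V"
    by metis
  obtain F where F: "F \<subseteq> C" "finite F" "C \<subseteq> (\<Union>x\<in>F. N x)"
    using compactE_image[OF assms(1), of C N] N assms(3) by blast
  show ?thesis
  proof (rule that[of "\<Union>x\<in>F. N x"])
    show "open (\<Union>x\<in>F. N x)" using N F assms by blast
    have c: "closure (\<Union>x\<in>F. N x) = (\<Union>x\<in>F. closure (N x))"
      using F(2) by (induction F) auto
    show "compact (closure (\<Union>x\<in>F. N x))" unfolding c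
      by (intro compact_UN) (use F N assms in auto)
    show "closure (\<Union>x\<in>F. N x) \<subseteq> V" unfolding c using F N assms by blast
  qed (use F in auto)
qed

text \<open>The compact K inside V is recorded because later constructions need supports strictly
  inside a given open set. The smaller open set from \<open>lc_between\<close> is where the Urysohn
  function may be nonzero, so K can be its closure.\<close>

lemma lc_bump:
  assumes "compact (C::'a set)" "open V" "C \<subseteq> V"
  obtains h :: "'a \<Rightarrow> real" and K where
    "continuous_on UNIV h" "\<And>x. 0 \<le> h x" "\<And>x. h x \<le> 1" "\<And>x. x \<in> C \<Longrightarrow> h x = 1"
    "compact K" "K \<subseteq> V" "\<And>x. x \<notin> K \<Longrightarrow> h x = 0" "(\<lambda>x. of_real (h x)) \<in> Cc"
proof -
  obtain U where U: "open U" "C \<subseteq> U" "compact (closure U)" "closure U \<subseteq> V"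
    using lc_between[OF assms] by blast
  have "closedin euclidean (- U)" "closedin euclidean C" "disjnt (-U) C"
    using U assms by (auto simp: disjnt_def compact_imp_closed)
  then obtain f where f: "continuous_map euclidean (top_of_set {0..1::real}) f" "f ` (-U) \<subseteq> {0}" "f ` C \<subseteq> {1}"
    using Urysohn_lemma[OF lc_normal, of "-U" C 0 1] by auto
  have c: "continuous_on UNIV f" and r: "\<And>x. f x \<in> {0..1}"
    using f(1) by (auto simp: continuous_map_in_subtopology)
  have z: "x \<notin> closure U \<Longrightarrow> f x = 0" for x using f(2) closure_subset[of U] by fastforce
  have "(\<lambda>x. of_real (f x)) \<in> Cc"
    by (rule CcI[of _ "closure U"]) (use c U z in \<open>auto intro!: continuous_intros\<close>)
  moreover have "f x = 1" if "x \<in> C" for x using f(3) that by blast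
  moreover have "0 \<le> f x" "f x \<le> 1" for x using r[of x] by auto
  ultimately show ?thesis
    using that[of f "closure U"] c U z by blast
qed

lemma lc_Tietze_real:
  fixes f :: "'a \<Rightarrow> real"
  assumes "closed Q" "continuous_on Q f"
  obtains g where "continuous_on UNIV g" "\<And>x. x \<in> Q \<Longrightarrow> g x = f x"
proof -
  have "closedin euclidean Q" "continuous_map (subtopology euclidean Q) euclideanreal f"
    using assms by auto
  then obtain g where "continuous_map euclidean euclideanreal g" "\<And>x. x \<in> Q \<Longrightarrow> g x = f x"
    using Tietze_extension_realinterval[OF lc_normal, of Q UNIV f] by auto
  then show ?thesis using that by auto
qed

text \<open>Many integrands are defined only on a fibre or on the composable pairs. Extending them
  to the whole type makes \<open>Cc\<close> of that type the single domain of all integration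
  functionals. Tietze's theorem does not keep the support compact; a bump equal to 1 on K restores
  this without touching the values on Q, as f vanishes on Q off K.\<close>

lemma Cc_Tietze:
  fixes f :: "'a \<Rightarrow> complex"
  assumes "closed Q" "continuous_on Q f" "compact K" "\<And>x. x \<in> Q \<Longrightarrow> x \<notin> K \<Longrightarrow> f x = 0"
  obtains F where "F \<in> Cc" "\<And>x. x \<in> Q \<Longrightarrow> F x = f x"
proof -
  obtain g where g: "continuous_on UNIV g" "\<And>x. x \<in> Q \<Longrightarrow> g x = Re (f x)"
    using lc_Tietze_real[OF assms(1), of "\<lambda>x. Re (f x)"] assms(2) by (auto intro: continuous_intros)
  obtain h where h: "continuous_on UNIV h" "\<And>x. x \<in> Q \<Longrightarrow> h x = Im (f x)"
    using lc_Tietze_real[OF assms(1), of "\<lambda>x. Im (f x)"] assms(2) by (auto intro: continuous_intros)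
  obtain b where b: "(\<lambda>x. complex_of_real (b x)) \<in> Cc" "\<And>x. x \<in> K \<Longrightarrow> b x = 1"
    by (rule lc_bump[OF assms(3), of UNIV]) auto
  have "(\<lambda>x. of_real (b x) * (of_real (g x) + \<i> * of_real (h x))) \<in> Cc"
    by (rule Cc_mult_cont[OF b(1)]) (auto intro!: continuous_intros g h)
  moreover have "of_real (b x) * (of_real (g x) + \<i> * of_real (h x)) = f x" if "x \<in> Q" for x
  proof -
    have "of_real (g x) + \<i> * of_real (h x) = f x" using g h that by (simp add: complex_eq_iff)
    then show ?thesis using b(2)[of x] assms(4)[OF that] by (cases "x \<in> K") auto
  qed
  ultimately show ?thesis using that by blast
qed

end

lemma lc_prod:
  assumes "locally_compact_space (euclidean :: 'a::topological_space topology)"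
    and "locally_compact_space (euclidean :: 'b::topological_space topology)"
  shows "locally_compact_space (euclidean :: ('a \<times> 'b) topology)"
proof -
  have "locally_compact_space (prod_topology (euclidean :: 'a topology) (euclidean :: 'b topology))"
    unfolding locally_compact_space_prod_topology using assms by blast
  then show ?thesis by simp
qed

section \<open>Semi-inner products and square summable sequences\<close>

lemma complex_mult_cnj_cmod: "z * cnj z = of_real ((cmod z)\<^sup>2)"
  by (rule complex_norm_square[symmetric])

lemma complex_cnj_mult_cmod: "cnj z * z = of_real ((cmod z)\<^sup>2)"
  by (subst mult.commute) (rule complex_norm_square[symmetric])

text \<open>The form may be degenerate: besides \<open>ell2\<close> it models \<open>Cc\<close> with
  integration over one fibre, where everything living off the fibre is null, and square integrable
  functions without identification almost everywhere.\<close>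

locale semi_ip =
  fixes W :: "('i \<Rightarrow> complex) set" and ip :: "('i \<Rightarrow> complex) \<Rightarrow> ('i \<Rightarrow> complex) \<Rightarrow> complex"
  assumes zero_W: "(\<lambda>i. 0) \<in> W"
    and add_W: "x \<in> W \<Longrightarrow> y \<in> W \<Longrightarrow> (\<lambda>i. x i + y i) \<in> W"
    and scale_W: "x \<in> W \<Longrightarrow> (\<lambda>i. c * x i) \<in> W"
    and ip_add: "x \<in> W \<Longrightarrow> y \<in> W \<Longrightarrow> z \<in> W \<Longrightarrow> ip x (\<lambda>i. y i + z i) = ip x y + ip x z"
    and ip_scale: "x \<in> W \<Longrightarrow> y \<in> W \<Longrightarrow> ip x (\<lambda>i. c * y i) = c * ip x y"
    and ip_sym: "x \<in> W \<Longrightarrow> y \<in> W \<Longrightarrow> ip y x = cnj (ip x y)"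
    and ip_pos: "x \<in> W \<Longrightarrow> 0 \<le> Re (ip x x)"
begin

definition nrm where "nrm x = sqrt (Re (ip x x))"

lemma uminus_W: "x \<in> W \<Longrightarrow> (\<lambda>i. - x i) \<in> W"
  using scale_W[of x "-1"] by simp

lemma diff_W: "x \<in> W \<Longrightarrow> y \<in> W \<Longrightarrow> (\<lambda>i. x i - y i) \<in> W"
  using add_W[of x "\<lambda>i. - y i"] uminus_W[of y] by simp

lemma ip_add_left: "x \<in> W \<Longrightarrow> y \<in> W \<Longrightarrow> z \<in> W \<Longrightarrow> ip (\<lambda>i. x i + y i) z = ip x z + ip y z"
  by (metis (no_types, lifting) add_W complex_cnj_add ip_add ip_sym)

lemma ip_scale_left: "x \<in> W \<Longrightarrow> y \<in> W \<Longrightarrow> ip (\<lambda>i. c * x i) y = cnj c * ip x y"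
  by (metis (no_types, lifting) scale_W complex_cnj_mult ip_scale ip_sym)

lemma ip_diff: "x \<in> W \<Longrightarrow> y \<in> W \<Longrightarrow> z \<in> W \<Longrightarrow> ip x (\<lambda>i. y i - z i) = ip x y - ip x z"
  using ip_add[of x y "\<lambda>i. - z i"] uminus_W[of z] ip_scale[of x z "-1"] by simp

lemma ip_diff_left: "x \<in> W \<Longrightarrow> y \<in> W \<Longrightarrow> z \<in> W \<Longrightarrow> ip (\<lambda>i. x i - y i) z = ip x z - ip y z"
  using ip_add_left[of x "\<lambda>i. - y i" z] uminus_W[of y] ip_scale_left[of y z "-1"] by simp

lemma nrm_nonneg [simp]: "x \<in> W \<Longrightarrow> 0 \<le> nrm x"
  by (simp add: nrm_def ip_pos)

lemma nrm_sq: "x \<in> W \<Longrightarrow> (nrm x)\<^sup>2 = Re (ip x x)"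
  by (simp add: nrm_def ip_pos)

lemma ip_self: "x \<in> W \<Longrightarrow> ip x x = of_real ((nrm x)\<^sup>2)"
  using ip_sym[of x x] by (simp add: nrm_sq complex_eq_iff)

lemma nrm_diff_sq:
  assumes "x \<in> W" "y \<in> W"
  shows "(nrm (\<lambda>i. x i - c * y i))\<^sup>2 = (nrm x)\<^sup>2 - 2 * Re (c * ip x y) + (cmod c)\<^sup>2 * (nrm y)\<^sup>2"
proof -
  have cy: "(\<lambda>i. c * y i) \<in> W" using scale_W assms by blast
  have "ip (\<lambda>i. x i - c * y i) (\<lambda>i. x i - c * y i) = ip x x - c * ip x y - cnj (c * ip x y) + (c * cnj c) * ip y y"
    using assms cy by (simp add: ip_diff ip_diff_left diff_W ip_scale ip_scale_left scale_W ip_sym[of x y] algebra_simps)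
  then have "Re (ip (\<lambda>i. x i - c * y i) (\<lambda>i. x i - c * y i)) = (nrm x)\<^sup>2 - 2 * Re (c * ip x y) + (cmod c)\<^sup>2 * (nrm y)\<^sup>2"
    unfolding complex_mult_cnj_cmod ip_self[OF assms(1)] ip_self[OF assms(2)] by (simp flip: of_real_power of_real_mult)
  then show ?thesis
    using assms cy by (subst nrm_sq) (auto simp: diff_W)
qed

lemma cauchy_schwarz:
  assumes "x \<in> W" "y \<in> W"
  shows "cmod (ip x y) \<le> nrm x * nrm y"
proof (cases "nrm y = 0")
  case True
  have "ip x y = 0"
  proof (rule ccontr)
    assume "ip x y \<noteq> 0"
    then have pos: "(cmod (ip x y))\<^sup>2 > 0" by simp
    \<comment> \<open>A multiple of the null vector y so large that the expanded squared norm of the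
      difference becomes exactly -1.\<close>
    define t where "t = ((nrm x)\<^sup>2 + 1) / (2 * (cmod (ip x y))\<^sup>2)"
    have "Re (of_real t * cnj (ip x y) * ip x y) = t * (cmod (ip x y))\<^sup>2"
      unfolding mult.assoc complex_cnj_mult_cmod by (simp only: Re_complex_of_real flip: of_real_mult)
    also have "\<dots> = ((nrm x)\<^sup>2 + 1) / 2" using pos by (simp add: t_def)
    finally have "(nrm (\<lambda>i. x i - of_real t * cnj (ip x y) * y i))\<^sup>2 = -1"
      using nrm_diff_sq[OF assms, of "of_real t * cnj (ip x y)"] True by simp
    moreover have "0 \<le> (nrm (\<lambda>i. x i - of_real t * cnj (ip x y) * y i))\<^sup>2" by simp
    ultimately show False by linarith
  qed
  then show ?thesis using True by simp
next
  case False
  then have p: "(nrm y)\<^sup>2 > 0" by simp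
  \<comment> \<open>The coefficient of the orthogonal projection of x to the line of y; the form is
    conjugate linear in the first argument, hence the conjugate.\<close>
  define c where "c = cnj (ip x y) / of_real ((nrm y)\<^sup>2)"
  have r: "Re (c * ip x y) = (cmod (ip x y))\<^sup>2 / (nrm y)\<^sup>2"
    unfolding c_def times_divide_eq_left complex_cnj_mult_cmod by (simp only: Re_complex_of_real flip: of_real_divide)
  have c2: "(cmod c)\<^sup>2 * (nrm y)\<^sup>2 = (cmod (ip x y))\<^sup>2 / (nrm y)\<^sup>2"
  proof -
    have "cmod c = cmod (ip x y) / (nrm y)\<^sup>2"
      unfolding c_def norm_divide norm_of_real complex_mod_cnj by simp
    then show ?thesis using False by (simp add: power_divide field_simps power2_eq_square)
  qed
  have "0 \<le> (nrm x)\<^sup>2 - (cmod (ip x y))\<^sup>2 / (nrm y)\<^sup>2"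
    using nrm_diff_sq[OF assms, of c] r c2 by (smt (verit) zero_le_power2)
  then have "(cmod (ip x y))\<^sup>2 \<le> (nrm x * nrm y)\<^sup>2"
    using p by (simp add: field_simps power_mult_distrib)
  then show ?thesis
    using assms by (meson mult_nonneg_nonneg nrm_nonneg power2_le_imp_le)
qed

lemma nrm_scale: "x \<in> W \<Longrightarrow> nrm (\<lambda>i. c * x i) = cmod c * nrm x"
proof -
  assume x: "x \<in> W"
  have "ip (\<lambda>i. c * x i) (\<lambda>i. c * x i) = (c * cnj c) * ip x x"
    using x by (simp add: ip_scale ip_scale_left scale_W)
  also have "\<dots> = of_real ((cmod c * nrm x)\<^sup>2)"
    using x unfolding complex_mult_cnj_cmod by (simp only: ip_self power_mult_distrib of_real_mult)
  finally have "ip (\<lambda>i. c * x i) (\<lambda>i. c * x i) = of_real ((cmod c * nrm x)\<^sup>2)" .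
  then show ?thesis using x unfolding nrm_def[of "\<lambda>i. c * x i"] by simp
qed

lemma nrm_triangle:
  assumes "x \<in> W" "y \<in> W"
  shows "nrm (\<lambda>i. x i + y i) \<le> nrm x + nrm y"
proof -
  have "(nrm (\<lambda>i. x i + y i))\<^sup>2 = (nrm x)\<^sup>2 + 2 * Re (ip x y) + (nrm y)\<^sup>2"
    using nrm_diff_sq[OF assms, of "-1"] by simp
  also have "\<dots> \<le> (nrm x + nrm y)\<^sup>2"
    using cauchy_schwarz[OF assms] complex_Re_le_cmod[of "ip x y"] by (simp add: power2_sum)
  finally show ?thesis
    using assms by (meson add_nonneg_nonneg nrm_nonneg power2_le_imp_le)
qed

lemma nrm_diff_commute: "x \<in> W \<Longrightarrow> y \<in> W \<Longrightarrow> nrm (\<lambda>i. x i - y i) = nrm (\<lambda>i. y i - x i)"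
  using nrm_scale[of "\<lambda>i. x i - y i" "-1"] diff_W[of x y] by simp

lemma nrm_triangle_diff:
  assumes "x \<in> W" "y \<in> W" "z \<in> W"
  shows "nrm (\<lambda>i. x i - z i) \<le> nrm (\<lambda>i. x i - y i) + nrm (\<lambda>i. y i - z i)"
  using nrm_triangle[of "\<lambda>i. x i - y i" "\<lambda>i. y i - z i"] assms diff_W by simp

lemma nrm_diff_abs:
  assumes "x \<in> W" "y \<in> W"
  shows "\<bar>nrm x - nrm y\<bar> \<le> nrm (\<lambda>i. x i - y i)"
  using nrm_triangle[of "\<lambda>i. x i - y i" y] nrm_triangle[of "\<lambda>i. y i - x i" x] nrm_diff_commute[of x y] assms diff_W
  by simp

lemma nrm_zero: "nrm (\<lambda>i. 0) = 0"
  using nrm_scale[OF zero_W, of 0] by simp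

text \<open>The first argument is exchanged before the second. This splitting is behind the
  continuity and convergence estimates for coefficients.\<close>

lemma ip_diff_bound:
  assumes "x \<in> W" "x' \<in> W" "y \<in> W" "y' \<in> W"
  shows "cmod (ip x y - ip x' y') \<le> nrm (\<lambda>i. x i - x' i) * nrm y + nrm x' * nrm (\<lambda>i. y i - y' i)"
proof -
  have "ip x y - ip x' y' = ip (\<lambda>i. x i - x' i) y + ip x' (\<lambda>i. y i - y' i)"
    using assms by (simp add: ip_diff ip_diff_left)
  then show ?thesis
    using cauchy_schwarz[of "\<lambda>i. x i - x' i" y] cauchy_schwarz[of x' "\<lambda>i. y i - y' i"] assms diff_W
    by (metis (no_types, lifting) add_mono norm_triangle_le)
qed

lemma sum_list_W: "(\<And>z. z \<in> set zs \<Longrightarrow> f z \<in> W) \<Longrightarrow> (\<lambda>i. \<Sum>z\<leftarrow>zs. f z i) \<in> W"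
  by (induction zs) (auto intro: zero_W add_W)

lemma ip_sum_list_left:
  assumes "y \<in> W"
  shows "(\<And>z. z \<in> set zs \<Longrightarrow> f z \<in> W) \<Longrightarrow> ip (\<lambda>i. \<Sum>z\<leftarrow>zs. f z i) y = (\<Sum>z\<leftarrow>zs. ip (f z) y)"
proof (induction zs)
  case Nil
  then show ?case using ip_scale_left[OF assms assms, of 0] by simp
next
  case (Cons a zs)
  then show ?case using assms by (simp add: ip_add_left sum_list_W)
qed

lemma ip_sum_list:
  assumes "y \<in> W"
  shows "(\<And>z. z \<in> set zs \<Longrightarrow> f z \<in> W) \<Longrightarrow> ip y (\<lambda>i. \<Sum>z\<leftarrow>zs. f z i) = (\<Sum>z\<leftarrow>zs. ip y (f z))"
proof (induction zs)
  case Nil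
  then show ?case using ip_scale[OF assms assms, of 0] by simp
next
  case (Cons a zs)
  then show ?case using assms by (simp add: ip_add sum_list_W)
qed

end

lemma cmod_mult_le_squares: "cmod (cnj a * b) \<le> (cmod a)\<^sup>2 + (cmod b)\<^sup>2"
proof -
  have "2 * (cmod a * cmod b) \<le> (cmod a)\<^sup>2 + (cmod b)\<^sup>2"
    using sum_squares_bound[of "cmod a" "cmod b"] by simp
  then show ?thesis by (simp add: norm_mult) (smt (verit) mult_nonneg_nonneg norm_ge_zero zero_le_power2)
qed

lemma cmod_add_sq_le: "(cmod (a + b))\<^sup>2 \<le> 2 * (cmod a)\<^sup>2 + 2 * (cmod b)\<^sup>2"
proof -
  have "(cmod (a + b))\<^sup>2 \<le> (cmod a + cmod b)\<^sup>2" by (simp add: norm_triangle_ineq power_mono)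
  also have "\<dots> \<le> 2 * (cmod a)\<^sup>2 + 2 * (cmod b)\<^sup>2"
    using sum_squares_bound[of "cmod a" "cmod b"] by (simp add: power2_sum)
  finally show ?thesis .
qed

lemma ell2_summable_inner:
  assumes "x \<in> ell2" "y \<in> ell2"
  shows "summable (\<lambda>n. cmod (cnj (x n) * y n))" "summable (\<lambda>n. cnj (x n) * y n)"
proof -
  have "summable (\<lambda>n. (cmod (x n))\<^sup>2 + (cmod (y n))\<^sup>2)"
    using assms by (auto simp: ell2_def intro: summable_add)
  then show "summable (\<lambda>n. cmod (cnj (x n) * y n))"
    by (rule summable_comparison_test'[where N = 0]) (use cmod_mult_le_squares in auto)
  then show "summable (\<lambda>n. cnj (x n) * y n)" by (rule summable_norm_cancel)
qed

interpretation ell2: semi_ip ell2 ell2_inner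
proof
  show "(\<lambda>i. 0) \<in> ell2" by (simp add: ell2_def)
  show "(\<lambda>i. x i + y i) \<in> ell2" if "x \<in> ell2" "y \<in> ell2" for x y
  proof -
    have "summable (\<lambda>n. 2 * (cmod (x n))\<^sup>2 + 2 * (cmod (y n))\<^sup>2)"
      using that by (auto simp: ell2_def intro!: summable_add summable_mult)
    then show ?thesis unfolding ell2_def mem_Collect_eq
      by (rule summable_comparison_test'[where N = 0]) (use cmod_add_sq_le in auto)
  qed
  show "(\<lambda>i. c * x i) \<in> ell2" if "x \<in> ell2" for x c
    using that by (auto simp: ell2_def norm_mult power_mult_distrib intro: summable_mult)
  show "ell2_inner x (\<lambda>i. y i + z i) = ell2_inner x y + ell2_inner x z" if "x \<in> ell2" "y \<in> ell2" "z \<in> ell2" for x y z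
    unfolding ell2_inner_def using that by (simp add: distrib_left suminf_add[symmetric] ell2_summable_inner)
  show "ell2_inner x (\<lambda>i. c * y i) = c * ell2_inner x y" if "x \<in> ell2" "y \<in> ell2" for x y c
    unfolding ell2_inner_def using suminf_mult[OF ell2_summable_inner(2)[OF that], of c] by (simp add: mult_ac)
  show "ell2_inner y x = cnj (ell2_inner x y)" if "x \<in> ell2" "y \<in> ell2" for x y
  proof -
    have "(\<lambda>n. cnj (cnj (x n) * y n)) sums cnj (ell2_inner x y)"
      unfolding ell2_inner_def sums_cnj using ell2_summable_inner(2)[OF that] by (rule summable_sums)
    then show ?thesis unfolding ell2_inner_def[of y x] by (simp add: sums_iff mult.commute)
  qed
  show "0 \<le> Re (ell2_inner x x)" if "x \<in> ell2" for x
  proof -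
    have "Re (ell2_inner x x) = (\<Sum>n. Re (cnj (x n) * x n))"
      unfolding ell2_inner_def by (rule Re_suminf[OF ell2_summable_inner(2)[OF that that]])
    also have "\<dots> \<ge> 0"
      by (rule suminf_nonneg) (use summable_Re[OF ell2_summable_inner(2)[OF that that]] in \<open>auto\<close>)
    finally show ?thesis .
  qed
qed

lemma ell2_nrm: "x \<in> ell2 \<Longrightarrow> ell2.nrm x = ell2_norm x"
proof -
  assume x: "x \<in> ell2"
  have "Re (ell2_inner x x) = (\<Sum>n. Re (cnj (x n) * x n))"
    unfolding ell2_inner_def by (rule Re_suminf[OF ell2_summable_inner(2)[OF x x]])
  moreover have "Re (cnj z * z) = (cmod z)\<^sup>2" for z
    unfolding complex_cnj_mult_cmod by simp
  ultimately show ?thesis by (simp only: ell2.nrm_def ell2_norm_def)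
qed

lemma ell2_norm_nonneg [simp]: "x \<in> ell2 \<Longrightarrow> 0 \<le> ell2_norm x"
  using ell2_nrm ell2.nrm_nonneg by metis

lemma ell2_norm_zero [simp]: "ell2_norm (\<lambda>n. 0) = 0"
  by (simp add: ell2_norm_def)

lemma ell2_inner_self: "x \<in> ell2 \<Longrightarrow> ell2_inner x x = of_real ((ell2_norm x)\<^sup>2)"
  using ell2.ip_self ell2_nrm by metis

lemma ell2_norm_eq_inner: "x \<in> ell2 \<Longrightarrow> ell2_norm x = sqrt (Re (ell2_inner x x))"
  using ell2_nrm ell2.nrm_def by metis

lemma ell2_cs: "x \<in> ell2 \<Longrightarrow> y \<in> ell2 \<Longrightarrow> cmod (ell2_inner x y) \<le> ell2_norm x * ell2_norm y"
  using ell2.cauchy_schwarz ell2_nrm by metis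

lemma ell2_norm_scale: "x \<in> ell2 \<Longrightarrow> ell2_norm (\<lambda>i. c * x i) = cmod c * ell2_norm x"
  using ell2.nrm_scale ell2_nrm ell2.scale_W by metis

lemma ell2_norm_triangle: "x \<in> ell2 \<Longrightarrow> y \<in> ell2 \<Longrightarrow> ell2_norm (\<lambda>i. x i + y i) \<le> ell2_norm x + ell2_norm y"
  using ell2.nrm_triangle[of x y] ell2_nrm ell2.add_W by metis

lemma ell2_norm_triangle_diff:
  "x \<in> ell2 \<Longrightarrow> y \<in> ell2 \<Longrightarrow> z \<in> ell2 \<Longrightarrow>
    ell2_norm (\<lambda>i. x i - z i) \<le> ell2_norm (\<lambda>i. x i - y i) + ell2_norm (\<lambda>i. y i - z i)"
  using ell2.nrm_triangle_diff[of x y z] ell2_nrm ell2.diff_W by metis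

lemma ell2_norm_diff_commute: "x \<in> ell2 \<Longrightarrow> y \<in> ell2 \<Longrightarrow> ell2_norm (\<lambda>i. x i - y i) = ell2_norm (\<lambda>i. y i - x i)"
  using ell2.nrm_diff_commute[of x y] ell2_nrm ell2.diff_W by metis

lemma ell2_norm_diff_abs: "x \<in> ell2 \<Longrightarrow> y \<in> ell2 \<Longrightarrow> \<bar>ell2_norm x - ell2_norm y\<bar> \<le> ell2_norm (\<lambda>i. x i - y i)"
  using ell2.nrm_diff_abs[of x y] ell2_nrm ell2.diff_W by metis

lemma ell2_inner_diff_bound:
  assumes "x \<in> ell2" "x' \<in> ell2" "y \<in> ell2" "y' \<in> ell2"
  shows "cmod (ell2_inner x y - ell2_inner x' y')
    \<le> ell2_norm (\<lambda>i. x i - x' i) * ell2_norm y + ell2_norm x' * ell2_norm (\<lambda>i. y i - y' i)"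
  using ell2.ip_diff_bound[of x x' y y'] assms ell2_nrm ell2.diff_W by metis

lemma ell2_coord_le:
  assumes "x \<in> ell2"
  shows "cmod (x n) \<le> ell2_norm x"
proof -
  have "(cmod (x n))\<^sup>2 = (\<Sum>k\<in>{n}. (cmod (x k))\<^sup>2)" by simp
  also have "\<dots> \<le> (\<Sum>k. (cmod (x k))\<^sup>2)"
    by (rule sum_le_suminf) (use assms in \<open>auto simp: ell2_def\<close>)
  finally show ?thesis unfolding ell2_norm_def by (rule real_le_rsqrt)
qed

lemma ell2_norm_eq_0: "x \<in> ell2 \<Longrightarrow> ell2_norm x = 0 \<Longrightarrow> x = (\<lambda>n. 0)"
  using ell2_coord_le[of x] by force

text \<open>Membership and norm bound follow from finite sums alone. Completeness, direct sums and
  Gram-Schmidt coordinates all produce sequences of which only finite sums are under direct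
  control.\<close>

lemma ell2_bounded_partial:
  assumes "\<And>K. (\<Sum>n<K. (cmod (x n))\<^sup>2) \<le> B\<^sup>2" "B \<ge> 0"
  shows "x \<in> ell2" "ell2_norm x \<le> B"
proof -
  have s: "summable (\<lambda>n. (cmod (x n))\<^sup>2)"
    by (rule summableI_nonneg_bounded[of _ "B\<^sup>2"]) (use assms in auto)
  then show "x \<in> ell2" by (simp add: ell2_def)
  have "(\<Sum>n. (cmod (x n))\<^sup>2) \<le> B\<^sup>2" by (rule suminf_le_const[OF s]) (use assms in auto)
  then show "ell2_norm x \<le> B" unfolding ell2_norm_def using assms(2) by (rule real_le_lsqrt[rotated])
qed

lemma ell2_partial_le:
  assumes "x \<in> ell2"
  shows "(\<Sum>n<K. (cmod (x n))\<^sup>2) \<le> (ell2_norm x)\<^sup>2"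
proof -
  have "(\<Sum>n<K. (cmod (x n))\<^sup>2) \<le> (\<Sum>n. (cmod (x n))\<^sup>2)"
    by (rule sum_le_suminf) (use assms in \<open>auto simp: ell2_def\<close>)
  also have "\<dots> = (ell2_norm x)\<^sup>2"
    unfolding ell2_norm_def using assms by (subst real_sqrt_pow2) (auto simp: ell2_def intro!: suminf_nonneg)
  finally show ?thesis .
qed

text \<open>The limit is taken coordinatewise. A finite sum of coordinates passes to the limit, so
  the Cauchy estimate survives on every finite section and therefore, by
  \<open>ell2_bounded_partial\<close>, on the whole sequence.\<close>

lemma ell2_complete:
  assumes x: "\<And>k. x k \<in> ell2"
    and C: "\<And>e. e > 0 \<Longrightarrow> \<exists>N. \<forall>m\<ge>N. \<forall>k\<ge>N. ell2_norm (\<lambda>n. x m n - x k n) < e"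
  obtains y where "y \<in> ell2" "(\<lambda>k. ell2_norm (\<lambda>n. x k n - y n)) \<longlonglongrightarrow> 0"
proof -
  have "Cauchy (\<lambda>k. x k n)" for n
  proof (rule CauchyI)
    fix e :: real assume "e > 0"
    then obtain N where N: "\<forall>m\<ge>N. \<forall>k\<ge>N. ell2_norm (\<lambda>n. x m n - x k n) < e" using C by blast
    have "cmod (x m n - x k n) < e" if "m \<ge> N" "k \<ge> N" for m k
      using ell2_coord_le[OF ell2.diff_W[OF x[of m] x[of k]], of n] N that by fastforce
    then show "\<exists>M. \<forall>m\<ge>M. \<forall>k\<ge>M. cmod (x m n - x k n) < e" by blast
  qed
  then have "\<forall>n. \<exists>l. (\<lambda>k. x k n) \<longlonglongrightarrow> l"
    unfolding Cauchy_convergent_iff convergent_def by blast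
  from choice[OF this] obtain y where y: "\<And>n. (\<lambda>k. x k n) \<longlonglongrightarrow> y n"
    by blast
  have key: "(\<lambda>n. x m n - y n) \<in> ell2 \<and> ell2_norm (\<lambda>n. x m n - y n) \<le> e"
    if N: "\<forall>m\<ge>N. \<forall>k\<ge>N. ell2_norm (\<lambda>n. x m n - x k n) < e" and m: "m \<ge> N" for m N e
  proof -
    have e: "e \<ge> 0" using N m ell2_norm_nonneg[OF ell2.diff_W[OF x x]] by (meson less_le_not_le linorder_le_cases order_trans)
    have "(\<Sum>n<K. (cmod (x m n - y n))\<^sup>2) \<le> e\<^sup>2" for K
    proof (rule tendsto_upperbound[of "\<lambda>k. \<Sum>n<K. (cmod (x m n - x k n))\<^sup>2" _ sequentially])
      show "(\<lambda>k. \<Sum>n<K. (cmod (x m n - x k n))\<^sup>2) \<longlonglongrightarrow> (\<Sum>n<K. (cmod (x m n - y n))\<^sup>2)"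
        by (intro tendsto_intros y)
      have "(\<Sum>n<K. (cmod (x m n - x k n))\<^sup>2) \<le> e\<^sup>2" if "k \<ge> N" for k
      proof -
        have "(\<Sum>n<K. (cmod (x m n - x k n))\<^sup>2) \<le> (ell2_norm (\<lambda>n. x m n - x k n))\<^sup>2"
          by (rule ell2_partial_le[OF ell2.diff_W[OF x x]])
        also have "\<dots> \<le> e\<^sup>2"
          by (rule power_mono) (use N m that ell2_norm_nonneg[OF ell2.diff_W[OF x x]] in \<open>auto intro: less_imp_le\<close>)
        finally show ?thesis .
      qed
      then show "\<forall>\<^sub>F k in sequentially. (\<Sum>n<K. (cmod (x m n - x k n))\<^sup>2) \<le> e\<^sup>2"
        using eventually_sequentially by blast
    qed simp
    then show ?thesis using ell2_bounded_partial[of "\<lambda>n. x m n - y n" e] e by blast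
  qed
  obtain N1 where "\<forall>m\<ge>N1. \<forall>k\<ge>N1. ell2_norm (\<lambda>n. x m n - x k n) < 1" using C[of 1] by auto
  then have "(\<lambda>n. x N1 n - y n) \<in> ell2" using key by blast
  then have yin: "y \<in> ell2" using ell2.diff_W[OF x[of N1], of "\<lambda>n. x N1 n - y n"] by simp
  have "(\<lambda>k. ell2_norm (\<lambda>n. x k n - y n)) \<longlonglongrightarrow> 0"
  proof (rule LIMSEQ_I)
    fix e :: real assume "e > 0"
    then obtain N where N: "\<forall>m\<ge>N. \<forall>k\<ge>N. ell2_norm (\<lambda>n. x m n - x k n) < e/2" using C[of "e/2"] by auto
    have "norm (ell2_norm (\<lambda>n. x k n - y n) - 0) < e" if "k \<ge> N" for k
      using key[OF N that] ell2_norm_nonneg[OF ell2.diff_W[OF x yin], of k] \<open>e > 0\<close> by auto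
    then show "\<exists>no. \<forall>n\<ge>no. norm (ell2_norm (\<lambda>k. x n k - y k) - 0) < e" by blast
  qed
  with yin show ?thesis using that by blast
qed

lemma ell2_inner_tendsto:
  assumes "\<And>k. x k \<in> ell2" "y \<in> ell2" "z \<in> ell2" "(\<lambda>k. ell2_norm (\<lambda>n. x k n - y n)) \<longlonglongrightarrow> 0"
  shows "(\<lambda>k. ell2_inner (x k) z) \<longlonglongrightarrow> ell2_inner y z"
proof (rule LIM_zero_cancel, rule Lim_null_comparison)
  show "\<forall>\<^sub>F k in sequentially. norm (ell2_inner (x k) z - ell2_inner y z) \<le> ell2_norm (\<lambda>n. x k n - y n) * ell2_norm z"
    using assms ell2_inner_diff_bound[of "x _" y z z] by (intro always_eventually allI) simp
  show "(\<lambda>k. ell2_norm (\<lambda>n. x k n - y n) * ell2_norm z) \<longlonglongrightarrow> 0"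
    using assms(4) by (rule tendsto_mult_left_zero)
qed

lemma ell2_norm_tendsto:
  assumes "\<And>k. x k \<in> ell2" "y \<in> ell2" "(\<lambda>k. ell2_norm (\<lambda>n. x k n - y n)) \<longlonglongrightarrow> 0"
  shows "(\<lambda>k. ell2_norm (x k)) \<longlonglongrightarrow> ell2_norm y"
  by (rule LIM_zero_cancel, rule Lim_null_comparison[OF _ assms(3)])
     (use assms ell2_norm_diff_abs[of "x _" y] in \<open>simp\<close>)

text \<open>The comparison function may depend on the point and on e, since the three-epsilon
  argument uses only uniform closeness near the point. With exact agreement near each point the
  lemma also serves to prove continuity locally.\<close>

lemma continuous_approx:
  fixes f :: "'a::topological_space \<Rightarrow> 'b::metric_space"
  assumes "\<And>x e. x \<in> S \<Longrightarrow> e > 0 \<Longrightarrow> \<exists>g V. continuous_on S g \<and> open V \<and> x \<in> V \<and> (\<forall>y\<in>V \<inter> S. dist (f y) (g y) \<le> e)"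
  shows "continuous_on S f"
  unfolding continuous_on_def
proof (intro ballI tendstoI)
  fix x e assume x: "x \<in> S" and e: "(e::real) > 0"
  obtain g V where g: "continuous_on S g" "open V" "x \<in> V" "\<forall>y\<in>V \<inter> S. dist (f y) (g y) \<le> e/3"
    using assms[OF x, of "e/3"] e by auto
  have "\<forall>\<^sub>F y in at x within S. dist (g y) (g x) < e/3"
    using g(1) x e unfolding continuous_on_def by (intro tendstoD) auto
  moreover have "\<forall>\<^sub>F y in at x within S. y \<in> V \<inter> S"
    using g(2,3) by (auto simp: eventually_at_topological)
  ultimately show "\<forall>\<^sub>F y in at x within S. dist (f y) (f x) < e"
  proof eventually_elim
    case (elim y)
    have "dist (f y) (f x) \<le> dist (f y) (g y) + dist (g y) (g x) + dist (g x) (f x)"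
      by (metis add.commute add_left_mono dist_triangle dist_triangle_le order_trans)
    moreover have "dist (f y) (g y) \<le> e/3" "dist (g x) (f x) \<le> e/3"
      using elim g(4) x g(3) by (auto simp: dist_commute)
    ultimately show ?case using elim by linarith
  qed
qed

section \<open>Bundles from positive definite kernels\<close>

locale grpd =
  fixes G :: "'g haar_groupoid" (structure)
  assumes grpd: "is_groupoid G"
begin

lemma inv_inv [simp]: "ginv G (ginv G x) = x"
  using grpd by (simp add: is_groupoid_def)

lemma rng_mult: "src G x = rng G y \<Longrightarrow> rng G (x \<cdot> y) = rng G x"
  using grpd by (simp add: is_groupoid_def)

lemma src_mult: "src G x = rng G y \<Longrightarrow> src G (x \<cdot> y) = src G y"
  using grpd by (simp add: is_groupoid_def)

lemma mult_assoc: "src G x = rng G y \<Longrightarrow> src G y = rng G z \<Longrightarrow> (x \<cdot> y) \<cdot> z = x \<cdot> (y \<cdot> z)"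
  using grpd by (simp add: is_groupoid_def)

lemma rng_mult_self [simp]: "rng G x \<cdot> x = x"
  using grpd by (simp add: is_groupoid_def)

lemma mult_src_self [simp]: "x \<cdot> src G x = x"
  using grpd by (simp add: is_groupoid_def)

lemma src_inv [simp]: "src G (ginv G x) = rng G x"
  by (simp add: src_def rng_def)

lemma rng_inv [simp]: "rng G (ginv G x) = src G x"
  by (simp add: src_def rng_def)

lemma mult_inv: "x \<cdot> ginv G x = rng G x"
  by (simp add: rng_def)

lemma inv_mult_self: "ginv G x \<cdot> x = src G x"
  by (simp add: src_def)

lemma rng_rng [simp]: "rng G (rng G x) = rng G x"
  using rng_mult[of x "ginv G x"] by (simp add: mult_inv)

lemma src_rng [simp]: "src G (rng G x) = rng G x"
  using src_mult[of x "ginv G x"] by (simp add: mult_inv)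

lemma rng_src [simp]: "rng G (src G x) = src G x"
  using rng_rng[of "ginv G x"] by simp

lemma src_src [simp]: "src G (src G x) = src G x"
  using src_rng[of "ginv G x"] by simp

lemma units_iff: "u \<in> units G \<longleftrightarrow> rng G u = u"
  by (auto simp: units_def) (metis rangeI)

lemma unit_rng: "u \<in> units G \<Longrightarrow> rng G u = u"
  by (simp add: units_iff)

lemma unit_src: "u \<in> units G \<Longrightarrow> src G u = u"
  by (metis src_rng units_iff)

lemma rng_units [simp]: "rng G x \<in> units G"
  by (simp add: units_iff)

lemma src_units [simp]: "src G x \<in> units G"
  by (simp add: units_iff)

lemma inv_cancel: "src G x = rng G y \<Longrightarrow> ginv G x \<cdot> (x \<cdot> y) = y"
  by (metis inv_mult_self mult_assoc rng_mult_self src_inv)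

lemma inv_cancel2: "rng G x = rng G y \<Longrightarrow> x \<cdot> (ginv G x \<cdot> y) = y"
  using inv_cancel[of "ginv G x" y] by simp

lemma inv_unit: "u \<in> units G \<Longrightarrow> ginv G u = u"
  by (metis inv_mult_self mult_src_self src_inv unit_rng unit_src)

lemma inv_mult: "src G x = rng G y \<Longrightarrow> ginv G (x \<cdot> y) = ginv G y \<cdot> ginv G x"
proof -
  assume xy: "src G x = rng G y"
  let ?z = "x \<cdot> y"
  have "?z \<cdot> (ginv G y \<cdot> ginv G x) = x \<cdot> (y \<cdot> (ginv G y \<cdot> ginv G x))"
    by (rule mult_assoc) (use xy in \<open>simp_all add: rng_mult\<close>)
  also have "\<dots> = rng G x" using xy by (simp add: inv_cancel2 mult_inv)
  finally have "ginv G ?z \<cdot> (?z \<cdot> (ginv G y \<cdot> ginv G x)) = ginv G ?z \<cdot> src G (ginv G ?z)"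
    using xy by (simp add: rng_mult)
  moreover have "ginv G ?z \<cdot> (?z \<cdot> (ginv G y \<cdot> ginv G x)) = ginv G y \<cdot> ginv G x"
    using xy by (intro inv_cancel) (simp add: src_mult rng_mult)
  ultimately show ?thesis by (simp only: mult_src_self)
qed

end

locale tgrpd = grpd G for G :: "'g::topological_space haar_groupoid" (structure) +
  assumes cont_rng: "continuous_on UNIV (rng G)" and cont_src: "continuous_on UNIV (src G)"

text \<open>
  All bundles below are constructed in this way: the fibre at \<open>u\<close> is the closed span of the vectors \<open>v u a\<close>, and the
  groupoid acts on the indices \<open>a\<close> only. The map that it induces on the spans is well defined and isometric
  because the action preserves the Gram matrices.
\<close>

locale kernel_bundle = tgrpd G for G :: "'g::topological_space haar_groupoid" (structure) +
  fixes X :: "'g \<Rightarrow> 'x set" and v :: "'g \<Rightarrow> 'x \<Rightarrow> nat \<Rightarrow> complex" and act :: "'g \<Rightarrow> 'x \<Rightarrow> 'x"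
    and Sec :: "('g \<Rightarrow> 'x) set"
  assumes v_ell2: "u \<in> units G \<Longrightarrow> a \<in> X u \<Longrightarrow> v u a \<in> ell2"
    and act_in: "a \<in> X (src G x) \<Longrightarrow> act x a \<in> X (rng G x)"
    and act_ip: "a \<in> X (src G x) \<Longrightarrow> b \<in> X (src G x) \<Longrightarrow>
      ell2_inner (v (rng G x) (act x a)) (v (rng G x) (act x b)) = ell2_inner (v (src G x) a) (v (src G x) b)"
    and act_mult: "src G x = rng G y \<Longrightarrow> a \<in> X (src G y) \<Longrightarrow>
      v (rng G x) (act (x \<cdot> y) a) = v (rng G x) (act x (act y a))"
    and act_unit: "u \<in> units G \<Longrightarrow> a \<in> X u \<Longrightarrow> v u (act u a) = v u a"
    and sec_in: "\<sigma> \<in> Sec \<Longrightarrow> u \<in> units G \<Longrightarrow> \<sigma> u \<in> X u"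
    and total: "u \<in> units G \<Longrightarrow> a \<in> X u \<Longrightarrow> e > 0 \<Longrightarrow>
      \<exists>zs. snd ` set zs \<subseteq> Sec \<and> ell2_norm (\<lambda>n. v u a n - (\<Sum>z\<leftarrow>zs. fst z * v u (snd z u) n)) < e"
    and cont: "\<sigma> \<in> Sec \<Longrightarrow> \<tau> \<in> Sec \<Longrightarrow>
      continuous_on UNIV (\<lambda>x. ell2_inner (v (rng G x) (act x (\<sigma> (src G x)))) (v (rng G x) (\<tau> (rng G x))))"
begin

text \<open>A vector of the span has many such lists. They are kept because the action is given on
  indices: \<open>amap\<close> transports a list, and \<open>cmb_norm_amap\<close>, applied to
  differences, shows that the resulting vector depends only on the vector transported.\<close>

definition cmb :: "'g \<Rightarrow> (complex \<times> 'x) list \<Rightarrow> nat \<Rightarrow> complex" where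
  "cmb u zs = (\<lambda>n. \<Sum>z\<leftarrow>zs. fst z * v u (snd z) n)"

definition amap :: "'g \<Rightarrow> (complex \<times> 'x) list \<Rightarrow> (complex \<times> 'x) list" where
  "amap x zs = map (\<lambda>z. (fst z, act x (snd z))) zs"

definition lin :: "complex \<Rightarrow> (complex \<times> 'y) list \<Rightarrow> (complex \<times> 'y) list" where
  "lin c zs = map (\<lambda>z. (c * fst z, snd z)) zs"

lemma snd_amap: "snd ` set zs \<subseteq> X (src G x) \<Longrightarrow> snd ` set (amap x zs) \<subseteq> X (rng G x)"
  by (auto simp: amap_def intro!: act_in)

lemma snd_lin [simp]: "snd ` set (lin c zs) = snd ` set zs"
  by (force simp: lin_def)

lemma cmb_in: "u \<in> units G \<Longrightarrow> snd ` set zs \<subseteq> X u \<Longrightarrow> cmb u zs \<in> ell2"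
  unfolding cmb_def by (rule ell2.sum_list_W) (auto intro!: ell2.scale_W v_ell2)

lemma cmb_append: "cmb u (zs @ ws) = (\<lambda>n. cmb u zs n + cmb u ws n)"
  by (simp add: cmb_def)

lemma cmb_lin: "cmb u (lin c zs) = (\<lambda>n. c * cmb u zs n)"
  by (simp add: cmb_def lin_def o_def sum_list_const_mult mult.assoc)

lemma cmb_single: "cmb u [(1, a)] = v u a"
  by (simp add: cmb_def)

lemma cmb_diff: "(\<lambda>n. cmb u zs n - cmb u ws n) = cmb u (zs @ lin (-1) ws)"
  by (simp add: cmb_append cmb_lin)

lemma cmb_inner_left:
  assumes "u \<in> units G" "snd ` set zs \<subseteq> X u" "y \<in> ell2"
  shows "ell2_inner (cmb u zs) y = (\<Sum>z\<leftarrow>zs. cnj (fst z) * ell2_inner (v u (snd z)) y)"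
proof -
  have "ell2_inner (cmb u zs) y = (\<Sum>z\<leftarrow>zs. ell2_inner (\<lambda>n. fst z * v u (snd z) n) y)"
    unfolding cmb_def using assms by (intro ell2.ip_sum_list_left) (auto intro!: ell2.scale_W v_ell2)
  also have "\<dots> = (\<Sum>z\<leftarrow>zs. cnj (fst z) * ell2_inner (v u (snd z)) y)"
    using assms by (intro arg_cong[where f = sum_list] map_cong) (auto intro!: ell2.ip_scale_left v_ell2)
  finally show ?thesis .
qed

lemma cmb_inner_right:
  assumes "u \<in> units G" "snd ` set zs \<subseteq> X u" "y \<in> ell2"
  shows "ell2_inner y (cmb u zs) = (\<Sum>z\<leftarrow>zs. fst z * ell2_inner y (v u (snd z)))"
proof -
  have "ell2_inner y (cmb u zs) = (\<Sum>z\<leftarrow>zs. ell2_inner y (\<lambda>n. fst z * v u (snd z) n))"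
    unfolding cmb_def using assms by (intro ell2.ip_sum_list) (auto intro!: ell2.scale_W v_ell2)
  also have "\<dots> = (\<Sum>z\<leftarrow>zs. fst z * ell2_inner y (v u (snd z)))"
    using assms by (intro arg_cong[where f = sum_list] map_cong) (auto intro!: ell2.ip_scale v_ell2)
  finally show ?thesis .
qed

lemma cmb_inner_amap:
  assumes "snd ` set zs \<subseteq> X (src G x)" "a \<in> X (src G x)"
  shows "ell2_inner (cmb (rng G x) (amap x zs)) (v (rng G x) (act x a)) = ell2_inner (cmb (src G x) zs) (v (src G x) a)"
proof -
  have "ell2_inner (cmb (rng G x) (amap x zs)) (v (rng G x) (act x a))
    = (\<Sum>z\<leftarrow>amap x zs. cnj (fst z) * ell2_inner (v (rng G x) (snd z)) (v (rng G x) (act x a)))"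
    using assms by (intro cmb_inner_left snd_amap v_ell2 act_in) auto
  also have "\<dots> = (\<Sum>z\<leftarrow>zs. cnj (fst z) * ell2_inner (v (src G x) (snd z)) (v (src G x) a))"
    unfolding amap_def map_map o_def
    by (intro arg_cong[where f = sum_list] map_cong) (use assms act_ip in auto)
  also have "\<dots> = ell2_inner (cmb (src G x) zs) (v (src G x) a)"
    using assms by (intro cmb_inner_left[symmetric] v_ell2) auto
  finally show ?thesis .
qed

lemma cmb_norm_amap:
  assumes "snd ` set zs \<subseteq> X (src G x)"
  shows "ell2_norm (cmb (rng G x) (amap x zs)) = ell2_norm (cmb (src G x) zs)"
proof -
  have "ell2_inner (cmb (rng G x) (amap x zs)) (cmb (rng G x) (amap x zs))
    = (\<Sum>z\<leftarrow>amap x zs. fst z * ell2_inner (cmb (rng G x) (amap x zs)) (v (rng G x) (snd z)))"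
    using assms by (intro cmb_inner_right snd_amap cmb_in) auto
  also have "\<dots> = (\<Sum>z\<leftarrow>zs. fst z * ell2_inner (cmb (rng G x) (amap x zs)) (v (rng G x) (act x (snd z))))"
    by (simp add: amap_def o_def)
  also have "\<dots> = (\<Sum>z\<leftarrow>zs. fst z * ell2_inner (cmb (src G x) zs) (v (src G x) (snd z)))"
    by (intro arg_cong[where f = sum_list] map_cong) (use assms cmb_inner_amap in auto)
  also have "\<dots> = ell2_inner (cmb (src G x) zs) (cmb (src G x) zs)"
    using assms by (intro cmb_inner_right[symmetric] cmb_in) auto
  finally show ?thesis
    using assms by (subst (1 2) ell2_norm_eq_inner) (auto intro!: cmb_in snd_amap)
qed

lemma amap_append: "amap x (zs @ ws) = amap x zs @ amap x ws"
  by (simp add: amap_def)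

lemma amap_lin: "amap x (lin c zs) = lin c (amap x zs)"
  by (simp add: amap_def lin_def)

definition H :: "'g \<Rightarrow> (nat \<Rightarrow> complex) set" where
  "H u = {h\<in>ell2. \<forall>e>0. \<exists>zs. snd ` set zs \<subseteq> X u \<and> ell2_norm (\<lambda>n. h n - cmb u zs n) < e}"

lemma H_ell2: "h \<in> H u \<Longrightarrow> h \<in> ell2"
  by (simp add: H_def)

lemma cmb_H: "u \<in> units G \<Longrightarrow> snd ` set zs \<subseteq> X u \<Longrightarrow> cmb u zs \<in> H u"
  unfolding H_def using cmb_in by (auto intro!: exI[of _ zs])

lemma v_H: "u \<in> units G \<Longrightarrow> a \<in> X u \<Longrightarrow> v u a \<in> H u"
  using cmb_H[of u "[(1, a)]"] by (simp add: cmb_single)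

lemma zero_H: "u \<in> units G \<Longrightarrow> (\<lambda>n. 0) \<in> H u"
  using cmb_H[of u "[]"] by (simp add: cmb_def)

lemma add_H:
  assumes u: "u \<in> units G" and h: "h \<in> H u" "k \<in> H u"
  shows "(\<lambda>n. h n + k n) \<in> H u"
  unfolding H_def
proof (intro CollectI conjI allI impI)
  show "(\<lambda>n. h n + k n) \<in> ell2" using h H_ell2 ell2.add_W by blast
  fix e :: real assume e: "e > 0"
  obtain zs where zs: "snd ` set zs \<subseteq> X u" "ell2_norm (\<lambda>n. h n - cmb u zs n) < e/2"
    using h(1) e half_gt_zero unfolding H_def by blast
  obtain ws where ws: "snd ` set ws \<subseteq> X u" "ell2_norm (\<lambda>n. k n - cmb u ws n) < e/2"
    using h(2) e half_gt_zero unfolding H_def by blast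
  have i: "(\<lambda>n. h n - cmb u zs n) \<in> ell2" "(\<lambda>n. k n - cmb u ws n) \<in> ell2"
    using ell2.diff_W[OF H_ell2[OF h(1)] cmb_in[OF u zs(1)]] ell2.diff_W[OF H_ell2[OF h(2)] cmb_in[OF u ws(1)]] .
  have "ell2_norm (\<lambda>n. (h n - cmb u zs n) + (k n - cmb u ws n)) < e"
    using ell2_norm_triangle[OF i] zs(2) ws(2) by linarith
  then have "ell2_norm (\<lambda>n. (h n + k n) - cmb u (zs @ ws) n) < e"
    by (simp add: cmb_append algebra_simps)
  then show "\<exists>zs. snd ` set zs \<subseteq> X u \<and> ell2_norm (\<lambda>n. h n + k n - cmb u zs n) < e"
    using zs ws by (intro exI[of _ "zs @ ws"]) auto
qed

lemma scale_H:
  assumes u: "u \<in> units G" and h: "h \<in> H u"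
  shows "(\<lambda>n. c * h n) \<in> H u"
  unfolding H_def
proof (intro CollectI conjI allI impI)
  show "(\<lambda>n. c * h n) \<in> ell2" using h H_ell2 ell2.scale_W by blast
  fix e :: real assume e: "e > 0"
  then have "e / (cmod c + 1) > 0" by (simp add: add_nonneg_pos)
  then obtain zs where zs: "snd ` set zs \<subseteq> X u" "ell2_norm (\<lambda>n. h n - cmb u zs n) < e / (cmod c + 1)"
    using h unfolding H_def by blast
  have i: "(\<lambda>n. h n - cmb u zs n) \<in> ell2" using zs h u by (intro ell2.diff_W H_ell2 cmb_in)
  have "ell2_norm (\<lambda>n. c * h n - cmb u (lin c zs) n) = cmod c * ell2_norm (\<lambda>n. h n - cmb u zs n)"
    using ell2_norm_scale[OF i, of c] by (simp add: cmb_lin algebra_simps)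
  also have "\<dots> \<le> (cmod c + 1) * ell2_norm (\<lambda>n. h n - cmb u zs n)"
    using ell2_norm_nonneg[OF i] by (intro mult_right_mono) auto
  also have "\<dots> < e" using zs(2) by (simp add: pos_less_divide_eq add_nonneg_pos mult.commute)
  finally show "\<exists>zs. snd ` set zs \<subseteq> X u \<and> ell2_norm (\<lambda>n. c * h n - cmb u zs n) < e"
    using zs by (intro exI[of _ "lin c zs"]) auto
qed

lemma closed_H:
  assumes u: "u \<in> units G" and x: "x \<in> ell2" and cl: "\<And>e. e > 0 \<Longrightarrow> \<exists>y\<in>H u. ell2_norm (\<lambda>n. x n - y n) < e"
  shows "x \<in> H u"
  unfolding H_def
proof (intro CollectI conjI allI impI)
  fix e :: real assume e: "e > 0"
  obtain y where y: "y \<in> H u" "ell2_norm (\<lambda>n. x n - y n) < e/2" using cl[of "e/2"] e by auto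
  obtain zs where zs: "snd ` set zs \<subseteq> X u" "ell2_norm (\<lambda>n. y n - cmb u zs n) < e/2"
    using y(1) e half_gt_zero unfolding H_def by blast
  have "ell2_norm (\<lambda>n. x n - cmb u zs n) < e"
    using ell2_norm_triangle_diff[OF x H_ell2[OF y(1)] cmb_in[OF u zs(1)]] y(2) zs(2) by linarith
  then show "\<exists>zs. snd ` set zs \<subseteq> X u \<and> ell2_norm (\<lambda>n. x n - cmb u zs n) < e" using zs by blast
qed (rule x)

lemma H_sub: "u \<in> units G \<Longrightarrow> ell2_closed_subspace (H u)"
  unfolding ell2_closed_subspace_def using H_ell2 zero_H add_H scale_H closed_H by blast

text \<open>The wanted vector is the limit of the transports of combinations that tend to h; these
  form a Cauchy sequence because transport preserves norms of differences. It is described by its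
  inner products with transported vectors, which do not mention the approximating sequence.\<close>

lemma L_ex:
  assumes h: "h \<in> H (src G x)"
  shows "\<exists>y\<in>H (rng G x). (\<forall>a\<in>X (src G x). ell2_inner y (v (rng G x) (act x a)) = ell2_inner h (v (src G x) a))
    \<and> ell2_norm y = ell2_norm h"
proof -
  let ?s = "src G x" and ?r = "rng G x"
  have "\<exists>zs. snd ` set zs \<subseteq> X ?s \<and> ell2_norm (\<lambda>n. h n - cmb ?s zs n) < inverse (real (Suc k))" for k
    using h unfolding H_def by simp
  then obtain Z where Z: "\<And>k. snd ` set (Z k) \<subseteq> X ?s"
    "\<And>k. ell2_norm (\<lambda>n. h n - cmb ?s (Z k) n) < inverse (real (Suc k))"
    by metis
  have hE: "h \<in> ell2" using h H_ell2 by blast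
  have cE: "cmb ?s (Z k) \<in> ell2" for k using Z by (intro cmb_in) auto
  define y where "y k = cmb ?r (amap x (Z k))" for k
  have yH: "y k \<in> H ?r" for k unfolding y_def using Z by (intro cmb_H snd_amap) auto
  have yE: "y k \<in> ell2" for k using yH H_ell2 by blast
  have ydiff: "ell2_norm (\<lambda>n. y m n - y k n) = ell2_norm (\<lambda>n. cmb ?s (Z m) n - cmb ?s (Z k) n)" for m k
    unfolding y_def cmb_diff amap_lin[symmetric] amap_append[symmetric]
    using Z(1)[of m] Z(1)[of k] by (intro cmb_norm_amap) (simp add: image_Un)
  have lim: "(\<lambda>k. ell2_norm (\<lambda>n. cmb ?s (Z k) n - h n)) \<longlonglongrightarrow> 0"
  proof (rule tendsto_sandwich[OF _ _ tendsto_const LIMSEQ_inverse_real_of_nat])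
    show "\<forall>\<^sub>F k in sequentially. 0 \<le> ell2_norm (\<lambda>n. cmb ?s (Z k) n - h n)"
      using ell2_norm_nonneg[OF ell2.diff_W[OF cE hE]] by simp
    show "\<forall>\<^sub>F k in sequentially. ell2_norm (\<lambda>n. cmb ?s (Z k) n - h n) \<le> inverse (real (Suc k))"
      using Z(2) ell2_norm_diff_commute[OF cE hE] by (intro always_eventually allI) (metis less_imp_le)
  qed
  have "\<exists>N. \<forall>m\<ge>N. \<forall>k\<ge>N. ell2_norm (\<lambda>n. y m n - y k n) < e" if e: "e > 0" for e
  proof -
    obtain N where N: "\<And>k. k \<ge> N \<Longrightarrow> norm (ell2_norm (\<lambda>n. cmb ?s (Z k) n - h n) - 0) < e/2"
      using LIMSEQ_D[OF lim, of "e/2"] e by auto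
    have "ell2_norm (\<lambda>n. y m n - y k n) < e" if "m \<ge> N" "k \<ge> N" for m k
    proof -
      have "ell2_norm (\<lambda>n. cmb ?s (Z m) n - cmb ?s (Z k) n)
          \<le> ell2_norm (\<lambda>n. cmb ?s (Z m) n - h n) + ell2_norm (\<lambda>n. cmb ?s (Z k) n - h n)"
        using ell2_norm_triangle_diff[OF cE hE cE, of m k] ell2_norm_diff_commute[OF cE hE, of k] by simp
      then show ?thesis using N[OF that(1)] N[OF that(2)] unfolding ydiff by simp
    qed
    then show ?thesis by blast
  qed
  then obtain z where z: "z \<in> ell2" "(\<lambda>k. ell2_norm (\<lambda>n. y k n - z n)) \<longlonglongrightarrow> 0"
    using ell2_complete[of y] yE by blast
  have "z \<in> H ?r"
  proof (rule closed_H[OF rng_units z(1)])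
    fix e :: real assume "e > 0"
    then obtain N where "\<And>k. k \<ge> N \<Longrightarrow> norm (ell2_norm (\<lambda>n. y k n - z n) - 0) < e"
      using LIMSEQ_D[OF z(2)] by blast
    from this[of N] have "ell2_norm (\<lambda>n. z n - y N n) < e"
      using ell2_norm_diff_commute[OF yE z(1), of N] by simp
    then show "\<exists>y\<in>H (rng G x). ell2_norm (\<lambda>n. z n - y n) < e" using yH by blast
  qed
  moreover have "ell2_inner z (v ?r (act x a)) = ell2_inner h (v ?s a)" if a: "a \<in> X ?s" for a
  proof (rule LIMSEQ_unique)
    show "(\<lambda>k. ell2_inner (y k) (v ?r (act x a))) \<longlonglongrightarrow> ell2_inner z (v ?r (act x a))"
      using yE z a by (intro ell2_inner_tendsto v_ell2 act_in) auto
    have "ell2_inner (y k) (v ?r (act x a)) = ell2_inner (cmb ?s (Z k)) (v ?s a)" for k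
      unfolding y_def using Z a by (intro cmb_inner_amap) auto
    moreover have "(\<lambda>k. ell2_inner (cmb ?s (Z k)) (v ?s a)) \<longlonglongrightarrow> ell2_inner h (v ?s a)"
      using cE hE lim a by (intro ell2_inner_tendsto v_ell2) auto
    ultimately show "(\<lambda>k. ell2_inner (y k) (v ?r (act x a))) \<longlonglongrightarrow> ell2_inner h (v ?s a)" by simp
  qed
  moreover have "ell2_norm z = ell2_norm h"
  proof (rule LIMSEQ_unique)
    show "(\<lambda>k. ell2_norm (y k)) \<longlonglongrightarrow> ell2_norm z" using yE z by (intro ell2_norm_tendsto)
    have "ell2_norm (y k) = ell2_norm (cmb ?s (Z k))" for k
      unfolding y_def using Z by (intro cmb_norm_amap) auto
    then show "(\<lambda>k. ell2_norm (y k)) \<longlonglongrightarrow> ell2_norm h" using cE hE lim ell2_norm_tendsto by simp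
  qed
  ultimately show ?thesis by blast
qed

lemma H_eq_0:
  assumes u: "u \<in> units G" and y: "y \<in> H u" and 0: "\<And>b. b \<in> X u \<Longrightarrow> ell2_inner y (v u b) = 0"
  shows "y = (\<lambda>n. 0)"
proof -
  have yE: "y \<in> ell2" using y H_ell2 by blast
  have "ell2_norm y = 0"
  proof (rule ccontr)
    assume "ell2_norm y \<noteq> 0"
    then have pos: "ell2_norm y > 0" using ell2_norm_nonneg[OF yE] by simp
    then obtain zs where zs: "snd ` set zs \<subseteq> X u" "ell2_norm (\<lambda>n. y n - cmb u zs n) < ell2_norm y"
      using y unfolding H_def by blast
    have cE: "cmb u zs \<in> ell2" using zs u by (intro cmb_in) auto
    have "(\<Sum>z\<leftarrow>zs. fst z * ell2_inner y (v u (snd z))) = (\<Sum>z\<leftarrow>zs. 0)"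
      by (intro arg_cong[where f = sum_list] map_cong) (use 0 zs in auto)
    then have "ell2_inner y (cmb u zs) = 0"
      using cmb_inner_right[OF u zs(1) yE] by simp
    then have "ell2_inner y (\<lambda>n. y n - cmb u zs n) = of_real ((ell2_norm y)\<^sup>2)"
      using ell2.ip_diff[OF yE yE cE] ell2_inner_self[OF yE] by simp
    then have "(ell2_norm y)\<^sup>2 \<le> ell2_norm y * ell2_norm (\<lambda>n. y n - cmb u zs n)"
      using ell2_cs[OF yE ell2.diff_W[OF yE cE]] by (simp add: norm_power)
    then show False using zs(2) pos by (simp add: power2_eq_square)
  qed
  then show ?thesis using ell2_norm_eq_0[OF yE] by blast
qed

text \<open>Acting with the inverse of x shows that every index vector over the range is itself a
  transported one, and the index vectors span a dense subspace of the fibre.\<close>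

lemma L_unique:
  assumes y: "y \<in> H (rng G x)" "y' \<in> H (rng G x)"
    and eq: "\<And>a. a \<in> X (src G x) \<Longrightarrow> ell2_inner y (v (rng G x) (act x a)) = ell2_inner y' (v (rng G x) (act x a))"
  shows "y = y'"
proof -
  have E: "y \<in> ell2" "y' \<in> ell2" using y H_ell2 by auto
  have "(\<lambda>n. y n - y' n) = (\<lambda>n. 0)"
  proof (rule H_eq_0[OF rng_units])
    show "(\<lambda>n. y n - y' n) \<in> H (rng G x)"
      using add_H[OF rng_units y(1) scale_H[OF rng_units y(2), of "-1"]] by simp
    fix b assume b: "b \<in> X (rng G x)"
    let ?a = "act (ginv G x) b"
    have a: "?a \<in> X (src G x)" using act_in[of b "ginv G x"] b by simp
    have "v (rng G x) (act x ?a) = v (rng G x) (act (x \<cdot> ginv G x) b)"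
      using act_mult[of x "ginv G x" b] b by simp
    also have "\<dots> = v (rng G x) b" using act_unit[of "rng G x" b] b by (simp add: mult_inv)
    finally have "v (rng G x) b = v (rng G x) (act x ?a)" by simp
    then show "ell2_inner (\<lambda>n. y n - y' n) (v (rng G x) b) = 0"
      using eq[OF a] ell2.ip_diff_left[OF E v_ell2[OF rng_units b]] by simp
  qed
  then show ?thesis by (metis (no_types, lifting) eq_iff_diff_eq_0 ext)
qed

definition L :: "'g \<Rightarrow> (nat \<Rightarrow> complex) \<Rightarrow> (nat \<Rightarrow> complex)" where
  "L x h = (SOME y. y \<in> H (rng G x) \<and> (\<forall>a\<in>X (src G x). ell2_inner y (v (rng G x) (act x a)) = ell2_inner h (v (src G x) a))
     \<and> ell2_norm y = ell2_norm h)"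

lemma L_spec:
  assumes "h \<in> H (src G x)"
  shows L_H: "L x h \<in> H (rng G x)"
    and L_inner: "a \<in> X (src G x) \<Longrightarrow> ell2_inner (L x h) (v (rng G x) (act x a)) = ell2_inner h (v (src G x) a)"
    and L_norm: "ell2_norm (L x h) = ell2_norm h"
  using someI_ex[of "\<lambda>y. y \<in> H (rng G x) \<and> (\<forall>a\<in>X (src G x). ell2_inner y (v (rng G x) (act x a)) = ell2_inner h (v (src G x) a))
     \<and> ell2_norm y = ell2_norm h"] L_ex[OF assms] unfolding L_def[symmetric] by blast+

text \<open>Additivity, homogeneity and the homomorphism law are all proved by this comparison of
  inner products, so the approximating sequences of \<open>L_ex\<close> do not have to be handled
  again.\<close>

lemma L_eqI:
  assumes "h \<in> H (src G x)" "y \<in> H (rng G x)"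
    "\<And>a. a \<in> X (src G x) \<Longrightarrow> ell2_inner y (v (rng G x) (act x a)) = ell2_inner h (v (src G x) a)"
  shows "L x h = y"
  using L_unique[OF L_H[OF assms(1)] assms(2)] L_inner[OF assms(1)] assms(3) by simp

lemma L_v: "a \<in> X (src G x) \<Longrightarrow> L x (v (src G x) a) = v (rng G x) (act x a)"
  by (rule L_eqI) (auto intro: v_H act_in act_ip)

lemma L_add:
  assumes "h \<in> H (src G x)" "k \<in> H (src G x)"
  shows "L x (\<lambda>n. h n + k n) = (\<lambda>n. L x h n + L x k n)"
proof (rule L_eqI)
  fix a assume a: "a \<in> X (src G x)"
  have E: "h \<in> ell2" "k \<in> ell2" "L x h \<in> ell2" "L x k \<in> ell2" "v (src G x) a \<in> ell2" "v (rng G x) (act x a) \<in> ell2"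
    using assms L_H H_ell2 a by (auto intro: v_ell2 act_in)
  then show "ell2_inner (\<lambda>n. L x h n + L x k n) (v (rng G x) (act x a)) = ell2_inner (\<lambda>n. h n + k n) (v (src G x) a)"
    using assms a by (simp add: ell2.ip_add_left L_inner)
qed (use assms L_H add_H in auto)

lemma L_scale:
  assumes "h \<in> H (src G x)"
  shows "L x (\<lambda>n. c * h n) = (\<lambda>n. c * L x h n)"
proof (rule L_eqI)
  fix a assume a: "a \<in> X (src G x)"
  have E: "h \<in> ell2" "L x h \<in> ell2" "v (src G x) a \<in> ell2" "v (rng G x) (act x a) \<in> ell2"
    using assms L_H H_ell2 a by (auto intro: v_ell2 act_in)
  then show "ell2_inner (\<lambda>n. c * L x h n) (v (rng G x) (act x a)) = ell2_inner (\<lambda>n. c * h n) (v (src G x) a)"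
    using assms a by (simp add: ell2.ip_scale_left L_inner)
qed (use assms L_H scale_H in auto)

lemma L_mult:
  assumes xy: "src G x = rng G y" and h: "h \<in> H (src G y)"
  shows "L (x \<cdot> y) h = L x (L y h)"
proof (rule L_eqI)
  show "h \<in> H (src G (x \<cdot> y))" using h xy by (simp add: src_mult)
  have LyH: "L y h \<in> H (src G x)" using L_H[OF h] xy by simp
  then show "L x (L y h) \<in> H (rng G (x \<cdot> y))" using L_H xy by (simp add: rng_mult)
  fix a assume "a \<in> X (src G (x \<cdot> y))"
  then have a: "a \<in> X (src G y)" using xy by (simp add: src_mult)
  have "ell2_inner (L x (L y h)) (v (rng G x) (act (x \<cdot> y) a)) = ell2_inner (L x (L y h)) (v (rng G x) (act x (act y a)))"
    using act_mult[OF xy a] by simp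
  also have "\<dots> = ell2_inner (L y h) (v (src G x) (act y a))"
    using act_in[OF a] xy by (intro L_inner[OF LyH]) simp
  also have "\<dots> = ell2_inner h (v (src G y) a)" using L_inner[OF h a] xy by simp
  finally show "ell2_inner (L x (L y h)) (v (rng G (x \<cdot> y)) (act (x \<cdot> y) a)) = ell2_inner h (v (src G (x \<cdot> y)) a)"
    using xy by (simp add: rng_mult src_mult)
qed

lemma L_unit: "u \<in> units G \<Longrightarrow> h \<in> H u \<Longrightarrow> L u h = h"
  by (rule L_eqI) (auto simp: unit_src unit_rng act_unit)

lemma L_onto: "L x ` H (src G x) = H (rng G x)"
proof (intro equalityI subsetI)
  fix k assume k: "k \<in> H (rng G x)"
  then have "L (ginv G x) k \<in> H (src G x)" using L_H[of k "ginv G x"] by simp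
  moreover have "L x (L (ginv G x) k) = k"
    using L_mult[of x "ginv G x" k] k L_unit[OF rng_units, of k x] by (simp add: mult_inv)
  ultimately show "k \<in> L x ` H (src G x)" by force
qed (use L_H in auto)

lemma L_diff:
  assumes "h \<in> H (src G x)" "k \<in> H (src G x)"
  shows "ell2_norm (\<lambda>n. L x h n - L x k n) = ell2_norm (\<lambda>n. h n - k n)"
proof -
  have k': "(\<lambda>n. -1 * k n) \<in> H (src G x)" using scale_H[OF src_units assms(2)] .
  have "(\<lambda>n. L x h n - L x k n) = L x (\<lambda>n. h n + -1 * k n)"
    unfolding L_add[OF assms(1) k'] L_scale[OF assms(2)] by simp
  then show ?thesis using L_norm[OF add_H[OF src_units assms(1) k']] by simp
qed

definition scmb :: "(complex \<times> ('g \<Rightarrow> 'x)) list \<Rightarrow> 'g \<Rightarrow> nat \<Rightarrow> complex" where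
  "scmb zs u = (\<lambda>n. \<Sum>z\<leftarrow>zs. fst z * v u (snd z u) n)"

text \<open>The continuous field generated by \<open>Sec\<close>: local uniform limits of
  combinations of its sections. Constant coefficients are enough, because a continuous coefficient
  is nearly constant near each point.\<close>

definition \<S> :: "('g \<Rightarrow> nat \<Rightarrow> complex) set" where
  "\<S> = {\<xi>\<in>Pi (units G) H. \<forall>u\<in>units G. \<forall>e>0. \<exists>zs. snd ` set zs \<subseteq> Sec \<and>
      (\<exists>V. open V \<and> u \<in> V \<and> (\<forall>w\<in>V \<inter> units G. ell2_norm (\<lambda>n. \<xi> w n - scmb zs w n) \<le> e))}"

lemma scmb_cmb: "scmb zs u = cmb u (map (\<lambda>z. (fst z, snd z u)) zs)"
  by (simp add: scmb_def cmb_def o_def)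

lemma scmb_set: "snd ` set zs \<subseteq> Sec \<Longrightarrow> u \<in> units G \<Longrightarrow> snd ` set (map (\<lambda>z. (fst z, snd z u)) zs) \<subseteq> X u"
  by (auto intro!: sec_in)

lemma scmb_H: "snd ` set zs \<subseteq> Sec \<Longrightarrow> u \<in> units G \<Longrightarrow> scmb zs u \<in> H u"
  unfolding scmb_cmb by (intro cmb_H scmb_set)

lemma scmb_append: "scmb (zs @ ws) u = (\<lambda>n. scmb zs u n + scmb ws u n)"
  by (simp add: scmb_def)

lemma scmb_lin: "scmb (lin c zs) u = (\<lambda>n. c * scmb zs u n)"
  by (simp add: scmb_def lin_def o_def sum_list_const_mult mult.assoc)

lemma scmb_S: "snd ` set zs \<subseteq> Sec \<Longrightarrow> scmb zs \<in> \<S>"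
  unfolding \<S>_def using scmb_H by (auto intro!: exI[of _ zs] exI[of _ UNIV])

lemma sec_S: "\<sigma> \<in> Sec \<Longrightarrow> (\<lambda>u. v u (\<sigma> u)) \<in> \<S>"
  using scmb_S[of "[(1, \<sigma>)]"] by (simp add: scmb_def[abs_def])

lemma S_H: "\<xi> \<in> \<S> \<Longrightarrow> u \<in> units G \<Longrightarrow> \<xi> u \<in> H u"
  by (auto simp: \<S>_def)

lemma S_approx:
  assumes "\<xi> \<in> \<S>" "u \<in> units G" "e > 0"
  obtains zs V where "snd ` set zs \<subseteq> Sec" "open V" "u \<in> V"
    "\<forall>w\<in>V \<inter> units G. ell2_norm (\<lambda>n. \<xi> w n - scmb zs w n) \<le> e"
  using assms unfolding \<S>_def by blast

lemma scmb_coeff_continuous: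
  assumes "snd ` set zs \<subseteq> Sec" "snd ` set ws \<subseteq> Sec"
  shows "continuous_on UNIV (\<lambda>x. ell2_inner (L x (scmb zs (src G x))) (scmb ws (rng G x)))"
proof -
  have "ell2_inner (L x (scmb zs (src G x))) (scmb ws (rng G x))
    = (\<Sum>w\<leftarrow>ws. \<Sum>z\<leftarrow>zs. cnj (fst z) * fst w *
        ell2_inner (v (rng G x) (act x (snd z (src G x)))) (v (rng G x) (snd w (rng G x))))" for x
  proof -
    let ?zs = "map (\<lambda>z. (fst z, snd z (src G x))) zs" and ?ws = "map (\<lambda>z. (fst z, snd z (rng G x))) ws"
    note 1 = scmb_set[OF assms(1) src_units, of x] and 2 = scmb_set[OF assms(2) rng_units, of x]
    have "L x (cmb (src G x) ?zs) = cmb (rng G x) (amap x ?zs)"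
      by (rule L_eqI[OF cmb_H[OF src_units 1] cmb_H[OF rng_units snd_amap[OF 1]] cmb_inner_amap[OF 1]])
    then have "ell2_inner (L x (scmb zs (src G x))) (scmb ws (rng G x)) = ell2_inner (cmb (rng G x) (amap x ?zs)) (cmb (rng G x) ?ws)"
      by (simp add: scmb_cmb)
    also have "\<dots> = (\<Sum>w\<leftarrow>?ws. fst w * ell2_inner (cmb (rng G x) (amap x ?zs)) (v (rng G x) (snd w)))"
      by (rule cmb_inner_right[OF rng_units 2 cmb_in[OF rng_units snd_amap[OF 1]]])
    also have "\<dots> = (\<Sum>w\<leftarrow>?ws. fst w * (\<Sum>z\<leftarrow>amap x ?zs. cnj (fst z) * ell2_inner (v (rng G x) (snd z)) (v (rng G x) (snd w))))"
      using 2 by (intro arg_cong[where f = sum_list] map_cong refl arg_cong2[where f = "(*)"] cmb_inner_left[OF rng_units snd_amap[OF 1]] v_ell2) auto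
    also have "\<dots> = (\<Sum>w\<leftarrow>ws. \<Sum>z\<leftarrow>zs. cnj (fst z) * fst w *
        ell2_inner (v (rng G x) (act x (snd z (src G x)))) (v (rng G x) (snd w (rng G x))))"
      by (simp add: amap_def o_def sum_list_const_mult[symmetric] mult_ac)
    finally show ?thesis .
  qed
  moreover have sl: "continuous_on UNIV (\<lambda>x. \<Sum>w\<leftarrow>ws. f w x)" if "\<forall>w\<in>set ws. continuous_on UNIV (\<lambda>x. f w x)"
    for ws and f :: "(complex \<times> ('g \<Rightarrow> 'x)) \<Rightarrow> 'g \<Rightarrow> complex"
    using that by (induction ws) (auto intro!: continuous_intros)
  have "continuous_on UNIV (\<lambda>x. \<Sum>w\<leftarrow>ws. \<Sum>z\<leftarrow>zs. cnj (fst z) * fst w *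
        ell2_inner (v (rng G x) (act x (snd z (src G x)))) (v (rng G x) (snd w (rng G x))))"
    using assms by (intro sl ballI continuous_on_mult continuous_on_const cont) auto
  ultimately show ?thesis by simp
qed

text \<open>At a unit the action is the identity, so the squared norm of a combination is a
  coefficient restricted to the units; a general section is a local uniform limit of
  combinations.\<close>

lemma S_norm_continuous:
  assumes "\<xi> \<in> \<S>"
  shows "continuous_on (units G) (\<lambda>u. ell2_norm (\<xi> u))"
proof (rule continuous_approx)
  fix u and e :: real assume u: "u \<in> units G" and e: "e > 0"
  obtain zs V where zs: "snd ` set zs \<subseteq> Sec" and V: "open V" "u \<in> V" "\<forall>w\<in>V \<inter> units G. ell2_norm (\<lambda>n. \<xi> w n - scmb zs w n) \<le> e"
    using assms u e unfolding \<S>_def by blast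
  have "continuous_on (units G) (\<lambda>u. sqrt (Re (ell2_inner (L u (scmb zs (src G u))) (scmb zs (rng G u)))))"
    by (intro continuous_intros continuous_on_subset[OF scmb_coeff_continuous[OF zs zs]]) auto
  then have "continuous_on (units G) (\<lambda>u. ell2_norm (scmb zs u))"
    by (rule continuous_on_cong[THEN iffD1, rotated -1])
       (auto simp: ell2_norm_eq_inner[OF H_ell2[OF scmb_H[OF zs]]] unit_src unit_rng L_unit scmb_H[OF zs])
  moreover have "dist (ell2_norm (\<xi> w)) (ell2_norm (scmb zs w)) \<le> e" if "w \<in> V \<inter> units G" for w
  proof -
    have w: "w \<in> units G" "ell2_norm (\<lambda>n. \<xi> w n - scmb zs w n) \<le> e" using V(3) that by auto
    show ?thesis
      using ell2_norm_diff_abs[OF H_ell2[OF S_H[OF assms w(1)]] H_ell2[OF scmb_H[OF zs w(1)]]] w(2)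
      unfolding dist_real_def by linarith
  qed
  ultimately show "\<exists>g V. continuous_on (units G) g \<and> open V \<and> u \<in> V \<and> (\<forall>y\<in>V \<inter> units G. dist (ell2_norm (\<xi> y)) (g y) \<le> e)"
    using V by blast
qed

lemma norm_locally_bounded:
  assumes "\<xi> \<in> \<S>" "u \<in> units G"
  obtains V where "open V" "u \<in> V" "\<forall>w\<in>V \<inter> units G. ell2_norm (\<xi> w) \<le> ell2_norm (\<xi> u) + 1"
proof -
  have "\<forall>\<^sub>F w in at u within units G. dist (ell2_norm (\<xi> w)) (ell2_norm (\<xi> u)) < 1"
    using S_norm_continuous[OF assms(1)] assms(2) unfolding continuous_on_def by (intro tendstoD) auto
  then obtain V where V: "open V" "u \<in> V" "\<forall>w\<in>V. w \<noteq> u \<longrightarrow> w \<in> units G \<longrightarrow> dist (ell2_norm (\<xi> w)) (ell2_norm (\<xi> u)) < 1"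
    unfolding eventually_at_topological by blast
  have "ell2_norm (\<xi> w) \<le> ell2_norm (\<xi> u) + 1" if "w \<in> V \<inter> units G" for w
  proof (cases "w = u")
    case False
    then have "\<bar>ell2_norm (\<xi> w) - ell2_norm (\<xi> u)\<bar> < 1"
      using V(3) that by (simp add: dist_real_def)
    then show ?thesis by linarith
  qed simp
  then show ?thesis using that V by blast
qed

lemma S_coeff_continuous:
  assumes xi: "\<xi> \<in> \<S>" and eta: "\<eta> \<in> \<S>"
  shows "continuous_on UNIV (\<lambda>x. ell2_inner (L x (\<xi> (src G x))) (\<eta> (rng G x)))"
proof (rule continuous_approx)
  fix x and e :: real assume e: "e > 0"
  define B where "B = ell2_norm (\<eta> (rng G x)) + 1"
  \<comment> \<open>One unit for the variation of the norm of \<xi> near the point, one more for the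
    distance d \<le> 1 from \<xi> to its approximant.\<close>
  define C where "C = ell2_norm (\<xi> (src G x)) + 2"
  have B: "B > 0" and C: "C > 0"
    using ell2_norm_nonneg[OF H_ell2[OF S_H[OF xi src_units]]] ell2_norm_nonneg[OF H_ell2[OF S_H[OF eta rng_units]]]
    by (auto simp: B_def C_def add_nonneg_pos)
  define d where "d = min 1 (e / (2 * B))"
  have d: "d > 0" "d \<le> 1" "d * B \<le> e/2" using e B by (auto simp: d_def min_def field_simps)
  define d' where "d' = e / (2 * C)"
  have d': "d' > 0" "C * d' = e/2" using e C by (auto simp: d'_def)
  obtain zs V1 where zs: "snd ` set zs \<subseteq> Sec" and V1: "open V1" "src G x \<in> V1"
    "\<forall>w\<in>V1 \<inter> units G. ell2_norm (\<lambda>n. \<xi> w n - scmb zs w n) \<le> d"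
    by (rule S_approx[OF xi src_units d(1)])
  obtain ws V2 where ws: "snd ` set ws \<subseteq> Sec" and V2: "open V2" "rng G x \<in> V2"
    "\<forall>w\<in>V2 \<inter> units G. ell2_norm (\<lambda>n. \<eta> w n - scmb ws w n) \<le> d'"
    by (rule S_approx[OF eta rng_units d'(1)])
  obtain V3 where V3: "open V3" "src G x \<in> V3" "\<forall>w\<in>V3 \<inter> units G. ell2_norm (\<xi> w) \<le> ell2_norm (\<xi> (src G x)) + 1"
    by (rule norm_locally_bounded[OF xi src_units, of x])
  obtain V4 where V4: "open V4" "rng G x \<in> V4" "\<forall>w\<in>V4 \<inter> units G. ell2_norm (\<eta> w) \<le> B"
    unfolding B_def by (rule norm_locally_bounded[OF eta rng_units, of x])
  let ?V = "(src G -` (V1 \<inter> V3)) \<inter> (rng G -` (V2 \<inter> V4))"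
  have "open ?V"
    using V1 V2 V3 V4 cont_rng cont_src by (intro open_Int open_vimage) auto
  moreover have "x \<in> ?V" using V1 V2 V3 V4 by auto
  moreover have "dist (ell2_inner (L y (\<xi> (src G y))) (\<eta> (rng G y))) (ell2_inner (L y (scmb zs (src G y))) (scmb ws (rng G y))) \<le> e"
    if y: "y \<in> ?V" for y
  proof -
    note xH = S_H[OF xi src_units, of y] and eH = S_H[OF eta rng_units, of y]
      and zH = scmb_H[OF zs src_units, of y] and wH = scmb_H[OF ws rng_units, of y]
    have 1: "ell2_norm (\<lambda>n. L y (\<xi> (src G y)) n - L y (scmb zs (src G y)) n) \<le> d"
      using L_diff[OF xH zH] V1(3) y by simp
    have "ell2_norm (scmb zs (src G y)) \<le> ell2_norm (\<xi> (src G y)) + d"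
    proof -
      have "ell2_norm (\<lambda>n. \<xi> (src G y) n - scmb zs (src G y) n) \<le> d" using V1(3) y by simp
      then show ?thesis using ell2_norm_diff_abs[OF H_ell2[OF xH] H_ell2[OF zH]] by linarith
    qed
    then have 2: "ell2_norm (L y (scmb zs (src G y))) \<le> C"
    proof -
      have "ell2_norm (\<xi> (src G y)) \<le> ell2_norm (\<xi> (src G x)) + 1" using V3(3) y by simp
      with \<open>ell2_norm (scmb zs (src G y)) \<le> ell2_norm (\<xi> (src G y)) + d\<close> show ?thesis
        using L_norm[OF zH] d(2) unfolding C_def by linarith
    qed
    have 3: "ell2_norm (\<eta> (rng G y)) \<le> B" using V4(3) y by simp
    have 4: "ell2_norm (\<lambda>n. \<eta> (rng G y) n - scmb ws (rng G y) n) \<le> d'" using V2(3) y by simp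
    have E: "L y (\<xi> (src G y)) \<in> ell2" "L y (scmb zs (src G y)) \<in> ell2" "\<eta> (rng G y) \<in> ell2" "scmb ws (rng G y) \<in> ell2"
      using L_H[OF xH] L_H[OF zH] eH wH H_ell2 by blast+
    have "cmod (ell2_inner (L y (\<xi> (src G y))) (\<eta> (rng G y)) - ell2_inner (L y (scmb zs (src G y))) (scmb ws (rng G y)))
      \<le> d * B + C * d'"
    proof (rule order_trans[OF ell2_inner_diff_bound[OF E]], rule add_mono)
      show "ell2_norm (\<lambda>n. L y (\<xi> (src G y)) n - L y (scmb zs (src G y)) n) * ell2_norm (\<eta> (rng G y)) \<le> d * B"
        using 1 3 d E by (intro mult_mono) auto
      show "ell2_norm (L y (scmb zs (src G y))) * ell2_norm (\<lambda>n. \<eta> (rng G y) n - scmb ws (rng G y) n) \<le> C * d'"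
        using 2 4 C E by (intro mult_mono) (auto intro!: ell2_norm_nonneg ell2.diff_W)
    qed
    also have "\<dots> \<le> e" using d d' by simp
    finally show ?thesis by (simp add: dist_norm)
  qed
  ultimately show "\<exists>g V. continuous_on UNIV g \<and> open V \<and> x \<in> V \<and>
      (\<forall>y\<in>V \<inter> UNIV. dist (ell2_inner (L y (\<xi> (src G y))) (\<eta> (rng G y))) (g y) \<le> e)"
    using scmb_coeff_continuous[OF zs ws] by (intro exI[of _ "\<lambda>y. ell2_inner (L y (scmb zs (src G y))) (scmb ws (rng G y))"] exI[of _ ?V]) auto
qed

lemma S_local:
  assumes xi: "\<xi> \<in> Pi (units G) H"
    and loc: "\<And>u e. u \<in> units G \<Longrightarrow> e > 0 \<Longrightarrow> \<exists>\<eta>\<in>\<S>. \<exists>V. open V \<and> u \<in> V \<and>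
           (\<forall>v\<in>V \<inter> units G. ell2_norm (\<lambda>n. \<xi> v n - \<eta> v n) \<le> e)"
  shows "\<xi> \<in> \<S>"
  unfolding \<S>_def
proof (intro CollectI conjI ballI allI impI)
  fix u and e :: real assume u: "u \<in> units G" and e: "e > 0"
  obtain \<eta> V where V: "\<eta> \<in> \<S>" "open V" "u \<in> V" "\<And>w. w \<in> V \<inter> units G \<Longrightarrow> ell2_norm (\<lambda>n. \<xi> w n - \<eta> w n) \<le> e/2"
    using loc[OF u, of "e/2"] e by auto
  obtain zs V' where zs: "snd ` set zs \<subseteq> Sec" and V': "open V'" "u \<in> V'"
    "\<forall>w\<in>V' \<inter> units G. ell2_norm (\<lambda>n. \<eta> w n - scmb zs w n) \<le> e/2"
    by (rule S_approx[OF V(1) u half_gt_zero[OF e]])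
  have "ell2_norm (\<lambda>n. \<xi> w n - scmb zs w n) \<le> e" if w: "w \<in> (V \<inter> V') \<inter> units G" for w
  proof -
    have E: "\<xi> w \<in> ell2" "\<eta> w \<in> ell2" "scmb zs w \<in> ell2"
      using xi S_H[OF V(1), of w] scmb_H[OF zs, of w] w H_ell2 by (auto simp: Pi_iff)
    have "ell2_norm (\<lambda>n. \<xi> w n - \<eta> w n) \<le> e/2" "ell2_norm (\<lambda>n. \<eta> w n - scmb zs w n) \<le> e/2"
      using V(4)[of w] V'(3) w by auto
    then show ?thesis using ell2_norm_triangle_diff[OF E] by linarith
  qed
  then show "\<exists>zs. snd ` set zs \<subseteq> Sec \<and> (\<exists>V. open V \<and> u \<in> V \<and> (\<forall>w\<in>V \<inter> units G. ell2_norm (\<lambda>n. \<xi> w n - scmb zs w n) \<le> e))"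
    using zs V V' by (intro exI[of _ zs] conjI exI[of _ "V \<inter> V'"]) auto
qed (rule xi)

lemma S_add:
  assumes "\<xi> \<in> \<S>" "\<eta> \<in> \<S>"
  shows "(\<lambda>u n. \<xi> u n + \<eta> u n) \<in> \<S>"
  unfolding \<S>_def
proof (intro CollectI conjI ballI allI impI)
  show "(\<lambda>u n. \<xi> u n + \<eta> u n) \<in> Pi (units G) H" using assms S_H by (auto intro!: add_H)
  fix u and e :: real assume u: "u \<in> units G" and e: "e > 0"
  obtain zs V where zs: "snd ` set zs \<subseteq> Sec" and V: "open V" "u \<in> V"
    "\<forall>w\<in>V \<inter> units G. ell2_norm (\<lambda>n. \<xi> w n - scmb zs w n) \<le> e/2"
    by (rule S_approx[OF assms(1) u half_gt_zero[OF e]])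
  obtain ws V' where ws: "snd ` set ws \<subseteq> Sec" and V': "open V'" "u \<in> V'"
    "\<forall>w\<in>V' \<inter> units G. ell2_norm (\<lambda>n. \<eta> w n - scmb ws w n) \<le> e/2"
    by (rule S_approx[OF assms(2) u half_gt_zero[OF e]])
  have "ell2_norm (\<lambda>n. (\<xi> w n + \<eta> w n) - scmb (zs @ ws) w n) \<le> e" if w: "w \<in> (V \<inter> V') \<inter> units G" for w
  proof -
    have "\<xi> w \<in> ell2" "\<eta> w \<in> ell2" "scmb zs w \<in> ell2" "scmb ws w \<in> ell2"
      using assms S_H scmb_H[OF zs, of w] scmb_H[OF ws, of w] w H_ell2 by blast+
    then have "ell2_norm (\<lambda>n. (\<xi> w n - scmb zs w n) + (\<eta> w n - scmb ws w n))
       \<le> ell2_norm (\<lambda>n. \<xi> w n - scmb zs w n) + ell2_norm (\<lambda>n. \<eta> w n - scmb ws w n)"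
      by (intro ell2_norm_triangle ell2.diff_W)
    also have "\<dots> \<le> e/2 + e/2" by (rule add_mono) (use V(3) V'(3) w in auto)
    also have "\<dots> = e" by simp
    finally show ?thesis by (simp add: scmb_append algebra_simps)
  qed
  then show "\<exists>zs. snd ` set zs \<subseteq> Sec \<and> (\<exists>V. open V \<and> u \<in> V \<and> (\<forall>w\<in>V \<inter> units G. ell2_norm (\<lambda>n. (\<xi> w n + \<eta> w n) - scmb zs w n) \<le> e))"
    using zs ws V V' by (intro exI[of _ "zs @ ws"] conjI exI[of _ "V \<inter> V'"]) auto
qed

lemma S_scale:
  assumes "\<xi> \<in> \<S>"
  shows "(\<lambda>u n. c * \<xi> u n) \<in> \<S>"
  unfolding \<S>_def
proof (intro CollectI conjI ballI allI impI)
  show "(\<lambda>u n. c * \<xi> u n) \<in> Pi (units G) H" using assms S_H by (auto intro!: scale_H)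
  fix u and e :: real assume u: "u \<in> units G" and e: "e > 0"
  then have e': "e / (cmod c + 1) > 0" by (simp add: add_nonneg_pos)
  obtain zs V where zs: "snd ` set zs \<subseteq> Sec" and V: "open V" "u \<in> V"
    "\<forall>w\<in>V \<inter> units G. ell2_norm (\<lambda>n. \<xi> w n - scmb zs w n) \<le> e / (cmod c + 1)"
    by (rule S_approx[OF assms u e'])
  have "ell2_norm (\<lambda>n. c * \<xi> w n - scmb (lin c zs) w n) \<le> e" if w: "w \<in> V \<inter> units G" for w
  proof -
    have i: "(\<lambda>n. \<xi> w n - scmb zs w n) \<in> ell2"
      using assms S_H scmb_H[OF zs, of w] w H_ell2 by (intro ell2.diff_W) blast+
    have "ell2_norm (\<lambda>n. c * \<xi> w n - scmb (lin c zs) w n) = cmod c * ell2_norm (\<lambda>n. \<xi> w n - scmb zs w n)"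
      using ell2_norm_scale[OF i, of c] by (simp add: scmb_lin algebra_simps)
    also have "\<dots> \<le> (cmod c + 1) * (e / (cmod c + 1))"
      using V(3) w ell2_norm_nonneg[OF i] by (intro mult_mono) auto
    also have "\<dots> = e" by (simp add: add_nonneg_pos less_imp_neq[THEN not_sym])
    finally show ?thesis .
  qed
  then show "\<exists>zs. snd ` set zs \<subseteq> Sec \<and> (\<exists>V. open V \<and> u \<in> V \<and> (\<forall>w\<in>V \<inter> units G. ell2_norm (\<lambda>n. c * \<xi> w n - scmb zs w n) \<le> e))"
    using zs V by (intro exI[of _ "lin c zs"] conjI exI[of _ V]) auto
qed

text \<open>The axiom \<open>total\<close> approximates single index vectors at one unit by values
  of sections; linearity and the definition of the fibre as a closure extend this to the whole
  fibre.\<close>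

lemma S_dense:
  assumes u: "u \<in> units G" and h: "h \<in> H u" and e: "e > 0"
  shows "\<exists>\<xi>\<in>\<S>. ell2_norm (\<lambda>n. \<xi> u n - h n) < e"
proof -
  have step: "\<exists>ws. snd ` set ws \<subseteq> Sec \<and> ell2_norm (\<lambda>n. cmb u zs n - scmb ws u n) < d"
    if "snd ` set zs \<subseteq> X u" "d > 0" for zs d
    using that
  proof (induction zs arbitrary: d)
    case Nil
    then show ?case by (intro exI[of _ "[]"]) (simp add: cmb_def scmb_def)
  next
    case (Cons z zs)
    obtain ws where ws: "snd ` set ws \<subseteq> Sec" "ell2_norm (\<lambda>n. cmb u zs n - scmb ws u n) < d/2"
      using Cons.IH[of "d/2"] Cons.prems by auto
    have dd: "d / (2 * (cmod (fst z) + 1)) > 0" using Cons.prems by (simp add: add_nonneg_pos)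
    obtain vs where vs: "snd ` set vs \<subseteq> Sec" "ell2_norm (\<lambda>n. v u (snd z) n - scmb vs u n) < d / (2 * (cmod (fst z) + 1))"
      using total[OF u _ dd, of "snd z"] Cons.prems unfolding scmb_def by auto
    have i: "(\<lambda>n. v u (snd z) n - scmb vs u n) \<in> ell2"
      using Cons.prems u scmb_H[OF vs(1) u] H_ell2 by (intro ell2.diff_W v_ell2) auto
    have j: "(\<lambda>n. cmb u zs n - scmb ws u n) \<in> ell2"
      using Cons.prems u scmb_H[OF ws(1) u] H_ell2 by (intro ell2.diff_W cmb_in) auto
    have "cmod (fst z) * ell2_norm (\<lambda>n. v u (snd z) n - scmb vs u n) \<le> (cmod (fst z) + 1) * ell2_norm (\<lambda>n. v u (snd z) n - scmb vs u n)"
      using ell2_norm_nonneg[OF i] by (intro mult_right_mono) auto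
    also have "\<dots> < d/2"
    proof -
      have p: "2 * (cmod (fst z) + 1) > 0" by (simp add: add_nonneg_pos)
      show ?thesis using vs(2)[unfolded pos_less_divide_eq[OF p]] by (simp add: algebra_simps)
    qed
    finally have "ell2_norm (\<lambda>n. fst z * (v u (snd z) n - scmb vs u n) + (cmb u zs n - scmb ws u n)) < d"
      using ell2_norm_triangle[OF ell2.scale_W[OF i, of "fst z"] j] ell2_norm_scale[OF i, of "fst z"] ws(2) by simp
    moreover have "(\<lambda>n. fst z * (v u (snd z) n - scmb vs u n) + (cmb u zs n - scmb ws u n))
        = (\<lambda>n. cmb u (z # zs) n - scmb (lin (fst z) vs @ ws) u n)"
      by (simp add: cmb_def scmb_append scmb_lin algebra_simps)
    ultimately show ?case using ws vs by (intro exI[of _ "lin (fst z) vs @ ws"]) (simp add: image_Un)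
  qed
  obtain zs where zs: "snd ` set zs \<subseteq> X u" "ell2_norm (\<lambda>n. h n - cmb u zs n) < e/2"
    using h half_gt_zero[OF e] unfolding H_def by blast
  obtain ws where ws: "snd ` set ws \<subseteq> Sec" "ell2_norm (\<lambda>n. cmb u zs n - scmb ws u n) < e/2"
    using step[OF zs(1) half_gt_zero[OF e]] by blast
  have E: "h \<in> ell2" "cmb u zs \<in> ell2" "scmb ws u \<in> ell2"
    using h H_ell2 cmb_in[OF u zs(1)] scmb_H[OF ws(1) u] by auto
  have "ell2_norm (\<lambda>n. scmb ws u n - h n) < e"
    using ell2_norm_triangle_diff[OF E] ell2_norm_diff_commute[OF E(1,3)] ws zs by simp
  then show ?thesis using scmb_S[OF ws(1)] by blast
qed

lemma field: "continuous_hilbert_field (units G) H \<S>"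
  unfolding continuous_hilbert_field_def
proof (intro conjI ballI allI impI)
  show "(\<lambda>u n. 0) \<in> \<S>" using scmb_S[of "[]"] by (simp add: scmb_def[abs_def])
  show "\<S> \<subseteq> Pi (units G) H" by (auto simp: \<S>_def)
qed (auto intro: H_sub S_add S_scale S_norm_continuous S_dense S_local)

lemma is_bundle: "G_hilbert_bundle G H \<S> L"
  unfolding G_hilbert_bundle_def coefficient_def
  using field L_onto L_add L_scale L_norm L_mult S_coeff_continuous by (auto simp: bounded_sections_def)

end

section \<open>The Fourier-Stieltjes algebra\<close>

text \<open>An arbitrary bundle taken from the definition of \<open>B_alg\<close>. It comes with
  isometries and the homomorphism law; preservation of inner products and triviality of the units
  must be deduced.\<close>

locale hbundle = tgrpd G for G :: "'g::topological_space haar_groupoid" (structure) +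
  fixes H \<S> L
  assumes bdl: "G_hilbert_bundle G H \<S> L"
begin

lemma fld: "continuous_hilbert_field (units G) H \<S>"
  using bdl by (simp add: G_hilbert_bundle_def)

lemma H_closed_subspace: "u \<in> units G \<Longrightarrow> ell2_closed_subspace (H u)"
  using fld by (simp add: continuous_hilbert_field_def)

lemma H_ell2: "u \<in> units G \<Longrightarrow> h \<in> H u \<Longrightarrow> h \<in> ell2"
  using H_closed_subspace[of u] by (auto simp: ell2_closed_subspace_def)

lemma H_add: "u \<in> units G \<Longrightarrow> h \<in> H u \<Longrightarrow> k \<in> H u \<Longrightarrow> (\<lambda>n. h n + k n) \<in> H u"
  using H_closed_subspace[of u] by (auto simp: ell2_closed_subspace_def)

lemma H_scale: "u \<in> units G \<Longrightarrow> h \<in> H u \<Longrightarrow> (\<lambda>n. c * h n) \<in> H u"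
  using H_closed_subspace[of u] by (auto simp: ell2_closed_subspace_def)

lemma H_diff: "u \<in> units G \<Longrightarrow> h \<in> H u \<Longrightarrow> k \<in> H u \<Longrightarrow> (\<lambda>n. h n - k n) \<in> H u"
  using H_add[of u h "\<lambda>n. -1 * k n"] H_scale[of u k "-1"] by simp

lemma fld_parts:
  "\<S> \<subseteq> Pi (units G) H" "(\<lambda>u n. 0) \<in> \<S>"
  "\<forall>\<xi>\<in>\<S>. \<forall>\<eta>\<in>\<S>. (\<lambda>u n. \<xi> u n + \<eta> u n) \<in> \<S>"
  "\<forall>c. \<forall>\<xi>\<in>\<S>. (\<lambda>u n. c * \<xi> u n) \<in> \<S>"
  "\<forall>u\<in>units G. \<forall>h\<in>H u. \<forall>e>0. \<exists>\<xi>\<in>\<S>. ell2_norm (\<lambda>n. \<xi> u n - h n) < e"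
  "\<forall>\<xi>\<in>\<S>. continuous_on (units G) (\<lambda>u. ell2_norm (\<xi> u))"
  using fld unfolding continuous_hilbert_field_def by - (elim conjE, assumption)+

lemma S_H: "\<xi> \<in> \<S> \<Longrightarrow> u \<in> units G \<Longrightarrow> \<xi> u \<in> H u"
  using fld_parts(1) by auto

lemma S_ell2: "\<xi> \<in> \<S> \<Longrightarrow> u \<in> units G \<Longrightarrow> \<xi> u \<in> ell2"
  using S_H H_ell2 by simp

lemma S_add: "\<xi> \<in> \<S> \<Longrightarrow> \<eta> \<in> \<S> \<Longrightarrow> (\<lambda>u n. \<xi> u n + \<eta> u n) \<in> \<S>"
  using fld_parts(3) by simp

lemma S_scale: "\<xi> \<in> \<S> \<Longrightarrow> (\<lambda>u n. c * \<xi> u n) \<in> \<S>"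
  using fld_parts(4) by simp

lemma S_dense: "u \<in> units G \<Longrightarrow> h \<in> H u \<Longrightarrow> e > 0 \<Longrightarrow> \<exists>\<xi>\<in>\<S>. ell2_norm (\<lambda>n. \<xi> u n - h n) < e"
  using fld_parts(5) by simp

lemma S_norm_cont: "\<xi> \<in> \<S> \<Longrightarrow> continuous_on (units G) (\<lambda>u. ell2_norm (\<xi> u))"
  using fld_parts(6) by simp

lemma S_local:
  assumes "\<And>u. u \<in> units G \<Longrightarrow> \<xi> u \<in> H u"
    and "\<And>u e. u \<in> units G \<Longrightarrow> e > 0 \<Longrightarrow> \<exists>\<eta>\<in>\<S>. \<exists>V. open V \<and> u \<in> V \<and>
           (\<forall>v\<in>V \<inter> units G. ell2_norm (\<lambda>n. \<xi> v n - \<eta> v n) \<le> e)"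
  shows "\<xi> \<in> \<S>"
proof -
  have "\<forall>\<xi>\<in>Pi (units G) H. (\<forall>u\<in>units G. \<forall>e>0. \<exists>\<eta>\<in>\<S>. \<exists>V. open V \<and> u \<in> V \<and>
      (\<forall>v\<in>V \<inter> units G. ell2_norm (\<lambda>n. \<xi> v n - \<eta> v n) \<le> e)) \<longrightarrow> \<xi> \<in> \<S>"
    using fld unfolding continuous_hilbert_field_def by (elim conjE)
  then show ?thesis using assms by (simp add: Pi_iff)
qed

lemma bdl_parts:
  "\<forall>x. L x ` H (src G x) = H (rng G x) \<and>
    (\<forall>h\<in>H (src G x). \<forall>k\<in>H (src G x). L x (\<lambda>n. h n + k n) = (\<lambda>n. L x h n + L x k n)) \<and>
    (\<forall>c. \<forall>h\<in>H (src G x). L x (\<lambda>n. c * h n) = (\<lambda>n. c * L x h n)) \<and>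
    (\<forall>h\<in>H (src G x). ell2_norm (L x h) = ell2_norm h)"
  "\<forall>x y. src G x = rng G y \<longrightarrow> (\<forall>h\<in>H (src G y). L (x \<cdot> y) h = L x (L y h))"
  "\<forall>\<xi>\<in>bounded_sections (units G) \<S>. \<forall>\<eta>\<in>bounded_sections (units G) \<S>. continuous_on UNIV (coefficient G L \<xi> \<eta>)"
  using bdl unfolding G_hilbert_bundle_def by - (elim conjE, assumption)+

lemma L_onto: "L x ` H (src G x) = H (rng G x)"
  using bdl_parts(1) by simp

lemma L_H: "h \<in> H (src G x) \<Longrightarrow> L x h \<in> H (rng G x)"
  using L_onto by blast

lemma L_add: "h \<in> H (src G x) \<Longrightarrow> k \<in> H (src G x) \<Longrightarrow> L x (\<lambda>n. h n + k n) = (\<lambda>n. L x h n + L x k n)"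
  using bdl_parts(1) by simp

lemma L_scale: "h \<in> H (src G x) \<Longrightarrow> L x (\<lambda>n. c * h n) = (\<lambda>n. c * L x h n)"
  using bdl_parts(1) by simp

lemma L_norm: "h \<in> H (src G x) \<Longrightarrow> ell2_norm (L x h) = ell2_norm h"
  using bdl_parts(1) by simp

lemma L_mult: "src G x = rng G y \<Longrightarrow> h \<in> H (src G y) \<Longrightarrow> L (x \<cdot> y) h = L x (L y h)"
  using bdl_parts(2) by simp

lemma L_diff:
  assumes "h \<in> H (src G x)" "k \<in> H (src G x)"
  shows "L x (\<lambda>n. h n - k n) = (\<lambda>n. L x h n - L x k n)"
  using L_add[OF assms(1) H_scale[OF src_units assms(2), of "-1"]] L_scale[OF assms(2), of "-1"] by simp

lemma L_ell2: "h \<in> H (src G x) \<Longrightarrow> L x h \<in> ell2"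
  by (rule H_ell2[OF rng_units L_H])

text \<open>Polarization. The norms of h - c k are preserved for every c, and the choices c = 1 and
  c = -i read off the real and the imaginary part.\<close>

lemma L_inner:
  assumes h: "h \<in> H (src G x)" and k: "k \<in> H (src G x)"
  shows "ell2_inner (L x h) (L x k) = ell2_inner h k"
proof -
  have E: "h \<in> ell2" "k \<in> ell2" using H_ell2[OF src_units h] H_ell2[OF src_units k] .
  have "Re (c * ell2_inner (L x h) (L x k)) = Re (c * ell2_inner h k)" for c
  proof -
    have ck: "(\<lambda>n. c * k n) \<in> H (src G x)" using H_scale k by simp
    have "ell2_norm (\<lambda>n. L x h n - c * L x k n) = ell2_norm (\<lambda>n. h n - c * k n)"
      using L_norm[OF H_diff[OF src_units h ck]] L_diff[OF h ck] L_scale[OF k] by simp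
    then have "(ell2.nrm (\<lambda>n. L x h n - c * L x k n))\<^sup>2 = (ell2.nrm (\<lambda>n. h n - c * k n))\<^sup>2"
      using ell2_nrm ell2.diff_W ell2.scale_W L_ell2 h k E by simp
    then show ?thesis
      using ell2.nrm_diff_sq[OF L_ell2[OF h] L_ell2[OF k], of c] ell2.nrm_diff_sq[OF E, of c] L_norm[OF h] L_norm[OF k]
        ell2_nrm[OF L_ell2[OF h]] ell2_nrm[OF L_ell2[OF k]] ell2_nrm[OF E(1)] ell2_nrm[OF E(2)] by simp
  qed
  from this[of 1] this[of "-\<i>"] show ?thesis by (simp add: complex_eq_iff)
qed

text \<open>A unit is idempotent, so \<open>L u\<close> is an idempotent linear isometry. It sends
  the difference of L u h and h to 0, and being isometric it shows that this difference is
  0.\<close>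

lemma L_unit:
  assumes u: "u \<in> units G" and h: "h \<in> H u"
  shows "L u h = h"
proof -
  have Lh: "L u h \<in> H u" using L_H[of h u] u h by (simp add: unit_src unit_rng)
  have "u \<cdot> u = u" using rng_mult_self[of u] u by (simp add: unit_rng)
  then have "L u (L u h) = L u h" using L_mult[of u u h] u h by (simp add: unit_src unit_rng)
  then have "L u (\<lambda>n. L u h n - h n) = (\<lambda>n. 0)"
    using L_diff[of "L u h" u h] u h Lh by (simp add: unit_src)
  then have "ell2_norm (\<lambda>n. L u h n - h n) = 0"
    using L_norm[of "\<lambda>n. L u h n - h n" u] H_diff[OF u Lh h] u by (simp add: unit_src)
  then have "(\<lambda>n. L u h n - h n) = (\<lambda>n. 0)"
    using ell2_norm_eq_0[OF H_ell2[OF u H_diff[OF u Lh h]]] by blast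
  then show ?thesis by (metis (no_types, lifting) eq_iff_diff_eq_0 ext)
qed

lemma coeff_cont:
  assumes "\<xi> \<in> bounded_sections (units G) \<S>" "\<eta> \<in> bounded_sections (units G) \<S>"
  shows "continuous_on UNIV (coefficient G L \<xi> \<eta>)"
  using bdl_parts(3) assms by simp

text \<open>Near u the product is uniformly close to the same section multiplied by the constant b
  u, and a continuous field is closed under local uniform approximation.\<close>

lemma S_mult:
  assumes xi: "\<xi> \<in> \<S>" and b: "continuous_on (units G) b"
  shows "(\<lambda>u n. b u * \<xi> u n) \<in> \<S>"
proof (rule S_local)
  show "u \<in> units G \<Longrightarrow> (\<lambda>n. b u * \<xi> u n) \<in> H u" for u
    using H_scale S_H xi by blast
  fix u and e :: real assume u: "u \<in> units G" and e: "e > 0"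
  have lim: "((\<lambda>w. cmod (b w - b u) * ell2_norm (\<xi> w)) \<longlongrightarrow> cmod (b u - b u) * ell2_norm (\<xi> u)) (at u within units G)"
    using b S_norm_cont[OF xi] u unfolding continuous_on_def by (intro tendsto_intros) auto
  have "\<forall>\<^sub>F w in at u within units G. cmod (b w - b u) * ell2_norm (\<xi> w) < e"
    using order_tendstoD(2)[OF lim, of e] e by simp
  then obtain V where V: "open V" "u \<in> V"
    "\<forall>w\<in>V. w \<noteq> u \<longrightarrow> w \<in> units G \<longrightarrow> cmod (b w - b u) * ell2_norm (\<xi> w) < e"
    unfolding eventually_at_topological by blast
  have "ell2_norm (\<lambda>n. b w * \<xi> w n - b u * \<xi> w n) \<le> e" if w: "w \<in> V \<inter> units G" for w
  proof -
    have "ell2_norm (\<lambda>n. (b w - b u) * \<xi> w n) = cmod (b w - b u) * ell2_norm (\<xi> w)"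
      using S_ell2[OF xi] w by (intro ell2_norm_scale) auto
    also have "\<dots> \<le> e" using V(3) w e by (cases "w = u") auto
    finally show ?thesis by (simp add: algebra_simps)
  qed
  then show "\<exists>\<eta>\<in>\<S>. \<exists>V. open V \<and> u \<in> V \<and> (\<forall>v\<in>V \<inter> units G. ell2_norm (\<lambda>n. b v * \<xi> v n - \<eta> v n) \<le> e)"
    by (intro bexI[OF _ S_scale[OF xi, of "b u"]] exI[of _ V]) (use V in simp)
qed

lemma bounded_sectionsI: "\<xi> \<in> \<S> \<Longrightarrow> (\<And>u. u \<in> units G \<Longrightarrow> ell2_norm (\<xi> u) \<le> B) \<Longrightarrow> \<xi> \<in> bounded_sections (units G) \<S>"
  unfolding bounded_sections_def by (auto intro!: bdd_aboveI2)

text \<open>Coefficients are known to be continuous for bounded sections only, so the bounded ones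
  must already fill out the fibres. They serve as generating sections of direct sums and tensor
  products.\<close>

lemma dense_bounded:
  assumes u: "u \<in> units G" and h: "h \<in> H u" and e: "e > 0"
  obtains \<xi> where "\<xi> \<in> bounded_sections (units G) \<S>" "ell2_norm (\<lambda>n. \<xi> u n - h n) < e"
proof -
  obtain \<xi> where xi: "\<xi> \<in> \<S>" "ell2_norm (\<lambda>n. \<xi> u n - h n) < e" using S_dense[OF assms] by blast
  define M where "M = ell2_norm (\<xi> u) + 1"
  have M: "M > 0" using ell2_norm_nonneg[OF S_ell2[OF xi(1) u]] by (simp add: M_def add_nonneg_pos)
  \<comment> \<open>Scaling by b caps the norm at M. Since M exceeds the norm of \<xi> at u, the
    value at u is unchanged.\<close>
  define b where "b w = M / max M (ell2_norm (\<xi> w))" for w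
  have "continuous_on (units G) (\<lambda>w. complex_of_real (b w))"
    unfolding b_def using M by (intro continuous_intros S_norm_cont[OF xi(1)]) auto
  then have S: "(\<lambda>w n. complex_of_real (b w) * \<xi> w n) \<in> \<S>" using S_mult[OF xi(1)] by blast
  have "b u = 1" using M by (simp add: b_def M_def max_def)
  moreover have "ell2_norm (\<lambda>n. complex_of_real (b w) * \<xi> w n) \<le> M" if w: "w \<in> units G" for w
  proof -
    have "ell2_norm (\<lambda>n. complex_of_real (b w) * \<xi> w n) = \<bar>b w\<bar> * ell2_norm (\<xi> w)"
      using ell2_norm_scale[OF S_ell2[OF xi(1) w], of "of_real (b w)"] by simp
    also have "\<dots> = M * (ell2_norm (\<xi> w) / max M (ell2_norm (\<xi> w)))" using M by (simp add: b_def)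
    also have "\<dots> \<le> M * 1" using M by (intro mult_left_mono) (auto simp: divide_le_eq)
    finally show ?thesis by simp
  qed
  ultimately show ?thesis
    using that[OF bounded_sectionsI[OF S, of M]] xi(2) by simp
qed

end

section \<open>Direct sums and tensor products of square summable sequences\<close>

lemma strict_mono_prod_encode: "strict_mono (\<lambda>j. prod_encode (k, j))"
  by (rule strict_monoI_Suc) (simp add: prod_encode_def)

definition emb :: "nat \<Rightarrow> (nat \<Rightarrow> complex) \<Rightarrow> nat \<Rightarrow> complex" where
  "emb k h = (\<lambda>n. if fst (prod_decode n) = k then h (snd (prod_decode n)) else 0)"

definition tens :: "(nat \<Rightarrow> complex) \<Rightarrow> (nat \<Rightarrow> complex) \<Rightarrow> nat \<Rightarrow> complex" where
  "tens h k = (\<lambda>n. h (fst (prod_decode n)) * k (snd (prod_decode n)))"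

lemma not_range_prod_encode: "n \<notin> range (\<lambda>j. prod_encode (k, j)) \<Longrightarrow> fst (prod_decode n) \<noteq> k"
  by (metis prod.collapse prod_decode_inverse rangeI)

lemma emb_ell2: "h \<in> ell2 \<Longrightarrow> emb k h \<in> ell2"
proof -
  assume "h \<in> ell2"
  then have "summable (\<lambda>j. (cmod (emb k h (prod_encode (k, j))))\<^sup>2)" by (simp add: emb_def ell2_def)
  then show ?thesis unfolding ell2_def mem_Collect_eq
    by (subst (asm) summable_mono_reindex[OF strict_mono_prod_encode]) (auto dest!: not_range_prod_encode simp: emb_def)
qed

lemma emb_inner: "ell2_inner (emb k h) x = ell2_inner h (\<lambda>j. x (prod_encode (k, j)))"
proof -
  have "(\<Sum>j. cnj (emb k h (prod_encode (k, j))) * x (prod_encode (k, j))) = (\<Sum>n. cnj (emb k h n) * x n)"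
    by (rule suminf_mono_reindex[OF strict_mono_prod_encode]) (auto dest!: not_range_prod_encode simp: emb_def)
  then show ?thesis by (simp add: ell2_inner_def emb_def)
qed

lemma emb_inner_emb: "ell2_inner (emb k h) (emb l h') = (if k = l then ell2_inner h h' else 0)"
  unfolding emb_inner by (simp add: emb_def) (simp add: ell2_inner_def)

lemma emb_norm: "h \<in> ell2 \<Longrightarrow> ell2_norm (emb k h) = ell2_norm h"
  by (simp add: ell2_norm_eq_inner emb_ell2 emb_inner_emb)

text \<open>A code dominates its two components, so the first N codes decode into a square of side
  N. Each partial sum is thus bounded by a finite double sum, and row k contributes at most a
  k.\<close>

lemma dsum_ell2:
  assumes y: "\<And>k. y k \<in> ell2" and a: "\<And>k. (ell2_norm (y k))\<^sup>2 \<le> a k" "summable a"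
  shows "(\<lambda>n. y (fst (prod_decode n)) (snd (prod_decode n))) \<in> ell2"
    and "ell2_norm (\<lambda>n. y (fst (prod_decode n)) (snd (prod_decode n))) \<le> sqrt (suminf a)"
proof -
  let ?x = "\<lambda>n. y (fst (prod_decode n)) (snd (prod_decode n))"
  have a0: "a k \<ge> 0" for k using a(1)[of k] by (meson order_trans zero_le_power2)
  have s: "suminf a \<ge> 0" using a(2) a0 by (intro suminf_nonneg)
  have b: "(\<Sum>n<N. (cmod (?x n))\<^sup>2) \<le> (sqrt (suminf a))\<^sup>2" for N
  proof -
    have "(\<Sum>n<N. (cmod (?x n))\<^sup>2) = (\<Sum>p\<in>prod_decode ` {..<N}. (cmod (y (fst p) (snd p)))\<^sup>2)"
      by (simp add: sum.reindex inj_prod_decode)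
    also have "\<dots> \<le> (\<Sum>p\<in>{..<N} \<times> {..<N}. (cmod (y (fst p) (snd p)))\<^sup>2)"
    proof (rule sum_mono2)
      show "prod_decode ` {..<N} \<subseteq> {..<N} \<times> {..<N}"
      proof
        fix p assume "p \<in> prod_decode ` {..<N}"
        then obtain n where n: "n < N" "p = prod_decode n" by (elim imageE) simp
        then have "prod_encode p = n" by simp
        then have "prod_encode (fst p, snd p) < N" using n(1) by simp
        then have "fst p < N" "snd p < N"
          using le_prod_encode_1[of "fst p" "snd p"] le_prod_encode_2[of "snd p" "fst p"] by auto
        then show "p \<in> {..<N} \<times> {..<N}" by (cases p) simp
      qed
    qed auto
    also have "\<dots> = (\<Sum>k<N. \<Sum>j<N. (cmod (y k j))\<^sup>2)"
      by (simp add: sum.cartesian_product case_prod_unfold)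
    also have "\<dots> \<le> (\<Sum>k<N. a k)"
      by (intro sum_mono order_trans[OF ell2_partial_le[OF y] a(1)])
    also have "\<dots> \<le> suminf a" by (intro sum_le_suminf) (use a a0 in auto)
    finally show ?thesis using s by simp
  qed
  show "?x \<in> ell2" "ell2_norm ?x \<le> sqrt (suminf a)"
    using ell2_bounded_partial[of ?x "sqrt (suminf a)"] b s by auto
qed

text \<open>Fubini for absolutely convergent series: unconditional summation over pairs gives the
  product, and the pairing bijection turns it into a sum in the order of the codes.\<close>

lemma has_sum_tens:
  fixes a b :: "nat \<Rightarrow> complex"
  assumes "summable (\<lambda>n. cmod (a n))" "summable (\<lambda>n. cmod (b n))"
  shows "(\<lambda>n. a (fst (prod_decode n)) * b (snd (prod_decode n))) sums (suminf a * suminf b)"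
    and "summable (\<lambda>n. cmod (a (fst (prod_decode n)) * b (snd (prod_decode n))))"
proof -
  have na: "((\<lambda>n. cmod (a n)) has_sum (\<Sum>n. cmod (a n))) UNIV" and nb: "((\<lambda>n. cmod (b n)) has_sum (\<Sum>n. cmod (b n))) UNIV"
    using assms by (auto intro!: norm_summable_imp_has_sum summable_sums)
  have ha: "(a has_sum suminf a) UNIV" and hb: "(b has_sum suminf b) UNIV"
    using assms by (auto intro!: norm_summable_imp_has_sum summable_sums dest: summable_norm_cancel)
  let ?f = "\<lambda>p. a (fst p) * b (snd p)"
  have nS: "(\<lambda>p. cmod (?f p)) summable_on (UNIV \<times> UNIV)"
  proof (rule summable_on_SigmaI[where g = "\<lambda>i. cmod (a i) * (\<Sum>n. cmod (b n))"])
    show "((\<lambda>y. cmod (?f (x, y))) has_sum cmod (a x) * (\<Sum>n. cmod (b n))) UNIV" for x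
      using has_sum_cmult_right[OF nb, of "cmod (a x)"] by (simp add: norm_mult)
    show "(\<lambda>i. cmod (a i) * (\<Sum>n. cmod (b n))) summable_on UNIV"
      using has_sum_cmult_left[OF na] summable_on_def by blast
  qed auto
  then have S: "?f summable_on (UNIV \<times> UNIV)" by (rule abs_summable_summable)
  have "(?f has_sum (suminf a * suminf b)) (UNIV \<times> UNIV)"
  proof (rule has_sum_SigmaI[OF _ _ S])
    show "((\<lambda>y. ?f (x, y)) has_sum a x * suminf b) UNIV" for x
      using has_sum_cmult_right[OF hb, of "a x"] by simp
    show "((\<lambda>x. a x * suminf b) has_sum suminf a * suminf b) UNIV" by (rule has_sum_cmult_left[OF ha])
  qed
  then have "((\<lambda>n. ?f (prod_decode n)) has_sum (suminf a * suminf b)) UNIV"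
    using has_sum_reindex_bij_betw[OF bij_prod_decode, of ?f] by simp
  then show "(\<lambda>n. a (fst (prod_decode n)) * b (snd (prod_decode n))) sums (suminf a * suminf b)"
    by (rule has_sum_imp_sums)
  obtain t where "((\<lambda>p. cmod (?f p)) has_sum t) (UNIV \<times> UNIV)" using nS summable_on_def by blast
  then have "((\<lambda>n. cmod (?f (prod_decode n))) has_sum t) UNIV"
    using has_sum_reindex_bij_betw[OF bij_prod_decode, of "\<lambda>p. cmod (?f p)"] by simp
  then show "summable (\<lambda>n. cmod (a (fst (prod_decode n)) * b (snd (prod_decode n))))"
    using has_sum_imp_sums sums_summable by blast
qed

lemma tens_ell2:
  assumes "h \<in> ell2" "k \<in> ell2"
  shows "tens h k \<in> ell2"
proof -
  have "summable (\<lambda>n. cmod (of_real ((cmod (h n))\<^sup>2) :: complex))" "summable (\<lambda>n. cmod (of_real ((cmod (k n))\<^sup>2) :: complex))"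
    using assms by (auto simp: ell2_def norm_power)
  from has_sum_tens(2)[OF this] show ?thesis
    by (simp add: ell2_def tens_def norm_mult norm_power power_mult_distrib)
qed

lemma tens_inner:
  assumes "h \<in> ell2" "k \<in> ell2" "h' \<in> ell2" "k' \<in> ell2"
  shows "ell2_inner (tens h k) (tens h' k') = ell2_inner h h' * ell2_inner k k'"
  using has_sum_tens(1)[OF ell2_summable_inner(1)[OF assms(1,3)] ell2_summable_inner(1)[OF assms(2,4)]]
  by (simp add: ell2_inner_def tens_def sums_iff mult_ac)

lemma tens_norm: "h \<in> ell2 \<Longrightarrow> k \<in> ell2 \<Longrightarrow> ell2_norm (tens h k) = ell2_norm h * ell2_norm k"
proof -
  assume h: "h \<in> ell2" and k: "k \<in> ell2"
  have "ell2_inner (tens h k) (tens h k) = of_real ((ell2_norm h * ell2_norm k)\<^sup>2)"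
    unfolding tens_inner[OF h k h k] ell2_inner_self[OF h] ell2_inner_self[OF k] power_mult_distrib of_real_mult ..
  then have "ell2_norm (tens h k) = sqrt ((ell2_norm h * ell2_norm k)\<^sup>2)"
    unfolding ell2_norm_eq_inner[OF tens_ell2[OF h k]] by (simp only: Re_complex_of_real)
  then show ?thesis using h k by (simp only: real_sqrt_abs) simp
qed

section \<open>The norm of the Fourier-Stieltjes algebra and multiplication by functions on the
  units\<close>

context tgrpd
begin

lemma units_nonempty: "units G \<noteq> {}"
  by (auto simp: units_def)

definition Bset :: "('g \<Rightarrow> complex) \<Rightarrow> real set" where
  "Bset \<phi> = {section_norm (units G) \<xi> * section_norm (units G) \<eta> | H \<S> L \<xi> \<eta>.
     G_hilbert_bundle G H \<S> L \<and> \<xi> \<in> bounded_sections (units G) \<S> \<and> \<eta> \<in> bounded_sections (units G) \<S> \<and>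
     \<phi> = coefficient G L \<xi> \<eta>}"

lemma B_norm_Bset: "B_norm G \<phi> = Inf (Bset \<phi>)"
  by (simp only: B_norm_def Bset_def)

lemma BsetI:
  assumes "G_hilbert_bundle G H \<S> L" "\<xi> \<in> bounded_sections (units G) \<S>" "\<eta> \<in> bounded_sections (units G) \<S>"
    "\<phi> = coefficient G L \<xi> \<eta>"
  shows "section_norm (units G) \<xi> * section_norm (units G) \<eta> \<in> Bset \<phi>"
  unfolding Bset_def
  by (rule CollectI, rule exI[of _ H], rule exI[of _ \<S>], rule exI[of _ L], rule exI[of _ \<xi>], rule exI[of _ \<eta>])
     (use assms in simp)

lemma BsetE:
  assumes "t \<in> Bset \<phi>"
  obtains H \<S> L \<xi> \<eta> where "hbundle G H \<S> L" "\<xi> \<in> bounded_sections (units G) \<S>" "\<eta> \<in> bounded_sections (units G) \<S>"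
    "\<phi> = coefficient G L \<xi> \<eta>" "t = section_norm (units G) \<xi> * section_norm (units G) \<eta>"
proof -
  obtain H \<S> L \<xi> \<eta> where A: "G_hilbert_bundle G H \<S> L" "\<xi> \<in> bounded_sections (units G) \<S>" "\<eta> \<in> bounded_sections (units G) \<S>"
    "\<phi> = coefficient G L \<xi> \<eta>" "t = section_norm (units G) \<xi> * section_norm (units G) \<eta>"
    using assms unfolding Bset_def by (elim CollectE exE conjE)
  have "hbundle G H \<S> L" by unfold_locales (rule A(1))
  then show ?thesis using that A(2-5) by simp
qed

lemma section_norm_upper:
  "\<xi> \<in> bounded_sections (units G) \<S> \<Longrightarrow> u \<in> units G \<Longrightarrow> ell2_norm (\<xi> u) \<le> section_norm (units G) \<xi>"
  unfolding section_norm_def by (rule cSUP_upper) (simp_all add: bounded_sections_def)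

lemma section_norm_nonneg:
  assumes "hbundle G H \<S> L" "\<xi> \<in> bounded_sections (units G) \<S>"
  shows "0 \<le> section_norm (units G) \<xi>"
proof -
  interpret hbundle G H \<S> L by fact
  obtain u where u: "u \<in> units G" using units_nonempty by auto
  have "0 \<le> ell2_norm (\<xi> u)" using assms(2) S_ell2[OF _ u] by (intro ell2_norm_nonneg) (simp add: bounded_sections_def)
  then show ?thesis using section_norm_upper[OF assms(2) u] by linarith
qed

lemma Bset_nonneg: "t \<in> Bset \<phi> \<Longrightarrow> 0 \<le> t"
  by (erule BsetE) (simp add: section_norm_nonneg)

lemma B_algI:
  assumes "hbundle G H \<S> L" "\<xi> \<in> \<S>" "\<eta> \<in> \<S>"
    and xi: "\<And>u. u \<in> units G \<Longrightarrow> ell2_norm (\<xi> u) \<le> p"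
    and eta: "\<And>u. u \<in> units G \<Longrightarrow> ell2_norm (\<eta> u) \<le> q"
  shows "coefficient G L \<xi> \<eta> \<in> B_alg G" "B_norm G (coefficient G L \<xi> \<eta>) \<le> p * q"
proof -
  interpret hbundle G H \<S> L by fact
  have bs: "\<xi> \<in> bounded_sections (units G) \<S>" "\<eta> \<in> bounded_sections (units G) \<S>"
    using assms bounded_sectionsI by blast+
  then show "coefficient G L \<xi> \<eta> \<in> B_alg G" unfolding B_alg_def
    by (intro CollectI exI[of _ H] exI[of _ \<S>] exI[of _ L] exI[of _ \<xi>] exI[of _ \<eta>]) (use bdl in simp)
  have "section_norm (units G) \<xi> * section_norm (units G) \<eta> \<in> Bset (coefficient G L \<xi> \<eta>)"
    by (rule BsetI[OF bdl bs refl])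
  then have "B_norm G (coefficient G L \<xi> \<eta>) \<le> section_norm (units G) \<xi> * section_norm (units G) \<eta>"
    unfolding B_norm_Bset by (rule cInf_lower) (rule bdd_belowI[of _ 0], erule Bset_nonneg)
  also have "\<dots> \<le> p * q"
  proof (rule mult_mono)
    show "section_norm (units G) \<xi> \<le> p" "section_norm (units G) \<eta> \<le> q"
      unfolding section_norm_def using units_nonempty xi eta by (auto intro!: cSUP_least)
    obtain u where u: "u \<in> units G" using units_nonempty by auto
    show "0 \<le> p" using xi[OF u] ell2_norm_nonneg[OF S_ell2[OF assms(2) u]] by linarith
    show "0 \<le> section_norm (units G) \<eta>" by (rule section_norm_nonneg[OF assms(1) bs(2)])
  qed
  finally show "B_norm G (coefficient G L \<xi> \<eta>) \<le> p * q" .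
qed

text \<open>The definition controls only the product of the two section norms. Rescaling the
  sections against each other makes both at most sqrt c, the symmetric form in which squared norms
  of many summands can be added.\<close>

lemma B_algE:
  assumes "\<phi> \<in> B_alg G" "B_norm G \<phi> < c"
  obtains H \<S> L \<xi> \<eta> where "hbundle G H \<S> L" "\<xi> \<in> \<S>" "\<eta> \<in> \<S>" "\<phi> = coefficient G L \<xi> \<eta>" "c > 0"
    "\<And>u. u \<in> units G \<Longrightarrow> ell2_norm (\<xi> u) \<le> sqrt c" "\<And>u. u \<in> units G \<Longrightarrow> ell2_norm (\<eta> u) \<le> sqrt c"
proof -
  have "Bset \<phi> \<noteq> {}" using assms(1) BsetI unfolding B_alg_def by blast
  then obtain t where "t \<in> Bset \<phi>" "t < c" using cInf_lessD[of "Bset \<phi>" c] assms(2) unfolding B_norm_Bset by auto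
  then obtain H \<S> L \<xi> \<eta> where A: "hbundle G H \<S> L" "\<xi> \<in> bounded_sections (units G) \<S>" "\<eta> \<in> bounded_sections (units G) \<S>"
     "\<phi> = coefficient G L \<xi> \<eta>" "section_norm (units G) \<xi> * section_norm (units G) \<eta> < c"
    by (elim BsetE) simp
  interpret hbundle G H \<S> L by (rule A)
  define p where "p = section_norm (units G) \<xi>"
  define q where "q = section_norm (units G) \<eta>"
  have le: "ell2_norm (\<xi> u) \<le> p" "ell2_norm (\<eta> u) \<le> q" if "u \<in> units G" for u
    unfolding p_def q_def using A(2,3) that section_norm_upper by auto
  have S: "\<xi> \<in> \<S>" "\<eta> \<in> \<S>" using A by (auto simp: bounded_sections_def)
  obtain u0 where u0: "u0 \<in> units G" using units_nonempty by blast
  have p0: "p \<ge> 0" "q \<ge> 0" using le[OF u0] ell2_norm_nonneg[OF S_ell2[OF S(1) u0]] ell2_norm_nonneg[OF S_ell2[OF S(2) u0]] by auto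
  have pq: "p * q < c" using A(5) by (simp add: p_def q_def)
  have c: "c > 0" using p0 pq by (meson mult_nonneg_nonneg order_le_less_trans)
  \<comment> \<open>For p = 0 the factor t only has to be large enough to bring q / t below sqrt c.
    Otherwise t p = sqrt c, and q / t \<le> sqrt c amounts to p q \<le> c.\<close>
  define t where "t = (if p = 0 then q / sqrt c + 1 else sqrt c / p)"
  have t: "t > 0" using p0 c by (auto simp: t_def add_nonneg_pos)
  have tp: "t * p \<le> sqrt c" using c by (simp add: t_def)
  have "q / t \<le> sqrt c"
  proof (cases "p = 0")
    case True
    have "q \<le> sqrt c * (q / sqrt c + 1)" using c by (simp add: distrib_left)
    then show ?thesis using True t by (simp add: t_def pos_divide_le_eq)
  next
    case False
    have "q * p \<le> c" using pq by (simp add: mult.commute)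
    then show ?thesis using False c p0 by (simp add: t_def pos_divide_le_eq)
  qed
  note tq = this
  have S': "(\<lambda>u n. of_real t * \<xi> u n) \<in> \<S>" "(\<lambda>u n. of_real (1/t) * \<eta> u n) \<in> \<S>" using S S_scale by blast+
  have "\<phi> = coefficient G L (\<lambda>u n. of_real t * \<xi> u n) (\<lambda>u n. of_real (1/t) * \<eta> u n)"
  proof
    fix x
    note xH = S_H[OF S(1) src_units, of x] and eE = S_ell2[OF S(2) rng_units, of x]
    have "coefficient G L (\<lambda>u n. of_real t * \<xi> u n) (\<lambda>u n. of_real (1/t) * \<eta> u n) x
       = cnj (of_real t) * (of_real (1/t) * ell2_inner (L x (\<xi> (src G x))) (\<eta> (rng G x)))"
      unfolding coefficient_def L_scale[OF xH]
      by (simp only: ell2.ip_scale_left[OF L_ell2[OF xH] ell2.scale_W[OF eE]] ell2.ip_scale[OF L_ell2[OF xH] eE])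
    also have "\<dots> = (of_real t * of_real (1/t)) * ell2_inner (L x (\<xi> (src G x))) (\<eta> (rng G x))"
      by (simp only: complex_cnj_complex_of_real mult.assoc)
    also have "of_real t * of_real (1/t) = (1::complex)" using t by simp
    finally show "\<phi> x = coefficient G L (\<lambda>u n. of_real t * \<xi> u n) (\<lambda>u n. of_real (1/t) * \<eta> u n) x"
      unfolding A(4) by (simp add: coefficient_def)
  qed
  moreover have "ell2_norm (\<lambda>n. of_real t * \<xi> u n) \<le> sqrt c" if u: "u \<in> units G" for u
  proof -
    have "ell2_norm (\<lambda>n. of_real t * \<xi> u n) = t * ell2_norm (\<xi> u)" using ell2_norm_scale[OF S_ell2[OF S(1) u]] t by simp
    also have "\<dots> \<le> t * p" using t le[OF u] by simp
    finally show ?thesis using tp by simp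
  qed
  moreover have "ell2_norm (\<lambda>n. of_real (1/t) * \<eta> u n) \<le> sqrt c" if u: "u \<in> units G" for u
  proof -
    have "ell2_norm (\<lambda>n. of_real (1/t) * \<eta> u n) = (1/t) * ell2_norm (\<eta> u)"
      using ell2_norm_scale[OF S_ell2[OF S(2) u], of "of_real (1/t)"] t by (simp add: norm_divide)
    also have "\<dots> \<le> (1/t) * q" using t le[OF u] by (intro mult_left_mono) auto
    finally show ?thesis using tq by simp
  qed
  ultimately show ?thesis using that[OF _ S'] c hbundle_axioms by blast
qed

lemma B_norm_nonneg: "\<phi> \<in> B_alg G \<Longrightarrow> 0 \<le> B_norm G \<phi>"
proof (rule ccontr)
  assume "\<phi> \<in> B_alg G" "\<not> 0 \<le> B_norm G \<phi>"
  then have "B_norm G \<phi> < 0" by simp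
  from B_algE[OF \<open>\<phi> \<in> B_alg G\<close> this] show False by blast
qed

lemma B_sup:
  assumes "\<phi> \<in> B_alg G"
  shows "cmod (\<phi> x) \<le> B_norm G \<phi>"
proof (rule field_le_epsilon)
  fix e :: real assume "e > 0"
  then have "B_norm G \<phi> < B_norm G \<phi> + e" by simp
  then obtain H \<S> L \<xi> \<eta> where A: "hbundle G H \<S> L" "\<xi> \<in> \<S>" "\<eta> \<in> \<S>" "\<phi> = coefficient G L \<xi> \<eta>" "B_norm G \<phi> + e > 0"
    "\<And>u. u \<in> units G \<Longrightarrow> ell2_norm (\<xi> u) \<le> sqrt (B_norm G \<phi> + e)" "\<And>u. u \<in> units G \<Longrightarrow> ell2_norm (\<eta> u) \<le> sqrt (B_norm G \<phi> + e)"
    using B_algE[OF assms, of "B_norm G \<phi> + e"] by blast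
  interpret hbundle G H \<S> L by fact
  note xH = S_H[OF A(2) src_units, of x] and eE = S_ell2[OF A(3) rng_units, of x]
  have "cmod (\<phi> x) \<le> ell2_norm (L x (\<xi> (src G x))) * ell2_norm (\<eta> (rng G x))"
    unfolding A(4) coefficient_def by (rule ell2_cs[OF L_ell2[OF xH] eE])
  also have "\<dots> \<le> sqrt (B_norm G \<phi> + e) * sqrt (B_norm G \<phi> + e)"
    using A(5) A(6)[OF src_units, of x] A(7)[OF rng_units, of x] L_norm[OF xH] ell2_norm_nonneg[OF eE] by (intro mult_mono) auto
  also have "\<dots> = B_norm G \<phi> + e" using A(5) by simp
  finally show "cmod (\<phi> x) \<le> B_norm G \<phi> + e" .
qed

lemma B_cont: "\<phi> \<in> B_alg G \<Longrightarrow> continuous_on A \<phi>"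
  unfolding B_alg_def G_hilbert_bundle_def using continuous_on_subset by blast

text \<open>The factor is absorbed by the second section, at the range. The estimate is first proved
  for every c above the norm, because the infimum need not be attained, and c then decreases to the
  norm.\<close>

lemma B_right:
  assumes phi: "\<phi> \<in> B_alg G" and b: "continuous_on (units G) b" "\<And>u. u \<in> units G \<Longrightarrow> cmod (b u) \<le> M"
  shows "(\<lambda>x. \<phi> x * b (rng G x)) \<in> B_alg G" "B_norm G (\<lambda>x. \<phi> x * b (rng G x)) \<le> M * B_norm G \<phi>"
proof -
  have M: "M \<ge> 0" using b(2) units_nonempty by (meson all_not_in_conv norm_ge_zero order_trans)
  have main: "(\<lambda>x. \<phi> x * b (rng G x)) \<in> B_alg G \<and> B_norm G (\<lambda>x. \<phi> x * b (rng G x)) \<le> M * c" if c: "B_norm G \<phi> < c" for c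
  proof -
    obtain H \<S> L \<xi> \<eta> where A: "hbundle G H \<S> L" "\<xi> \<in> \<S>" "\<eta> \<in> \<S>" "\<phi> = coefficient G L \<xi> \<eta>" "c > 0"
      "\<And>u. u \<in> units G \<Longrightarrow> ell2_norm (\<xi> u) \<le> sqrt c" "\<And>u. u \<in> units G \<Longrightarrow> ell2_norm (\<eta> u) \<le> sqrt c"
      using B_algE[OF phi c] by blast
    interpret hbundle G H \<S> L by fact
    have S: "(\<lambda>u n. b u * \<eta> u n) \<in> \<S>" using S_mult[OF A(3) b(1)] .
    have n: "ell2_norm (\<lambda>n. b u * \<eta> u n) \<le> M * sqrt c" if "u \<in> units G" for u
      using ell2_norm_scale[OF S_ell2[OF A(3) that], of "b u"] b(2)[OF that] A(7)[OF that] M ell2_norm_nonneg[OF S_ell2[OF A(3) that]]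
      by (auto intro!: mult_mono)
    have "(\<lambda>x. \<phi> x * b (rng G x)) = coefficient G L \<xi> (\<lambda>u n. b u * \<eta> u n)"
      unfolding A(4) coefficient_def
      using ell2.ip_scale[OF L_ell2[OF S_H[OF A(2) src_units]] S_ell2[OF A(3) rng_units]] by (simp add: mult.commute)
    moreover have "sqrt c * (M * sqrt c) = M * c" using A(5) by simp
    ultimately show ?thesis
      using B_algI[OF A(1,2) S A(6) n] by metis
  qed
  from main[of "B_norm G \<phi> + 1"] show "(\<lambda>x. \<phi> x * b (rng G x)) \<in> B_alg G" by simp
  show "B_norm G (\<lambda>x. \<phi> x * b (rng G x)) \<le> M * B_norm G \<phi>"
  proof (rule tendsto_lowerbound)
    show "((\<lambda>c. M * c) \<longlongrightarrow> M * B_norm G \<phi>) (at_right (B_norm G \<phi>))" by (intro tendsto_intros)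
    show "\<forall>\<^sub>F c in at_right (B_norm G \<phi>). B_norm G (\<lambda>x. \<phi> x * b (rng G x)) \<le> M * c"
      using main by (auto simp: eventually_at_right_field intro: gt_ex)
  qed simp
qed

text \<open>Here the first section absorbs the factor, at the source, and the inner product is
  conjugate linear there; hence the conjugate of b. Multiplication by scalars is the case of a
  constant b.\<close>

lemma B_left:
  assumes phi: "\<phi> \<in> B_alg G" and b: "continuous_on (units G) b" "\<And>u. u \<in> units G \<Longrightarrow> cmod (b u) \<le> M"
  shows "(\<lambda>x. b (src G x) * \<phi> x) \<in> B_alg G" "B_norm G (\<lambda>x. b (src G x) * \<phi> x) \<le> M * B_norm G \<phi>"
proof -
  have M: "M \<ge> 0" using b(2) units_nonempty by (meson all_not_in_conv norm_ge_zero order_trans)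
  have main: "(\<lambda>x. b (src G x) * \<phi> x) \<in> B_alg G \<and> B_norm G (\<lambda>x. b (src G x) * \<phi> x) \<le> M * c" if c: "B_norm G \<phi> < c" for c
  proof -
    obtain H \<S> L \<xi> \<eta> where A: "hbundle G H \<S> L" "\<xi> \<in> \<S>" "\<eta> \<in> \<S>" "\<phi> = coefficient G L \<xi> \<eta>" "c > 0"
      "\<And>u. u \<in> units G \<Longrightarrow> ell2_norm (\<xi> u) \<le> sqrt c" "\<And>u. u \<in> units G \<Longrightarrow> ell2_norm (\<eta> u) \<le> sqrt c"
      using B_algE[OF phi c] by blast
    interpret hbundle G H \<S> L by fact
    have S: "(\<lambda>u n. cnj (b u) * \<xi> u n) \<in> \<S>" by (rule S_mult[OF A(2)]) (intro continuous_intros b)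
    have n: "ell2_norm (\<lambda>n. cnj (b u) * \<xi> u n) \<le> M * sqrt c" if "u \<in> units G" for u
      using ell2_norm_scale[OF S_ell2[OF A(2) that], of "cnj (b u)"] b(2)[OF that] A(6)[OF that] M ell2_norm_nonneg[OF S_ell2[OF A(2) that]]
      by (auto intro!: mult_mono)
    have "(\<lambda>x. b (src G x) * \<phi> x) = coefficient G L (\<lambda>u n. cnj (b u) * \<xi> u n) \<eta>"
      unfolding A(4) coefficient_def L_scale[OF S_H[OF A(2) src_units]]
      using ell2.ip_scale_left[OF L_ell2[OF S_H[OF A(2) src_units]] S_ell2[OF A(3) rng_units]] by simp
    moreover have "(M * sqrt c) * sqrt c = M * c" using A(5) by simp
    ultimately show ?thesis
      using B_algI[OF A(1) S A(3) n A(7)] by metis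
  qed
  from main[of "B_norm G \<phi> + 1"] show "(\<lambda>x. b (src G x) * \<phi> x) \<in> B_alg G" by simp
  show "B_norm G (\<lambda>x. b (src G x) * \<phi> x) \<le> M * B_norm G \<phi>"
  proof (rule tendsto_lowerbound)
    show "((\<lambda>c. M * c) \<longlongrightarrow> M * B_norm G \<phi>) (at_right (B_norm G \<phi>))" by (intro tendsto_intros)
    show "\<forall>\<^sub>F c in at_right (B_norm G \<phi>). B_norm G (\<lambda>x. b (src G x) * \<phi> x) \<le> M * c"
      using main by (auto simp: eventually_at_right_field intro: gt_ex)
  qed simp
qed

lemma B_scale:
  assumes "\<phi> \<in> B_alg G"
  shows "(\<lambda>x. c * \<phi> x) \<in> B_alg G" "B_norm G (\<lambda>x. c * \<phi> x) \<le> cmod c * B_norm G \<phi>"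
  by (rule B_left[OF assms, of "\<lambda>_. c" "cmod c", OF continuous_on_const order_refl])+

end

section \<open>Countable direct sums of bundles\<close>

locale hdsum = tgrpd G for G :: "'g::topological_space haar_groupoid" (structure) +
  fixes H :: "nat \<Rightarrow> 'g \<Rightarrow> (nat \<Rightarrow> complex) set" and \<S> :: "nat \<Rightarrow> ('g \<Rightarrow> nat \<Rightarrow> complex) set"
    and L :: "nat \<Rightarrow> 'g \<Rightarrow> (nat \<Rightarrow> complex) \<Rightarrow> nat \<Rightarrow> complex"
  assumes hb: "hbundle G (H k) (\<S> k) (L k)"
begin

definition dX :: "'g \<Rightarrow> (nat \<times> (nat \<Rightarrow> complex)) set" where "dX u = {a. snd a \<in> H (fst a) u}"
definition dv :: "'g \<Rightarrow> nat \<times> (nat \<Rightarrow> complex) \<Rightarrow> nat \<Rightarrow> complex" where "dv u a = emb (fst a) (snd a)"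
definition dact :: "'g \<Rightarrow> nat \<times> (nat \<Rightarrow> complex) \<Rightarrow> nat \<times> (nat \<Rightarrow> complex)" where
  "dact x a = (fst a, L (fst a) x (snd a))"
definition dSec :: "('g \<Rightarrow> nat \<times> (nat \<Rightarrow> complex)) set" where
  "dSec = {\<lambda>u. (k, \<xi> u) | k \<xi>. \<xi> \<in> bounded_sections (units G) (\<S> k)}"

lemma hE: "u \<in> units G \<Longrightarrow> h \<in> H k u \<Longrightarrow> h \<in> ell2"
  by (rule hbundle.H_ell2[OF hb])

lemma dSecI: "\<xi> \<in> bounded_sections (units G) (\<S> k) \<Longrightarrow> (\<lambda>u. (k, \<xi> u)) \<in> dSec"
  unfolding dSec_def by blast

lemma dSecE:
  assumes "\<sigma> \<in> dSec"
  obtains k \<xi> where "\<sigma> = (\<lambda>u. (k, \<xi> u))" "\<xi> \<in> bounded_sections (units G) (\<S> k)" "\<xi> \<in> \<S> k"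
  using assms unfolding dSec_def bounded_sections_def by blast

lemma kernel: "kernel_bundle G dX dv dact dSec"
proof unfold_locales
  show "u \<in> units G \<Longrightarrow> a \<in> dX u \<Longrightarrow> dv u a \<in> ell2" for u a
    using hE by (simp add: dX_def dv_def emb_ell2)
  show "a \<in> dX (src G x) \<Longrightarrow> dact x a \<in> dX (rng G x)" for a x
    using hbundle.L_H[OF hb] by (simp add: dX_def dact_def)
  show "ell2_inner (dv (rng G x) (dact x a)) (dv (rng G x) (dact x b)) = ell2_inner (dv (src G x) a) (dv (src G x) b)"
    if "a \<in> dX (src G x)" "b \<in> dX (src G x)" for a b x
  proof (cases "fst a = fst b")
    case True
    then show ?thesis using that hbundle.L_inner[OF hb] by (simp add: dv_def dact_def emb_inner_emb dX_def)
  next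
    case False
    then show ?thesis by (simp add: dv_def dact_def emb_inner_emb)
  qed
  show "dv (rng G x) (dact (x \<cdot> y) a) = dv (rng G x) (dact x (dact y a))"
    if "src G x = rng G y" "a \<in> dX (src G y)" for a x y
    using that hbundle.L_mult[OF hb] by (simp add: dv_def dact_def dX_def)
  show "u \<in> units G \<Longrightarrow> a \<in> dX u \<Longrightarrow> dv u (dact u a) = dv u a" for u a
    using hbundle.L_unit[OF hb] by (simp add: dv_def dact_def dX_def)
  show "\<sigma> \<in> dSec \<Longrightarrow> u \<in> units G \<Longrightarrow> \<sigma> u \<in> dX u" for \<sigma> u
    by (erule dSecE) (simp add: dX_def hbundle.S_H[OF hb])
  show "\<exists>zs. snd ` set zs \<subseteq> dSec \<and> ell2_norm (\<lambda>n. dv u a n - (\<Sum>z\<leftarrow>zs. fst z * dv u (snd z u) n)) < e"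
    if u: "u \<in> units G" and a: "a \<in> dX u" and e: "e > 0" for u a and e :: real
  proof -
    have aH: "snd a \<in> H (fst a) u" using a by (simp add: dX_def)
    obtain \<xi> where xi: "\<xi> \<in> bounded_sections (units G) (\<S> (fst a))" "ell2_norm (\<lambda>n. \<xi> u n - snd a n) < e"
      by (rule hbundle.dense_bounded[OF hb u aH e])
    have E: "\<xi> u \<in> ell2" "snd a \<in> ell2"
      using xi(1) hbundle.S_ell2[OF hb _ u, of \<xi> "fst a"] hE[OF u aH] by (simp_all add: bounded_sections_def)
    have "(\<lambda>n. dv u a n - (\<Sum>z\<leftarrow>[(1, \<lambda>u. (fst a, \<xi> u))]. fst z * dv u (snd z u) n)) = emb (fst a) (\<lambda>n. snd a n - \<xi> u n)"
      by (auto simp: dv_def emb_def)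
    then have "ell2_norm (\<lambda>n. dv u a n - (\<Sum>z\<leftarrow>[(1, \<lambda>u. (fst a, \<xi> u))]. fst z * dv u (snd z u) n)) < e"
      using emb_norm[OF ell2.diff_W[OF E(2,1)], of "fst a"] xi(2) ell2_norm_diff_commute[OF E] by simp
    then show ?thesis using dSecI[OF xi(1)] by (intro exI[of _ "[(1, \<lambda>u. (fst a, \<xi> u))]"]) simp
  qed
  show "continuous_on UNIV (\<lambda>x. ell2_inner (dv (rng G x) (dact x (\<sigma> (src G x)))) (dv (rng G x) (\<tau> (rng G x))))"
    if s: "\<sigma> \<in> dSec" and t: "\<tau> \<in> dSec" for \<sigma> \<tau>
  proof -
    obtain k \<xi> where k: "\<sigma> = (\<lambda>u. (k, \<xi> u))" "\<xi> \<in> bounded_sections (units G) (\<S> k)" by (rule dSecE[OF s])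
    obtain l \<eta> where l: "\<tau> = (\<lambda>u. (l, \<eta> u))" "\<eta> \<in> bounded_sections (units G) (\<S> l)" by (rule dSecE[OF t])
    show ?thesis
    proof (cases "k = l")
      case True
      then show ?thesis
        using hbundle.coeff_cont[OF hb k(2), of \<eta>] l k by (simp add: dv_def dact_def emb_inner_emb coefficient_def)
    next
      case False
      then show ?thesis using k l by (simp add: dv_def dact_def emb_inner_emb)
    qed
  qed
qed

interpretation K: kernel_bundle G dX dv dact dSec by (rule kernel)

lemma sum_bundle: "hbundle G K.H K.\<S> K.L"
  by unfold_locales (rule K.is_bundle)

definition glue :: "(nat \<Rightarrow> 'g \<Rightarrow> nat \<Rightarrow> complex) \<Rightarrow> 'g \<Rightarrow> nat \<Rightarrow> complex" where
  "glue \<xi> u = (\<lambda>n. \<xi> (fst (prod_decode n)) u (snd (prod_decode n)))"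

definition part :: "nat \<Rightarrow> (nat \<Rightarrow> 'g \<Rightarrow> nat \<Rightarrow> complex) \<Rightarrow> 'g \<Rightarrow> nat \<Rightarrow> complex" where
  "part M \<xi> u = (\<lambda>n. if fst (prod_decode n) < M then glue \<xi> u n else 0)"

context
  fixes \<xi> :: "nat \<Rightarrow> 'g \<Rightarrow> nat \<Rightarrow> complex" and a :: "nat \<Rightarrow> real"
  assumes xi: "\<And>k. \<xi> k \<in> \<S> k" and bnd: "\<And>k u. u \<in> units G \<Longrightarrow> ell2_norm (\<xi> k u) \<le> sqrt (a k)"
    and a0: "\<And>k. a k \<ge> 0" and a: "summable a"
begin

lemma xiE: "u \<in> units G \<Longrightarrow> \<xi> k u \<in> ell2"
  using hbundle.S_ell2[OF hb xi] .

lemma bnd2: "u \<in> units G \<Longrightarrow> (ell2_norm (\<xi> k u))\<^sup>2 \<le> a k"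
  using power_mono[OF bnd ell2_norm_nonneg[OF xiE], of u k 2] a0 by simp

lemma glue_ell2: "u \<in> units G \<Longrightarrow> glue \<xi> u \<in> ell2"
  and glue_norm: "u \<in> units G \<Longrightarrow> ell2_norm (glue \<xi> u) \<le> sqrt (suminf a)"
  using dsum_ell2[of "\<lambda>k. \<xi> k u" a] xiE[of u] bnd2[of u] a unfolding glue_def by auto

lemma part_Suc: "part (Suc M) \<xi> u = (\<lambda>n. part M \<xi> u n + emb M (\<xi> M u) n)"
  by (auto simp: part_def emb_def glue_def)

lemma part_0: "part 0 \<xi> u = (\<lambda>n. 0)"
  by (simp add: part_def)

lemma part_S: "part M \<xi> \<in> K.\<S>"
proof (induction M)
  case 0
  then show ?case using hbundle.fld_parts(2)[OF sum_bundle] by (simp add: part_0[abs_def])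
next
  case (Suc M)
  have "\<xi> M \<in> bounded_sections (units G) (\<S> M)"
    by (rule hbundle.bounded_sectionsI[OF hb xi bnd])
  from K.sec_S[OF dSecI[OF this]] have "(\<lambda>u. emb M (\<xi> M u)) \<in> K.\<S>" by (simp add: dv_def)
  from K.S_add[OF Suc this] show ?case by (simp add: part_Suc[abs_def])
qed

definition tail where "tail M = (\<Sum>k. if k < M then 0 else a k)"

lemma tail_summable: "summable (\<lambda>k. if k < M then 0 else a k)"
  by (rule summable_comparison_test'[OF a, where N = 0]) (use a0 in auto)

lemma tail_tendsto: "tail \<longlonglongrightarrow> 0"
proof -
  have "tail = (\<lambda>M. suminf a - (\<Sum>k<M. a k))"
  proof
    fix M
    have s: "(\<lambda>k. if k < M then a k else 0) sums (\<Sum>k<M. a k)"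
      using sums_If_finite_set[of "{..<M}" a] by simp
    have "(\<lambda>k. a k - (if k < M then a k else 0)) sums (suminf a - (\<Sum>k<M. a k))"
      by (rule sums_diff[OF summable_sums[OF a] s])
    moreover have "(\<lambda>k. a k - (if k < M then a k else 0)) = (\<lambda>k. if k < M then 0 else a k)" by auto
    ultimately show "tail M = suminf a - (\<Sum>k<M. a k)" unfolding tail_def by (simp add: sums_iff)
  qed
  moreover have "(\<lambda>M. suminf a - (\<Sum>k<M. a k)) \<longlonglongrightarrow> suminf a - suminf a"
    by (intro tendsto_intros summable_LIMSEQ a)
  ultimately show ?thesis by simp
qed

text \<open>Discarding the first M rows leaves a sequence dominated by the tail of the series of a.
  The bound is the same at all units, so the finite parts converge uniformly and \<open>glue\<close>
  is a continuous section.\<close>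

lemma glue_part: "u \<in> units G \<Longrightarrow> ell2_norm (\<lambda>n. glue \<xi> u n - part M \<xi> u n) \<le> sqrt (tail M)"
proof -
  assume u: "u \<in> units G"
  let ?y = "\<lambda>k. if k < M then (\<lambda>n. 0) else \<xi> k u"
  have "(\<lambda>n. glue \<xi> u n - part M \<xi> u n) = (\<lambda>n. ?y (fst (prod_decode n)) (snd (prod_decode n)))"
    by (auto simp: glue_def part_def)
  moreover have "ell2_norm (\<lambda>n. ?y (fst (prod_decode n)) (snd (prod_decode n))) \<le> sqrt (tail M)"
    unfolding tail_def using xiE[OF u] bnd2[OF u] tail_summable by (intro dsum_ell2(2)) (auto simp: ell2.zero_W)
  ultimately show ?thesis by simp
qed

lemma sqrt_tail_tendsto: "(\<lambda>M. sqrt (tail M)) \<longlonglongrightarrow> 0"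
  using tendsto_real_sqrt[OF tail_tendsto] by simp

lemma glue_part_tendsto:
  assumes u: "u \<in> units G"
  shows "(\<lambda>M. ell2_norm (\<lambda>n. part M \<xi> u n - glue \<xi> u n)) \<longlonglongrightarrow> 0"
proof (rule tendsto_sandwich[OF _ _ tendsto_const sqrt_tail_tendsto])
  have E: "part M \<xi> u \<in> ell2" for M using hbundle.S_ell2[OF sum_bundle part_S u] .
  show "\<forall>\<^sub>F M in sequentially. 0 \<le> ell2_norm (\<lambda>n. part M \<xi> u n - glue \<xi> u n)"
    using E ell2_norm_nonneg[OF ell2.diff_W[OF _ glue_ell2[OF u]]] by simp
  show "\<forall>\<^sub>F M in sequentially. ell2_norm (\<lambda>n. part M \<xi> u n - glue \<xi> u n) \<le> sqrt (tail M)"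
    using glue_part[OF u] ell2_norm_diff_commute[OF E glue_ell2[OF u]] by simp
qed

lemma small_tail: "e > 0 \<Longrightarrow> \<exists>M. sqrt (tail M) < e"
  using order_tendstoD(2)[OF sqrt_tail_tendsto, of e] eventually_happens[of _ sequentially] by auto

lemma glue_H: "u \<in> units G \<Longrightarrow> glue \<xi> u \<in> K.H u"
proof (rule K.closed_H[OF _ glue_ell2])
  fix e :: real assume u: "u \<in> units G" and "e > 0"
  then obtain M where "sqrt (tail M) < e" using small_tail by auto
  then show "\<exists>y\<in>K.H u. ell2_norm (\<lambda>n. glue \<xi> u n - y n) < e"
    using glue_part[OF u, of M] by (intro bexI[OF _ K.S_H[OF part_S[of M] u]]) simp
qed

lemma glue_S: "glue \<xi> \<in> K.\<S>"
proof (rule K.S_local)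
  show "glue \<xi> \<in> Pi (units G) K.H" using glue_H by simp
  fix u and e :: real assume "e > 0"
  then obtain M where M: "sqrt (tail M) < e" using small_tail by auto
  have "\<forall>v\<in>UNIV \<inter> units G. ell2_norm (\<lambda>n. glue \<xi> v n - part M \<xi> v n) \<le> e"
    using glue_part[of _ M] M by (auto intro: order_trans less_imp_le)
  then show "\<exists>\<eta>\<in>K.\<S>. \<exists>V. open V \<and> u \<in> V \<and> (\<forall>v\<in>V \<inter> units G. ell2_norm (\<lambda>n. glue \<xi> v n - \<eta> v n) \<le> e)"
    by (intro bexI[OF _ part_S[of M]] exI[of _ UNIV]) simp
qed

lemma L_part_inner:
  assumes z: "z \<in> ell2"
  shows "ell2_inner (K.L x (part M \<xi> (src G x))) z = (\<Sum>k<M. ell2_inner (L k x (\<xi> k (src G x))) (\<lambda>j. z (prod_encode (k, j))))"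
proof (induction M)
  case 0
  have "K.L x (\<lambda>n. 0) = (\<lambda>n. 0)"
    using K.L_scale[OF K.zero_H[OF src_units], of x 0] by simp
  then show ?case by (simp add: part_0) (simp add: ell2_inner_def)
next
  case (Suc M)
  have aX: "(M, \<xi> M (src G x)) \<in> dX (src G x)"
    using hbundle.S_H[OF hb xi src_units] by (simp add: dX_def)
  have e: "emb M (\<xi> M (src G x)) = dv (src G x) (M, \<xi> M (src G x))" by (simp add: dv_def)
  have eH: "emb M (\<xi> M (src G x)) \<in> K.H (src G x)" unfolding e by (rule K.v_H[OF src_units aX])
  have pH: "part M \<xi> (src G x) \<in> K.H (src G x)" by (rule K.S_H[OF part_S src_units])
  have Le: "K.L x (emb M (\<xi> M (src G x))) = emb M (L M x (\<xi> M (src G x)))"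
    unfolding e K.L_v[OF aX] by (simp add: dv_def dact_def)
  have E: "K.L x (part M \<xi> (src G x)) \<in> ell2" "K.L x (emb M (\<xi> M (src G x))) \<in> ell2"
    using K.H_ell2[OF K.L_H[OF pH]] K.H_ell2[OF K.L_H[OF eH]] .
  show ?case
    unfolding part_Suc K.L_add[OF pH eH] ell2.ip_add_left[OF E z] Suc by (simp add: Le emb_inner)
qed

text \<open>The action on the sum is known on generating vectors, hence on finite parts. Continuity
  of the isometry carries it to the limit, so the coefficient of glued sections is the series of the
  coefficients.\<close>

lemma glue_coeff:
  assumes z: "z \<in> ell2"
  shows "(\<lambda>k. ell2_inner (L k x (\<xi> k (src G x))) (\<lambda>j. z (prod_encode (k, j)))) sums ell2_inner (K.L x (glue \<xi> (src G x))) z"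
proof -
  note pH = K.S_H[OF part_S src_units, of _ x] and gH = K.S_H[OF glue_S src_units, of x]
  have "(\<lambda>M. ell2_norm (\<lambda>n. K.L x (part M \<xi> (src G x)) n - K.L x (glue \<xi> (src G x)) n)) \<longlonglongrightarrow> 0"
    using glue_part_tendsto[OF src_units, of x] K.L_diff[OF pH gH] by simp
  from ell2_inner_tendsto[OF K.H_ell2[OF K.L_H[OF pH]] K.H_ell2[OF K.L_H[OF gH]] z this]
  show ?thesis unfolding sums_def L_part_inner[OF z] .
qed

end

end

section \<open>Tensor products of two bundles\<close>

locale htensor = tgrpd G for G :: "'g::topological_space haar_groupoid" (structure) +
  fixes H1 S1 L1 H2 S2 L2
  assumes hb1: "hbundle G H1 S1 L1" and hb2: "hbundle G H2 S2 L2"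
begin

sublocale b1: hbundle G H1 S1 L1 by (rule hb1)
sublocale b2: hbundle G H2 S2 L2 by (rule hb2)

definition tX :: "'g \<Rightarrow> ((nat \<Rightarrow> complex) \<times> (nat \<Rightarrow> complex)) set" where "tX u = H1 u \<times> H2 u"
definition tv :: "'g \<Rightarrow> (nat \<Rightarrow> complex) \<times> (nat \<Rightarrow> complex) \<Rightarrow> nat \<Rightarrow> complex" where "tv u a = tens (fst a) (snd a)"
definition tact :: "'g \<Rightarrow> (nat \<Rightarrow> complex) \<times> (nat \<Rightarrow> complex) \<Rightarrow> (nat \<Rightarrow> complex) \<times> (nat \<Rightarrow> complex)" where
  "tact x a = (L1 x (fst a), L2 x (snd a))"
definition tSec :: "('g \<Rightarrow> (nat \<Rightarrow> complex) \<times> (nat \<Rightarrow> complex)) set" where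
  "tSec = {\<lambda>u. (\<xi> u, \<eta> u) | \<xi> \<eta>. \<xi> \<in> bounded_sections (units G) S1 \<and> \<eta> \<in> bounded_sections (units G) S2}"

lemma tSecI: "\<xi> \<in> bounded_sections (units G) S1 \<Longrightarrow> \<eta> \<in> bounded_sections (units G) S2 \<Longrightarrow> (\<lambda>u. (\<xi> u, \<eta> u)) \<in> tSec"
  unfolding tSec_def by blast

lemma tSecE:
  assumes "\<sigma> \<in> tSec"
  obtains \<xi> \<eta> where "\<sigma> = (\<lambda>u. (\<xi> u, \<eta> u))" "\<xi> \<in> bounded_sections (units G) S1" "\<xi> \<in> S1"
    "\<eta> \<in> bounded_sections (units G) S2" "\<eta> \<in> S2"
  using assms unfolding tSec_def bounded_sections_def by blast

lemma tXE: "u \<in> units G \<Longrightarrow> a \<in> tX u \<Longrightarrow> fst a \<in> ell2" "u \<in> units G \<Longrightarrow> a \<in> tX u \<Longrightarrow> snd a \<in> ell2"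
  using b1.H_ell2[of u "fst a"] b2.H_ell2[of u "snd a"] by (auto simp: tX_def)

lemma tact_in: "a \<in> tX (src G x) \<Longrightarrow> tact x a \<in> tX (rng G x)"
  using b1.L_H[of "fst a" x] b2.L_H[of "snd a" x] by (auto simp: tX_def tact_def)

lemma kernel: "kernel_bundle G tX tv tact tSec"
proof unfold_locales
  show "u \<in> units G \<Longrightarrow> a \<in> tX u \<Longrightarrow> tv u a \<in> ell2" for u a
    using tXE by (simp add: tv_def tens_ell2)
  show "a \<in> tX (src G x) \<Longrightarrow> tact x a \<in> tX (rng G x)" for a x
    by (rule tact_in)
  show "ell2_inner (tv (rng G x) (tact x a)) (tv (rng G x) (tact x b)) = ell2_inner (tv (src G x) a) (tv (src G x) b)"
    if a: "a \<in> tX (src G x)" and b: "b \<in> tX (src G x)" for a b x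
  proof -
    note E = tXE[OF rng_units tact_in[OF a]] tXE[OF rng_units tact_in[OF b]]
      tXE[OF src_units a] tXE[OF src_units b]
    have "ell2_inner (L1 x (fst a)) (L1 x (fst b)) = ell2_inner (fst a) (fst b)"
      "ell2_inner (L2 x (snd a)) (L2 x (snd b)) = ell2_inner (snd a) (snd b)"
      using b1.L_inner[of "fst a" x "fst b"] b2.L_inner[of "snd a" x "snd b"] a b by (auto simp: tX_def)
    then show ?thesis using E by (simp add: tv_def tens_inner) (simp add: tact_def)
  qed
  show "tv (rng G x) (tact (x \<cdot> y) a) = tv (rng G x) (tact x (tact y a))"
    if "src G x = rng G y" "a \<in> tX (src G y)" for a x y
    using b1.L_mult[OF that(1), of "fst a"] b2.L_mult[OF that(1), of "snd a"] that(2) by (auto simp: tv_def tact_def tX_def)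
  show "u \<in> units G \<Longrightarrow> a \<in> tX u \<Longrightarrow> tv u (tact u a) = tv u a" for u a
    using b1.L_unit[of u "fst a"] b2.L_unit[of u "snd a"] by (auto simp: tv_def tact_def tX_def)
  show "\<sigma> \<in> tSec \<Longrightarrow> u \<in> units G \<Longrightarrow> \<sigma> u \<in> tX u" for \<sigma> u
    by (erule tSecE) (simp add: tX_def b1.S_H b2.S_H)
  show "\<exists>zs. snd ` set zs \<subseteq> tSec \<and> ell2_norm (\<lambda>n. tv u a n - (\<Sum>z\<leftarrow>zs. fst z * tv u (snd z u) n)) < e"
    if u: "u \<in> units G" and a: "a \<in> tX u" and e: "e > 0" for u a and e :: real
  proof -
    have aH: "fst a \<in> H1 u" "snd a \<in> H2 u" using a by (auto simp: tX_def)
    have aE: "fst a \<in> ell2" "snd a \<in> ell2" using tXE[OF u a] .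
    \<comment> \<open>With a = (a1, a2) the error is at most |a1 - \<xi>| |a2| + |\<xi>| |a2 -
      \<eta>|. Each part gets e/2; adding 1 to the norms avoids a zero denominator. The bound d2
      depends on \<xi>, so \<xi> is chosen before \<eta>.\<close>
    define d1 where "d1 = e / (2 * (ell2_norm (snd a) + 1))"
    have p1: "ell2_norm (snd a) + 1 > 0" using ell2_norm_nonneg[OF aE(2)] by linarith
    have dp: "e / (2 * p) * p = e/2" if "p > 0" for p using that by (simp add: field_simps)
    have d1: "d1 > 0" "d1 * (ell2_norm (snd a) + 1) = e/2"
      unfolding d1_def using e p1 dp[OF p1] by simp_all
    obtain \<xi> where xi: "\<xi> \<in> bounded_sections (units G) S1" "ell2_norm (\<lambda>n. \<xi> u n - fst a n) < d1"
      by (rule b1.dense_bounded[OF u aH(1) d1(1)])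
    have xE: "\<xi> u \<in> ell2" using xi(1) b1.S_ell2[OF _ u] by (simp add: bounded_sections_def)
    define d2 where "d2 = e / (2 * (ell2_norm (\<xi> u) + 1))"
    have p2: "ell2_norm (\<xi> u) + 1 > 0" using ell2_norm_nonneg[OF xE] by linarith
    have d2: "d2 > 0" "(ell2_norm (\<xi> u) + 1) * d2 = e/2"
      unfolding d2_def mult.commute[of "ell2_norm (\<xi> u) + 1"] using e p2 dp[OF p2] by simp_all
    obtain \<eta> where eta: "\<eta> \<in> bounded_sections (units G) S2" "ell2_norm (\<lambda>n. \<eta> u n - snd a n) < d2"
      by (rule b2.dense_bounded[OF u aH(2) d2(1)])
    have eE: "\<eta> u \<in> ell2" using eta(1) b2.S_ell2[OF _ u] by (simp add: bounded_sections_def)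
    note D1 = ell2.diff_W[OF aE(1) xE] and D2 = ell2.diff_W[OF aE(2) eE]
    have "(\<lambda>n. tv u a n - (\<Sum>z\<leftarrow>[(1, \<lambda>u. (\<xi> u, \<eta> u))]. fst z * tv u (snd z u) n))
       = (\<lambda>n. tens (\<lambda>n. fst a n - \<xi> u n) (snd a) n + tens (\<xi> u) (\<lambda>n. snd a n - \<eta> u n) n)"
      by (simp add: tv_def tens_def algebra_simps)
    then have "ell2_norm (\<lambda>n. tv u a n - (\<Sum>z\<leftarrow>[(1, \<lambda>u. (\<xi> u, \<eta> u))]. fst z * tv u (snd z u) n))
       \<le> ell2_norm (\<lambda>n. fst a n - \<xi> u n) * ell2_norm (snd a) + ell2_norm (\<xi> u) * ell2_norm (\<lambda>n. snd a n - \<eta> u n)"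
      using ell2_norm_triangle[OF tens_ell2[OF D1 aE(2)] tens_ell2[OF xE D2]] tens_norm[OF D1 aE(2)] tens_norm[OF xE D2] by simp
    also have "\<dots> \<le> d1 * ell2_norm (snd a) + ell2_norm (\<xi> u) * d2"
      using xi(2) eta(2) ell2_norm_diff_commute[OF aE(1) xE] ell2_norm_diff_commute[OF aE(2) eE]
        ell2_norm_nonneg[OF aE(2)] ell2_norm_nonneg[OF xE] by (intro add_mono mult_left_mono mult_right_mono) auto
    also have "\<dots> < d1 * (ell2_norm (snd a) + 1) + (ell2_norm (\<xi> u) + 1) * d2"
      using d1(1) d2(1) by (simp add: algebra_simps)
    also have "\<dots> = e" using d1(2) d2(2) by simp
    finally show ?thesis using tSecI[OF xi(1) eta(1)] by (intro exI[of _ "[(1, \<lambda>u. (\<xi> u, \<eta> u))]"]) simp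
  qed
  show "continuous_on UNIV (\<lambda>x. ell2_inner (tv (rng G x) (tact x (\<sigma> (src G x)))) (tv (rng G x) (\<tau> (rng G x))))"
    if s: "\<sigma> \<in> tSec" and t: "\<tau> \<in> tSec" for \<sigma> \<tau>
  proof -
    obtain \<xi> \<eta> where k: "\<sigma> = (\<lambda>u. (\<xi> u, \<eta> u))" "\<xi> \<in> bounded_sections (units G) S1" "\<xi> \<in> S1"
      "\<eta> \<in> bounded_sections (units G) S2" "\<eta> \<in> S2" by (rule tSecE[OF s])
    obtain \<xi>' \<eta>' where l: "\<tau> = (\<lambda>u. (\<xi>' u, \<eta>' u))" "\<xi>' \<in> bounded_sections (units G) S1" "\<xi>' \<in> S1"
      "\<eta>' \<in> bounded_sections (units G) S2" "\<eta>' \<in> S2" by (rule tSecE[OF t])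
    have "ell2_inner (tv (rng G x) (tact x (\<sigma> (src G x)))) (tv (rng G x) (\<tau> (rng G x)))
       = coefficient G L1 \<xi> \<xi>' x * coefficient G L2 \<eta> \<eta>' x" for x
      unfolding k l tv_def tact_def coefficient_def fst_conv snd_conv
      by (rule tens_inner[OF b1.L_ell2[OF b1.S_H[OF k(3) src_units]] b2.L_ell2[OF b2.S_H[OF k(5) src_units]]
          b1.S_ell2[OF l(3) rng_units] b2.S_ell2[OF l(5) rng_units]])
    then show ?thesis
      using b1.coeff_cont[OF k(2) l(2)] b2.coeff_cont[OF k(4) l(4)] by (simp add: continuous_on_mult)
  qed
qed

interpretation K: kernel_bundle G tX tv tact tSec by (rule kernel)

lemma tensor_bundle: "hbundle G K.H K.\<S> K.L"
  by unfold_locales (rule K.is_bundle)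

lemma tensor_coeff:
  assumes "\<xi> \<in> S1" "\<eta> \<in> S2" "\<xi>' \<in> S1" "\<eta>' \<in> S2"
  shows "coefficient G K.L (\<lambda>u. tens (\<xi> u) (\<eta> u)) (\<lambda>u. tens (\<xi>' u) (\<eta>' u)) x = coefficient G L1 \<xi> \<xi>' x * coefficient G L2 \<eta> \<eta>' x"
proof -
  have a: "(\<xi> (src G x), \<eta> (src G x)) \<in> tX (src G x)"
    using assms by (simp add: tX_def b1.S_H b2.S_H)
  have "K.L x (tens (\<xi> (src G x)) (\<eta> (src G x))) = tens (L1 x (\<xi> (src G x))) (L2 x (\<eta> (src G x)))"
    using K.L_v[OF a] by (simp add: tv_def tact_def)
  then show ?thesis
    unfolding coefficient_def using assms
    by (simp add: tens_inner b1.L_ell2 b2.L_ell2 b1.S_H b2.S_H b1.S_ell2 b2.S_ell2)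
qed

lemma tensor_S: "\<xi> \<in> bounded_sections (units G) S1 \<Longrightarrow> \<eta> \<in> bounded_sections (units G) S2 \<Longrightarrow> (\<lambda>u. tens (\<xi> u) (\<eta> u)) \<in> K.\<S>"
  using K.sec_S[OF tSecI[of \<xi> \<eta>]] by (simp add: tv_def)

lemma tensor_product:
  assumes "\<xi> \<in> S1" "\<eta> \<in> S2" "\<xi>' \<in> S1" "\<eta>' \<in> S2" "p \<ge> 0" "p' \<ge> 0"
    "\<And>u. u \<in> units G \<Longrightarrow> ell2_norm (\<xi> u) \<le> p" "\<And>u. u \<in> units G \<Longrightarrow> ell2_norm (\<eta> u) \<le> q"
    "\<And>u. u \<in> units G \<Longrightarrow> ell2_norm (\<xi>' u) \<le> p'" "\<And>u. u \<in> units G \<Longrightarrow> ell2_norm (\<eta>' u) \<le> q'"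
  shows "(\<lambda>x. coefficient G L1 \<xi> \<xi>' x * coefficient G L2 \<eta> \<eta>' x) \<in> B_alg G"
    "B_norm G (\<lambda>x. coefficient G L1 \<xi> \<xi>' x * coefficient G L2 \<eta> \<eta>' x) \<le> (p * q) * (p' * q')"
proof -
  have eq: "(\<lambda>x. coefficient G L1 \<xi> \<xi>' x * coefficient G L2 \<eta> \<eta>' x) = coefficient G K.L (\<lambda>u. tens (\<xi> u) (\<eta> u)) (\<lambda>u. tens (\<xi>' u) (\<eta>' u))"
    using tensor_coeff[OF assms(1-4)] by auto
  have n: "ell2_norm (tens (\<xi> u) (\<eta> u)) \<le> p * q" "ell2_norm (tens (\<xi>' u) (\<eta>' u)) \<le> p' * q'" if u: "u \<in> units G" for u
    using tens_norm[OF b1.S_ell2[OF assms(1) u] b2.S_ell2[OF assms(2) u]] tens_norm[OF b1.S_ell2[OF assms(3) u] b2.S_ell2[OF assms(4) u]]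
      mult_mono[OF assms(7)[OF u] assms(8)[OF u] assms(5) ell2_norm_nonneg[OF b2.S_ell2[OF assms(2) u]]]
      mult_mono[OF assms(9)[OF u] assms(10)[OF u] assms(6) ell2_norm_nonneg[OF b2.S_ell2[OF assms(4) u]]]
    by simp_all
  have S: "(\<lambda>u. tens (\<xi> u) (\<eta> u)) \<in> K.\<S>" "(\<lambda>u. tens (\<xi>' u) (\<eta>' u)) \<in> K.\<S>"
    using assms by (auto intro!: tensor_S b1.bounded_sectionsI b2.bounded_sectionsI)
  show "(\<lambda>x. coefficient G L1 \<xi> \<xi>' x * coefficient G L2 \<eta> \<eta>' x) \<in> B_alg G"
    "B_norm G (\<lambda>x. coefficient G L1 \<xi> \<xi>' x * coefficient G L2 \<eta> \<eta>' x) \<le> (p * q) * (p' * q')"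
    unfolding eq using B_algI[OF tensor_bundle S n] by auto
qed

end

section \<open>Sums, products and completeness in the Fourier-Stieltjes algebra\<close>

context tgrpd
begin

text \<open>Squared norms add in a direct sum, so sections with norms at most sqrt (a k) in the k-th
  summand glue to sections whose norm is at most the root of the sum; the product of the two norms
  is the sum itself. The strict bounds leave room for representations that are not optimal.\<close>

theorem B_sum:
  assumes "\<And>k. \<phi> k \<in> B_alg G" "\<And>k. B_norm G (\<phi> k) < a k" "summable a"
  shows "\<And>x. summable (\<lambda>k. \<phi> k x)" "(\<lambda>x. \<Sum>k. \<phi> k x) \<in> B_alg G" "B_norm G (\<lambda>x. \<Sum>k. \<phi> k x) \<le> suminf a"
proof -
  let ?P = "\<lambda>k (H, \<S>, L, \<xi>, \<eta>). hbundle G H \<S> L \<and> \<xi> \<in> \<S> \<and> \<eta> \<in> \<S> \<and> \<phi> k = coefficient G L \<xi> \<eta> \<and> a k > 0 \<and>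
    (\<forall>u\<in>units G. ell2_norm (\<xi> u) \<le> sqrt (a k)) \<and> (\<forall>u\<in>units G. ell2_norm (\<eta> u) \<le> sqrt (a k))"
  have "\<forall>k. \<exists>z. ?P k z"
  proof
    fix k
    show "\<exists>z. ?P k z"
    proof (rule B_algE[OF assms(1,2), of k])
      fix H \<S> L \<xi> \<eta> assume "hbundle G H \<S> L" "\<xi> \<in> \<S>" "\<eta> \<in> \<S>" "\<phi> k = coefficient G L \<xi> \<eta>" "a k > 0"
        "\<And>u. u \<in> units G \<Longrightarrow> ell2_norm (\<xi> u) \<le> sqrt (a k)" "\<And>u. u \<in> units G \<Longrightarrow> ell2_norm (\<eta> u) \<le> sqrt (a k)"
      then show ?thesis by (intro exI[of _ "(H, \<S>, L, \<xi>, \<eta>)"]) simp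
    qed
  qed
  from choice[OF this] obtain Z where Z: "\<forall>k. ?P k (Z k)" by (elim exE)
  define H where "H k = fst (Z k)" for k
  define \<S> where "\<S> k = fst (snd (Z k))" for k
  define L where "L k = fst (snd (snd (Z k)))" for k
  define \<xi> where "\<xi> k = fst (snd (snd (snd (Z k))))" for k
  define \<eta> where "\<eta> k = snd (snd (snd (snd (Z k))))" for k
  have A: "hbundle G (H k) (\<S> k) (L k)" "\<xi> k \<in> \<S> k" "\<eta> k \<in> \<S> k" "\<phi> k = coefficient G (L k) (\<xi> k) (\<eta> k)" "a k > 0"
    "\<And>u. u \<in> units G \<Longrightarrow> ell2_norm (\<xi> k u) \<le> sqrt (a k)" "\<And>u. u \<in> units G \<Longrightarrow> ell2_norm (\<eta> k u) \<le> sqrt (a k)" for k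
    using spec[OF Z, of k] by (simp_all add: H_def \<S>_def L_def \<xi>_def \<eta>_def case_prod_unfold)
  have "hdsum G H \<S> L" using A(1) by (simp add: hdsum_def hdsum_axioms_def tgrpd_axioms)
  then interpret hdsum G H \<S> L .
  interpret K: kernel_bundle G dX dv dact dSec by (rule kernel)
  have a0: "a k \<ge> 0" for k using A(5)[of k] by simp
  note gx = glue_S[OF A(2) A(6) a0 assms(3)] and ge = glue_S[OF A(3) A(7) a0 assms(3)]
  have sums: "(\<lambda>k. \<phi> k x) sums coefficient G K.L (glue \<xi>) (glue \<eta>) x" for x
  proof -
    have "glue \<eta> (rng G x) \<in> ell2" by (rule glue_ell2[OF A(3) A(7) a0 assms(3) rng_units])
    from glue_coeff[OF A(2) A(6) a0 assms(3) this, of x] show ?thesis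
      by (simp add: A(4) coefficient_def glue_def)
  qed
  show "summable (\<lambda>k. \<phi> k x)" for x using sums by (rule sums_summable)
  have eq: "(\<lambda>x. \<Sum>k. \<phi> k x) = coefficient G K.L (glue \<xi>) (glue \<eta>)"
    using sums by (auto simp: sums_iff)
  have s0: "suminf a \<ge> 0" using assms(3) a0 by (intro suminf_nonneg)
  show "(\<lambda>x. \<Sum>k. \<phi> k x) \<in> B_alg G" "B_norm G (\<lambda>x. \<Sum>k. \<phi> k x) \<le> suminf a"
    unfolding eq using B_algI[OF sum_bundle gx ge glue_norm[OF A(2) A(6) a0 assms(3)] glue_norm[OF A(3) A(7) a0 assms(3)]] s0
    by auto
qed

text \<open>The empty index set yields the bundle with zero fibres. The zero function is needed to
  pad a finite sum to a series.\<close>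

lemma B_zero: "(\<lambda>x. 0) \<in> B_alg G" "B_norm G (\<lambda>x. 0) = 0"
proof -
  interpret K: kernel_bundle G "\<lambda>_. {}" "\<lambda>_ _. undefined" "\<lambda>_ _. undefined" "{} :: ('g \<Rightarrow> nat) set"
    by unfold_locales auto
  have hb: "hbundle G K.H K.\<S> K.L" by unfold_locales (rule K.is_bundle)
  have z: "(\<lambda>u n. 0) \<in> K.\<S>" by (rule hbundle.fld_parts(2)[OF hb])
  have "coefficient G K.L (\<lambda>u n. 0) (\<lambda>u n. 0) = (\<lambda>x. 0)" by (simp add: coefficient_def ell2_inner_def)
  then show "(\<lambda>x. 0) \<in> B_alg G" "B_norm G (\<lambda>x. 0) = 0"
    using B_algI[OF hb z z, of 0 0] B_norm_nonneg[of "\<lambda>x. 0"] by auto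
qed

lemma B_add:
  assumes phi: "\<phi> \<in> B_alg G" and psi: "\<psi> \<in> B_alg G"
  shows "(\<lambda>x. \<phi> x + \<psi> x) \<in> B_alg G" "B_norm G (\<lambda>x. \<phi> x + \<psi> x) \<le> B_norm G \<phi> + B_norm G \<psi>"
proof -
  have main: "(\<lambda>x. \<phi> x + \<psi> x) \<in> B_alg G \<and> B_norm G (\<lambda>x. \<phi> x + \<psi> x) \<le> B_norm G \<phi> + B_norm G \<psi> + e" if e: "e > 0" for e
  proof -
    \<comment> \<open>Two functions followed by zeros. The bounds in \<open>B_sum\<close> are
      strict, so each term is raised by a piece of a geometric series with sum e.\<close>
    define f where "f k = (if k = 0 then \<phi> else if k = 1 then \<psi> else (\<lambda>x. 0))" for k :: nat
    define b where "b k = (if k = 0 then B_norm G \<phi> else if k = 1 then B_norm G \<psi> else 0)" for k :: nat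
    have hs: "(\<lambda>k. (e/2) * (1/2)^k) sums ((e/2) * (1 / (1 - 1/2)))" by (intro sums_mult geometric_sums) simp
    have bs: "b sums (\<Sum>k\<in>{0,1}. b k)" by (rule sums_finite) (auto simp: b_def)
    have s: "(\<lambda>k. b k + (e/2) * (1/2)^k) sums (B_norm G \<phi> + B_norm G \<psi> + e)"
      using sums_add[OF bs hs] by (simp add: b_def)
    have 1: "f k \<in> B_alg G" for k using phi psi B_zero(1) by (simp add: f_def)
    have 2: "B_norm G (f k) < b k + (e/2) * (1/2)^k" for k using e B_zero(2) by (simp add: f_def b_def)
    have "(\<Sum>k. f k x) = \<phi> x + \<psi> x" for x
    proof -
      have "(\<lambda>k. f k x) sums (\<Sum>k\<in>{0,1}. f k x)" by (rule sums_finite) (auto simp: f_def)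
      then show ?thesis by (simp add: sums_iff f_def)
    qed
    then show ?thesis using B_sum(2,3)[OF 1 2 sums_summable[OF s]] s by (simp add: sums_iff)
  qed
  from main[of 1] show "(\<lambda>x. \<phi> x + \<psi> x) \<in> B_alg G" by simp
  show "B_norm G (\<lambda>x. \<phi> x + \<psi> x) \<le> B_norm G \<phi> + B_norm G \<psi>"
    by (rule field_le_epsilon) (use main in simp)
qed

lemma B_diff:
  assumes "\<phi> \<in> B_alg G" "\<psi> \<in> B_alg G"
  shows "(\<lambda>x. \<phi> x - \<psi> x) \<in> B_alg G" "B_norm G (\<lambda>x. \<phi> x - \<psi> x) \<le> B_norm G \<phi> + B_norm G \<psi>"
  using B_add[OF assms(1) B_scale(1)[OF assms(2), of "-1"]] B_scale(2)[OF assms(2), of "-1"] by auto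

lemma B_triangle_diff:
  assumes "\<phi> \<in> B_alg G" "\<psi> \<in> B_alg G" "\<omega> \<in> B_alg G"
  shows "B_norm G (\<lambda>x. \<phi> x - \<omega> x) \<le> B_norm G (\<lambda>x. \<phi> x - \<psi> x) + B_norm G (\<lambda>x. \<psi> x - \<omega> x)"
  using B_add(2)[OF B_diff(1)[OF assms(1,2)] B_diff(1)[OF assms(2,3)]] by simp

lemma B_mult:
  assumes phi: "\<phi> \<in> B_alg G" and psi: "\<psi> \<in> B_alg G"
  shows "(\<lambda>x. \<phi> x * \<psi> x) \<in> B_alg G" "B_norm G (\<lambda>x. \<phi> x * \<psi> x) \<le> B_norm G \<phi> * B_norm G \<psi>"
proof -
  have main: "(\<lambda>x. \<phi> x * \<psi> x) \<in> B_alg G \<and> B_norm G (\<lambda>x. \<phi> x * \<psi> x) \<le> c * d"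
    if c: "B_norm G \<phi> < c" and d: "B_norm G \<psi> < d" for c d
  proof -
    obtain H1 S1 L1 \<xi> \<xi>' where A: "hbundle G H1 S1 L1" "\<xi> \<in> S1" "\<xi>' \<in> S1" "\<phi> = coefficient G L1 \<xi> \<xi>'" "c > 0"
      "\<And>u. u \<in> units G \<Longrightarrow> ell2_norm (\<xi> u) \<le> sqrt c" "\<And>u. u \<in> units G \<Longrightarrow> ell2_norm (\<xi>' u) \<le> sqrt c"
      using B_algE[OF phi c] by blast
    obtain H2 S2 L2 \<eta> \<eta>' where B: "hbundle G H2 S2 L2" "\<eta> \<in> S2" "\<eta>' \<in> S2" "\<psi> = coefficient G L2 \<eta> \<eta>'" "d > 0"
      "\<And>u. u \<in> units G \<Longrightarrow> ell2_norm (\<eta> u) \<le> sqrt d" "\<And>u. u \<in> units G \<Longrightarrow> ell2_norm (\<eta>' u) \<le> sqrt d"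
      using B_algE[OF psi d] by blast
    have c0: "sqrt c \<ge> 0" using A(5) by simp
    have ht: "htensor G H1 S1 L1 H2 S2 L2"
      using A(1) B(1) by (simp add: htensor_def htensor_axioms_def tgrpd_axioms)
    have "sqrt c * sqrt d * (sqrt c * sqrt d) = (sqrt c * sqrt c) * (sqrt d * sqrt d)" by (simp only: mult_ac)
    also have "\<dots> = c * d" using A(5) B(5) by simp
    finally show ?thesis
      using htensor.tensor_product[OF ht A(2) B(2) A(3) B(3) c0 c0 A(6) B(6) A(7) B(7)] unfolding A(4) B(4) by simp
  qed
  from main[of "B_norm G \<phi> + 1" "B_norm G \<psi> + 1"] show "(\<lambda>x. \<phi> x * \<psi> x) \<in> B_alg G" by simp
  show "B_norm G (\<lambda>x. \<phi> x * \<psi> x) \<le> B_norm G \<phi> * B_norm G \<psi>"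
  proof (rule tendsto_lowerbound)
    show "((\<lambda>e. (B_norm G \<phi> + e) * (B_norm G \<psi> + e)) \<longlongrightarrow> B_norm G \<phi> * B_norm G \<psi>) (at_right 0)"
      by (rule tendsto_eq_intros refl | simp)+
    show "\<forall>\<^sub>F e in at_right 0. B_norm G (\<lambda>x. \<phi> x * \<psi> x) \<le> (B_norm G \<phi> + e) * (B_norm G \<psi> + e)"
      using main by (auto simp: eventually_at_right_field intro!: exI[of _ 1])
  qed simp
qed

text \<open>A subsequence with increments below (1/2)^k makes the remainder a telescoping series, to
  which \<open>B_sum\<close> applies. The pointwise limit is part of the data, since the
  applications know it in advance.\<close>

lemma B_complete:
  assumes phi: "\<And>n. \<phi> n \<in> B_alg G"
    and C: "\<And>e. e > 0 \<Longrightarrow> \<exists>N. \<forall>m\<ge>N. \<forall>n\<ge>N. B_norm G (\<lambda>x. \<phi> m x - \<phi> n x) < e"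
    and lim: "\<And>x. (\<lambda>n. \<phi> n x) \<longlonglongrightarrow> \<psi> x"
  shows "\<psi> \<in> B_alg G" "(\<lambda>n. B_norm G (\<lambda>x. \<psi> x - \<phi> n x)) \<longlonglongrightarrow> 0"
proof -
  have "\<forall>k. \<exists>N. \<forall>m\<ge>N. \<forall>n\<ge>N. B_norm G (\<lambda>x. \<phi> m x - \<phi> n x) < (1/2)^k" using C by simp
  from choice[OF this] obtain f0 where f0: "\<And>k m n. m \<ge> f0 k \<Longrightarrow> n \<ge> f0 k \<Longrightarrow> B_norm G (\<lambda>x. \<phi> m x - \<phi> n x) < (1/2)^k"
    by blast
  \<comment> \<open>Adding k and all thresholds up to k makes f strictly increasing while f k stays
    above the threshold f0 k.\<close>
  define f where "f k = k + (\<Sum>j\<le>k. f0 j)" for k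
  have f1: "f k \<ge> f0 k" for k unfolding f_def using member_le_sum[of k "{..k}" f0] by simp
  have f2: "f k \<le> f (Suc k)" for k by (simp add: f_def)
  have fm: "strict_mono f" by (rule strict_monoI_Suc) (simp add: f_def)
  have tailB: "(\<lambda>x. \<psi> x - \<phi> (f K) x) \<in> B_alg G \<and> B_norm G (\<lambda>x. \<psi> x - \<phi> (f K) x) \<le> 2 * (1/2)^K" for K
  proof -
    let ?g = "\<lambda>k x. \<phi> (f (Suc (K + k))) x - \<phi> (f (K + k)) x"
    have 1: "?g k \<in> B_alg G" for k by (rule B_diff(1)[OF phi phi])
    have 2: "B_norm G (?g k) < (1/2)^K * (1/2)^k" for k
      using f0[of "K + k" "f (Suc (K + k))" "f (K + k)"] f1[of "K + k"] f2[of "K + k"] by (simp add: power_add)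
    have s: "(\<lambda>k. (1/2)^K * (1/2::real)^k) sums ((1/2)^K * (1 / (1 - 1/2)))" by (intro sums_mult geometric_sums) simp
    have "(\<lambda>k. ?g k x) sums (\<psi> x - \<phi> (f K) x)" for x
    proof -
      have "(\<lambda>k. \<phi> (f (K + k)) x) \<longlonglongrightarrow> \<psi> x"
        using LIMSEQ_subseq_LIMSEQ[OF lim fm, of x] LIMSEQ_ignore_initial_segment[of "\<lambda>k. \<phi> (f k) x" "\<psi> x" K]
        by (simp add: o_def add.commute)
      from telescope_sums[OF this] show ?thesis by simp
    qed
    then have "(\<Sum>k. ?g k x) = \<psi> x - \<phi> (f K) x" for x by (simp add: sums_iff)
    then show ?thesis using B_sum(2,3)[OF 1 2 sums_summable[OF s]] s by (simp add: sums_iff)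
  qed
  have "(\<lambda>x. (\<psi> x - \<phi> (f 0) x) + \<phi> (f 0) x) \<in> B_alg G" using B_add(1)[OF _ phi] tailB by blast
  then show psi: "\<psi> \<in> B_alg G" by simp
  show "(\<lambda>n. B_norm G (\<lambda>x. \<psi> x - \<phi> n x)) \<longlonglongrightarrow> 0"
  proof (rule LIMSEQ_I)
    fix e :: real assume e: "e > 0"
    obtain K where K: "(1/2)^K < e/3" using real_arch_pow_inv[of "e/3" "1/2"] e by auto
    have "norm (B_norm G (\<lambda>x. \<psi> x - \<phi> n x) - 0) < e" if n: "n \<ge> f K" for n
    proof -
      have "B_norm G (\<lambda>x. \<psi> x - \<phi> n x) \<le> B_norm G (\<lambda>x. \<psi> x - \<phi> (f K) x) + B_norm G (\<lambda>x. \<phi> (f K) x - \<phi> n x)"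
        by (rule B_triangle_diff[OF psi phi phi])
      also have "\<dots> < 2 * (1/2)^K + (1/2)^K"
        using tailB[of K] f0[of K "f K" n] f1[of K] n by (intro add_le_less_mono) auto
      also have "\<dots> < e" using K by simp
      finally show ?thesis using B_norm_nonneg[OF B_diff(1)[OF psi phi]] by simp
    qed
    then show "\<exists>no. \<forall>n\<ge>no. norm (B_norm G (\<lambda>x. \<psi> x - \<phi> n x) - 0) < e" by blast
  qed
qed

end

section \<open>Embedding a separable semi-inner product space\<close>

context semi_ip
begin

lemma cnj_ip: "x \<in> W \<Longrightarrow> y \<in> W \<Longrightarrow> cnj (ip x y) = ip y x"
  by (rule ip_sym[symmetric])

text \<open>
  \<open>gs d n\<close> is the projection to the orthogonal complement of \<open>d 0, \<dots>, d (n - 1)\<close>; in a null direction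
  \<open>dir d n\<close> is \<open>0\<close>, as \<open>1 / 0 = 0\<close>.
\<close>

primrec gs :: "(nat \<Rightarrow> 'i \<Rightarrow> complex) \<Rightarrow> nat \<Rightarrow> ('i \<Rightarrow> complex) \<Rightarrow> 'i \<Rightarrow> complex" where
  "gs d 0 f = f"
| "gs d (Suc n) f = (\<lambda>i. gs d n f i - ip (\<lambda>i. of_real (1 / nrm (gs d n (d n))) * gs d n (d n) i) (gs d n f)
      * (of_real (1 / nrm (gs d n (d n))) * gs d n (d n) i))"

definition dir where "dir d n = (\<lambda>i. of_real (1 / nrm (gs d n (d n))) * gs d n (d n) i)"

lemma gs_Suc: "gs d (Suc n) f = (\<lambda>i. gs d n f i - ip (dir d n) (gs d n f) * dir d n i)"
  by (simp add: dir_def)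

declare gs.simps(2) [simp del]

context
  fixes d :: "nat \<Rightarrow> 'i \<Rightarrow> complex"
  assumes d: "\<And>n. d n \<in> W"
begin

lemma gs_W: "f \<in> W \<Longrightarrow> gs d n f \<in> W"
  and dir_W: "dir d n \<in> W"
proof -
  have "\<forall>f\<in>W. gs d n f \<in> W" for n
  proof (induction n)
    case (Suc n)
    then have "dir d n \<in> W" unfolding dir_def using d by (intro scale_W) simp
    then show ?case using Suc unfolding gs_Suc by (auto intro!: diff_W scale_W)
  qed simp
  then have g: "f \<in> W \<Longrightarrow> gs d n f \<in> W" for f n by simp
  show "f \<in> W \<Longrightarrow> gs d n f \<in> W" by (rule g)
  show "dir d n \<in> W" unfolding dir_def by (rule scale_W[OF g[OF d]])
qed

lemma gs_add: "f \<in> W \<Longrightarrow> g \<in> W \<Longrightarrow> gs d n (\<lambda>i. f i + g i) = (\<lambda>i. gs d n f i + gs d n g i)"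
proof (induction n)
  case (Suc n)
  show ?case
    unfolding gs_Suc Suc.IH[OF Suc.prems] using ip_add[OF dir_W gs_W[OF Suc.prems(1)] gs_W[OF Suc.prems(2)]]
    by (simp add: algebra_simps)
qed simp

lemma gs_scale: "f \<in> W \<Longrightarrow> gs d n (\<lambda>i. c * f i) = (\<lambda>i. c * gs d n f i)"
proof (induction n)
  case (Suc n)
  show ?case
    unfolding gs_Suc Suc.IH[OF Suc.prems] using ip_scale[OF dir_W gs_W[OF Suc.prems(1)]]
    by (simp add: algebra_simps)
qed simp

lemma dir_norm: "nrm (dir d n) = 1 \<or> nrm (dir d n) = 0"
  unfolding dir_def using nrm_scale[OF gs_W[OF d], of "of_real (1 / nrm (gs d n (d n)))" n n] nrm_nonneg[OF gs_W[OF d], of n n]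
  by (auto simp: norm_divide)

text \<open>Pythagoras. The direction is a unit vector or a null vector, and in the second case the
  coefficient vanishes by the Cauchy-Schwarz inequality.\<close>

lemma gs_norm:
  assumes f: "f \<in> W"
  shows "(nrm (gs d (Suc n) f))\<^sup>2 = (nrm (gs d n f))\<^sup>2 - (cmod (ip (dir d n) (gs d n f)))\<^sup>2"
proof -
  let ?x = "gs d n f" and ?e = "dir d n"
  let ?c = "ip ?e ?x"
  have c: "?c * ip ?x ?e = of_real ((cmod ?c)\<^sup>2)"
    using cnj_ip[OF dir_W gs_W[OF f], of n n] complex_mult_cnj_cmod[of ?c] by simp
  have "(nrm (gs d (Suc n) f))\<^sup>2 = (nrm ?x)\<^sup>2 - 2 * (cmod ?c)\<^sup>2 + (cmod ?c)\<^sup>2 * (nrm ?e)\<^sup>2"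
    unfolding gs_Suc nrm_diff_sq[OF gs_W[OF f] dir_W] c by (simp only: Re_complex_of_real)
  moreover have "cmod ?c = 0" if "nrm ?e = 0"
    using cauchy_schwarz[OF dir_W gs_W[OF f], of n n] that by simp
  ultimately show ?thesis using dir_norm[of n] by auto
qed

lemma gs_null: "nrm (gs d (Suc n) (d n)) = 0"
proof (cases "nrm (gs d n (d n)) = 0")
  case True
  then have "dir d n = (\<lambda>i. 0)" by (simp add: dir_def)
  then show ?thesis using True by (simp add: gs_Suc)
next
  case False
  let ?w = "gs d n (d n)" and ?c = "complex_of_real (1 / nrm (gs d n (d n)))"
  have wW: "?w \<in> W" by (rule gs_W[OF d])
  have "ip (dir d n) ?w = cnj ?c * of_real ((nrm ?w)\<^sup>2)"
    unfolding dir_def ip_scale_left[OF wW wW] ip_self[OF wW] ..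
  then have one: "ip (dir d n) ?w * ?c = 1" using False by (simp add: power2_eq_square)
  have "ip (dir d n) ?w * dir d n i = ?w i" for i
  proof -
    have "dir d n i = ?c * ?w i" by (simp only: dir_def)
    then have "ip (dir d n) ?w * dir d n i = (ip (dir d n) ?w * ?c) * ?w i" by (simp only: mult.assoc)
    then show ?thesis by (simp only: one mult_1_left)
  qed
  then show ?thesis by (simp add: gs_Suc nrm_zero)
qed

lemma gs_mono:
  assumes "f \<in> W" "m \<le> n"
  shows "nrm (gs d n f) \<le> nrm (gs d m f)"
  using assms(2)
proof (induction rule: dec_induct)
  case (step k)
  have "(nrm (gs d (Suc k) f))\<^sup>2 \<le> (nrm (gs d k f))\<^sup>2" unfolding gs_norm[OF assms(1)] by simp
  then have "nrm (gs d (Suc k) f) \<le> nrm (gs d k f)"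
    using nrm_nonneg[OF gs_W[OF assms(1)]] by (rule power2_le_imp_le)
  then show ?case using step.IH by simp
qed simp

definition vec :: "('i \<Rightarrow> complex) \<Rightarrow> nat \<Rightarrow> complex" where "vec f n = ip (dir d n) (gs d n f)"

lemma vec_partial: "f \<in> W \<Longrightarrow> (\<Sum>k<n. (cmod (vec f k))\<^sup>2) = (nrm f)\<^sup>2 - (nrm (gs d n f))\<^sup>2"
  by (induction n) (simp_all add: gs_norm vec_def)

text \<open>The vector d n is null after n + 1 steps and stays so because norms only decrease; a
  finite combination is therefore null from some step on.\<close>

lemma gs_lin_null:
  "\<exists>N. nrm (gs d N (\<lambda>i. \<Sum>z\<leftarrow>zs. fst z * d (snd z) i)) = 0"
proof (induction zs)
  case Nil
  show ?case by (intro exI[of _ 0]) (simp add: nrm_zero)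
next
  case (Cons z zs)
  let ?g = "\<lambda>i. \<Sum>z\<leftarrow>zs. fst z * d (snd z) i"
  have g: "?g \<in> W" by (rule sum_list_W) (use d scale_W in auto)
  obtain N where N: "nrm (gs d N ?g) = 0" using Cons by auto
  let ?M = "max N (Suc (snd z))"
  have 1: "nrm (gs d ?M ?g) = 0" using gs_mono[OF g, of N ?M] N nrm_nonneg[OF gs_W[OF g], of ?M] by simp
  have 2: "nrm (gs d ?M (d (snd z))) = 0"
    using gs_mono[OF d, of "Suc (snd z)" ?M "snd z"] gs_null[of "snd z"] nrm_nonneg[OF gs_W[OF d], of ?M "snd z"] by simp
  have "nrm (gs d ?M (\<lambda>i. fst z * d (snd z) i + ?g i)) \<le> 0"
    unfolding gs_add[OF scale_W[OF d] g] gs_scale[OF d]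
    using nrm_triangle[OF scale_W[OF gs_W[OF d]] gs_W[OF g], of "fst z" ?M "snd z" ?M] nrm_scale[OF gs_W[OF d], of "fst z" ?M "snd z"] 1 2 by simp
  moreover have "(\<lambda>i. fst z * d (snd z) i + ?g i) \<in> W" using g d by (intro add_W scale_W)
  ultimately have "nrm (gs d ?M (\<lambda>i. fst z * d (snd z) i + ?g i)) = 0"
    using nrm_nonneg[OF gs_W] by (meson order_antisym)
  then show ?case by (intro exI[of _ ?M]) simp
qed

context
  assumes dense: "\<And>f e. f \<in> W \<Longrightarrow> e > 0 \<Longrightarrow> \<exists>zs. nrm (\<lambda>i. f i - (\<Sum>z\<leftarrow>zs. fst z * d (snd z) i)) < e"
begin

lemma gs_small:
  assumes f: "f \<in> W" and e: "e > 0"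
  obtains N where "nrm (gs d N f) < e"
proof -
  obtain zs where zs: "nrm (\<lambda>i. f i - (\<Sum>z\<leftarrow>zs. fst z * d (snd z) i)) < e" using dense[OF f e] by blast
  let ?g = "\<lambda>i. \<Sum>z\<leftarrow>zs. fst z * d (snd z) i"
  have g: "?g \<in> W" by (rule sum_list_W) (use d scale_W in auto)
  obtain N where N: "nrm (gs d N ?g) = 0" using gs_lin_null by blast
  have fg: "(\<lambda>i. f i - ?g i) \<in> W" by (rule diff_W[OF f g])
  have "f = (\<lambda>i. (f i - ?g i) + ?g i)" by simp
  then have "gs d N f = (\<lambda>i. gs d N (\<lambda>i. f i - ?g i) i + gs d N ?g i)" using gs_add[OF fg g, of N] by simp
  then have "nrm (gs d N f) \<le> nrm (gs d N (\<lambda>i. f i - ?g i))"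
    using nrm_triangle[OF gs_W[OF fg] gs_W[OF g], of N N] N by simp
  also have "\<dots> \<le> nrm (\<lambda>i. f i - ?g i)" using gs_mono[OF fg, of 0 N] by simp
  finally have "nrm (gs d N f) < e" using zs by simp
  then show ?thesis by (rule that)
qed

text \<open>Parseval's identity. The remainder after N steps is at most the distance to any
  combination that has become null by then, so density makes it arbitrarily small.\<close>

lemma
  assumes f: "f \<in> W"
  shows vec_ell2: "vec f \<in> ell2" and vec_norm: "ell2_norm (vec f) = nrm f"
proof -
  have "(\<Sum>k<n. (cmod (vec f k))\<^sup>2) \<le> (nrm f)\<^sup>2" for n using vec_partial[OF f] by simp
  from ell2_bounded_partial[OF this nrm_nonneg[OF f]]
  have E: "vec f \<in> ell2" and le: "ell2_norm (vec f) \<le> nrm f" by auto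
  show "vec f \<in> ell2" by (rule E)
  have "(nrm f)\<^sup>2 \<le> (ell2_norm (vec f))\<^sup>2"
  proof (rule field_le_epsilon)
    fix e :: real assume e: "e > 0"
    obtain N where N: "nrm (gs d N f) < sqrt e" by (rule gs_small[OF f, of "sqrt e"]) (use e in auto)
    have "(nrm (gs d N f))\<^sup>2 \<le> (sqrt e)\<^sup>2" using N nrm_nonneg[OF gs_W[OF f]] by (intro power_mono) auto
    then show "(nrm f)\<^sup>2 \<le> (ell2_norm (vec f))\<^sup>2 + e"
      using vec_partial[OF f, of N] ell2_partial_le[OF E, of N] e by simp
  qed
  then have "nrm f \<le> ell2_norm (vec f)" using ell2_norm_nonneg[OF E] by (rule power2_le_imp_le)
  then show "ell2_norm (vec f) = nrm f" using le by simp
qed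

lemma vec_inner:
  assumes f: "f \<in> W" and g: "g \<in> W"
  shows "ell2_inner (vec f) (vec g) = ip f g"
proof -
  have vd: "vec (\<lambda>i. f i - c * g i) = (\<lambda>n. vec f n - c * vec g n)" for c
  proof
    fix n
    have "gs d n (\<lambda>i. f i - c * g i) = (\<lambda>i. gs d n f i - c * gs d n g i)"
      using gs_add[OF f scale_W[OF g], of n "-c"] gs_scale[OF g, of n "-c"] by simp
    then show "vec (\<lambda>i. f i - c * g i) n = vec f n - c * vec g n"
      unfolding vec_def using ip_diff[OF dir_W gs_W[OF f] scale_W[OF gs_W[OF g]]] ip_scale[OF dir_W gs_W[OF g]] by simp
  qed
  have "Re (c * ell2_inner (vec f) (vec g)) = Re (c * ip f g)" for c
  proof -
    have "(ell2.nrm (\<lambda>n. vec f n - c * vec g n))\<^sup>2 = (nrm (\<lambda>i. f i - c * g i))\<^sup>2"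
      unfolding vd[symmetric] using diff_W[OF f scale_W[OF g]] by (simp add: ell2_nrm vec_ell2 vec_norm)
    then show ?thesis
      using nrm_diff_sq[OF f g, of c] ell2.nrm_diff_sq[OF vec_ell2[OF f] vec_ell2[OF g], of c]
      by (simp add: ell2_nrm vec_ell2 vec_norm f g)
  qed
  from this[of 1] this[of "-\<i>"] show ?thesis by (simp add: complex_eq_iff)
qed

end

end

end

text \<open>A single countable family has to be dense in L^2 of every fibre. Uniform closeness
  suffices only if the error is also confined to a compact set: the bound e * b p, with b
  independent of e, bounds the L^2 norm of the error on each fibre by e times that of b.\<close>

lemma Cc_separable:
  assumes lc: "locally_compact_space (euclidean :: 'a::{second_countable_topology, t2_space} topology)"
  obtains d :: "nat \<Rightarrow> 'a::{second_countable_topology, t2_space} \<Rightarrow> complex" where "\<And>n. d n \<in> Cc"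
    "\<And>f. f \<in> Cc \<Longrightarrow> \<exists>b. (\<lambda>p. complex_of_real (b p)) \<in> Cc \<and> (\<forall>p. 0 \<le> b p) \<and>
      (\<forall>e>0. \<exists>zs. \<forall>p. cmod (f p - (\<Sum>z\<leftarrow>zs. fst z * d (snd z) p)) \<le> e * b p)"
proof -
  obtain B :: "'a set set" where B: "countable B" "\<And>C. C \<in> B \<Longrightarrow> open C" "\<And>S. open S \<Longrightarrow> \<exists>U. U \<subseteq> B \<and> S = \<Union>U"
    using univ_second_countable by metis
  have base: "\<exists>C\<in>B. x \<in> C \<and> C \<subseteq> S" if "open S" "x \<in> S" for x S
    using B(3)[OF that(1)] that(2) by blast
  \<comment> \<open>Pairs of basic open sets that admit a Urysohn function in between. There are
    countably many, and one function is fixed for each.\<close>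
  define good where "good = {p \<in> B \<times> B. compact (closure (fst p)) \<and> closure (fst p) \<subseteq> snd p}"
  have "\<exists>h::'a \<Rightarrow> real. continuous_on UNIV h \<and> (\<forall>x. 0 \<le> h x) \<and> (\<forall>x\<in>fst p. h x = 1) \<and> (\<forall>x. x \<notin> snd p \<longrightarrow> h x = 0) \<and> (\<lambda>x. complex_of_real (h x)) \<in> Cc"
    if "p \<in> good" for p
  proof -
    have g: "compact (closure (fst p))" "open (snd p)" "closure (fst p) \<subseteq> snd p" using that B(2) by (auto simp: good_def)
    obtain h :: "'a \<Rightarrow> real" and K where h: "continuous_on UNIV h" "\<And>x. 0 \<le> h x" "\<And>x. h x \<le> 1" "\<And>x. x \<in> closure (fst p) \<Longrightarrow> h x = 1"
      "compact K" "K \<subseteq> snd p" "\<And>x. x \<notin> K \<Longrightarrow> h x = 0" "(\<lambda>x. complex_of_real (h x)) \<in> Cc"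
      by (rule lc_bump[OF lc g]) blast
    have "\<forall>x. x \<notin> snd p \<longrightarrow> h x = 0" using h(6,7) by blast
    moreover have "\<forall>x\<in>fst p. h x = 1" using h(4) closure_subset[of "fst p"] by blast
    ultimately show ?thesis using h(1,2,8) by blast
  qed
  then have "\<forall>p\<in>good. \<exists>h::'a \<Rightarrow> real. continuous_on UNIV h \<and> (\<forall>x. 0 \<le> h x) \<and> (\<forall>x\<in>fst p. h x = 1) \<and> (\<forall>x. x \<notin> snd p \<longrightarrow> h x = 0) \<and> (\<lambda>x. complex_of_real (h x)) \<in> Cc"
    by blast
  from bchoice[OF this] obtain h :: "'a set \<times> 'a set \<Rightarrow> 'a \<Rightarrow> real" where h:
    "\<And>p. p \<in> good \<Longrightarrow> continuous_on UNIV (h p)" "\<And>p x. p \<in> good \<Longrightarrow> 0 \<le> h p x" "\<And>p x. p \<in> good \<Longrightarrow> x \<in> fst p \<Longrightarrow> h p x = 1"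
    "\<And>p x. p \<in> good \<Longrightarrow> x \<notin> snd p \<Longrightarrow> h p x = 0" "\<And>p. p \<in> good \<Longrightarrow> (\<lambda>x. complex_of_real (h p x)) \<in> Cc"
    by blast
  \<comment> \<open>Where the functions h p' with p' in F add up to at least 1, the q F p form a
    partition of unity. The maximum with 1 keeps the quotient continuous and the total at most 1
    elsewhere.\<close>
  define q where "q F p x = complex_of_real (h p x) * complex_of_real (1 / max 1 (\<Sum>p'\<in>F. h p' x))" for F p x
  define Ix where "Ix = {F. finite F \<and> F \<subseteq> good} \<times> good"
  have cg: "countable good" using B(1) unfolding good_def by (intro countable_subset[OF Collect_restrict] countable_SIGMA)
  have cI: "countable ((\<lambda>(F, p). q F p) ` Ix)"
    unfolding Ix_def using cg by (intro countable_image countable_SIGMA countable_Collect_finite_subset)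
  define Q where "Q = insert (\<lambda>x. 0) ((\<lambda>(F, p). q F p) ` Ix)"
  define d where "d = from_nat_into Q"
  have cQ: "countable Q" using cI by (simp add: Q_def)
  have rd: "range d = Q" unfolding d_def by (rule range_from_nat_into[OF _ cQ]) (simp add: Q_def)
  have qC: "q F p \<in> Cc" if "(F, p) \<in> Ix" for F p
  proof -
    have F: "\<And>p'. p' \<in> F \<Longrightarrow> p' \<in> good" and p: "p \<in> good" using that by (auto simp: Ix_def)
    show ?thesis unfolding q_def
      by (rule Cc_mult_cont(1)[OF h(5)[OF p]]) (intro continuous_intros h(1) F, auto)
  qed
  have "Q \<subseteq> Cc" using qC Cc_zero by (auto simp: Q_def)
  then have dC: "d n \<in> Cc" for n using rd by auto
  show ?thesis
  proof (rule that[OF dC])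
    fix f :: "'a \<Rightarrow> complex" assume f: "f \<in> Cc"
    obtain K where K: "compact K" "\<And>x. x \<notin> K \<Longrightarrow> f x = 0" by (rule CcE[OF f]) blast
    obtain U where U: "open U" "K \<subseteq> U" "compact (closure U)" by (rule lc_between[OF lc K(1) open_UNIV]) auto
    obtain b :: "'a \<Rightarrow> real" where b: "\<And>x. 0 \<le> b x" "\<And>x. x \<in> closure U \<Longrightarrow> b x = 1" "(\<lambda>x. complex_of_real (b x)) \<in> Cc"
      by (rule lc_bump[OF lc U(3) open_UNIV]) auto
    have "\<exists>zs. \<forall>p. cmod (f p - (\<Sum>z\<leftarrow>zs. fst z * d (snd z) p)) \<le> e * b p" if e: "e > 0" for e
    proof -
      have "\<exists>p\<in>good. x \<in> fst p \<and> snd p \<subseteq> U \<and> (\<forall>y\<in>snd p. cmod (f y - f x) < e)" if x: "x \<in> K" for x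
      proof -
        have "open {y\<in>U. cmod (f y - f x) < e}"
        proof -
          have "continuous_on UNIV (\<lambda>y. cmod (f y - f x))" by (intro continuous_intros Cc_cont f)
          then have "open {y. cmod (f y - f x) < e}" by (intro open_Collect_less continuous_on_const)
          then show ?thesis using open_Int[OF U(1)] by (simp add: Collect_conj_eq)
        qed
        then obtain C2 where C2: "C2 \<in> B" "x \<in> C2" "C2 \<subseteq> {y\<in>U. cmod (f y - f x) < e}"
          using base[of "{y\<in>U. cmod (f y - f x) < e}" x] x U(2) e by auto
        obtain V where V: "open V" "{x} \<subseteq> V" "compact (closure V)" "closure V \<subseteq> C2"
          by (rule lc_between[OF lc, of "{x}" C2]) (use C2 B(2) in auto)
        obtain C1 where C1: "C1 \<in> B" "x \<in> C1" "C1 \<subseteq> V" using base[OF V(1), of x] V(2) by auto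
        have "closure C1 \<subseteq> closure V" by (rule closure_mono[OF C1(3)])
        then have "compact (closure C1)" using compact_Int_closed[OF V(3), of "closure C1"] by (simp add: Int_absorb1)
        then have "(C1, C2) \<in> good" using C1 C2 V \<open>closure C1 \<subseteq> closure V\<close> by (auto simp: good_def)
        then show ?thesis using C1 C2 by (intro bexI[of _ "(C1, C2)"]) auto
      qed
      then have "\<forall>x\<in>K. \<exists>p. p \<in> good \<and> x \<in> fst p \<and> snd p \<subseteq> U \<and> (\<forall>y\<in>snd p. cmod (f y - f x) < e)" by blast
      from bchoice[OF this] obtain P where P: "\<And>x. x \<in> K \<Longrightarrow> P x \<in> good" "\<And>x. x \<in> K \<Longrightarrow> x \<in> fst (P x)"
        "\<And>x. x \<in> K \<Longrightarrow> snd (P x) \<subseteq> U" "\<And>x y. x \<in> K \<Longrightarrow> y \<in> snd (P x) \<Longrightarrow> cmod (f y - f x) < e" by blast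
      obtain X where X: "X \<subseteq> K" "finite X" "K \<subseteq> (\<Union>x\<in>X. fst (P x))"
      proof (rule compactE_image[OF K(1), of K "\<lambda>x. fst (P x)"])
        show "open (fst (P x))" if "x \<in> K" for x using P(1)[OF that] B(2) by (auto simp: good_def)
        show "K \<subseteq> (\<Union>x\<in>K. fst (P x))" using P(2) by blast
      qed blast
      define F where "F = P ` X"
      have F: "finite F" "F \<subseteq> good" using X P(1) by (auto simp: F_def)
      \<comment> \<open>Several points may have the same pair under P, so the sum runs over pairs,
        each with one sample point.\<close>
      define c where "c p = (SOME x. x \<in> X \<and> P x = p)" for p
      have c: "c p \<in> X" "P (c p) = p" if "p \<in> F" for p
        using someI_ex[of "\<lambda>x. x \<in> X \<and> P x = p"] that by (auto simp: F_def c_def[symmetric])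
      have qQ: "q F p \<in> Q" if "p \<in> F" for p
        using that F by (auto simp: Q_def Ix_def intro!: image_eqI[of _ _ "(F, p)"])
      have "\<forall>p\<in>F. \<exists>n. d n = q F p"
      proof
        fix p assume "p \<in> F"
        then have "q F p \<in> range d" using qQ by (simp only: rd)
        then obtain n where "q F p = d n" by (elim rangeE)
        then show "\<exists>n. d n = q F p" by (intro exI[of _ n]) simp
      qed
      from bchoice[OF this] obtain ix where ix: "\<And>p. p \<in> F \<Longrightarrow> d (ix p) = q F p" by blast
      obtain ps where ps: "set ps = F" "distinct ps" using finite_distinct_list[OF F(1)] by blast
      let ?zs = "map (\<lambda>p. (f (c p), ix p)) ps"
      have "cmod (f x - (\<Sum>z\<leftarrow>?zs. fst z * d (snd z) x)) \<le> e * b x" for x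
      proof -
        define S where "S = (\<Sum>p\<in>F. h p x)"
        define M where "M = max 1 S"
        have M: "M \<ge> 1" "M \<ge> S" by (auto simp: M_def)
        have hn: "p \<in> F \<Longrightarrow> h p x \<ge> 0" for p using F(2) by (intro h(2)) blast
        have "(\<Sum>z\<leftarrow>?zs. fst z * d (snd z) x) = (\<Sum>p\<leftarrow>ps. f (c p) * q F p x)"
          unfolding map_map o_def fst_conv snd_conv
          by (intro arg_cong[where f = sum_list] map_cong refl) (simp add: ix ps)
        also have "\<dots> = (\<Sum>p\<in>F. f (c p) * of_real (h p x / M))"
          unfolding sum_list_distinct_conv_sum_set[OF ps(2)] ps(1) by (simp add: q_def M_def S_def)
        finally have s: "(\<Sum>z\<leftarrow>?zs. fst z * d (snd z) x) = (\<Sum>p\<in>F. f (c p) * of_real (h p x / M))" .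
        have fx: "f x = (\<Sum>p\<in>F. f x * of_real (h p x / M))"
        proof (cases "x \<in> K")
          case True
          then obtain y where y: "y \<in> X" "x \<in> fst (P y)" using X(3) by blast
          have "y \<in> K" using X(1) y(1) by blast
          then have "1 = h (P y) x" using h(3)[OF P(1) y(2)] by simp
          also have "\<dots> \<le> S" unfolding S_def using y(1) F(1) hn by (intro member_le_sum) (auto simp: F_def)
          finally have "M = S" by (simp add: M_def)
          then have "(\<Sum>p\<in>F. h p x / M) = 1" using M unfolding sum_divide_distrib[symmetric] S_def[symmetric] by simp
          then show ?thesis unfolding sum_distrib_left[symmetric] of_real_sum[symmetric] by simp
        next
          case False
          then show ?thesis using K(2) by simp
        qed
        have "f x - (\<Sum>z\<leftarrow>?zs. fst z * d (snd z) x) = (\<Sum>p\<in>F. (f x - f (c p)) * of_real (h p x / M))"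
          unfolding s left_diff_distrib sum_subtractf fx[symmetric] ..
        also have "cmod \<dots> \<le> (\<Sum>p\<in>F. e * (h p x / M) * b x)"
        proof (rule sum_norm_le)
          fix p assume p: "p \<in> F"
          show "cmod ((f x - f (c p)) * of_real (h p x / M)) \<le> e * (h p x / M) * b x"
          proof (cases "x \<in> snd p")
            case True
            have cK: "c p \<in> K" using c(1)[OF p] X(1) by blast
            have "x \<in> U" using True P(3)[OF cK] c(2)[OF p] by auto
            then have "b x = 1" using b(2) closure_subset[of U] by blast
            moreover have "cmod (f x - f (c p)) \<le> e" using P(4)[OF cK, of x] c(2)[OF p] True by simp
            moreover have "0 \<le> h p x / M" using hn[OF p] M(1) by simp
            ultimately show ?thesis
              unfolding norm_mult norm_of_real by (simp only: abs_of_nonneg mult_1_right mult_right_mono)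
          next
            case False
            then have "h p x = 0" using h(4) F(2) p by blast
            then show ?thesis by simp
          qed
        qed
        also have "\<dots> = e * b x * (S / M)"
          by (simp add: S_def sum_distrib_left sum_distrib_right sum_divide_distrib mult_ac)
        also have "\<dots> \<le> e * b x * 1"
          using e b(1) M by (intro mult_left_mono) auto
        finally show ?thesis by simp
      qed
      then show ?thesis by blast
    qed
    then show "\<exists>b. (\<lambda>p. complex_of_real (b p)) \<in> Cc \<and> (\<forall>p. 0 \<le> b p) \<and>
      (\<forall>e>0. \<exists>zs. \<forall>p. cmod (f p - (\<Sum>z\<leftarrow>zs. fst z * d (snd z) p)) \<le> e * b p)"
      using b by (intro exI[of _ b]) auto
  qed
qed

section \<open>Square integrable functions on left spaces of the groupoid\<close>

lemma closed_equalizer: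
  fixes f g :: "'a::topological_space \<Rightarrow> 'b::t2_space"
  assumes "closed S" "continuous_on S f" "continuous_on S g"
  shows "closed {x\<in>S. f x = g x}"
proof -
  have "closed {p :: 'b \<times> 'b. fst p = snd p}" by (intro closed_Collect_eq continuous_intros)
  then have "closed (S \<inter> (\<lambda>x. (f x, g x)) -` {p. fst p = snd p})"
    using assms by (intro continuous_closed_preimage continuous_on_Pair)
  moreover have "S \<inter> (\<lambda>x. (f x, g x)) -` {p. fst p = snd p} = {x\<in>S. f x = g x}" by auto
  ultimately show ?thesis by simp
qed

locale lcg =
  fixes G :: "'g::{second_countable_topology, t2_space} haar_groupoid" (structure)
  assumes lcg: "lc_haar_groupoid G"
begin

lemma lc: "locally_compact_space (euclidean :: 'g topology)"
  using lcg by (simp add: lc_haar_groupoid_def)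

lemma cont_inv: "continuous_on A (ginv G)"
  using lcg continuous_on_subset[of UNIV "ginv G" A] by (simp add: lc_haar_groupoid_def)

lemma cont_mult:
  assumes "continuous_on S f" "continuous_on S g" "\<And>x. x \<in> S \<Longrightarrow> src G (f x) = rng G (g x)"
  shows "continuous_on S (\<lambda>x. f x \<cdot> g x)"
proof -
  have m: "continuous_on {(x, y). src G x = rng G y} (\<lambda>(x, y). x \<cdot> y)"
    using lcg by (simp add: lc_haar_groupoid_def)
  have "continuous_on S (\<lambda>x. (\<lambda>(x, y). x \<cdot> y) (f x, g x))"
    by (rule continuous_on_compose2[OF m continuous_on_Pair[OF assms(1,2)]]) (use assms(3) in auto)
  then show ?thesis by simp
qed

sublocale grpd G
  using lcg by unfold_locales (simp add: lc_haar_groupoid_def)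

sublocale tgrpd G
proof unfold_locales
  have "continuous_on UNIV (\<lambda>x. x \<cdot> ginv G x)" by (intro cont_mult continuous_on_id cont_inv) simp
  then show "continuous_on UNIV (rng G)" by (simp add: mult_inv)
  have "continuous_on UNIV (\<lambda>x. ginv G x \<cdot> x)" by (intro cont_mult continuous_on_id cont_inv) simp
  then show "continuous_on UNIV (src G)" by (simp add: inv_mult_self)
qed

lemma cont_rng': "continuous_on A (rng G)" and cont_src': "continuous_on A (src G)"
  using cont_rng cont_src continuous_on_subset by blast+

lemma closed_units: "closed (units G)"
proof -
  have "units G = {x. rng G x = x}" using units_iff by blast
  then show ?thesis using closed_Collect_eq[OF cont_rng continuous_on_id] by simp
qed

lemma closed_fibre: "closed {x. rng G x = u}"
  by (intro closed_Collect_eq cont_rng' continuous_on_const)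

end

text \<open>
  A left space \<open>P\<close> of the groupoid with an invariant system of functionals \<open>I u\<close>, integration over the fibre of \<open>\<rho>\<close> at
  \<open>u\<close>. Working with functionals on \<open>Cc\<close> instead of measures avoids product measures on the composable pairs.
\<close>

locale gspace = lcg G for G :: "'g::{second_countable_topology, t2_space} haar_groupoid" (structure) +
  fixes P :: "'p::{second_countable_topology, t2_space} set" and \<rho> :: "'p \<Rightarrow> 'g"
    and pact :: "'g \<Rightarrow> 'p \<Rightarrow> 'p" and I :: "'g \<Rightarrow> ('p \<Rightarrow> complex) \<Rightarrow> complex"
  assumes lcP: "locally_compact_space (euclidean :: 'p topology)"
    and closed_P: "closed P" and cont_rho: "continuous_on P \<rho>"
    and pact_in: "p \<in> P \<Longrightarrow> \<rho> p = src G x \<Longrightarrow> pact x p \<in> P"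
    and rho_pact: "p \<in> P \<Longrightarrow> \<rho> p = src G x \<Longrightarrow> \<rho> (pact x p) = rng G x"
    and pact_mult: "src G x = rng G y \<Longrightarrow> p \<in> P \<Longrightarrow> \<rho> p = src G y \<Longrightarrow> pact (x \<cdot> y) p = pact x (pact y p)"
    and pact_unit: "p \<in> P \<Longrightarrow> \<rho> p = u \<Longrightarrow> pact u p = p"
    and cont_pact: "continuous_on {(x, p). p \<in> P \<and> \<rho> p = src G x} (\<lambda>(x, p). pact x p)"
    and I_cong: "u \<in> units G \<Longrightarrow> (\<And>p. p \<in> P \<Longrightarrow> \<rho> p = u \<Longrightarrow> f p = g p) \<Longrightarrow> I u f = I u g"
    and I_add: "u \<in> units G \<Longrightarrow> f \<in> Cc \<Longrightarrow> g \<in> Cc \<Longrightarrow> I u (\<lambda>p. f p + g p) = I u f + I u g"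
    and I_scale: "u \<in> units G \<Longrightarrow> f \<in> Cc \<Longrightarrow> I u (\<lambda>p. c * f p) = c * I u f"
    and I_cnj: "u \<in> units G \<Longrightarrow> f \<in> Cc \<Longrightarrow> I u (\<lambda>p. cnj (f p)) = cnj (I u f)"
    and I_mono: "u \<in> units G \<Longrightarrow> f \<in> Cc \<Longrightarrow> g \<in> Cc \<Longrightarrow> (\<And>p. p \<in> P \<Longrightarrow> \<rho> p = u \<Longrightarrow> cmod (f p) \<le> Re (g p)) \<Longrightarrow>
      cmod (I u f) \<le> Re (I u g)"
    and I_cont: "f \<in> Cc \<Longrightarrow> continuous_on (units G) (\<lambda>u. I u f)"
    and I_inv: "f \<in> Cc \<Longrightarrow> g \<in> Cc \<Longrightarrow> (\<And>p. p \<in> P \<Longrightarrow> \<rho> p = src G x \<Longrightarrow> g p = f (pact x p)) \<Longrightarrow>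
      I (src G x) g = I (rng G x) f"
begin

definition ip where "ip u f g = I u (\<lambda>p. cnj (f p) * g p)"

lemma I_diff: "u \<in> units G \<Longrightarrow> f \<in> Cc \<Longrightarrow> g \<in> Cc \<Longrightarrow> I u (\<lambda>p. f p - g p) = I u f - I u g"
  using I_add[of u f "\<lambda>p. - g p"] I_scale[of u g "-1"] Cc_uminus[of g] by simp

lemma I_zero: "u \<in> units G \<Longrightarrow> I u (\<lambda>p. 0) = 0"
  using I_scale[OF _ Cc_zero, of u 0] by simp

lemma cnj_mult_Cc:
  fixes f g :: "'a::t2_space \<Rightarrow> complex"
  shows "f \<in> Cc \<Longrightarrow> g \<in> Cc \<Longrightarrow> (\<lambda>p. cnj (f p) * g p) \<in> Cc"
  by (intro Cc_mult Cc_cnj)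

lemma semi_ip_ip: "u \<in> units G \<Longrightarrow> semi_ip Cc (ip u)"
proof
  assume u: "u \<in> units G"
  show "(\<lambda>i::'p. 0) \<in> Cc" by (rule Cc_zero)
  show "(\<lambda>i. x i + y i) \<in> Cc" if "x \<in> Cc" "y \<in> Cc" for x y :: "'p \<Rightarrow> complex" using that by (rule Cc_add)
  show "(\<lambda>i. c * x i) \<in> Cc" if "x \<in> Cc" for x :: "'p \<Rightarrow> complex" and c using that by (rule Cc_scale)
  show "ip u x (\<lambda>i. y i + z i) = ip u x y + ip u x z" if "x \<in> Cc" "y \<in> Cc" "z \<in> Cc" for x y z
    unfolding ip_def distrib_left by (rule I_add[OF u cnj_mult_Cc[OF that(1,2)] cnj_mult_Cc[OF that(1,3)]])
  show "ip u x (\<lambda>i. c * y i) = c * ip u x y" if "x \<in> Cc" "y \<in> Cc" for x y c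
    unfolding ip_def I_scale[OF u cnj_mult_Cc[OF that], symmetric] by (simp only: mult.left_commute)
  show "ip u y x = cnj (ip u x y)" if "x \<in> Cc" "y \<in> Cc" for x y
    unfolding ip_def I_cnj[OF u cnj_mult_Cc[OF that], symmetric] by (simp add: mult.commute)
  show "0 \<le> Re (ip u x x)" if "x \<in> Cc" for x
  proof -
    have "cmod (I u (\<lambda>p. 0)) \<le> Re (ip u x x)"
      unfolding ip_def by (rule I_mono[OF u Cc_zero cnj_mult_Cc[OF that that]]) simp
    then show ?thesis using I_zero[OF u] by simp
  qed
qed

lemma slice_Cc:
  fixes h :: "'a::t2_space \<times> 'p \<Rightarrow> complex"
  assumes "h \<in> Cc"
  shows "(\<lambda>p. h (x, p)) \<in> Cc"
proof -
  obtain K where K: "compact K" "\<And>z. z \<notin> K \<Longrightarrow> h z = 0" by (rule CcE[OF assms]) blast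
  show ?thesis
  proof (rule CcI[of _ "snd ` K"])
    show "continuous_on UNIV (\<lambda>p. h (x, p))"
      by (rule continuous_on_compose2[OF Cc_cont[OF assms, of UNIV]]) (auto intro!: continuous_intros)
    show "compact (snd ` K)" by (intro compact_continuous_image K continuous_intros)
    show "h (x, p) = 0" if "p \<notin> snd ` K" for p using K(2)[of "(x, p)"] that by force
  qed
qed

text \<open>Fibre and integrand vary together. By the tube lemma h (x, p) is close to h (x0, p) for
  all p in the projected support, and the mass that the fibres give to a bump over it is locally
  bounded.\<close>

lemma I_param:
  fixes h :: "'a::t2_space \<times> 'p \<Rightarrow> complex"
  assumes h: "h \<in> Cc" and k: "continuous_on S \<kappa>" "\<And>x. x \<in> S \<Longrightarrow> \<kappa> x \<in> units G"
  shows "continuous_on S (\<lambda>x. I (\<kappa> x) (\<lambda>p. h (x, p)))"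
proof (rule continuous_approx)
  fix x0 and e :: real assume x0: "x0 \<in> S" and e: "e > 0"
  obtain K where K: "compact K" "\<And>z. z \<notin> K \<Longrightarrow> h z = 0" by (rule CcE[OF h]) blast
  have C: "compact (snd ` K)" by (intro compact_continuous_image K continuous_intros)
  obtain b :: "'p \<Rightarrow> real" where b: "\<And>x. 0 \<le> b x" "\<And>x. x \<in> snd ` K \<Longrightarrow> b x = 1" "(\<lambda>x. complex_of_real (b x)) \<in> Cc"
    by (rule lc_bump[OF lcP C open_UNIV]) auto
  define N where "N x = Re (I (\<kappa> x) (\<lambda>p. of_real (b p)))" for x
  have Nc: "continuous_on S N"
    unfolding N_def using k by (intro continuous_on_Re continuous_on_compose2[OF I_cont[OF b(3)] k(1)]) auto
  have N0: "N x \<ge> 0" if "x \<in> S" for x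
  proof -
    have "cmod (I (\<kappa> x) (\<lambda>p. 0)) \<le> N x" unfolding N_def
      by (rule I_mono[OF k(2)[OF that] Cc_zero b(3)]) (use b(1) in simp)
    then show ?thesis using I_zero[OF k(2)[OF that]] by simp
  qed
  have "\<forall>\<^sub>F x in at x0 within S. N x < N x0 + 1"
    using Nc x0 unfolding continuous_on_def by (intro order_tendstoD(2)) auto
  then obtain V1 where V1: "open V1" "x0 \<in> V1" "\<forall>x\<in>V1. x \<noteq> x0 \<longrightarrow> x \<in> S \<longrightarrow> N x < N x0 + 1"
    unfolding eventually_at_topological by blast
  define dl where "dl = e / (N x0 + 1)"
  have N1: "N x0 + 1 > 0" using N0[OF x0] by simp
  have dl: "dl > 0" "dl * (N x0 + 1) = e" using e N1 by (auto simp: dl_def)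
  have h0: "continuous_on UNIV (\<lambda>z. h (x0, snd z))"
    by (rule continuous_on_compose2[OF Cc_cont[OF h, of UNIV]]) (auto intro!: continuous_intros)
  have "open {z. cmod (h z - h (x0, snd z)) < dl}"
    by (intro open_Collect_less continuous_on_norm continuous_on_diff continuous_on_const Cc_cont h h0)
  moreover have "{x0} \<times> (snd ` K) \<subseteq> {z. cmod (h z - h (x0, snd z)) < dl}" using dl(1) by auto
  ultimately have "\<exists>V2. x0 \<in> V2 \<and> open V2 \<and> V2 \<times> (snd ` K) \<subseteq> {z. cmod (h z - h (x0, snd z)) < dl}"
    by (intro Elementary_Topology.tube_lemma[OF C])
  then obtain V2 where V2: "x0 \<in> V2" "open V2" "V2 \<times> (snd ` K) \<subseteq> {z. cmod (h z - h (x0, snd z)) < dl}" by blast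
  have "dist (I (\<kappa> x) (\<lambda>p. h (x, p))) (I (\<kappa> x) (\<lambda>p. h (x0, p))) \<le> e" if x: "x \<in> (V1 \<inter> V2) \<inter> S" for x
  proof -
    have xS: "x \<in> S" using x by simp
    have pw: "cmod (h (x, p) - h (x0, p)) \<le> dl * b p" for p
    proof (cases "p \<in> snd ` K")
      case True
      then have "(x, p) \<in> V2 \<times> (snd ` K)" using x by simp
      then have "cmod (h (x, p) - h (x0, p)) < dl" using V2(3) by fastforce
      then show ?thesis using b(2)[OF True] by simp
    next
      case False
      then have "h (x, p) = 0" "h (x0, p) = 0" using K(2)[of "(x, p)"] K(2)[of "(x0, p)"] by force+
      then show ?thesis using dl b(1)[of p] by simp
    qed
    have "cmod (I (\<kappa> x) (\<lambda>p. h (x, p) - h (x0, p))) \<le> Re (I (\<kappa> x) (\<lambda>p. of_real dl * of_real (b p)))"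
      by (rule I_mono[OF k(2)[OF xS] Cc_diff[OF slice_Cc[OF h] slice_Cc[OF h]] Cc_scale[OF b(3)]]) (use pw in simp)
    also have "\<dots> = dl * N x" unfolding I_scale[OF k(2)[OF xS] b(3)] by (simp add: N_def)
    also have "\<dots> \<le> dl * (N x0 + 1)"
      using V1(3) x dl by (cases "x = x0") (auto intro!: mult_left_mono less_imp_le)
    finally show ?thesis
      unfolding dist_norm I_diff[OF k(2)[OF xS] slice_Cc[OF h] slice_Cc[OF h], symmetric] using dl(2) by simp
  qed
  moreover have "continuous_on S (\<lambda>x. I (\<kappa> x) (\<lambda>p. h (x0, p)))"
    by (rule continuous_on_compose2[OF I_cont[OF slice_Cc[OF h]] k(1)]) (use k(2) in auto)
  ultimately show "\<exists>g V. continuous_on S g \<and> open V \<and> x0 \<in> V \<and> (\<forall>y\<in>V \<inter> S. dist (I (\<kappa> y) (\<lambda>p. h (y, p))) (g y) \<le> e)"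
    using V1(1,2) V2(1,2)
    by (intro exI[of _ "\<lambda>x. I (\<kappa> x) (\<lambda>p. h (x0, p))"] exI[of _ "V1 \<inter> V2"]) auto
qed

lemma closed_Q: "closed {z\<in>UNIV \<times> P. \<rho> (snd z) = rng G (fst z)}"
proof (rule closed_equalizer)
  show "closed (UNIV \<times> P)" by (intro closed_Times closed_UNIV closed_P)
  show "continuous_on (UNIV \<times> P) (\<lambda>z. \<rho> (snd z))"
    by (rule continuous_on_compose2[OF cont_rho]) (auto intro!: continuous_intros)
  show "continuous_on (UNIV \<times> P) (\<lambda>z. rng G (fst z))"
    by (rule continuous_on_compose2[OF cont_rng]) (auto intro!: continuous_intros)
qed

lemma cont_shift:
  assumes "f \<in> Cc"
  shows "continuous_on {z\<in>UNIV \<times> P. \<rho> (snd z) = rng G (fst z)} (\<lambda>z. f (pact (ginv G (fst z)) (snd z)))"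
proof (rule continuous_on_compose2[OF Cc_cont[OF assms, of UNIV]])
  have "continuous_on {z\<in>UNIV \<times> P. \<rho> (snd z) = rng G (fst z)} (\<lambda>z. (\<lambda>(x, p). pact x p) (ginv G (fst z), snd z))"
  proof (rule continuous_on_compose2[OF cont_pact])
    show "continuous_on {z\<in>UNIV \<times> P. \<rho> (snd z) = rng G (fst z)} (\<lambda>z. (ginv G (fst z), snd z))"
      by (intro continuous_on_Pair continuous_on_compose2[OF cont_inv[of UNIV]] continuous_on_fst continuous_on_snd continuous_on_id) auto
  qed auto
  then show "continuous_on {z\<in>UNIV \<times> P. \<rho> (snd z) = rng G (fst z)} (\<lambda>z. pact (ginv G (fst z)) (snd z))" by simp
qed auto

text \<open>The integrand makes sense only on the closed set of pairs (x, p) with p over the range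
  of x. A bump in x makes its support compact, so that Tietze's theorem applies, and being 1 near x0
  it does not change the function there.\<close>

lemma coef_cont:
  assumes f: "f \<in> Cc" and g: "g \<in> Cc"
  shows "continuous_on UNIV (\<lambda>x. I (rng G x) (\<lambda>p. cnj (f (pact (ginv G x) p)) * g p))"
proof (rule continuous_approx)
  fix x0 :: 'g and e :: real assume e: "e > 0"
  obtain V0 where V0: "open V0" "{x0} \<subseteq> V0" "compact (closure V0)"
    by (rule lc_between[OF lc, of "{x0}" UNIV]) auto
  obtain c :: "'g \<Rightarrow> real" and C where c: "continuous_on UNIV c" "\<And>x. x \<in> closure V0 \<Longrightarrow> c x = 1" "compact C" "\<And>x. x \<notin> C \<Longrightarrow> c x = 0"
    by (rule lc_bump[OF lc V0(3) open_UNIV]) auto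
  let ?Q = "{z\<in>UNIV \<times> P. \<rho> (snd z) = rng G (fst z)}"
  obtain K where K: "compact K" "\<And>p. p \<notin> K \<Longrightarrow> g p = 0" by (rule CcE[OF g]) blast
  have "continuous_on ?Q (\<lambda>z. of_real (c (fst z)) * (cnj (f (pact (ginv G (fst z)) (snd z))) * g (snd z)))"
    by (intro continuous_on_mult continuous_on_cnj continuous_on_of_real cont_shift f continuous_on_compose2[OF c(1)]
        continuous_on_compose2[OF Cc_cont[OF g, of UNIV]] continuous_on_fst continuous_on_snd continuous_on_id) auto
  moreover have "of_real (c (fst z)) * (cnj (f (pact (ginv G (fst z)) (snd z))) * g (snd z)) = 0" if "z \<notin> C \<times> K" for z
    using that c(4)[of "fst z"] K(2)[of "snd z"] by (cases z) auto
  ultimately obtain h where h: "h \<in> Cc" "\<And>z. z \<in> ?Q \<Longrightarrow> h z = of_real (c (fst z)) * (cnj (f (pact (ginv G (fst z)) (snd z))) * g (snd z))"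
    using Cc_Tietze[OF lc_prod[OF lc lcP] closed_Q _ compact_Times[OF c(3) K(1)]] by blast
  have "continuous_on UNIV (\<lambda>x. I (rng G x) (\<lambda>p. h (x, p)))"
    by (rule I_param[OF h(1) cont_rng rng_units])
  moreover have "I (rng G x) (\<lambda>p. cnj (f (pact (ginv G x) p)) * g p) = I (rng G x) (\<lambda>p. h (x, p))" if "x \<in> V0" for x
  proof (rule I_cong[OF rng_units])
    fix p assume p: "p \<in> P" "\<rho> p = rng G x"
    have "c x = 1" using c(2) closure_subset[of V0] that by blast
    then show "cnj (f (pact (ginv G x) p)) * g p = h (x, p)" using h(2)[of "(x, p)"] p by simp
  qed
  ultimately show "\<exists>g' V. continuous_on UNIV g' \<and> open V \<and> x0 \<in> V \<and>
      (\<forall>y\<in>V \<inter> UNIV. dist (I (rng G y) (\<lambda>p. cnj (f (pact (ginv G y) p)) * g p)) (g' y) \<le> e)"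
    using V0 e by (intro exI[of _ "\<lambda>x. I (rng G x) (\<lambda>p. h (x, p))"] exI[of _ V0]) auto
qed

text \<open>The translate of f is defined on one fibre. An extension to \<open>Cc\<close> is chosen
  so that all units can share the index set \<open>Cc\<close>; two extensions will give the same
  vector, since only values on the fibre enter the inner product.\<close>

lemma shift_ex:
  assumes f: "f \<in> Cc"
  shows "\<exists>f'\<in>Cc. \<forall>p\<in>P. \<rho> p = rng G x \<longrightarrow> f' p = f (pact (ginv G x) p)"
proof -
  let ?Q = "{p\<in>P. \<rho> p = rng G x}"
  obtain K where K: "compact K" "\<And>p. p \<notin> K \<Longrightarrow> f p = 0" by (rule CcE[OF f]) blast
  have cl: "closed {p\<in>P. \<rho> p = y}" for y
    by (rule closed_equalizer[OF closed_P cont_rho continuous_on_const])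
  have c1: "continuous_on {p\<in>P. \<rho> p = src G y} (pact y)" for y
  proof -
    have "continuous_on {p\<in>P. \<rho> p = src G y} (\<lambda>p. (\<lambda>(x, p). pact x p) (y, p))"
      by (rule continuous_on_compose2[OF cont_pact]) (auto intro!: continuous_intros)
    then show ?thesis by simp
  qed
  have "continuous_on ?Q (\<lambda>p. f (pact (ginv G x) p))"
    by (rule continuous_on_compose2[OF Cc_cont[OF f, of UNIV]]) (use c1[of "ginv G x"] in auto)
  moreover have "compact (pact x ` (K \<inter> {p\<in>P. \<rho> p = src G x}))"
    by (intro compact_continuous_image compact_Int_closed K cl continuous_on_subset[OF c1[of x]]) auto
  moreover have "f (pact (ginv G x) p) = 0" if p: "p \<in> ?Q" and n: "p \<notin> pact x ` (K \<inter> {p\<in>P. \<rho> p = src G x})" for p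
  proof (rule ccontr)
    let ?q = "pact (ginv G x) p"
    assume "f ?q \<noteq> 0"
    then have "?q \<in> K" using K(2) by blast
    moreover have "?q \<in> P" "\<rho> ?q = src G x" using p pact_in[of p "ginv G x"] rho_pact[of p "ginv G x"] by auto
    moreover have "pact x ?q = p"
      using pact_mult[of x "ginv G x" p] pact_unit[of p "rng G x"] p by (simp add: mult_inv)
    ultimately show False using n by force
  qed
  ultimately obtain F where "F \<in> Cc" "\<And>p. p \<in> ?Q \<Longrightarrow> F p = f (pact (ginv G x) p)"
    using Cc_Tietze[OF lcP cl[of "rng G x"]] by blast
  then show ?thesis by (intro bexI[of _ F]) auto
qed

definition shift where "shift x f = (SOME f'. f' \<in> Cc \<and> (\<forall>p\<in>P. \<rho> p = rng G x \<longrightarrow> f' p = f (pact (ginv G x) p)))"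

lemma shift:
  assumes "f \<in> Cc"
  shows "shift x f \<in> Cc" "p \<in> P \<Longrightarrow> \<rho> p = rng G x \<Longrightarrow> shift x f p = f (pact (ginv G x) p)"
  using someI_ex[of "\<lambda>f'. f' \<in> Cc \<and> (\<forall>p\<in>P. \<rho> p = rng G x \<longrightarrow> f' p = f (pact (ginv G x) p))"] shift_ex[OF assms, of x]
  unfolding shift_def[symmetric] by blast+

lemma ip_shift:
  assumes f: "f \<in> Cc" and g: "g \<in> Cc"
  shows "ip (rng G x) (shift x f) (shift x g) = ip (src G x) f g"
  unfolding ip_def
proof (rule I_inv[symmetric, OF cnj_mult_Cc[OF shift(1)[OF f] shift(1)[OF g]] cnj_mult_Cc[OF f g]])
  fix p assume p: "p \<in> P" "\<rho> p = src G x"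
  have "pact (ginv G x) (pact x p) = p"
    using pact_mult[of "ginv G x" x p] pact_unit[of p "src G x"] p by (simp add: inv_mult_self)
  then show "cnj (f p) * g p = cnj (shift x f (pact x p)) * shift x g (pact x p)"
    using shift(2)[OF f, of "pact x p" x] shift(2)[OF g, of "pact x p" x] pact_in[OF p] rho_pact[OF p] by simp
qed

lemma ip_cong:
  assumes "u \<in> units G" "\<And>p. p \<in> P \<Longrightarrow> \<rho> p = u \<Longrightarrow> f p = f' p" "\<And>p. p \<in> P \<Longrightarrow> \<rho> p = u \<Longrightarrow> g p = g' p"
  shows "ip u f g = ip u f' g'"
  unfolding ip_def by (rule I_cong[OF assms(1)]) (simp add: assms)

text \<open>The fibre vectors are Gram-Schmidt coordinates for one countable family that is dense
  over every unit. These coordinates may vary wildly with the unit, but \<open>kernel_bundle\<close>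
  asks only that the inner products of translates be continuous.\<close>

theorem L2_bundle:
  obtains H \<S> L V where "hbundle G H \<S> L" "\<And>f. f \<in> Cc \<Longrightarrow> (\<lambda>u. V u f) \<in> \<S>"
    "\<And>u f. u \<in> units G \<Longrightarrow> f \<in> Cc \<Longrightarrow> ell2_norm (V u f) = sqrt (Re (ip u f f))"
    "\<And>f g x. f \<in> Cc \<Longrightarrow> g \<in> Cc \<Longrightarrow>
      coefficient G L (\<lambda>u. V u f) (\<lambda>u. V u g) x = I (rng G x) (\<lambda>p. cnj (f (pact (ginv G x) p)) * g p)"
proof -
  obtain d :: "nat \<Rightarrow> 'p \<Rightarrow> complex" where d: "\<And>n. d n \<in> Cc"
    "\<And>f. f \<in> Cc \<Longrightarrow> \<exists>b. (\<lambda>p. complex_of_real (b p)) \<in> Cc \<and> (\<forall>p. 0 \<le> b p) \<and>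
      (\<forall>e>0. \<exists>zs. \<forall>p. cmod (f p - (\<Sum>z\<leftarrow>zs. fst z * d (snd z) p)) \<le> e * b p)"
    by (rule Cc_separable[OF lcP]) blast
  have dense: "\<exists>zs. semi_ip.nrm (ip u) (\<lambda>p. f p - (\<Sum>z\<leftarrow>zs. fst z * d (snd z) p)) < e"
    if u: "u \<in> units G" and f: "f \<in> Cc" and e: "e > 0" for u f and e :: real
  proof -
    interpret semi_ip Cc "ip u" by (rule semi_ip_ip[OF u])
    obtain b where b: "(\<lambda>p. complex_of_real (b p)) \<in> Cc" "\<And>p. 0 \<le> b p"
      "\<And>e. e > 0 \<Longrightarrow> \<exists>zs. \<forall>p. cmod (f p - (\<Sum>z\<leftarrow>zs. fst z * d (snd z) p)) \<le> e * b p"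
      using d(2)[OF f] by blast
    let ?b = "\<lambda>p. complex_of_real (b p)"
    define dl where "dl = e / (nrm ?b + 1)"
    have p1: "nrm ?b + 1 > 0" using nrm_nonneg[OF b(1)] by linarith
    have dl: "dl > 0" "dl * (nrm ?b + 1) = e" using e p1 by (auto simp: dl_def)
    obtain zs where zs: "\<And>p. cmod (f p - (\<Sum>z\<leftarrow>zs. fst z * d (snd z) p)) \<le> dl * b p" using b(3)[OF dl(1)] by blast
    let ?g = "\<lambda>p. f p - (\<Sum>z\<leftarrow>zs. fst z * d (snd z) p)"
    have g: "?g \<in> Cc" by (intro Cc_diff f Cc_sum_list Cc_scale d)
    have db: "(\<lambda>p. of_real dl * ?b p) \<in> Cc" by (rule Cc_scale[OF b(1)])
    have "cmod (ip u ?g ?g) \<le> Re (ip u (\<lambda>p. of_real dl * ?b p) (\<lambda>p. of_real dl * ?b p))"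
      unfolding ip_def
    proof (rule I_mono[OF u cnj_mult_Cc[OF g g] cnj_mult_Cc[OF db db]])
      fix p
      have "cmod (cnj (?g p) * ?g p) = cmod (?g p) * cmod (?g p)" by (simp only: norm_mult complex_mod_cnj)
      also have "\<dots> \<le> (dl * b p) * (dl * b p)" using zs[of p] by (intro mult_mono) (auto simp: dl b(2) less_imp_le)
      finally show "cmod (cnj (?g p) * ?g p) \<le> Re (cnj (of_real dl * ?b p) * (of_real dl * ?b p))" by simp
    qed
    then have "(nrm ?g)\<^sup>2 \<le> (nrm (\<lambda>p. of_real dl * ?b p))\<^sup>2"
      unfolding nrm_sq[OF g] nrm_sq[OF db] using complex_Re_le_cmod order_trans by blast
    then have "nrm ?g \<le> nrm (\<lambda>p. of_real dl * ?b p)" using nrm_nonneg[OF db] by (rule power2_le_imp_le)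
    also have "\<dots> = dl * nrm ?b" using nrm_scale[OF b(1), of "of_real dl"] dl(1) by simp
    also have "\<dots> < e" using dl by (simp add: algebra_simps)
    finally show ?thesis by blast
  qed
  define V where "V u f = semi_ip.vec (ip u) d f" for u f
  have VE: "V u f \<in> ell2" if "u \<in> units G" "f \<in> Cc" for u f
    unfolding V_def by (rule semi_ip.vec_ell2[OF semi_ip_ip[OF that(1)] d(1) dense[OF that(1)] that(2)])
  have Vi: "ell2_inner (V u f) (V u g) = ip u f g" if "u \<in> units G" "f \<in> Cc" "g \<in> Cc" for u f g
    unfolding V_def by (rule semi_ip.vec_inner[OF semi_ip_ip[OF that(1)] d(1) dense[OF that(1)] that(2,3)])
  \<comment> \<open>The choice made in \<open>shift\<close> satisfies the laws of an action only on
    the fibre. Passing to vectors removes the ambiguity, which is the form in which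
    \<open>act_mult\<close> and \<open>act_unit\<close> are required.\<close>
  have Veq: "V u f = V u g" if u: "u \<in> units G" and f: "f \<in> Cc" and g: "g \<in> Cc" and eq: "\<And>p. p \<in> P \<Longrightarrow> \<rho> p = u \<Longrightarrow> f p = g p" for u f g
  proof -
    note E = VE[OF u f] VE[OF u g]
    have ii: "ip u f f = ip u g g" "ip u f g = ip u g g" "ip u g f = ip u g g"
      by (auto intro!: ip_cong[OF u] simp: eq)
    have "ell2_inner (\<lambda>n. V u f n - V u g n) (\<lambda>n. V u f n - V u g n) = 0"
      using E by (simp add: ell2.ip_diff ell2.ip_diff_left ell2.diff_W Vi u f g ii)
    then have "ell2_norm (\<lambda>n. V u f n - V u g n) = 0"
      by (simp add: ell2_norm_eq_inner[OF ell2.diff_W[OF E]])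
    then have "(\<lambda>n. V u f n - V u g n) = (\<lambda>n. 0)" by (rule ell2_norm_eq_0[OF ell2.diff_W[OF E]])
    then show ?thesis by (metis (no_types, lifting) eq_iff_diff_eq_0 ext)
  qed
  define Sec :: "('g \<Rightarrow> 'p \<Rightarrow> complex) set" where "Sec = (\<lambda>f u. f) ` Cc"
  have ip_I: "ip (rng G x) (shift x f) g = I (rng G x) (\<lambda>p. cnj (f (pact (ginv G x) p)) * g p)" if "f \<in> Cc" for f g x
    unfolding ip_def by (rule I_cong[OF rng_units]) (simp add: shift(2)[OF that])
  interpret K: kernel_bundle G "\<lambda>u. Cc" V shift Sec
  proof unfold_locales
    show "V u a \<in> ell2" if "u \<in> units G" "a \<in> Cc" for u a by (rule VE[OF that])
    show "shift x a \<in> Cc" if "a \<in> Cc" for a x by (rule shift(1)[OF that])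
    show "ell2_inner (V (rng G x) (shift x a)) (V (rng G x) (shift x b)) = ell2_inner (V (src G x) a) (V (src G x) b)"
      if "a \<in> Cc" "b \<in> Cc" for a b x
      using that by (simp add: Vi shift(1) ip_shift)
    show "V (rng G x) (shift (x \<cdot> y) a) = V (rng G x) (shift x (shift y a))" if xy: "src G x = rng G y" and a: "a \<in> Cc" for a x y
    proof (rule Veq[OF rng_units shift(1)[OF a] shift(1)[OF shift(1)[OF a]]])
      fix p assume p: "p \<in> P" "\<rho> p = rng G x"
      have p': "\<rho> p = src G (ginv G x)" using p by simp
      have "shift x (shift y a) p = shift y a (pact (ginv G x) p)" by (rule shift(2)[OF shift(1)[OF a] p])
      also have "\<dots> = a (pact (ginv G y) (pact (ginv G x) p))"
        by (rule shift(2)[OF a pact_in[OF p(1) p']]) (simp add: rho_pact[OF p(1) p'] xy)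
      also have "\<dots> = a (pact (ginv G y \<cdot> ginv G x) p)"
        using pact_mult[of "ginv G y" "ginv G x" p] p xy by simp
      also have "\<dots> = shift (x \<cdot> y) a p"
        using shift(2)[OF a p(1), of "x \<cdot> y"] p xy by (simp add: inv_mult rng_mult)
      finally show "shift (x \<cdot> y) a p = shift x (shift y a) p" by simp
    qed
    show "V u (shift u a) = V u a" if u: "u \<in> units G" and a: "a \<in> Cc" for u a
      by (rule Veq[OF u shift(1)[OF a] a])
         (use shift(2)[OF a, of _ u] u in \<open>simp add: unit_rng inv_unit pact_unit\<close>)
    show "\<sigma> u \<in> Cc" if "\<sigma> \<in> Sec" for \<sigma> u using that by (auto simp: Sec_def)
    show "\<exists>zs. snd ` set zs \<subseteq> Sec \<and> ell2_norm (\<lambda>n. V u a n - (\<Sum>z\<leftarrow>zs. fst z * V u (snd z u) n)) < e"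
      if "u \<in> units G" "a \<in> Cc" "e > 0" for u a and e :: real
      using that by (intro exI[of _ "[(1, \<lambda>u. a)]"]) (simp add: Sec_def)
    show "continuous_on UNIV (\<lambda>x. ell2_inner (V (rng G x) (shift x (\<sigma> (src G x)))) (V (rng G x) (\<tau> (rng G x))))"
      if "\<sigma> \<in> Sec" "\<tau> \<in> Sec" for \<sigma> \<tau>
    proof -
      obtain f g where fg: "\<sigma> = (\<lambda>u. f)" "f \<in> Cc" "\<tau> = (\<lambda>u. g)" "g \<in> Cc" using \<open>\<sigma> \<in> Sec\<close> \<open>\<tau> \<in> Sec\<close> by (auto simp: Sec_def)
      show ?thesis using coef_cont[OF fg(2,4)] by (simp add: fg Vi shift(1) ip_I)
    qed
  qed
  show ?thesis
  proof (rule that)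
    show "hbundle G K.H K.\<S> K.L" by unfold_locales (rule K.is_bundle)
    show "(\<lambda>u. V u f) \<in> K.\<S>" if "f \<in> Cc" for f
      using K.sec_S[of "\<lambda>u. f"] that by (simp add: Sec_def)
    show "ell2_norm (V u f) = sqrt (Re (ip u f f))" if "u \<in> units G" "f \<in> Cc" for u f
      using ell2_norm_eq_inner[OF VE[OF that]] Vi[OF that(1) that(2) that(2)] by simp
    show "coefficient G K.L (\<lambda>u. V u f) (\<lambda>u. V u g) x = I (rng G x) (\<lambda>p. cnj (f (pact (ginv G x) p)) * g p)"
      if "f \<in> Cc" "g \<in> Cc" for f g x
      unfolding coefficient_def K.L_v[OF that(1)] Vi[OF rng_units shift(1)[OF that(1)] that(2)] by (rule ip_I[OF that(1)])
  qed
qed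

theorem coeff_B:
  assumes f: "f \<in> Cc" and g: "g \<in> Cc"
    and a: "\<And>u. u \<in> units G \<Longrightarrow> sqrt (Re (ip u f f)) \<le> a" and b: "\<And>u. u \<in> units G \<Longrightarrow> sqrt (Re (ip u g g)) \<le> b"
  shows "(\<lambda>x. I (rng G x) (\<lambda>p. cnj (f (pact (ginv G x) p)) * g p)) \<in> B_alg G"
    "B_norm G (\<lambda>x. I (rng G x) (\<lambda>p. cnj (f (pact (ginv G x) p)) * g p)) \<le> a * b"
proof -
  obtain H \<S> L V where A: "hbundle G H \<S> L" "\<And>f. f \<in> Cc \<Longrightarrow> (\<lambda>u. V u f) \<in> \<S>"
    "\<And>u f. u \<in> units G \<Longrightarrow> f \<in> Cc \<Longrightarrow> ell2_norm (V u f) = sqrt (Re (ip u f f))"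
    "\<And>f g x. f \<in> Cc \<Longrightarrow> g \<in> Cc \<Longrightarrow>
      coefficient G L (\<lambda>u. V u f) (\<lambda>u. V u g) x = I (rng G x) (\<lambda>p. cnj (f (pact (ginv G x) p)) * g p)"
    by (rule L2_bundle) blast
  have eq: "(\<lambda>x. I (rng G x) (\<lambda>p. cnj (f (pact (ginv G x) p)) * g p)) = coefficient G L (\<lambda>u. V u f) (\<lambda>u. V u g)"
    using A(4)[OF f g] by auto
  show "(\<lambda>x. I (rng G x) (\<lambda>p. cnj (f (pact (ginv G x) p)) * g p)) \<in> B_alg G"
    "B_norm G (\<lambda>x. I (rng G x) (\<lambda>p. cnj (f (pact (ginv G x) p)) * g p)) \<le> a * b"
    unfolding eq using B_algI[OF A(1) A(2)[OF f] A(2)[OF g], of a b] A(3) f g a b by auto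
qed

text \<open>The image of the support under \<rho> is compact, so the continuous fibre norm is
  bounded there, and over all other units it is 0.\<close>

lemma norm_bounded:
  assumes f: "f \<in> Cc"
  obtains a where "\<And>u. u \<in> units G \<Longrightarrow> sqrt (Re (ip u f f)) \<le> a"
proof -
  obtain K where K: "compact K" "\<And>p. p \<notin> K \<Longrightarrow> f p = 0" by (rule CcE[OF f]) blast
  have c: "continuous_on (units G) (\<lambda>u. sqrt (Re (ip u f f)))"
    unfolding ip_def by (intro continuous_on_real_sqrt continuous_on_Re I_cont cnj_mult_Cc f)
  have "compact (\<rho> ` (K \<inter> P))"
    by (intro compact_continuous_image compact_Int_closed K closed_P continuous_on_subset[OF cont_rho]) auto
  then have KU: "compact (\<rho> ` (K \<inter> P) \<inter> units G)" by (rule compact_Int_closed[OF _ closed_units])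
  have "bounded ((\<lambda>u. sqrt (Re (ip u f f))) ` (\<rho> ` (K \<inter> P) \<inter> units G))"
    by (intro compact_imp_bounded compact_continuous_image continuous_on_subset[OF c] KU) auto
  then obtain a where a: "\<And>u. u \<in> \<rho> ` (K \<inter> P) \<inter> units G \<Longrightarrow> \<bar>sqrt (Re (ip u f f))\<bar> \<le> a"
    unfolding bounded_iff by auto
  have "sqrt (Re (ip u f f)) \<le> max a 0" if u: "u \<in> units G" for u
  proof (cases "u \<in> \<rho> ` (K \<inter> P)")
    case True
    then show ?thesis using a[of u] u by auto
  next
    case False
    have "ip u f f = ip u (\<lambda>p. 0) (\<lambda>p. 0)"
      by (rule ip_cong[OF u]) (use False K(2) in blast)+
    also have "\<dots> = 0" using I_zero[OF u] by (simp add: ip_def)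
    finally show ?thesis by simp
  qed
  then show ?thesis by (rule that)
qed

end

section \<open>The Fourier algebra\<close>

context lcg
begin

abbreviation fib :: "'g \<Rightarrow> 'g set" where "fib u \<equiv> {x. rng G x = u}"

lemma haar: "left_haar_system G"
  using lcg by (simp add: lc_haar_groupoid_def)

lemma haar_regular: "u \<in> units G \<Longrightarrow> regular_borel_measure (top_of_set (fib u)) (haar G u)"
  using haar by (simp add: left_haar_system_def)

lemma space_haar: "u \<in> units G \<Longrightarrow> space (haar G u) = fib u"
  using haar_regular by (simp add: regular_borel_measure_def)

text \<open>The fibre is closed, hence Borel, so the sigma algebra generated by its relatively open
  sets is the trace of the Borel sets. Continuity on the fibre then gives measurability.\<close>

lemma sets_haar:
  assumes u: "u \<in> units G"
  shows "sets (haar G u) = sets (restrict_space borel (fib u))"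
proof -
  have "sets (haar G u) = sigma_sets (fib u) {V. openin (top_of_set (fib u)) V}"
    using haar_regular[OF u] by (simp add: regular_borel_measure_def)
  also have "{V. openin (top_of_set (fib u)) V} = (\<inter>) (fib u) ` {V. open V}"
    unfolding openin_open by blast
  also have "sigma_sets (fib u) \<dots> = (\<inter>) (fib u) ` sigma_sets UNIV {V. open V}"
  proof (rule sigma_sets_Int[symmetric])
    have "fib u \<in> sets borel" using closed_fibre by (rule borel_closed)
    then show "fib u \<in> sigma_sets UNIV {V. open V}" by (simp add: borel_def)
  qed simp
  also have "\<dots> = sets (restrict_space borel (fib u))"
    by (simp add: sets_restrict_space borel_def)
  finally show ?thesis .
qed

lemma haar_measurable: "u \<in> units G \<Longrightarrow> continuous_on (fib u) f \<Longrightarrow> f \<in> borel_measurable (haar G u)"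
  using borel_measurable_continuous_on_restrict[of "fib u" f] measurable_cong_sets[OF sets_haar refl] by blast

lemma haar_borel_sets: "u \<in> units G \<Longrightarrow> V \<in> sets borel \<Longrightarrow> V \<inter> fib u \<in> sets (haar G u)"
  unfolding sets_haar sets_restrict_space by (rule image_eqI[of _ _ V]) auto

lemma haar_closed_sets: "u \<in> units G \<Longrightarrow> closed V \<Longrightarrow> V \<inter> fib u \<in> sets (haar G u)"
  by (intro haar_borel_sets borel_closed)

lemma haar_compact: "u \<in> units G \<Longrightarrow> compact K \<Longrightarrow> emeasure (haar G u) (K \<inter> fib u) < \<infinity>"
  using haar_regular[of u] compact_Int_closed[OF _ closed_fibre, of K u]
  unfolding regular_borel_measure_def compactin_subtopology by auto

lemma haar_integrable_cont:
  fixes f :: "'g \<Rightarrow> 'b::{banach, second_countable_topology}"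
  assumes u: "u \<in> units G" and f: "continuous_on (fib u) f" and K: "compact K" "\<And>x. x \<in> fib u \<Longrightarrow> x \<notin> K \<Longrightarrow> f x = 0"
  shows "integrable (haar G u) f"
proof -
  have "bounded (f ` (K \<inter> fib u))"
    by (intro compact_imp_bounded compact_continuous_image continuous_on_subset[OF f] compact_Int_closed K closed_fibre) auto
  then obtain B where "\<forall>y\<in>f ` (K \<inter> fib u). norm y \<le> B" unfolding bounded_iff by blast
  then show ?thesis
    using u K by (intro integrableI_bounded_set[of "K \<inter> fib u" _ _ B] haar_measurable f haar_closed_sets haar_compact compact_imp_closed)
       (auto simp: space_haar intro!: AE_I2)
qed

lemma haar_integrable:
  assumes "u \<in> units G" "f \<in> Cc"
  shows "integrable (haar G u) f"
proof -
  obtain K where "compact K" "\<And>x. x \<notin> K \<Longrightarrow> f x = 0" using CcE[OF assms(2)] by blast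
  then show ?thesis using assms by (intro haar_integrable_cont Cc_cont) auto
qed

definition I1 :: "'g \<Rightarrow> ('g \<Rightarrow> complex) \<Rightarrow> complex" where "I1 u f = (\<integral>t. f t \<partial>haar G u)"

text \<open>The groupoid acts on itself by left multiplication; the resulting bundle is the regular
  one, with the coefficients \<open>coef\<close> below.\<close>

sublocale H: gspace G UNIV "rng G" "\<lambda>x p. x \<cdot> p" I1
proof unfold_locales
  show "locally_compact_space (euclidean :: 'g topology)" by (rule lc)
  show "closed (UNIV :: 'g set)" by simp
  show "continuous_on UNIV (rng G)" by (rule cont_rng)
  show "rng G p = src G x \<Longrightarrow> rng G (x \<cdot> p) = rng G x" for p x by (simp add: rng_mult)
  show "src G x = rng G y \<Longrightarrow> rng G p = src G y \<Longrightarrow> x \<cdot> y \<cdot> p = x \<cdot> (y \<cdot> p)" for x y p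
    by (simp add: mult_assoc)
  show "rng G p = u \<Longrightarrow> u \<cdot> p = p" for p u by auto
  show "continuous_on {(x, p). p \<in> UNIV \<and> rng G p = src G x} (\<lambda>(x, p). x \<cdot> p)"
    unfolding case_prod_unfold by (intro cont_mult continuous_intros) auto
  show "I1 u f = I1 u g" if "u \<in> units G" "\<And>p. p \<in> UNIV \<Longrightarrow> rng G p = u \<Longrightarrow> f p = g p" for u f g
    unfolding I1_def using that by (intro Bochner_Integration.integral_cong) (auto simp: space_haar)
  show "I1 u (\<lambda>p. f p + g p) = I1 u f + I1 u g" if "u \<in> units G" "f \<in> Cc" "g \<in> Cc" for u f g
    unfolding I1_def using that by (intro Bochner_Integration.integral_add haar_integrable)
  show "I1 u (\<lambda>p. c * f p) = c * I1 u f" for u f c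
    unfolding I1_def by simp
  show "I1 u (\<lambda>p. cnj (f p)) = cnj (I1 u f)" for u f
    unfolding I1_def by simp
  show "cmod (I1 u f) \<le> Re (I1 u g)"
    if u: "u \<in> units G" and f: "f \<in> Cc" and g: "g \<in> Cc" and le: "\<And>p. p \<in> UNIV \<Longrightarrow> rng G p = u \<Longrightarrow> cmod (f p) \<le> Re (g p)" for u f g
  proof -
    have "cmod (I1 u f) \<le> (\<integral>t. cmod (f t) \<partial>haar G u)" unfolding I1_def by (rule integral_norm_bound)
    also have "\<dots> \<le> (\<integral>t. Re (g t) \<partial>haar G u)"
      using haar_integrable[OF u f] haar_integrable[OF u g] le u
      by (intro integral_mono) (auto simp: space_haar)
    also have "\<dots> = Re (I1 u g)" unfolding I1_def using haar_integrable[OF u g] by simp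
    finally show ?thesis .
  qed
  show "continuous_on (units G) (\<lambda>u. I1 u f)" if "f \<in> Cc" for f
    using haar that by (simp add: left_haar_system_def I1_def)
  show "I1 (src G x) g = I1 (rng G x) f"
    if "f \<in> Cc" "g \<in> Cc" "\<And>p. p \<in> UNIV \<Longrightarrow> rng G p = src G x \<Longrightarrow> g p = f (x \<cdot> p)" for f g x
  proof -
    have "I1 (src G x) g = (\<integral>t. f (x \<cdot> t) \<partial>haar G (src G x))"
      unfolding I1_def using that(3) by (intro Bochner_Integration.integral_cong) (auto simp: space_haar)
    then show ?thesis using haar that(1) by (simp add: left_haar_system_def I1_def)
  qed
qed simp

section \<open>The composable pairs with the iterated Haar integral\<close>

definition P2 :: "('g \<times> 'g) set" where "P2 = {p\<in>UNIV. src G (fst p) = rng G (snd p)}"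
definition inner_int :: "('g \<times> 'g \<Rightarrow> complex) \<Rightarrow> 'g \<Rightarrow> complex" where "inner_int F t = I1 (src G t) (\<lambda>w. F (t, w))"
definition I2 :: "'g \<Rightarrow> ('g \<times> 'g \<Rightarrow> complex) \<Rightarrow> complex" where "I2 u F = I1 u (inner_int F)"

lemma inner_int_Cc:
  assumes "F \<in> Cc"
  shows "inner_int F \<in> Cc"
proof -
  obtain K where K: "compact K" "\<And>z. z \<notin> K \<Longrightarrow> F z = 0" using CcE[OF assms] by blast
  show ?thesis
  proof (rule CcI)
    show "continuous_on UNIV (inner_int F)"
      unfolding inner_int_def by (rule H.I_param[OF assms cont_src src_units])
    show "compact (fst ` K)" by (intro compact_continuous_image K continuous_intros)
    show "inner_int F t = 0" if "t \<notin> fst ` K" for t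
    proof -
      have "(\<lambda>w. F (t, w)) = (\<lambda>w. 0)" using K(2) that by force
      then show ?thesis unfolding inner_int_def by (simp add: H.I_zero)
    qed
  qed
qed

text \<open>Two base points with the same source are allowed because invariance compares t with x
  \<cdot> t, for which the inner integral runs over the same fibre.\<close>

lemma inner_int_cong:
  assumes "\<And>w. rng G w = src G t \<Longrightarrow> F (t, w) = F' (t', w)" "src G t' = src G t"
  shows "inner_int F t = inner_int F' t'"
  unfolding inner_int_def assms(2) by (rule H.I_cong[OF src_units]) (rule assms(1))

text \<open>Left multiplication changes the first component only and keeps its source, so the inner
  integral is unaffected and invariance reduces to that of the outer integral.\<close>

sublocale H2: gspace G P2 "\<lambda>p. rng G (fst p)" "\<lambda>x p. (x \<cdot> fst p, snd p)" I2
proof unfold_locales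
  show "locally_compact_space (euclidean :: ('g \<times> 'g) topology)" by (rule lc_prod[OF lc lc])
  show "closed P2" unfolding P2_def
    by (intro closed_equalizer closed_UNIV continuous_on_compose2[OF cont_src[unfolded continuous_on_def[symmetric]]]
        continuous_on_compose2[OF cont_rng] continuous_on_fst continuous_on_snd continuous_on_id) auto
  show "continuous_on P2 (\<lambda>p. rng G (fst p))"
    by (intro continuous_on_compose2[OF cont_rng] continuous_on_fst continuous_on_id) auto
  show "p \<in> P2 \<Longrightarrow> rng G (fst p) = src G x \<Longrightarrow> (x \<cdot> fst p, snd p) \<in> P2" for p x
    by (simp add: P2_def src_mult)
  show "p \<in> P2 \<Longrightarrow> rng G (fst p) = src G x \<Longrightarrow> rng G (fst (x \<cdot> fst p, snd p)) = rng G x" for p x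
    by (simp add: rng_mult)
  show "(x \<cdot> y \<cdot> fst p, snd p) = (x \<cdot> fst (y \<cdot> fst p, snd p), snd (y \<cdot> fst p, snd p))"
    if "src G x = rng G y" "p \<in> P2" "rng G (fst p) = src G y" for x y and p :: "'g \<times> 'g"
    using that by (simp add: mult_assoc)
  show "rng G (fst p) = u \<Longrightarrow> (u \<cdot> fst p, snd p) = p" for p :: "'g \<times> 'g" and u by auto
  show "continuous_on {(x, p). p \<in> P2 \<and> rng G (fst p) = src G x} (\<lambda>(x, p). (x \<cdot> fst p, snd p))"
    unfolding case_prod_unfold by (intro continuous_on_Pair cont_mult continuous_intros) auto
  show "I2 u f = I2 u g" if u: "u \<in> units G" and eq: "\<And>p. p \<in> P2 \<Longrightarrow> rng G (fst p) = u \<Longrightarrow> f p = g p" for u f g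
    unfolding I2_def by (rule H.I_cong[OF u], rule inner_int_cong) (use eq in \<open>auto simp: P2_def\<close>)
  show "I2 u (\<lambda>p. f p + g p) = I2 u f + I2 u g" if "u \<in> units G" "f \<in> Cc" "g \<in> Cc" for u f g
  proof -
    have "inner_int (\<lambda>p. f p + g p) = (\<lambda>t. inner_int f t + inner_int g t)"
      unfolding inner_int_def using that by (simp add: H.I_add H.slice_Cc)
    then show ?thesis unfolding I2_def using that by (simp add: H.I_add inner_int_Cc)
  qed
  show "I2 u (\<lambda>p. c * f p) = c * I2 u f" if "u \<in> units G" "f \<in> Cc" for u f c
  proof -
    have "inner_int (\<lambda>p. c * f p) = (\<lambda>t. c * inner_int f t)"
      unfolding inner_int_def using that by (simp add: H.I_scale H.slice_Cc)
    then show ?thesis unfolding I2_def using that by (simp add: H.I_scale inner_int_Cc)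
  qed
  show "I2 u (\<lambda>p. cnj (f p)) = cnj (I2 u f)" if "u \<in> units G" "f \<in> Cc" for u f
  proof -
    have "inner_int (\<lambda>p. cnj (f p)) = (\<lambda>t. cnj (inner_int f t))"
      unfolding inner_int_def using that by (simp add: H.I_cnj H.slice_Cc)
    then show ?thesis unfolding I2_def using that by (simp add: H.I_cnj inner_int_Cc)
  qed
  show "cmod (I2 u f) \<le> Re (I2 u g)"
    if u: "u \<in> units G" and f: "f \<in> Cc" and g: "g \<in> Cc" and le: "\<And>p. p \<in> P2 \<Longrightarrow> rng G (fst p) = u \<Longrightarrow> cmod (f p) \<le> Re (g p)" for u f g
    unfolding I2_def
  proof (rule H.I_mono[OF u inner_int_Cc[OF f] inner_int_Cc[OF g]])
    fix t assume "rng G t = u"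
    then show "cmod (inner_int f t) \<le> Re (inner_int g t)"
      unfolding inner_int_def using le
      by (intro H.I_mono[OF src_units H.slice_Cc[OF f] H.slice_Cc[OF g]]) (simp add: P2_def)
  qed
  show "continuous_on (units G) (\<lambda>u. I2 u f)" if "f \<in> Cc" for f
    unfolding I2_def by (rule H.I_cont[OF inner_int_Cc[OF that]])
  show "I2 (src G x) g = I2 (rng G x) f"
    if f: "f \<in> Cc" and g: "g \<in> Cc" and eq: "\<And>p. p \<in> P2 \<Longrightarrow> rng G (fst p) = src G x \<Longrightarrow> g p = f (x \<cdot> fst p, snd p)" for f g x
    unfolding I2_def
  proof (rule H.I_inv[OF inner_int_Cc[OF f] inner_int_Cc[OF g]])
    fix p assume p: "rng G p = src G x"
    show "inner_int g p = inner_int f (x \<cdot> p)"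
      by (rule inner_int_cong) (use p eq in \<open>auto simp: src_mult P2_def\<close>)
  qed
qed

lemma L2_inner_I1: "L2_inner G u f g = I1 u (\<lambda>t. cnj (f t) * g t)"
  by (simp add: L2_inner_def I1_def)

lemma L2_norm_ip: "f \<in> Cc \<Longrightarrow> u \<in> units G \<Longrightarrow> L2_norm G u f = sqrt (Re (H.ip u f f))"
proof -
  assume f: "f \<in> Cc" and u: "u \<in> units G"
  have "H.ip u f f = (\<integral>t. complex_of_real ((cmod (f t))\<^sup>2) \<partial>haar G u)"
    unfolding H.ip_def I1_def complex_cnj_mult_cmod ..
  also have "\<dots> = of_real (\<integral>t. (cmod (f t))\<^sup>2 \<partial>haar G u)" by (rule integral_complex_of_real)
  finally show ?thesis by (simp add: L2_norm_def)
qed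

text \<open>In convolution notation this is g * f^*, where f^* is the conjugate of the composition
  of f with inversion.\<close>

definition coef :: "('g \<Rightarrow> complex) \<Rightarrow> ('g \<Rightarrow> complex) \<Rightarrow> 'g \<Rightarrow> complex" where
  "coef f g x = L2_inner G (rng G x) (\<lambda>t. f (ginv G x \<cdot> t)) g"

lemma A_cf_coef: "A_cf G = {coef f g | f g. f \<in> Cc \<and> g \<in> Cc}"
  unfolding A_cf_def coef_def[abs_def] ..

lemma coef_I1: "coef f g = (\<lambda>x. I1 (rng G x) (\<lambda>t. cnj (f (ginv G x \<cdot> t)) * g t))"
  by (auto simp: coef_def L2_inner_I1)

lemma coef_B:
  assumes "f \<in> Cc" "g \<in> Cc" "\<And>u. u \<in> units G \<Longrightarrow> L2_norm G u f \<le> a" "\<And>u. u \<in> units G \<Longrightarrow> L2_norm G u g \<le> b"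
  shows "coef f g \<in> B_alg G" "B_norm G (coef f g) \<le> a * b"
  unfolding coef_I1 using H.coeff_B[OF assms(1,2), of a b] assms by (simp_all add: L2_norm_ip)

lemma L2_norm_bounded:
  assumes "f \<in> Cc"
  obtains a where "\<And>u. u \<in> units G \<Longrightarrow> L2_norm G u f \<le> a"
  using H.norm_bounded[OF assms] L2_norm_ip[OF assms] by metis

lemma coef_in_B: "f \<in> Cc \<Longrightarrow> g \<in> Cc \<Longrightarrow> coef f g \<in> B_alg G"
proof -
  assume f: "f \<in> Cc" and g: "g \<in> Cc"
  obtain a where a: "\<And>u. u \<in> units G \<Longrightarrow> L2_norm G u f \<le> a" by (rule L2_norm_bounded[OF f]) blast
  obtain b where b: "\<And>u. u \<in> units G \<Longrightarrow> L2_norm G u g \<le> b" by (rule L2_norm_bounded[OF g]) blast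
  show ?thesis by (rule coef_B(1)[OF f g a b])
qed

text \<open>If the integrand is nonzero at t, then t lies in the support of g and y = x^-1 t in that
  of f, whence x = t y^-1. So the coefficient lives on the compact set of such products.\<close>

lemma coef_Cc:
  assumes f: "f \<in> Cc" and g: "g \<in> Cc"
  shows "coef f g \<in> Cc"
proof -
  obtain K where K: "compact K" "\<And>x. x \<notin> K \<Longrightarrow> f x = 0" by (rule CcE[OF f]) blast
  obtain M where M: "compact M" "\<And>x. x \<notin> M \<Longrightarrow> g x = 0" by (rule CcE[OF g]) blast
  let ?Q = "{p\<in>UNIV. src G (fst p) = src G (snd p)}"
  have cl: "closed ?Q"
    by (intro closed_equalizer closed_UNIV continuous_on_compose2[OF cont_src] continuous_on_fst continuous_on_snd continuous_on_id) auto
  have c: "continuous_on ?Q (\<lambda>p. fst p \<cdot> ginv G (snd p))"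
    by (intro cont_mult continuous_on_compose2[OF cont_inv[of UNIV]] continuous_on_fst continuous_on_snd continuous_on_id) auto
  show ?thesis
  proof (rule CcI)
    show "continuous_on UNIV (coef f g)" by (rule B_cont[OF coef_in_B[OF f g]])
    show "compact ((\<lambda>p. fst p \<cdot> ginv G (snd p)) ` ((M \<times> K) \<inter> ?Q))"
      by (intro compact_continuous_image compact_Int_closed compact_Times K M cl continuous_on_subset[OF c]) auto
    fix x assume x: "x \<notin> (\<lambda>p. fst p \<cdot> ginv G (snd p)) ` ((M \<times> K) \<inter> ?Q)"
    have "cnj (f (ginv G x \<cdot> t)) * g t = 0" if t: "rng G t = rng G x" for t
    proof (rule ccontr)
      assume "cnj (f (ginv G x \<cdot> t)) * g t \<noteq> 0"
      then have "t \<in> M" "ginv G x \<cdot> t \<in> K" using K(2) M(2) by auto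
      moreover have "src G t = src G (ginv G x \<cdot> t)" using t by (simp add: src_mult)
      moreover have "t \<cdot> ginv G (ginv G x \<cdot> t) = x"
      proof -
        have "ginv G (ginv G x \<cdot> t) = ginv G t \<cdot> x" using t by (simp add: inv_mult)
        then show ?thesis using t by (simp add: inv_cancel2)
      qed
      ultimately have "x = fst (t, ginv G x \<cdot> t) \<cdot> ginv G (snd (t, ginv G x \<cdot> t))" "(t, ginv G x \<cdot> t) \<in> (M \<times> K) \<inter> ?Q" by auto
      then show False using x by blast
    qed
    then have "coef f g x = I1 (rng G x) (\<lambda>t. 0)"
      unfolding coef_I1 by (intro H.I_cong) auto
    then show "coef f g x = 0" by (simp add: H.I_zero)
  qed
qed

lemma D_cont: "b \<in> D G \<Longrightarrow> continuous_on (units G) b"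
  by (simp add: C0_def)

lemma D_zero: "b \<in> D G \<Longrightarrow> u \<notin> units G \<Longrightarrow> b u = 0"
  by (simp add: C0_def)

lemma D_bounded:
  assumes b: "b \<in> D G"
  obtains M where "M \<ge> 0" "\<And>u. u \<in> units G \<Longrightarrow> cmod (b u) \<le> M"
proof -
  obtain K where K: "compact K" "K \<subseteq> units G" "\<forall>x\<in>units G - K. cmod (b x) < 1"
    using b unfolding C0_def mem_Collect_eq by (meson zero_less_one)
  have "bounded (b ` K)" by (intro compact_imp_bounded compact_continuous_image K continuous_on_subset[OF D_cont[OF b] K(2)])
  then obtain B where B: "\<And>x. x \<in> K \<Longrightarrow> cmod (b x) \<le> B" unfolding bounded_iff by blast
  have "cmod (b u) \<le> max 1 B" if "u \<in> units G" for u
  proof (cases "u \<in> K")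
    case True
    then show ?thesis using B[of u] by simp
  next
    case False
    then have "cmod (b u) < 1" using K(3) that by simp
    then show ?thesis by simp
  qed
  then show ?thesis by (intro that[of "max 1 B"]) auto
qed

lemma D_rng_cont: "b \<in> D G \<Longrightarrow> continuous_on A (\<lambda>x. b (rng G x))"
  by (rule continuous_on_compose2[OF D_cont cont_rng']) auto

lemma coef_right: "coef f (\<lambda>t. g t * b (rng G t)) x = coef f g x * b (rng G x)"
proof -
  have "coef f (\<lambda>t. g t * b (rng G t)) x = (\<integral>t. (cnj (f (ginv G x \<cdot> t)) * g t) * b (rng G x) \<partial>haar G (rng G x))"
    unfolding coef_def L2_inner_def by (intro Bochner_Integration.integral_cong) (auto simp: space_haar mult.assoc)
  also have "\<dots> = coef f g x * b (rng G x)" unfolding coef_def L2_inner_def by (rule integral_mult_left_zero)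
  finally show ?thesis .
qed

text \<open>Here f is evaluated at x^-1 t, whose range is the source of x. A factor of f that
  depends on the range thus becomes a function of the source of x, conjugated because f enters
  conjugated.\<close>

lemma coef_left: "coef (\<lambda>t. f t * cnj (b (rng G t))) g x = b (src G x) * coef f g x"
proof -
  have "coef (\<lambda>t. f t * cnj (b (rng G t))) g x = (\<integral>t. b (src G x) * (cnj (f (ginv G x \<cdot> t)) * g t) \<partial>haar G (rng G x))"
    unfolding coef_def L2_inner_def by (intro Bochner_Integration.integral_cong) (auto simp: space_haar rng_mult)
  also have "\<dots> = b (src G x) * coef f g x" unfolding coef_def L2_inner_def by (rule integral_mult_right_zero)
  finally show ?thesis .
qed

lemma A_cf_alg_B: "\<phi> \<in> A_cf_alg G \<Longrightarrow> \<phi> \<in> B_alg G"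
  by (induction rule: A_cf_alg.induct) (auto simp: A_cf_coef intro: coef_in_B B_add(1) B_scale(1) B_mult(1))

lemma A_cf_alg_Cc: "\<phi> \<in> A_cf_alg G \<Longrightarrow> \<phi> \<in> Cc"
  by (induction rule: A_cf_alg.induct) (auto simp: A_cf_coef intro: coef_Cc Cc_add Cc_scale Cc_mult)

lemma A_cf_alg_right: "\<phi> \<in> A_cf_alg G \<Longrightarrow> b \<in> D G \<Longrightarrow> (\<lambda>x. \<phi> x * b (rng G x)) \<in> A_cf_alg G"
proof (induction rule: A_cf_alg.induct)
  case (gen \<phi>)
  then obtain f g where fg: "\<phi> = coef f g" "f \<in> Cc" "g \<in> Cc" by (auto simp: A_cf_coef)
  have "(\<lambda>x. \<phi> x * b (rng G x)) = coef f (\<lambda>t. g t * b (rng G t))" by (auto simp: coef_right fg(1))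
  moreover have "(\<lambda>t. g t * b (rng G t)) \<in> Cc" by (rule Cc_mult_cont(1)[OF fg(3) D_rng_cont[OF gen(2)]])
  ultimately show ?case using fg by (intro A_cf_alg.gen) (auto simp: A_cf_coef)
next
  case (add \<phi> \<psi>)
  then show ?case using A_cf_alg.add by (simp add: distrib_right)
next
  case (scale \<phi> c)
  then show ?case using A_cf_alg.scale by (simp add: mult.assoc)
next
  case (mult \<phi> \<psi>)
  then show ?case using A_cf_alg.mult[of \<phi> G "\<lambda>x. \<psi> x * b (rng G x)"] by (simp add: mult.assoc)
qed

lemma A_cf_alg_left: "\<phi> \<in> A_cf_alg G \<Longrightarrow> b \<in> D G \<Longrightarrow> (\<lambda>x. b (src G x) * \<phi> x) \<in> A_cf_alg G"
proof (induction rule: A_cf_alg.induct)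
  case (gen \<phi>)
  then obtain f g where fg: "\<phi> = coef f g" "f \<in> Cc" "g \<in> Cc" by (auto simp: A_cf_coef)
  have "(\<lambda>x. b (src G x) * \<phi> x) = coef (\<lambda>t. f t * cnj (b (rng G t))) g" by (auto simp: coef_left fg(1))
  moreover have "(\<lambda>t. f t * cnj (b (rng G t))) \<in> Cc"
    by (rule Cc_mult_cont(1)[OF fg(2)]) (intro continuous_on_cnj D_rng_cont gen(2))
  ultimately show ?case using fg by (intro A_cf_alg.gen) (auto simp: A_cf_coef)
next
  case (add \<phi> \<psi>)
  then show ?case using A_cf_alg.add by (simp add: distrib_left)
next
  case (scale \<phi> c)
  have "(\<lambda>x. b (src G x) * (c * \<phi> x)) = (\<lambda>x. c * (b (src G x) * \<phi> x))" by (simp add: mult.left_commute)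
  then show ?case using A_cf_alg.scale[OF scale.IH[OF scale.prems], of c] by simp
next
  case (mult \<phi> \<psi>)
  then show ?case using A_cf_alg.mult[of "\<lambda>x. b (src G x) * \<phi> x" G \<psi>] by (simp add: mult.assoc)
qed

section \<open>Closure properties of the Fourier algebra\<close>

lemma fa_B: "\<phi> \<in> fourier_alg G \<Longrightarrow> \<phi> \<in> B_alg G"
  by (simp add: fourier_alg_def)

lemma fa_approx:
  assumes "\<phi> \<in> fourier_alg G" "e > 0"
  obtains \<psi> where "\<psi> \<in> A_cf_alg G" "\<psi> \<in> B_alg G" "B_norm G (\<lambda>x. \<phi> x - \<psi> x) < e"
  using assms A_cf_alg_B unfolding fourier_alg_def by blast

lemma fa_I:
  assumes "\<phi> \<in> B_alg G" "\<And>e. e > 0 \<Longrightarrow> \<exists>\<psi>\<in>A_cf_alg G. B_norm G (\<lambda>x. \<phi> x - \<psi> x) < e"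
  shows "\<phi> \<in> fourier_alg G"
  using assms by (simp add: fourier_alg_def)

lemma A_cf_alg_fa: "\<phi> \<in> A_cf_alg G \<Longrightarrow> \<phi> \<in> fourier_alg G"
  by (rule fa_I[OF A_cf_alg_B], assumption, rule bexI[of _ \<phi>]) (simp_all add: B_zero(2))

lemma coef_alg: "f \<in> Cc \<Longrightarrow> g \<in> Cc \<Longrightarrow> coef f g \<in> A_cf_alg G"
  by (rule A_cf_alg.gen) (auto simp: A_cf_coef)

lemma coef_fa: "f \<in> Cc \<Longrightarrow> g \<in> Cc \<Longrightarrow> coef f g \<in> fourier_alg G"
  by (intro A_cf_alg_fa coef_alg)

lemma fa_closed:
  assumes psi: "\<psi> \<in> B_alg G" and ap: "\<And>e. e > 0 \<Longrightarrow> \<exists>\<phi>\<in>fourier_alg G. B_norm G (\<lambda>x. \<psi> x - \<phi> x) < e"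
  shows "\<psi> \<in> fourier_alg G"
proof (rule fa_I[OF psi])
  fix e :: real assume e: "e > 0"
  obtain \<phi> where phi: "\<phi> \<in> fourier_alg G" "B_norm G (\<lambda>x. \<psi> x - \<phi> x) < e/2" using ap[OF half_gt_zero[OF e]] by blast
  obtain \<omega> where o: "\<omega> \<in> A_cf_alg G" "\<omega> \<in> B_alg G" "B_norm G (\<lambda>x. \<phi> x - \<omega> x) < e/2"
    by (rule fa_approx[OF phi(1) half_gt_zero[OF e]])
  have "B_norm G (\<lambda>x. \<psi> x - \<omega> x) < e"
    using B_triangle_diff[OF psi fa_B[OF phi(1)] o(2)] phi(2) o(3) by simp
  then show "\<exists>\<psi>'\<in>A_cf_alg G. B_norm G (\<lambda>x. \<psi> x - \<psi>' x) < e" using o(1) by blast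
qed

lemma fa_add:
  assumes phi: "\<phi> \<in> fourier_alg G" and psi: "\<psi> \<in> fourier_alg G"
  shows "(\<lambda>x. \<phi> x + \<psi> x) \<in> fourier_alg G"
proof (rule fa_I[OF B_add(1)[OF fa_B[OF phi] fa_B[OF psi]]])
  fix e :: real assume e: "e > 0"
  obtain p where p: "p \<in> A_cf_alg G" "p \<in> B_alg G" "B_norm G (\<lambda>x. \<phi> x - p x) < e/2"
    by (rule fa_approx[OF phi half_gt_zero[OF e]])
  obtain q where q: "q \<in> A_cf_alg G" "q \<in> B_alg G" "B_norm G (\<lambda>x. \<psi> x - q x) < e/2"
    by (rule fa_approx[OF psi half_gt_zero[OF e]])
  have "(\<lambda>x. (\<phi> x + \<psi> x) - (p x + q x)) = (\<lambda>x. (\<phi> x - p x) + (\<psi> x - q x))" by auto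
  then have "B_norm G (\<lambda>x. (\<phi> x + \<psi> x) - (p x + q x)) < e"
    using B_add(2)[OF B_diff(1)[OF fa_B[OF phi] p(2)] B_diff(1)[OF fa_B[OF psi] q(2)]] p(3) q(3) by simp
  then show "\<exists>\<psi>'\<in>A_cf_alg G. B_norm G (\<lambda>x. (\<phi> x + \<psi> x) - \<psi>' x) < e"
    by (intro bexI[OF _ A_cf_alg.add[OF p(1) q(1)]])
qed

lemma fa_left:
  assumes phi: "\<phi> \<in> fourier_alg G" and b: "b \<in> D G"
  shows "(\<lambda>x. b (src G x) * \<phi> x) \<in> fourier_alg G"
proof -
  obtain M where M: "M \<ge> 0" "\<And>u. u \<in> units G \<Longrightarrow> cmod (b u) \<le> M" by (rule D_bounded[OF b]) blast
  show ?thesis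
  proof (rule fa_I[OF B_left(1)[OF fa_B[OF phi] D_cont[OF b] M(2)]])
    fix e :: real assume e: "e > 0"
    have p: "M + 1 > 0" using M(1) by simp
    then have e': "e / (M + 1) > 0" using e by simp
    obtain q where q: "q \<in> A_cf_alg G" "q \<in> B_alg G" "B_norm G (\<lambda>x. \<phi> x - q x) < e / (M + 1)"
      by (rule fa_approx[OF phi e'])
    note d = B_diff(1)[OF fa_B[OF phi] q(2)]
    have "B_norm G (\<lambda>x. b (src G x) * (\<phi> x - q x)) \<le> M * B_norm G (\<lambda>x. \<phi> x - q x)"
      by (rule B_left(2)[OF d D_cont[OF b] M(2)])
    also have "\<dots> \<le> (M + 1) * B_norm G (\<lambda>x. \<phi> x - q x)"
      using B_norm_nonneg[OF d] by (intro mult_right_mono) auto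
    also have "\<dots> < e" using q(3) p by (simp only: pos_less_divide_eq mult.commute)
    finally have "B_norm G (\<lambda>x. b (src G x) * \<phi> x - b (src G x) * q x) < e" by (simp only: right_diff_distrib)
    then show "\<exists>\<psi>'\<in>A_cf_alg G. B_norm G (\<lambda>x. b (src G x) * \<phi> x - \<psi>' x) < e"
      by (intro bexI[OF _ A_cf_alg_left[OF q(1) b]])
  qed
qed

lemma fa_right:
  assumes phi: "\<phi> \<in> fourier_alg G" and b: "b \<in> D G"
  shows "(\<lambda>x. \<phi> x * b (rng G x)) \<in> fourier_alg G"
proof -
  obtain M where M: "M \<ge> 0" "\<And>u. u \<in> units G \<Longrightarrow> cmod (b u) \<le> M" by (rule D_bounded[OF b]) blast
  show ?thesis
  proof (rule fa_I[OF B_right(1)[OF fa_B[OF phi] D_cont[OF b] M(2)]])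
    fix e :: real assume e: "e > 0"
    have p: "M + 1 > 0" using M(1) by simp
    then have e': "e / (M + 1) > 0" using e by simp
    obtain q where q: "q \<in> A_cf_alg G" "q \<in> B_alg G" "B_norm G (\<lambda>x. \<phi> x - q x) < e / (M + 1)"
      by (rule fa_approx[OF phi e'])
    note d = B_diff(1)[OF fa_B[OF phi] q(2)]
    have "B_norm G (\<lambda>x. (\<phi> x - q x) * b (rng G x)) \<le> M * B_norm G (\<lambda>x. \<phi> x - q x)"
      by (rule B_right(2)[OF d D_cont[OF b] M(2)])
    also have "\<dots> \<le> (M + 1) * B_norm G (\<lambda>x. \<phi> x - q x)"
      using B_norm_nonneg[OF d] by (intro mult_right_mono) auto
    also have "\<dots> < e" using q(3) p by (simp only: pos_less_divide_eq mult.commute)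
    finally have "B_norm G (\<lambda>x. \<phi> x * b (rng G x) - q x * b (rng G x)) < e" by (simp only: left_diff_distrib)
    then show "\<exists>\<psi>'\<in>A_cf_alg G. B_norm G (\<lambda>x. \<phi> x * b (rng G x) - \<psi>' x) < e"
      by (intro bexI[OF _ A_cf_alg_right[OF q(1) b]])
  qed
qed

lemma fa_mult:
  assumes phi: "\<phi> \<in> fourier_alg G" and psi: "\<psi> \<in> fourier_alg G"
  shows "(\<lambda>x. \<phi> x * \<psi> x) \<in> fourier_alg G"
proof (rule fa_I[OF B_mult(1)[OF fa_B[OF phi] fa_B[OF psi]]])
  fix e :: real assume e: "e > 0"
  have p1: "B_norm G \<psi> + 1 > 0" using B_norm_nonneg[OF fa_B[OF psi]] by simp
  then have e1: "e / (2 * (B_norm G \<psi> + 1)) > 0" using e by simp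
  obtain p where p: "p \<in> A_cf_alg G" "p \<in> B_alg G" "B_norm G (\<lambda>x. \<phi> x - p x) < e / (2 * (B_norm G \<psi> + 1))"
    by (rule fa_approx[OF phi e1])
  have p2: "B_norm G p + 1 > 0" using B_norm_nonneg[OF p(2)] by simp
  then have e2: "e / (2 * (B_norm G p + 1)) > 0" using e by simp
  obtain q where q: "q \<in> A_cf_alg G" "q \<in> B_alg G" "B_norm G (\<lambda>x. \<psi> x - q x) < e / (2 * (B_norm G p + 1))"
    by (rule fa_approx[OF psi e2])
  note d1 = B_diff(1)[OF fa_B[OF phi] p(2)] and d2 = B_diff(1)[OF fa_B[OF psi] q(2)]
  have dp: "e / (2 * r) * r = e/2" if "r > 0" for r using that by (simp add: field_simps)
  have "B_norm G (\<lambda>x. (\<phi> x - p x) * \<psi> x) \<le> B_norm G (\<lambda>x. \<phi> x - p x) * B_norm G \<psi>"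
    by (rule B_mult(2)[OF d1 fa_B[OF psi]])
  also have "\<dots> \<le> B_norm G (\<lambda>x. \<phi> x - p x) * (B_norm G \<psi> + 1)"
    using B_norm_nonneg[OF d1] by (intro mult_left_mono) auto
  also have "\<dots> < e / (2 * (B_norm G \<psi> + 1)) * (B_norm G \<psi> + 1)" by (rule mult_strict_right_mono[OF p(3) p1])
  finally have 1: "B_norm G (\<lambda>x. (\<phi> x - p x) * \<psi> x) < e/2" unfolding dp[OF p1] .
  have "B_norm G (\<lambda>x. p x * (\<psi> x - q x)) \<le> B_norm G p * B_norm G (\<lambda>x. \<psi> x - q x)"
    by (rule B_mult(2)[OF p(2) d2])
  also have "\<dots> \<le> B_norm G (\<lambda>x. \<psi> x - q x) * (B_norm G p + 1)"
    using B_norm_nonneg[OF d2] by (subst mult.commute) (intro mult_left_mono, auto)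
  also have "\<dots> < e / (2 * (B_norm G p + 1)) * (B_norm G p + 1)" by (rule mult_strict_right_mono[OF q(3) p2])
  finally have 2: "B_norm G (\<lambda>x. p x * (\<psi> x - q x)) < e/2" unfolding dp[OF p2] .
  have "(\<lambda>x. \<phi> x * \<psi> x - p x * q x) = (\<lambda>x. (\<phi> x - p x) * \<psi> x + p x * (\<psi> x - q x))"
    by (auto simp: algebra_simps)
  then have "B_norm G (\<lambda>x. \<phi> x * \<psi> x - p x * q x) < e"
    using B_add(2)[OF B_mult(1)[OF d1 fa_B[OF psi]] B_mult(1)[OF p(2) d2]] 1 2 by simp
  then show "\<exists>\<psi>'\<in>A_cf_alg G. B_norm G (\<lambda>x. \<phi> x * \<psi> x - \<psi>' x) < e"
    by (intro bexI[OF _ A_cf_alg.mult[OF p(1) q(1)]])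
qed

lemma fa_scale:
  assumes phi: "\<phi> \<in> fourier_alg G"
  shows "(\<lambda>x. c * \<phi> x) \<in> fourier_alg G"
proof (rule fa_I[OF B_scale(1)[OF fa_B[OF phi]]])
  fix e :: real assume e: "e > 0"
  have p: "cmod c + 1 > 0" by (simp add: add_nonneg_pos)
  then have e': "e / (cmod c + 1) > 0" using e by simp
  obtain q where q: "q \<in> A_cf_alg G" "q \<in> B_alg G" "B_norm G (\<lambda>x. \<phi> x - q x) < e / (cmod c + 1)"
    by (rule fa_approx[OF phi e'])
  note d = B_diff(1)[OF fa_B[OF phi] q(2)]
  have "B_norm G (\<lambda>x. c * (\<phi> x - q x)) \<le> cmod c * B_norm G (\<lambda>x. \<phi> x - q x)" by (rule B_scale(2)[OF d])
  also have "\<dots> \<le> (cmod c + 1) * B_norm G (\<lambda>x. \<phi> x - q x)"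
    using B_norm_nonneg[OF d] by (intro mult_right_mono) auto
  also have "\<dots> < e" using q(3) p by (simp only: pos_less_divide_eq mult.commute)
  finally have "B_norm G (\<lambda>x. c * \<phi> x - c * q x) < e" by (simp only: right_diff_distrib)
  then show "\<exists>\<psi>'\<in>A_cf_alg G. B_norm G (\<lambda>x. c * \<phi> x - \<psi>' x) < e"
    by (intro bexI[OF _ A_cf_alg.scale[OF q(1), of c]])
qed

lemma fa_cont: "\<phi> \<in> fourier_alg G \<Longrightarrow> continuous_on A \<phi>"
  by (intro B_cont fa_B)

lemma fa_vanish:
  assumes phi: "\<phi> \<in> fourier_alg G" and e: "e > 0"
  obtains K where "compact K" "\<And>x. x \<notin> K \<Longrightarrow> cmod (\<phi> x) < e"
proof -
  obtain p where p: "p \<in> A_cf_alg G" "p \<in> B_alg G" "B_norm G (\<lambda>x. \<phi> x - p x) < e" by (rule fa_approx[OF assms])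
  obtain K where K: "compact K" "\<And>x. x \<notin> K \<Longrightarrow> p x = 0" by (rule CcE[OF A_cf_alg_Cc[OF p(1)]]) blast
  have "cmod (\<phi> x) < e" if "x \<notin> K" for x
    using B_sup[OF B_diff(1)[OF fa_B[OF phi] p(2)], of x] p(3) K(2)[OF that] by simp
  then show ?thesis using that K(1) by blast
qed

end

section \<open>Peak functions\<close>

context gspace
begin

text \<open>The composition of f with the action of x is meaningful on one fibre only and need not
  belong to \<open>Cc\<close>. The axiom of invariance is applied to its extension
  \<open>shift\<close>, which agrees with it there.\<close>

lemma I_shift:
  assumes f: "f \<in> Cc"
  shows "I (src G x) (\<lambda>p. f (pact x p)) = I (rng G x) f"
proof -
  have "I (src G x) (\<lambda>p. f (pact x p)) = I (src G x) (shift (ginv G x) f)"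
    by (rule I_cong[OF src_units]) (simp add: shift(2)[OF f])
  also have "\<dots> = I (rng G x) f"
    by (rule I_inv[OF f shift(1)[OF f]]) (simp add: shift(2)[OF f])
  finally show ?thesis .
qed

end

context lcg
begin

definition nsq :: "'g \<Rightarrow> ('g \<Rightarrow> complex) \<Rightarrow> real" where "nsq u f = (\<integral>t. (cmod (f t))\<^sup>2 \<partial>haar G u)"

lemma L2_norm_nsq: "L2_norm G u f = sqrt (nsq u f)"
  by (simp add: L2_norm_def nsq_def)

lemma nsq_I1: "I1 u (\<lambda>t. cnj (f t) * f t) = of_real (nsq u f)"
proof -
  have "I1 u (\<lambda>t. cnj (f t) * f t) = (\<integral>t. complex_of_real ((cmod (f t))\<^sup>2) \<partial>haar G u)"
    unfolding I1_def complex_cnj_mult_cmod ..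
  also have "\<dots> = of_real (nsq u f)" unfolding nsq_def by (rule integral_complex_of_real)
  finally show ?thesis .
qed

lemma nsq_cont: "f \<in> Cc \<Longrightarrow> continuous_on (units G) (\<lambda>u. nsq u f)"
proof -
  assume f: "f \<in> Cc"
  have "continuous_on (units G) (\<lambda>u. Re (I1 u (\<lambda>t. cnj (f t) * f t)))"
    by (intro continuous_on_Re H.I_cont H.cnj_mult_Cc f)
  then show ?thesis unfolding nsq_I1 by simp
qed

lemma cmod_sq_integrable: "u \<in> units G \<Longrightarrow> f \<in> Cc \<Longrightarrow> integrable (haar G u) (\<lambda>t. (cmod (f t))\<^sup>2)"
proof -
  assume u: "u \<in> units G" and f: "f \<in> Cc"
  have "integrable (haar G u) (\<lambda>t. Re (cnj (f t) * f t))"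
    by (intro integrable_Re haar_integrable u H.cnj_mult_Cc f)
  then show ?thesis unfolding complex_cnj_mult_cmod by simp
qed

lemma nsq_mono:
  assumes u: "u \<in> units G" and f: "f \<in> Cc" and g: "g \<in> Cc"
    and le: "\<And>t. rng G t = u \<Longrightarrow> cmod (f t) \<le> c * cmod (g t)"
  shows "nsq u f \<le> c\<^sup>2 * nsq u g"
proof -
  have "nsq u f \<le> (\<integral>t. c\<^sup>2 * (cmod (g t))\<^sup>2 \<partial>haar G u)"
    unfolding nsq_def
  proof (rule integral_mono[OF cmod_sq_integrable[OF u f]])
    show "integrable (haar G u) (\<lambda>t. c\<^sup>2 * (cmod (g t))\<^sup>2)" using cmod_sq_integrable[OF u g] by simp
    fix t assume "t \<in> space (haar G u)"
    then have "cmod (f t) \<le> c * cmod (g t)" using le u by (simp add: space_haar)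
    then have "(cmod (f t))\<^sup>2 \<le> (c * cmod (g t))\<^sup>2" by (rule power_mono) simp
    then show "(cmod (f t))\<^sup>2 \<le> c\<^sup>2 * (cmod (g t))\<^sup>2" by (simp add: power_mult_distrib)
  qed
  then show ?thesis by (simp add: nsq_def)
qed

lemma nsq_zero:
  assumes u: "u \<in> units G" and "\<And>t. rng G t = u \<Longrightarrow> f t = 0"
  shows "nsq u f = 0"
proof -
  have "nsq u f = (\<integral>t. 0 \<partial>haar G u)"
    unfolding nsq_def by (rule Bochner_Integration.integral_cong) (use assms in \<open>auto simp: space_haar\<close>)
  then show ?thesis by simp
qed

lemma nsq_nonneg: "0 \<le> nsq u f"
  unfolding nsq_def by (rule integral_nonneg_AE) simp

lemma nsq_shift: "f \<in> Cc \<Longrightarrow> nsq (src G x) (\<lambda>t. f (x \<cdot> t)) = nsq (rng G x) f"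
proof -
  assume f: "f \<in> Cc"
  have "complex_of_real (nsq (src G x) (\<lambda>t. f (x \<cdot> t))) = of_real (nsq (rng G x) f)"
    unfolding nsq_I1[symmetric] by (rule H.I_shift[OF H.cnj_mult_Cc[OF f f]])
  then show ?thesis by (simp only: of_real_eq_iff)
qed

lemma I1_scale: "I1 u (\<lambda>t. c * f t) = c * I1 u f"
  unfolding I1_def by simp

lemma I1_of_real: "I1 u (\<lambda>t. of_real (h t)) = of_real (\<integral>t. h t \<partial>haar G u)"
  unfolding I1_def by (rule integral_complex_of_real)

lemma units_nhd:
  fixes c :: "'g \<Rightarrow> real"
  assumes "continuous_on (units G) c" "v \<in> units G" "c v < a"
  obtains W where "open W" "v \<in> W" "\<And>w. w \<in> W \<Longrightarrow> w \<in> units G \<Longrightarrow> c w < a"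
proof -
  have "openin (top_of_set (units G)) (units G \<inter> c -` {..<a})"
    by (rule continuous_openin_preimage_gen[OF assms(1)]) simp
  then obtain W where W: "open W" "units G \<inter> c -` {..<a} = units G \<inter> W" by (auto simp: openin_open)
  show ?thesis by (rule that[OF W(1)]) (use W(2) assms in auto)
qed

text \<open>Multiplication is continuous on the closed set of composable pairs. Adding the open
  complement to the preimage of U gives an open set around {x0} \<times> K, to which the tube lemma
  applies.\<close>

lemma mult_tube:
  assumes K: "compact K" and U: "open U" and sub: "\<And>w. w \<in> K \<Longrightarrow> rng G w = src G x0 \<Longrightarrow> x0 \<cdot> w \<in> U"
  obtains V where "open V" "x0 \<in> V" "\<And>x w. x \<in> V \<Longrightarrow> w \<in> K \<Longrightarrow> rng G w = src G x \<Longrightarrow> x \<cdot> w \<in> U"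
proof -
  have cl: "closed P2" by (rule H2.closed_P)
  have c: "continuous_on P2 (\<lambda>p. fst p \<cdot> snd p)"
    by (rule cont_mult) (auto intro!: continuous_intros simp: P2_def)
  have "openin (top_of_set P2) (P2 \<inter> (\<lambda>p. fst p \<cdot> snd p) -` U)"
    by (rule continuous_openin_preimage_gen[OF c U])
  then obtain W where W: "open W" "P2 \<inter> (\<lambda>p. fst p \<cdot> snd p) -` U = P2 \<inter> W" by (auto simp: openin_open)
  have "open (W \<union> - P2)" using W(1) cl by (intro open_Un open_Compl)
  moreover have "{x0} \<times> K \<subseteq> W \<union> - P2"
  proof
    fix z assume "z \<in> {x0} \<times> K"
    then obtain w where w: "z = (x0, w)" "w \<in> K" by auto
    show "z \<in> W \<union> - P2"
    proof (cases "z \<in> P2")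
      case True
      then have "z \<in> P2 \<inter> (\<lambda>p. fst p \<cdot> snd p) -` U" using sub w by (auto simp: P2_def)
      then show ?thesis using W(2) by blast
    qed simp
  qed
  ultimately have "\<exists>V. x0 \<in> V \<and> open V \<and> V \<times> K \<subseteq> W \<union> - P2" by (rule Elementary_Topology.tube_lemma[OF K])
  then obtain V where V: "x0 \<in> V" "open V" "V \<times> K \<subseteq> W \<union> - P2" by blast
  show ?thesis
  proof (rule that[OF V(2,1)])
    fix x w assume a: "x \<in> V" "w \<in> K" "rng G w = src G x"
    then have "(x, w) \<in> P2" "(x, w) \<in> W \<union> - P2" using V(3) by (auto simp: P2_def)
    then have "(x, w) \<in> P2 \<inter> W" by blast
    then show "x \<cdot> w \<in> U" unfolding W(2)[symmetric] by simp
  qed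
qed

lemma haar_open_SUP:
  assumes "u \<in> units G" "openin (top_of_set (fib u)) V"
  shows "emeasure (haar G u) V = (SUP K\<in>{K. compactin (top_of_set (fib u)) K \<and> K \<subseteq> V}. emeasure (haar G u) K)"
proof -
  have "\<forall>V. openin (top_of_set (fib u)) V \<longrightarrow> emeasure (haar G u) V =
      (SUP K\<in>{K. compactin (top_of_set (fib u)) K \<and> K \<subseteq> V}. emeasure (haar G u) K)"
    using haar_regular[OF assms(1)] unfolding regular_borel_measure_def by (elim conjE)
  then show ?thesis using assms(2) by blast
qed

text \<open>C carries more than half of the mass of N on the fibre. This factor 2, together with
  those lost on nearby fibres and by a truncation, makes up the bound 16 in
  \<open>peak\<close>.\<close>

lemma haar_inner_regular:
  assumes v: "v \<in> units G" and N: "open N" "v \<in> N" "N \<subseteq> K" "compact K"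
  obtains C where "compact C" "C \<subseteq> N" "C \<subseteq> fib v" "0 < measure (haar G v) (N \<inter> fib v)"
    "measure (haar G v) (N \<inter> fib v) < 2 * measure (haar G v) C"
proof -
  let ?M = "haar G v"
  let ?V = "N \<inter> fib v"
  have Vs: "?V \<in> sets ?M" using N(1) by (intro haar_borel_sets v) simp
  have "emeasure ?M ?V \<le> emeasure ?M (K \<inter> fib v)"
    using N v by (intro emeasure_mono haar_closed_sets compact_imp_closed) auto
  then have fin: "emeasure ?M ?V < \<infinity>" using haar_compact[OF v N(4)] by (rule order_le_less_trans)
  have "v \<in> ?V" using N(2) v by (simp add: unit_rng)
  then have pos: "emeasure ?M ?V > 0" using haar v N(1) unfolding left_haar_system_def by blast
  have eq: "emeasure ?M ?V = ennreal (measure ?M ?V)" using fin by (intro emeasure_eq_ennreal_measure) auto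
  have mpos: "0 < measure ?M ?V" using pos unfolding eq by simp
  have "openin (top_of_set (fib v)) ?V" using N(1) by (auto simp: openin_open)
  then have "emeasure ?M ?V = (SUP C\<in>{C. compactin (top_of_set (fib v)) C \<and> C \<subseteq> ?V}. emeasure ?M C)"
    by (rule haar_open_SUP[OF v])
  moreover have "ennreal (measure ?M ?V / 2) < emeasure ?M ?V" unfolding eq using mpos by (intro ennreal_lessI) auto
  ultimately have "\<exists>C\<in>{C. compactin (top_of_set (fib v)) C \<and> C \<subseteq> ?V}. ennreal (measure ?M ?V / 2) < emeasure ?M C"
    by (simp add: less_SUP_iff)
  then obtain C where C: "compactin (top_of_set (fib v)) C" "C \<subseteq> ?V" "ennreal (measure ?M ?V / 2) < emeasure ?M C" by blast
  have Cc: "compact C" "C \<subseteq> fib v" using C(1) by (auto simp: compactin_subtopology)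
  have "emeasure ?M C = ennreal (measure ?M C)"
    using order_le_less_trans[OF emeasure_mono[OF C(2) Vs] fin] by (intro emeasure_eq_ennreal_measure) auto
  then have "measure ?M ?V / 2 < measure ?M C" using C(3) by (simp add: ennreal_less_iff)
  then show ?thesis using that[OF Cc(1) _ Cc(2) mpos] C(2) by auto
qed

text \<open>
  In a group one would take for \<open>p\<close> and \<open>q\<close> the normalized indicator of a neighbourhood of the unit
  and the indicator of a slightly larger translate. Inner regularity of the measure provides
  continuous substitutes whose norms still have a product bounded by a constant.
\<close>

lemma peak:
  assumes N1: "open N1" "src G x0 \<in> N1" and N2: "open N2" "x0 \<in> N2"
  obtains p q V P Q where "p \<in> Cc" "q \<in> Cc" "open V" "x0 \<in> V" "\<And>x. x \<in> V \<Longrightarrow> coef p q x = 1"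
    "\<And>w. p w \<noteq> 0 \<Longrightarrow> w \<in> N1" "\<And>t. q t \<noteq> 0 \<Longrightarrow> t \<in> N2"
    "\<And>w. w \<in> units G \<Longrightarrow> nsq w p \<le> P\<^sup>2" "\<And>w. w \<in> units G \<Longrightarrow> nsq w q \<le> Q\<^sup>2" "P \<ge> 0" "Q \<ge> 0" "P * Q \<le> 16"
proof -
  define v where "v = src G x0"
  have v: "v \<in> units G" by (simp add: v_def)
  obtain N0 where N0: "open N0" "{v} \<subseteq> N0" "compact (closure N0)"
    by (rule lc_between[OF lc, of "{v}" UNIV]) auto
  \<comment> \<open>On the fibre over v the open set W describes the w for which x0 w lies in N2.
    Shrinking N by it puts the translate of this part of N by x0 into N2.\<close>
  have "continuous_on (fib v) (\<lambda>w. x0 \<cdot> w)" by (rule cont_mult) (auto simp: v_def)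
  from continuous_openin_preimage_gen[OF this N2(1)]
  obtain W where W: "open W" "fib v \<inter> (\<lambda>w. x0 \<cdot> w) -` N2 = fib v \<inter> W" by (auto simp: openin_open)
  have "x0 \<cdot> v = x0" unfolding v_def by simp
  then have "v \<in> fib v \<inter> (\<lambda>w. x0 \<cdot> w) -` N2" using N2(2) v by (simp add: unit_rng)
  then have vW: "v \<in> W" unfolding W(2) by simp
  define N where "N = N1 \<inter> N0 \<inter> W"
  have N: "open N" "v \<in> N" "N \<subseteq> closure N0" using N1 N0 W vW closure_subset[of N0] by (auto simp: N_def v_def)
  define \<mu> where "\<mu> = measure (haar G v) (N \<inter> fib v)"
  obtain C where C: "compact C" "C \<subseteq> N" "C \<subseteq> fib v" "0 < \<mu>" "\<mu> < 2 * measure (haar G v) C"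
    unfolding \<mu>_def by (rule haar_inner_regular[OF v N N0(3)])
  have ind_int: "integrable (haar G v) (indicator (N \<inter> fib v) :: 'g \<Rightarrow> real)" "integrable (haar G v) (indicator C :: 'g \<Rightarrow> real)"
  proof -
    have "emeasure (haar G v) (N \<inter> fib v) \<le> emeasure (haar G v) (closure N0 \<inter> fib v)"
      using N v by (intro emeasure_mono haar_closed_sets) auto
    then have "emeasure (haar G v) (N \<inter> fib v) < \<infinity>" using haar_compact[OF v N0(3)] by (rule order_le_less_trans)
    then show "integrable (haar G v) (indicator (N \<inter> fib v) :: 'g \<Rightarrow> real)"
      using N(1) v by (intro integrable_real_indicator haar_borel_sets) auto
    have CC: "C = C \<inter> fib v" using C(3) by blast
    show "integrable (haar G v) (indicator C :: 'g \<Rightarrow> real)"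
      by (subst CC, intro integrable_real_indicator haar_closed_sets haar_compact compact_imp_closed v C(1))
  qed
  obtain k :: "'g \<Rightarrow> real" and K0 where k: "continuous_on UNIV k" "\<And>x. 0 \<le> k x" "\<And>x. k x \<le> 1" "\<And>x. x \<in> C \<Longrightarrow> k x = 1"
    "compact K0" "K0 \<subseteq> N" "\<And>x. x \<notin> K0 \<Longrightarrow> k x = 0" "(\<lambda>x. complex_of_real (k x)) \<in> Cc"
    by (rule lc_bump[OF lc C(1) N(1) C(2)]) blast
  \<comment> \<open>From k the function p is made. As k2 equals 1 on the compact set outside which k
    vanishes, its translate, from which q is made, is 1 wherever the translate of k is
    nonzero.\<close>
  obtain k2 :: "'g \<Rightarrow> real" and K2 where k2: "\<And>x. 0 \<le> k2 x" "\<And>x. k2 x \<le> 1" "\<And>x. x \<in> K0 \<Longrightarrow> k2 x = 1"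
    "K2 \<subseteq> N" "\<And>x. x \<notin> K2 \<Longrightarrow> k2 x = 0" "(\<lambda>x. complex_of_real (k2 x)) \<in> Cc"
    by (rule lc_bump[OF lc k(5) N(1) k(6)]) blast
  let ?k = "\<lambda>x. complex_of_real (k x)" and ?k2 = "\<lambda>x. complex_of_real (k2 x)"
  have nsq_le: "nsq v (\<lambda>x. complex_of_real (h x)) \<le> \<mu>"
    if h: "(\<lambda>x. complex_of_real (h x)) \<in> Cc" "\<And>x. 0 \<le> h x" "\<And>x. h x \<le> 1" "\<And>x. x \<notin> N \<Longrightarrow> h x = 0" for h :: "'g \<Rightarrow> real"
  proof -
    have "nsq v (\<lambda>x. complex_of_real (h x)) \<le> (\<integral>x. indicator (N \<inter> fib v) x \<partial>haar G v)"
      unfolding nsq_def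
    proof (rule integral_mono[OF cmod_sq_integrable[OF v h(1)] ind_int(1)])
      fix x assume "x \<in> space (haar G v)"
      then have "x \<in> fib v" using space_haar[OF v] by simp
      then show "(cmod (complex_of_real (h x)))\<^sup>2 \<le> indicator (N \<inter> fib v) x"
        using h(2,3)[of x] h(4)[of x] by (cases "x \<in> N") (auto simp: power_le_one)
    qed
    also have "\<dots> = \<mu>" using space_haar[OF v] by (simp add: \<mu>_def Int_assoc)
    finally show ?thesis .
  qed
  have kv: "nsq v ?k \<le> \<mu>" using k(6,7) by (intro nsq_le k(8,2,3)) blast
  have k2v: "nsq v ?k2 \<le> \<mu>" using k2(4,5) by (intro nsq_le k2(6,1,2)) blast
  \<comment> \<open>The integral of k over the fibre at w, by which p is normalized. At v it is
    above \<mu> / 2, since k is 1 on C.\<close>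
  define c where "c w = Re (I1 w ?k)" for w
  have cI: "I1 w ?k = of_real (c w)" for w by (simp add: c_def I1_of_real)
  have c_cont: "continuous_on (units G) c" unfolding c_def by (intro continuous_on_Re H.I_cont k(8))
  have "measure (haar G v) C = (\<integral>x. indicator C x \<partial>haar G v)" using ind_int(2) C(3) space_haar[OF v] by (simp add: Int_absorb2)
  also have "\<dots> \<le> (\<integral>x. k x \<partial>haar G v)"
  proof (rule integral_mono[OF ind_int(2)])
    show "integrable (haar G v) k" using integrable_Re[OF haar_integrable[OF v k(8)]] by simp
    show "indicator C x \<le> k x" for x using k(2,4)[of x] by (cases "x \<in> C") auto
  qed
  also have "\<dots> = c v" by (simp add: c_def I1_of_real)
  finally have cv: "c v > \<mu> / 2" using C(5) by simp
  have cv0: "c v > 0" using cv C(4) by simp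
  obtain W1 where W1: "open W1" "v \<in> W1" "\<And>w. w \<in> W1 \<Longrightarrow> w \<in> units G \<Longrightarrow> nsq w ?k < 2 * \<mu>"
    by (rule units_nhd[OF nsq_cont[OF k(8)] v, of "2 * \<mu>"]) (use kv C(4) in auto)
  obtain W2 where W2: "open W2" "v \<in> W2" "\<And>w. w \<in> W2 \<Longrightarrow> w \<in> units G \<Longrightarrow> - c w < - (c v / 2)"
    by (rule units_nhd[OF continuous_on_minus[OF c_cont] v, of "- (c v / 2)"]) (use cv0 in auto)
  obtain U1 where U1: "open U1" "{v} \<subseteq> U1" "compact (closure U1)" "closure U1 \<subseteq> W1"
    by (rule lc_between[OF lc, of "{v}" W1]) (use W1 in auto)
  obtain \<beta> :: "'g \<Rightarrow> real" and K\<beta> where be: "continuous_on UNIV \<beta>" "\<And>x. 0 \<le> \<beta> x" "\<And>x. \<beta> x \<le> 1" "\<And>x. x \<in> closure U1 \<Longrightarrow> \<beta> x = 1"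
    "K\<beta> \<subseteq> W1" "\<And>x. x \<notin> K\<beta> \<Longrightarrow> \<beta> x = 0"
    by (rule lc_bump[OF lc U1(3) W1(1) U1(4)]) blast
  \<comment> \<open>Near v this is k divided by its integral. The maximum keeps the denominator away
    from 0 at all other units, and \<beta> restricts p to units where \<open>nsq\<close> of k is
    below 2 \<mu>.\<close>
  define p where "p t = ?k t * of_real (\<beta> (rng G t) / max (c (rng G t)) (c v / 2))" for t
  have p: "p \<in> Cc"
    unfolding p_def using cv0
    by (intro Cc_mult_cont(1) k(8) continuous_intros continuous_on_compose2[OF be(1) cont_rng] continuous_on_compose2[OF c_cont cont_rng]) auto
  \<comment> \<open>The modulus of p is at most (2 / c v) k, and 2 / c v \<le> 4 / \<mu>; the bound
    is therefore (4 / \<mu>)^2 times 2 \<mu>.\<close>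
  have pN: "nsq w p \<le> (sqrt (32 / \<mu>))\<^sup>2" if w: "w \<in> units G" for w
  proof (cases "w \<in> W1")
    case True
    have "nsq w p \<le> (2 / c v)\<^sup>2 * nsq w ?k"
    proof (rule nsq_mono[OF w p k(8)])
      fix t assume "rng G t = w"
      have m: "c v / 2 \<le> max (c (rng G t)) (c v / 2)" by simp
      have "\<beta> (rng G t) / max (c (rng G t)) (c v / 2) \<le> 1 / (c v / 2)"
        using be(2,3)[of "rng G t"] m cv0 by (intro frac_le) auto
      moreover have "0 \<le> \<beta> (rng G t) / max (c (rng G t)) (c v / 2)" using be(2)[of "rng G t"] m cv0 by (intro divide_nonneg_pos) auto
      ultimately have "\<bar>\<beta> (rng G t) / max (c (rng G t)) (c v / 2)\<bar> \<le> 2 / c v" by simp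
      then show "cmod (p t) \<le> 2 / c v * cmod (?k t)"
        unfolding p_def norm_mult norm_of_real mult.commute[of "2 / c v"] by (rule mult_left_mono) simp
    qed
    also have "\<dots> \<le> (4 / \<mu>)\<^sup>2 * (2 * \<mu>)"
    proof (rule mult_mono)
      have "2 / c v \<le> 2 / (\<mu> / 2)" using cv C(4) by (intro frac_le) auto
      then show "(2 / c v)\<^sup>2 \<le> (4 / \<mu>)\<^sup>2" using cv0 by (intro power_mono) auto
    qed (use W1(3)[OF True w] nsq_nonneg in auto)
    also have "\<dots> = (sqrt (32 / \<mu>))\<^sup>2" using C(4) by (simp add: power2_eq_square)
    finally show ?thesis .
  next
    case False
    have "nsq w p = 0" by (rule nsq_zero[OF w]) (use False be(5,6) in \<open>auto simp: p_def\<close>)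
    then show ?thesis using C(4) by simp
  qed
  define q1 where "q1 = H.shift x0 ?k2"
  have q1: "q1 \<in> Cc" "\<And>t. rng G t = rng G x0 \<Longrightarrow> q1 t = ?k2 (ginv G x0 \<cdot> t)"
    unfolding q1_def by (rule H.shift(1)[OF k2(6)]) (rule H.shift(2)[OF k2(6)], simp_all)
  \<comment> \<open>The function q1 is the exact translate of k2 only on the fibre of x0. Doubling
    and truncating at 1 turns the open condition Re q1 > 1/2 into q0 = 1, at the price of a factor 4
    in the squared norm.\<close>
  define q0 where "q0 t = complex_of_real (min 1 (2 * max 0 (Re (q1 t))))" for t
  have q0: "q0 \<in> Cc" unfolding q0_def
    by (rule Cc_post[OF q1(1), where h = "\<lambda>z. complex_of_real (min 1 (2 * max 0 (Re z)))"]) (auto intro!: continuous_intros)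
  have "nsq (rng G x0) q0 \<le> 2\<^sup>2 * nsq (rng G x0) q1"
  proof (rule nsq_mono[OF rng_units q0 q1(1)])
    fix t
    have "min 1 (2 * max 0 (Re (q1 t))) \<le> 2 * cmod (q1 t)" using complex_Re_le_cmod[of "q1 t"] norm_ge_zero[of "q1 t"]
      unfolding min_def max_def by simp
    then show "cmod (q0 t) \<le> 2 * cmod (q1 t)" unfolding q0_def norm_of_real by simp
  qed
  also have "nsq (rng G x0) q1 = nsq v ?k2"
  proof -
    have "nsq v ?k2 = nsq (src G x0) (\<lambda>t. q1 (x0 \<cdot> t))"
      unfolding nsq_def v_def
      by (rule Bochner_Integration.integral_cong) (auto simp: space_haar q1(2) rng_mult inv_cancel)
    then show ?thesis using nsq_shift[OF q1(1)] by simp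
  qed
  finally have q0u: "nsq (rng G x0) q0 < 8 * \<mu>" using k2v C(4) by simp
  obtain W3 where W3: "open W3" "rng G x0 \<in> W3" "\<And>w. w \<in> W3 \<Longrightarrow> w \<in> units G \<Longrightarrow> nsq w q0 < 8 * \<mu>"
    by (rule units_nhd[OF nsq_cont[OF q0] rng_units q0u]) blast
  \<comment> \<open>N3 also restricts the range to units where the squared norm of q0 is below 8
    \<mu>. Together with the bound for p this gives 32 / \<mu> times 8 \<mu>, which is 16
    squared.\<close>
  define N3 where "N3 = N2 \<inter> (rng G -` W3)"
  have N3: "open N3" unfolding N3_def by (intro open_Int N2(1) open_vimage W3(1) cont_rng)
  define Z where "Z = (\<lambda>w. x0 \<cdot> w) ` (K0 \<inter> fib v)"
  have Z: "compact Z" unfolding Z_def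
    by (intro compact_continuous_image compact_Int_closed k(5) closed_fibre cont_mult continuous_intros) (auto simp: v_def)
  have ZN: "Z \<subseteq> N3"
  proof
    fix z assume "z \<in> Z"
    then obtain w where w: "z = x0 \<cdot> w" "w \<in> K0" "rng G w = v" by (auto simp: Z_def)
    have "w \<in> fib v \<inter> W" using w(2,3) k(6) by (auto simp: N_def)
    then have "z \<in> N2" unfolding W(2)[symmetric] using w(1) by simp
    moreover have "rng G z = rng G x0" using w by (simp add: rng_mult v_def)
    ultimately show "z \<in> N3" using W3(2) by (simp add: N3_def)
  qed
  obtain U2 where U2: "open U2" "Z \<subseteq> U2" "compact (closure U2)" "closure U2 \<subseteq> N3"
    by (rule lc_between[OF lc Z N3 ZN])
  obtain \<gamma> :: "'g \<Rightarrow> real" and K\<gamma> where ga: "\<And>x. 0 \<le> \<gamma> x" "\<And>x. \<gamma> x \<le> 1" "\<And>x. x \<in> closure U2 \<Longrightarrow> \<gamma> x = 1"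
    "K\<gamma> \<subseteq> N3" "\<And>x. x \<notin> K\<gamma> \<Longrightarrow> \<gamma> x = 0" "(\<lambda>x. complex_of_real (\<gamma> x)) \<in> Cc"
    by (rule lc_bump[OF lc U2(3) N3 U2(4)]) blast
  define q where "q t = q0 t * of_real (\<gamma> t)" for t
  have q: "q \<in> Cc" unfolding q_def by (rule Cc_mult[OF q0 ga(6)])
  have qN: "q t \<noteq> 0 \<Longrightarrow> t \<in> N3" for t using ga(4,5) by (auto simp: q_def)
  have qQ: "nsq w q \<le> (sqrt (8 * \<mu>))\<^sup>2" if w: "w \<in> units G" for w
  proof (cases "\<exists>t. rng G t = w \<and> q t \<noteq> 0")
    case True
    then obtain t where "rng G t = w" "t \<in> N3" using qN by blast
    then have "w \<in> W3" by (auto simp: N3_def)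
    have "nsq w q \<le> 1\<^sup>2 * nsq w q0"
      by (rule nsq_mono[OF w q q0]) (use ga(1,2) in \<open>auto simp: q_def norm_mult mult_left_le\<close>)
    also have "\<dots> \<le> 8 * \<mu>" using W3(3)[OF \<open>w \<in> W3\<close> w] by simp
    finally show ?thesis using C(4) by simp
  next
    case False
    then have "nsq w q = 0" by (intro nsq_zero[OF w]) auto
    then show ?thesis using C(4) by simp
  qed
  define U3 where "U3 = U2 \<inter> {t. 1/2 < Re (q1 t)}"
  have U3: "open U3" unfolding U3_def
    by (intro open_Int U2(1) open_Collect_less continuous_on_const continuous_on_Re Cc_cont q1(1))
  obtain V1 where V1: "open V1" "x0 \<in> V1" "\<And>x w. x \<in> V1 \<Longrightarrow> w \<in> K0 \<Longrightarrow> rng G w = src G x \<Longrightarrow> x \<cdot> w \<in> U3"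
  proof (rule mult_tube[OF k(5) U3, of x0])
    fix w assume w: "w \<in> K0" "rng G w = src G x0"
    then have "x0 \<cdot> w \<in> U2" using U2(2) by (auto simp: Z_def v_def)
    moreover have "q1 (x0 \<cdot> w) = 1" using q1(2)[of "x0 \<cdot> w"] w k2(3) by (simp add: rng_mult inv_cancel)
    ultimately show "x0 \<cdot> w \<in> U3" by (simp add: U3_def)
  qed blast
  define V where "V = V1 \<inter> src G -` (U1 \<inter> W2)"
  have V: "open V" "x0 \<in> V" unfolding V_def
    using V1 U1(1,2) W2(1,2) by (auto intro!: open_Int open_vimage cont_src simp: v_def)
  \<comment> \<open>If p is nonzero at w = x^-1 t, then w lies in K0, so t = x w lies in U3 and q t
    = 1. The coefficient is thus the integral of the conjugate of p over the fibre at the source of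
    x, which is 1.\<close>
  have one: "coef p q x = 1" if x: "x \<in> V" for x
  proof -
    have xs: "src G x \<in> U1" "src G x \<in> W2" and x1: "x \<in> V1" using x by (auto simp: V_def)
    have cs: "c (src G x) > c v / 2" using W2(3)[OF xs(2)] by simp
    have be1: "\<beta> (src G x) = 1" using be(4)[of "src G x"] xs(1) closure_subset[of U1] by blast
    have ps: "p w = ?k w * of_real (1 / c (src G x))" if "rng G w = src G x" for w
      using that cs be1 by (simp add: p_def max_def)
    have "coef p q x = I1 (rng G x) (\<lambda>t. cnj (p (ginv G x \<cdot> t)))"
      unfolding coef_I1
    proof (rule H.I_cong[OF rng_units])
      fix t assume t: "rng G t = rng G x"
      show "cnj (p (ginv G x \<cdot> t)) * q t = cnj (p (ginv G x \<cdot> t))"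
      proof (cases "ginv G x \<cdot> t \<in> K0")
        case True
        have "x \<cdot> (ginv G x \<cdot> t) \<in> U3" by (rule V1(3)[OF x1 True]) (simp add: t rng_mult)
        then have "t \<in> U3" using t by (simp add: inv_cancel2)
        then have "q0 t = 1" "\<gamma> t = 1" using ga(3)[of t] closure_subset[of U2] by (auto simp: U3_def q0_def)
        then show ?thesis by (simp add: q_def)
      next
        case False
        then have "p (ginv G x \<cdot> t) = 0" using k(7) by (simp add: p_def)
        then show ?thesis by simp
      qed
    qed
    also have "\<dots> = I1 (rng G x) (H.shift x (\<lambda>t. cnj (p t)))"
      by (rule H.I_cong[OF rng_units]) (simp add: H.shift(2)[OF Cc_cnj[OF p]])
    also have "\<dots> = I1 (src G x) (\<lambda>w. H.shift x (\<lambda>t. cnj (p t)) (x \<cdot> w))"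
      by (rule H.I_shift[OF H.shift(1)[OF Cc_cnj[OF p]], symmetric])
    also have "\<dots> = I1 (src G x) (\<lambda>w. of_real (1 / c (src G x)) * ?k w)"
      by (rule H.I_cong[OF src_units])
         (simp add: H.shift(2)[OF Cc_cnj[OF p]] rng_mult inv_cancel ps)
    also have "\<dots> = of_real (1 / c (src G x)) * of_real (c (src G x))"
      unfolding I1_scale cI ..
    also have "\<dots> = 1" using cs cv0 by simp
    finally show ?thesis .
  qed
  show ?thesis
  proof (rule that[OF p q V one _ _ pN qQ])
    show "p w \<noteq> 0 \<Longrightarrow> w \<in> N1" for w using k(6,7) by (auto simp: p_def N_def)
    show "q t \<noteq> 0 \<Longrightarrow> t \<in> N2" for t using qN[of t] by (simp add: N3_def)
    have "sqrt (32 / \<mu>) * sqrt (8 * \<mu>) = sqrt (16\<^sup>2)"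
      unfolding real_sqrt_mult[symmetric] using C(4) by simp
    then show "sqrt (32 / \<mu>) * sqrt (8 * \<mu>) \<le> 16" by simp
  qed (use C(4) in auto)
qed

end

section \<open>Multiplicative functionals are point evaluations\<close>

context gspace
begin

definition cf where "cf f g x = I (rng G x) (\<lambda>p. cnj (f (pact (ginv G x) p)) * g p)"

lemma cf_ip: "f \<in> Cc \<Longrightarrow> cf f g x = ip (rng G x) (shift x f) g"
  unfolding cf_def ip_def by (rule I_cong[OF rng_units]) (simp add: shift(2))

lemma cf_diff_right: "f \<in> Cc \<Longrightarrow> g \<in> Cc \<Longrightarrow> g' \<in> Cc \<Longrightarrow> cf f (\<lambda>p. g p - g' p) x = cf f g x - cf f g' x"
  unfolding cf_ip by (rule semi_ip.ip_diff[OF semi_ip_ip[OF rng_units] shift(1)])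

lemma cf_diff_left:
  assumes "f \<in> Cc" "f' \<in> Cc" "g \<in> Cc"
  shows "cf (\<lambda>p. f p - f' p) g x = cf f g x - cf f' g x"
proof -
  have "cf (\<lambda>p. f p - f' p) g x = ip (rng G x) (\<lambda>p. shift x f p - shift x f' p) g"
    unfolding cf_def ip_def by (rule I_cong[OF rng_units]) (simp add: shift(2) assms)
  also have "\<dots> = cf f g x - cf f' g x"
    unfolding cf_ip[OF assms(1)] cf_ip[OF assms(2)]
    by (rule semi_ip.ip_diff_left[OF semi_ip_ip[OF rng_units] shift(1)[OF assms(1)] shift(1)[OF assms(2)] assms(3)])
  finally show ?thesis .
qed

end

context lcg
begin

lemma coef_cf: "coef f g = H.cf f g"
  unfolding coef_I1 H.cf_def[abs_def] ..

lemma nsq_cong: "u \<in> units G \<Longrightarrow> (\<And>t. rng G t = u \<Longrightarrow> f t = g t) \<Longrightarrow> nsq u f = nsq u g"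
  unfolding nsq_def by (rule Bochner_Integration.integral_cong) (auto simp: space_haar)

text \<open>Alone, f (w y) need not have compact support in (w, y). The cut-off c confines w, and
  then y is the product of the inverse of w with a point of the support of f.\<close>

lemma translate_Cc:
  assumes c: "c \<in> Cc" and f: "f \<in> Cc"
  obtains F where "F \<in> Cc" "\<And>w y. rng G y = src G w \<Longrightarrow> F (w, y) = c w * f (w \<cdot> y)"
proof -
  obtain K where K: "compact K" "\<And>x. x \<notin> K \<Longrightarrow> c x = 0" by (rule CcE[OF c]) blast
  obtain M where M: "compact M" "\<And>x. x \<notin> M \<Longrightarrow> f x = 0" by (rule CcE[OF f]) blast
  let ?Q = "{p\<in>UNIV. rng G (fst p) = rng G (snd p)}"
  let ?h = "\<lambda>p. (fst p, ginv G (fst p) \<cdot> snd p)"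
  have cl: "closed ?Q"
    by (intro closed_equalizer closed_UNIV continuous_on_compose2[OF cont_rng] continuous_on_fst continuous_on_snd continuous_on_id) auto
  have ch: "continuous_on ?Q ?h"
    by (intro continuous_on_Pair cont_mult continuous_on_compose2[OF cont_inv[of UNIV]] continuous_on_fst continuous_on_snd continuous_on_id) auto
  have comp: "compact (?h ` ((K \<times> M) \<inter> ?Q))"
    by (intro compact_continuous_image compact_Int_closed compact_Times K M cl continuous_on_subset[OF ch]) auto
  have cf: "continuous_on P2 (\<lambda>z. c (fst z) * f (fst z \<cdot> snd z))"
  proof (intro continuous_on_mult)
    show "continuous_on P2 (\<lambda>z. c (fst z))"
      by (rule continuous_on_compose2[OF Cc_cont[OF c, of UNIV]]) (auto intro!: continuous_intros)
    show "continuous_on P2 (\<lambda>z. f (fst z \<cdot> snd z))"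
      by (rule continuous_on_compose2[OF Cc_cont[OF f, of UNIV] cont_mult]) (auto intro!: continuous_intros simp: P2_def)
  qed
  have van: "c (fst z) * f (fst z \<cdot> snd z) = 0" if z: "z \<in> P2" and n: "z \<notin> ?h ` ((K \<times> M) \<inter> ?Q)" for z
  proof (rule ccontr)
    assume "c (fst z) * f (fst z \<cdot> snd z) \<noteq> 0"
    then have "fst z \<in> K" "fst z \<cdot> snd z \<in> M" using K(2) M(2) by auto
    moreover have s: "src G (fst z) = rng G (snd z)" using z by (simp add: P2_def)
    ultimately have "(fst z, fst z \<cdot> snd z) \<in> (K \<times> M) \<inter> ?Q" by (simp add: rng_mult)
    moreover have "?h (fst z, fst z \<cdot> snd z) = z" using s by (simp add: inv_cancel)
    ultimately show False using n by (metis (no_types, lifting) image_eqI)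
  qed
  obtain F where F: "F \<in> Cc" "\<And>z. z \<in> P2 \<Longrightarrow> F z = c (fst z) * f (fst z \<cdot> snd z)"
    using Cc_Tietze[OF lc_prod[OF lc lc] H2.closed_P cf comp van] by blast
  show ?thesis by (rule that[OF F(1)]) (simp add: F(2) P2_def)
qed

lemma product_Cc:
  assumes c: "c \<in> Cc" and f: "f \<in> Cc"
  shows "(\<lambda>z :: 'g \<times> 'g. c (fst z) * f (snd z)) \<in> Cc"
proof -
  obtain K where K: "compact K" "\<And>x. x \<notin> K \<Longrightarrow> c x = 0" by (rule CcE[OF c]) blast
  obtain M where M: "compact M" "\<And>x. x \<notin> M \<Longrightarrow> f x = 0" by (rule CcE[OF f]) blast
  show ?thesis
  proof (rule CcI[OF _ compact_Times[OF K(1) M(1)]])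
    show "continuous_on UNIV (\<lambda>z :: 'g \<times> 'g. c (fst z) * f (snd z))"
      by (intro continuous_on_mult continuous_on_compose2[OF Cc_cont[OF c, of UNIV]] continuous_on_compose2[OF Cc_cont[OF f, of UNIV]]
          continuous_on_fst continuous_on_snd continuous_on_id) auto
    show "c (fst z) * f (snd z) = 0" if "z \<notin> K \<times> M" for z :: "'g \<times> 'g"
      using that K(2)[of "fst z"] M(2)[of "snd z"] by (cases z) auto
  qed
qed

lemma fst_mult_Cc:
  assumes p: "p \<in> Cc" and A: "A \<in> Cc"
  shows "(\<lambda>z :: 'g \<times> 'g. p (fst z) * A z) \<in> Cc"
  by (rule Cc_mult_cont(2)[OF A])
     (rule continuous_on_compose2[OF Cc_cont[OF p, of UNIV] continuous_on_fst[OF continuous_on_id]], simp)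

text \<open>Integrating over y first leaves the squared modulus of p times the squared fibre norm of
  A (w, y), at most a^2 wherever p is nonzero. The norm over the pairs is thus bounded by a
  product.\<close>

lemma norm_fst_mult:
  assumes p: "p \<in> Cc" and A: "A \<in> Cc" and u: "u \<in> units G"
    and a: "\<And>w. p w \<noteq> 0 \<Longrightarrow> nsq (src G w) (\<lambda>y. A (w, y)) \<le> a\<^sup>2" "a \<ge> 0"
    and P: "nsq u p \<le> P\<^sup>2" "P \<ge> 0"
  shows "sqrt (Re (H2.ip u (\<lambda>z. p (fst z) * A z) (\<lambda>z. p (fst z) * A z))) \<le> a * P"
proof -
  let ?F = "\<lambda>z. p (fst z) * A z"
  have F: "?F \<in> Cc" by (rule fst_mult_Cc[OF p A])
  have inner: "inner_int (\<lambda>z. cnj (?F z) * ?F z) w = (cnj (p w) * p w) * of_real (nsq (src G w) (\<lambda>y. A (w, y)))" for w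
  proof -
    have "inner_int (\<lambda>z. cnj (?F z) * ?F z) w = I1 (src G w) (\<lambda>y. (cnj (p w) * p w) * (cnj (A (w, y)) * A (w, y)))"
      unfolding inner_int_def by (simp add: mult_ac)
    then show ?thesis unfolding I1_scale nsq_I1 .
  qed
  have "cmod (I1 u (inner_int (\<lambda>z. cnj (?F z) * ?F z))) \<le> Re (I1 u (\<lambda>w. of_real (a\<^sup>2) * (cnj (p w) * p w)))"
  proof (rule H.I_mono[OF u inner_int_Cc[OF H.cnj_mult_Cc[OF F F]] Cc_scale[OF H.cnj_mult_Cc[OF p p]]])
    fix w
    have "(cmod (p w))\<^sup>2 * nsq (src G w) (\<lambda>y. A (w, y)) \<le> (cmod (p w))\<^sup>2 * a\<^sup>2"
      using a(1)[of w] by (cases "p w = 0") (auto intro!: mult_left_mono)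
    moreover have "inner_int (\<lambda>z. cnj (?F z) * ?F z) w = of_real ((cmod (p w))\<^sup>2 * nsq (src G w) (\<lambda>y. A (w, y)))"
      unfolding inner by (simp only: complex_cnj_mult_cmod of_real_mult)
    moreover have "Re (of_real (a\<^sup>2) * (cnj (p w) * p w)) = (cmod (p w))\<^sup>2 * a\<^sup>2"
      unfolding complex_cnj_mult_cmod of_real_mult[symmetric] Re_complex_of_real by (rule mult.commute)
    ultimately show "cmod (inner_int (\<lambda>z. cnj (?F z) * ?F z) w) \<le> Re (of_real (a\<^sup>2) * (cnj (p w) * p w))"
      using nsq_nonneg[of "src G w" "\<lambda>y. A (w, y)"] by (simp only: norm_of_real abs_of_nonneg mult_nonneg_nonneg zero_le_power2)
  qed
  also have "\<dots> = a\<^sup>2 * nsq u p" unfolding I1_scale nsq_I1 by simp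
  also have "\<dots> \<le> a\<^sup>2 * P\<^sup>2" using P by (intro mult_left_mono) auto
  finally have "Re (H2.ip u ?F ?F) \<le> (a * P)\<^sup>2"
    unfolding H2.ip_def I2_def power_mult_distrib using complex_Re_le_cmod order_trans by blast
  then show ?thesis using a(2) P(2) by (intro real_le_lsqrt) auto
qed

text \<open>
  Multiplying the coefficient \<open>\<phi> = coef f g\<close> by the peak function \<open>coef p q\<close> amounts to the coefficient
  of the functions \<open>p w * f (w y)\<close> and \<open>q t * g (t y)\<close> of \<open>L\<^sup>2\<close> of the composable pairs. As \<open>p\<close> and
  \<open>q\<close> live near the unit and near \<open>x0\<close>, these are close in norm to \<open>p w * f y\<close> and \<open>q t * g (x0 y)\<close>.
\<close>

lemma peak_approx:
  assumes f: "f \<in> Cc" and g: "g \<in> Cc" and e: "e > 0"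
    and Ph: "\<And>u. u \<in> units G \<Longrightarrow> nsq u f \<le> Ph\<^sup>2" "Ph \<ge> 0"
    and Ga: "\<And>u. u \<in> units G \<Longrightarrow> nsq u g \<le> Ga\<^sup>2" "Ga \<ge> 0"
  obtains \<psi> V where "\<psi> \<in> A_cf_alg G" "open V" "x0 \<in> V" "\<And>x. x \<in> V \<Longrightarrow> \<psi> x = 1"
    "B_norm G (\<lambda>x. coef f g x * \<psi> x - coef f g x0 * \<psi> x) \<le> e * (16 * (Ga + Ph + 1))"
proof -
  define v where "v = src G x0"
  have v: "v \<in> units G" "src G v = v" "rng G v = v" by (simp_all add: v_def)
  have bump: "\<exists>b U. b \<in> Cc \<and> open U \<and> z \<in> U \<and> (\<forall>w\<in>U. b w = (1::complex))" for z :: 'g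
  proof -
    obtain U where U: "open U" "{z} \<subseteq> U" "compact (closure U)" by (rule lc_between[OF lc, of "{z}" UNIV]) auto
    obtain b :: "'g \<Rightarrow> real" where "\<And>x. x \<in> closure U \<Longrightarrow> b x = 1" "(\<lambda>x. complex_of_real (b x)) \<in> Cc"
      by (rule lc_bump[OF lc U(3) open_UNIV]) auto
    then show ?thesis using U closure_subset[of U]
      by (intro exI[of _ "\<lambda>x. complex_of_real (b x)"] exI[of _ U]) auto
  qed
  \<comment> \<open>Cut-offs that are 1 where p and q will live. They bring the functions on pairs
    into \<open>Cc\<close> and disappear after multiplication by p and q, see \<open>pb\<close> and
    \<open>qb\<close>.\<close>
  obtain b1 U1 where b1: "b1 \<in> Cc" "open U1" "v \<in> U1" "\<And>w. w \<in> U1 \<Longrightarrow> b1 w = (1::complex)" using bump[of v] by blast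
  obtain b2 U2 where b2: "b2 \<in> Cc" "open U2" "x0 \<in> U2" "\<And>w. w \<in> U2 \<Longrightarrow> b2 w = (1::complex)" using bump[of x0] by blast
  obtain A1 where A1: "A1 \<in> Cc" "\<And>w y. rng G y = src G w \<Longrightarrow> A1 (w, y) = b1 w * f (w \<cdot> y)"
    by (rule translate_Cc[OF b1(1) f]) blast
  define A2 where "A2 = (\<lambda>z :: 'g \<times> 'g. b1 (fst z) * f (snd z))"
  have A2: "A2 \<in> Cc" unfolding A2_def by (rule product_Cc[OF b1(1) f])
  obtain B1 where B1: "B1 \<in> Cc" "\<And>w y. rng G y = src G w \<Longrightarrow> B1 (w, y) = b2 w * g (w \<cdot> y)"
    by (rule translate_Cc[OF b2(1) g]) blast
  define g' where "g' = H.shift (ginv G x0) g"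
  have g': "g' \<in> Cc" unfolding g'_def by (rule H.shift(1)[OF g])
  have g'_eq: "g' y = g (x0 \<cdot> y)" if "rng G y = v" for y
    unfolding g'_def using H.shift(2)[OF g, of y "ginv G x0"] that by (simp add: v_def)
  define B2 where "B2 = (\<lambda>z :: 'g \<times> 'g. b2 (fst z) * g' (snd z))"
  have B2: "B2 \<in> Cc" unfolding B2_def by (rule product_Cc[OF b2(1) g'])
  have E_cont: "continuous_on UNIV (\<lambda>w. nsq (src G w) (\<lambda>y. F (w, y)))" if "F \<in> Cc" for F
  proof -
    have "continuous_on UNIV (\<lambda>w. Re (inner_int (\<lambda>z. cnj (F z) * F z) w))"
      by (intro continuous_on_Re Cc_cont inner_int_Cc H.cnj_mult_Cc that)
    then show ?thesis unfolding inner_int_def nsq_I1 by simp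
  qed
  define DA where "DA z = A1 z - A2 z" for z
  have DA: "DA \<in> Cc" unfolding DA_def by (rule Cc_diff[OF A1(1) A2])
  define DB where "DB z = B1 z - B2 z" for z
  have DB: "DB \<in> Cc" unfolding DB_def by (rule Cc_diff[OF B1(1) B2])
  have EA0: "nsq (src G v) (\<lambda>y. DA (v, y)) = 0"
  proof (rule nsq_zero[OF src_units])
    fix y assume "rng G y = src G v"
    then have "rng G y = v" using v by simp
    then have "v \<cdot> y = y" by auto
    then show "DA (v, y) = 0" using A1(2)[of y v] \<open>rng G y = v\<close> v by (simp add: DA_def A2_def)
  qed
  have EB0: "nsq (src G x0) (\<lambda>y. DB (x0, y)) = 0"
    by (rule nsq_zero[OF src_units]) (use B1(2) g'_eq in \<open>simp add: DB_def B2_def v_def\<close>)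
  \<comment> \<open>The inner product, over the fibre at y, of f with the translate of g by x0. At
    the source of x0 it is the value of \<phi> at x0; nearby it is close to that value by
    continuity.\<close>
  define m where "m y = I1 y (\<lambda>t. cnj (f t) * g' t)" for y
  have m_cont: "continuous_on UNIV (\<lambda>t. m (src G t))"
    unfolding m_def by (rule continuous_on_compose2[OF H.I_cont[OF H.cnj_mult_Cc[OF f g']] cont_src]) auto
  have m_v: "m (src G x0) = coef f g x0"
  proof -
    let ?S = "\<lambda>t. cnj (H.shift x0 f t) * g t"
    have S: "?S \<in> Cc" by (rule H.cnj_mult_Cc[OF H.shift(1)[OF f] g])
    have "coef f g x0 = I1 (rng G x0) ?S"
      unfolding coef_I1 by (rule H.I_cong[OF rng_units]) (simp add: H.shift(2)[OF f])
    also have "\<dots> = I1 (src G x0) (\<lambda>t. ?S (x0 \<cdot> t))" by (rule H.I_shift[OF S, symmetric])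
    also have "\<dots> = m (src G x0)"
      unfolding m_def by (rule H.I_cong[OF src_units]) (simp add: H.shift(2)[OF f] rng_mult inv_cancel g'_eq v_def)
    finally show ?thesis ..
  qed
  \<comment> \<open>The fibre norms of the two differences are continuous and vanish at v and at x0
    respectively. On these neighbourhoods they are below e, and on \<open>N2\<close> the function m
    differs by less than e from its value at the source of x0.\<close>
  define N1 where "N1 = U1 \<inter> {w. nsq (src G w) (\<lambda>y. DA (w, y)) < e\<^sup>2}"
  define N2 where "N2 = U2 \<inter> {t. nsq (src G t) (\<lambda>y. DB (t, y)) < e\<^sup>2} \<inter> {t. cmod (m (src G t) - coef f g x0) < e}"
  have N1: "open N1" "src G x0 \<in> N1"
    unfolding N1_def using b1 EA0 e
    by (auto intro!: open_Int open_Collect_less E_cont DA continuous_on_const simp: v_def)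
  have N2: "open N2" "x0 \<in> N2"
    unfolding N2_def using b2 EB0 e m_v
    by (auto intro!: open_Int open_Collect_less E_cont DB continuous_on_const continuous_on_norm continuous_on_diff m_cont)
  obtain p q V P Q where pq: "p \<in> Cc" "q \<in> Cc" "open V" "x0 \<in> V" "\<And>x. x \<in> V \<Longrightarrow> coef p q x = 1"
    "\<And>w. p w \<noteq> 0 \<Longrightarrow> w \<in> N1" "\<And>t. q t \<noteq> 0 \<Longrightarrow> t \<in> N2"
    "\<And>w. w \<in> units G \<Longrightarrow> nsq w p \<le> P\<^sup>2" "\<And>w. w \<in> units G \<Longrightarrow> nsq w q \<le> Q\<^sup>2" "P \<ge> 0" "Q \<ge> 0" "P * Q \<le> 16"
    by (rule peak[OF N1 N2]) blast
  have pb: "p w * b1 w = p w" for w using pq(6)[of w] b1(4) by (cases "p w = 0") (auto simp: N1_def)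
  have qb: "q t * b2 t = q t" for t using pq(7)[of t] b2(4) by (cases "q t = 0") (auto simp: N2_def)
  define F1 where "F1 = (\<lambda>z. p (fst z) * A1 z)"
  define F2 where "F2 = (\<lambda>z. p (fst z) * A2 z)"
  define K1 where "K1 = (\<lambda>z. q (fst z) * B1 z)"
  define K2 where "K2 = (\<lambda>z. q (fst z) * B2 z)"
  have FC: "F1 \<in> Cc" "F2 \<in> Cc" "K1 \<in> Cc" "K2 \<in> Cc"
    unfolding F1_def F2_def K1_def K2_def using pq A1 A2 B1 B2 by (auto intro: fst_mult_Cc)
  have dF: "(\<lambda>z. F1 z - F2 z) = (\<lambda>z. p (fst z) * DA z)" and dK: "(\<lambda>z. K1 z - K2 z) = (\<lambda>z. q (fst z) * DB z)"
    by (auto simp: F1_def F2_def K1_def K2_def DA_def DB_def algebra_simps)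
  have bF: "sqrt (Re (H2.ip u (\<lambda>z. F1 z - F2 z) (\<lambda>z. F1 z - F2 z))) \<le> e * P" if u: "u \<in> units G" for u
    unfolding dF using e pq(6)
    by (intro norm_fst_mult[OF pq(1) DA u _ _ pq(8)[OF u] pq(10)]) (auto simp: N1_def intro: less_imp_le)
  have bF2: "sqrt (Re (H2.ip u F2 F2)) \<le> Ph * P" if u: "u \<in> units G" for u
    unfolding F2_def
  proof (rule norm_fst_mult[OF pq(1) A2 u _ Ph(2) pq(8)[OF u] pq(10)])
    fix w assume "p w \<noteq> 0"
    then have "b1 w = 1" using pq(6) b1(4) by (auto simp: N1_def)
    then show "nsq (src G w) (\<lambda>y. A2 (w, y)) \<le> Ph\<^sup>2" using Ph(1)[OF src_units, of w] by (simp add: A2_def)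
  qed
  have bK: "sqrt (Re (H2.ip u (\<lambda>z. K1 z - K2 z) (\<lambda>z. K1 z - K2 z))) \<le> e * Q" if u: "u \<in> units G" for u
    unfolding dK using e pq(7)
    by (intro norm_fst_mult[OF pq(2) DB u _ _ pq(9)[OF u] pq(11)]) (auto simp: N2_def intro: less_imp_le)
  have bK1: "sqrt (Re (H2.ip u K1 K1)) \<le> Ga * Q" if u: "u \<in> units G" for u
    unfolding K1_def
  proof (rule norm_fst_mult[OF pq(2) B1(1) u _ Ga(2) pq(9)[OF u] pq(11)])
    fix t assume "q t \<noteq> 0"
    then have b: "b2 t = 1" using pq(7) b2(4) by (auto simp: N2_def)
    have "nsq (src G t) (\<lambda>y. B1 (t, y)) = nsq (src G t) (\<lambda>y. g (t \<cdot> y))"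
      by (rule nsq_cong[OF src_units]) (simp add: B1(2) b)
    then show "nsq (src G t) (\<lambda>y. B1 (t, y)) \<le> Ga\<^sup>2" using Ga(1)[OF rng_units, of t] nsq_shift[OF g, of t] by simp
  qed
  let ?c2 = "H2.cf"
  have n1: "?c2 (\<lambda>z. F1 z - F2 z) K1 \<in> B_alg G" "B_norm G (?c2 (\<lambda>z. F1 z - F2 z) K1) \<le> (e * P) * (Ga * Q)"
    using H2.coeff_B[OF Cc_diff[OF FC(1,2)] FC(3) bF bK1] unfolding H2.cf_def[abs_def] by auto
  have n2: "?c2 F2 (\<lambda>z. K1 z - K2 z) \<in> B_alg G" "B_norm G (?c2 F2 (\<lambda>z. K1 z - K2 z)) \<le> (Ph * P) * (e * Q)"
    using H2.coeff_B[OF FC(2) Cc_diff[OF FC(3,4)] bF2 bK] unfolding H2.cf_def[abs_def] by auto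
  \<comment> \<open>The third error: m is not constant on the support of q, and q3 measures its
    deviation from the value at the source of x0.\<close>
  define q3 where "q3 t = q t * m (src G t) - coef f g x0 * q t" for t
  have qm: "(\<lambda>t. q t * m (src G t)) \<in> Cc" by (rule Cc_mult_cont(1)[OF pq(2) m_cont])
  have q3: "q3 \<in> Cc" unfolding q3_def by (intro Cc_diff qm Cc_scale pq(2))
  have n3: "coef p q3 \<in> B_alg G" "B_norm G (coef p q3) \<le> P * (e * Q)"
  proof -
    have a: "L2_norm G u p \<le> P" if "u \<in> units G" for u
      unfolding L2_norm_nsq using pq(8)[OF that] pq(10) by (rule real_le_lsqrt[rotated])
    have b: "L2_norm G u q3 \<le> e * Q" if u: "u \<in> units G" for u
    proof -
      have "nsq u q3 \<le> e\<^sup>2 * nsq u q"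
      proof (rule nsq_mono[OF u q3 pq(2)])
        fix t
        have "cmod (q3 t) = cmod (m (src G t) - coef f g x0) * cmod (q t)"
          by (simp add: q3_def norm_mult[symmetric] algebra_simps)
        also have "\<dots> \<le> e * cmod (q t)"
          using pq(7)[of t] by (cases "q t = 0") (auto simp: N2_def intro!: mult_right_mono less_imp_le)
        finally show "cmod (q3 t) \<le> e * cmod (q t)" .
      qed
      also have "\<dots> \<le> e\<^sup>2 * Q\<^sup>2" using pq(9)[OF u] by (intro mult_left_mono) auto
      finally have "nsq u q3 \<le> (e * Q)\<^sup>2" by (simp add: power_mult_distrib)
      then show ?thesis unfolding L2_norm_nsq using e pq(11) by (intro real_le_lsqrt) auto
    qed
    show "coef p q3 \<in> B_alg G" "B_norm G (coef p q3) \<le> P * (e * Q)" by (rule coef_B[OF pq(1) q3 a b], assumption+)+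
  qed
  \<comment> \<open>The substitution s = t y in the inner integral turns it into the coefficient of
    f and g at x, the same for all t. Left invariance thus makes a product of two coefficients a
    single coefficient.\<close>
  have val1: "?c2 F1 K1 x = coef f g x * coef p q x" for x
  proof -
    let ?S = "\<lambda>s. cnj (H.shift x f s) * g s"
    have S: "?S \<in> Cc" by (rule H.cnj_mult_Cc[OF H.shift(1)[OF f] g])
    have cS: "coef f g x = I1 (rng G x) ?S"
      unfolding coef_I1 by (rule H.I_cong[OF rng_units]) (simp add: H.shift(2)[OF f])
    have "?c2 F1 K1 x = I1 (rng G x) (\<lambda>t. coef f g x * (cnj (p (ginv G x \<cdot> t)) * q t))"
      unfolding H2.cf_def I2_def
    proof (rule H.I_cong[OF rng_units])
      fix t assume t: "rng G t = rng G x"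
      have "inner_int (\<lambda>z. cnj (F1 (ginv G x \<cdot> fst z, snd z)) * K1 z) t
         = I1 (src G t) (\<lambda>y. (cnj (p (ginv G x \<cdot> t)) * q t) * ?S (t \<cdot> y))"
        unfolding inner_int_def
      proof (rule H.I_cong[OF src_units])
        fix y assume y: "rng G y = src G t"
        have "F1 (ginv G x \<cdot> t, y) = (p (ginv G x \<cdot> t) * b1 (ginv G x \<cdot> t)) * f (ginv G x \<cdot> (t \<cdot> y))"
          using A1(2)[of y "ginv G x \<cdot> t"] y t by (simp add: F1_def src_mult mult_assoc)
        moreover have "K1 (t, y) = (q t * b2 t) * g (t \<cdot> y)" using B1(2)[OF y] by (simp add: K1_def)
        moreover have "H.shift x f (t \<cdot> y) = f (ginv G x \<cdot> (t \<cdot> y))"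
          by (rule H.shift(2)[OF f]) (use t y in \<open>simp_all add: rng_mult\<close>)
        ultimately show "cnj (F1 (ginv G x \<cdot> fst (t, y), snd (t, y))) * K1 (t, y)
            = (cnj (p (ginv G x \<cdot> t)) * q t) * ?S (t \<cdot> y)"
          by (simp add: pb qb)
      qed
      also have "\<dots> = (cnj (p (ginv G x \<cdot> t)) * q t) * coef f g x"
        unfolding I1_scale H.I_shift[OF S] cS t ..
      finally show "inner_int (\<lambda>z. cnj (F1 (ginv G x \<cdot> fst z, snd z)) * K1 z) t
         = coef f g x * (cnj (p (ginv G x \<cdot> t)) * q t)" by (simp only: mult.commute)
    qed
    then show ?thesis unfolding I1_scale by (simp add: coef_I1)
  qed
  \<comment> \<open>Without the translations by w and t, the inner integral is m, which depends on t
    only through its source and so can be moved into the second function of the outer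
    coefficient.\<close>
  have val2: "?c2 F2 K2 x = coef p (\<lambda>t. q t * m (src G t)) x" for x
    unfolding H2.cf_def I2_def coef_I1
  proof (rule H.I_cong[OF rng_units])
    fix t assume t: "rng G t = rng G x"
    have "inner_int (\<lambda>z. cnj (F2 (ginv G x \<cdot> fst z, snd z)) * K2 z) t
       = I1 (src G t) (\<lambda>y. (cnj (p (ginv G x \<cdot> t) * b1 (ginv G x \<cdot> t)) * (q t * b2 t)) * (cnj (f y) * g' y))"
      unfolding inner_int_def F2_def K2_def A2_def B2_def by (simp add: mult_ac)
    then show "inner_int (\<lambda>z. cnj (F2 (ginv G x \<cdot> fst z, snd z)) * K2 z) t = cnj (p (ginv G x \<cdot> t)) * (q t * m (src G t))"
      unfolding I1_scale pb qb m_def by (simp only: mult.assoc)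
  qed
  \<comment> \<open>The passage from F1, K1 to F2, K2 changes one function at a time. The three
    bounds e P Ga Q, Ph P e Q and P e Q add up to e (Ga + Ph + 1) P Q.\<close>
  have "coef f g x * coef p q x - coef f g x0 * coef p q x
      = (?c2 (\<lambda>z. F1 z - F2 z) K1 x + ?c2 F2 (\<lambda>z. K1 z - K2 z) x) + coef p q3 x" for x
  proof -
    have "coef p q3 x = coef p (\<lambda>t. q t * m (src G t)) x - coef p (\<lambda>t. coef f g x0 * q t) x"
      unfolding q3_def coef_cf by (rule H.cf_diff_right[OF pq(1) qm Cc_scale[OF pq(2)]])
    also have "coef p (\<lambda>t. coef f g x0 * q t) x = coef f g x0 * coef p q x"
      unfolding coef_I1 I1_scale[symmetric] by (simp only: mult.left_commute)
    finally show ?thesis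
      unfolding H2.cf_diff_left[OF FC(1,2,3)] H2.cf_diff_right[OF FC(2,3,4)] val1 val2 by simp
  qed
  then have "B_norm G (\<lambda>x. coef f g x * coef p q x - coef f g x0 * coef p q x)
     \<le> ((e * P) * (Ga * Q) + (Ph * P) * (e * Q)) + P * (e * Q)"
    using B_add(2)[OF B_add(1)[OF n1(1) n2(1)] n3(1)] B_add(2)[OF n1(1) n2(1)] n1(2) n2(2) n3(2) by simp
  also have "\<dots> = (e * (Ga + Ph + 1)) * (P * Q)" by (simp add: algebra_simps)
  also have "\<dots> \<le> (e * (Ga + Ph + 1)) * 16" using e Ga(2) Ph(2) pq(12) by (intro mult_left_mono) auto
  finally have "B_norm G (\<lambda>x. coef f g x * coef p q x - coef f g x0 * coef p q x) \<le> e * (16 * (Ga + Ph + 1))"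
    by (simp add: algebra_simps)
  then show ?thesis using that[OF coef_alg[OF pq(1,2)] pq(3,4,5)] by blast
qed

text \<open>Elements of \<open>C0\<close> vanish off their base set, so the bump is cut off at the
  units; its support stays compact because the units are closed.\<close>

lemma D_bump:
  assumes C: "compact C" "C \<subseteq> units G" and S: "closed S" "C \<inter> S = {}"
  obtains b where "b \<in> D G" "\<And>u. u \<in> C \<Longrightarrow> b u = 1" "\<And>w. w \<in> S \<Longrightarrow> b w = 0"
proof -
  obtain h :: "'g \<Rightarrow> real" and K where h: "continuous_on UNIV h" "\<And>u. u \<in> C \<Longrightarrow> h u = 1" "compact K" "K \<subseteq> - S" "\<And>x. x \<notin> K \<Longrightarrow> h x = 0"
    by (rule lc_bump[OF lc C(1), of "- S"]) (use S in auto)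
  let ?b = "\<lambda>w. if w \<in> units G then complex_of_real (h w) else 0"
  have "?b \<in> D G"
    unfolding C0_def
  proof (intro CollectI conjI allI impI)
    have "continuous_on (units G) (\<lambda>w. complex_of_real (h w))"
      by (intro continuous_intros continuous_on_subset[OF h(1)]) auto
    then show "continuous_on (units G) ?b" by (rule continuous_on_eq) simp
    fix e :: real assume "e > 0"
    show "\<exists>K. compact K \<and> K \<subseteq> units G \<and> (\<forall>x\<in>units G - K. cmod (?b x) < e)"
    proof (intro exI conjI ballI)
      show "compact (K \<inter> units G)" by (rule compact_Int_closed[OF h(3) closed_units])
      fix x assume "x \<in> units G - K \<inter> units G"
      then have "h x = 0" by (intro h(5)) blast
      then show "cmod (?b x) < e" using \<open>e > 0\<close> by simp
    qed simp
  qed simp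
  moreover have "?b w = 0" if "w \<in> S" for w using h(4,5) that by auto
  ultimately show ?thesis using that[of ?b] C(2) h(2) by (simp add: subset_iff)
qed

text \<open>Applied to X \<phi> = \<alpha> \<phi> u. The peak functions show that X and evaluation
  at x0 agree on the generators, hence on the generated algebra, and both are continuous for the
  norm of B(G).\<close>

theorem char_eval:
  assumes u: "u \<in> units G"
    and add: "\<And>\<phi> \<psi>. \<phi> \<in> fourier_alg G \<Longrightarrow> \<psi> \<in> fourier_alg G \<Longrightarrow> X (\<lambda>x. \<phi> x + \<psi> x) = X \<phi> + X \<psi>"
    and scale: "\<And>c \<phi>. \<phi> \<in> fourier_alg G \<Longrightarrow> X (\<lambda>x. c * \<phi> x) = c * X \<phi>"
    and mult: "\<And>\<phi> \<psi>. \<phi> \<in> fourier_alg G \<Longrightarrow> \<psi> \<in> fourier_alg G \<Longrightarrow> X (\<lambda>x. \<phi> x * \<psi> x) = X \<phi> * X \<psi>"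
    and bound: "\<And>\<phi>. \<phi> \<in> fourier_alg G \<Longrightarrow> cmod (X \<phi>) \<le> C * B_norm G \<phi>"
    and module: "\<And>\<phi> b. \<phi> \<in> fourier_alg G \<Longrightarrow> b \<in> D G \<Longrightarrow> X (\<lambda>x. \<phi> x * b (rng G x)) = X \<phi> * b u"
    and nonzero: "\<phi>1 \<in> fourier_alg G" "X \<phi>1 \<noteq> 0"
  shows "\<exists>x0. rng G x0 = u \<and> (\<forall>\<phi>\<in>fourier_alg G. X \<phi> = \<phi> x0)"
proof -
  have diff: "X (\<lambda>x. \<phi> x - \<psi> x) = X \<phi> - X \<psi>" if "\<phi> \<in> fourier_alg G" "\<psi> \<in> fourier_alg G" for \<phi> \<psi>
    using add[OF that(1) fa_scale[OF that(2), of "-1"]] scale[OF that(2), of "-1"] by simp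
  have fad: "(\<lambda>x. \<phi> x - \<psi> x) \<in> fourier_alg G" if "\<phi> \<in> fourier_alg G" "\<psi> \<in> fourier_alg G" for \<phi> \<psi>
    using fa_add[OF that(1) fa_scale[OF that(2), of "-1"]] by simp
  have bound': "cmod (X \<phi>) \<le> \<bar>C\<bar> * B_norm G \<phi>" if "\<phi> \<in> fourier_alg G" for \<phi>
    using bound[OF that] B_norm_nonneg[OF fa_B[OF that]] by (meson abs_ge_self mult_right_mono order_trans)
  have X0: "X (\<lambda>x. 0) = 0" using scale[OF nonzero(1), of 0] by simp
  have Cp: "\<bar>C\<bar> + 1 > 0" by simp
  obtain \<psi>0 where psi0: "\<psi>0 \<in> A_cf_alg G" "X \<psi>0 \<noteq> 0"
  proof -
    have "cmod (X \<phi>1) / (\<bar>C\<bar> + 1) > 0" using nonzero(2) by simp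
    then obtain \<psi> where psi: "\<psi> \<in> A_cf_alg G" "\<psi> \<in> B_alg G" "B_norm G (\<lambda>x. \<phi>1 x - \<psi> x) < cmod (X \<phi>1) / (\<bar>C\<bar> + 1)"
      using fa_approx[OF nonzero(1)] by blast
    note d = fad[OF nonzero(1) A_cf_alg_fa[OF psi(1)]]
    have "cmod (X \<phi>1 - X \<psi>) \<le> \<bar>C\<bar> * B_norm G (\<lambda>x. \<phi>1 x - \<psi> x)"
      using bound'[OF d] diff[OF nonzero(1) A_cf_alg_fa[OF psi(1)]] by simp
    also have "\<dots> \<le> (\<bar>C\<bar> + 1) * B_norm G (\<lambda>x. \<phi>1 x - \<psi> x)"
      using B_norm_nonneg[OF fa_B[OF d]] by (intro mult_right_mono) auto
    also have "\<dots> < cmod (X \<phi>1)" using psi(3) Cp by (simp only: pos_less_divide_eq mult.commute)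
    finally have "X \<psi> \<noteq> 0" by auto
    then show ?thesis using that psi(1) by blast
  qed
  obtain K where K: "compact K" "\<And>x. x \<notin> K \<Longrightarrow> \<psi>0 x = 0" by (rule CcE[OF A_cf_alg_Cc[OF psi0(1)]]) blast
  \<comment> \<open>Otherwise every point of the fibre has a function that vanishes near it but is
    not annihilated by X. Multiplying \<psi>0 by finitely many of these keeps X nonzero and clears a
    neighbourhood of the part of K over u.\<close>
  have "\<exists>x0\<in>fib u. \<forall>\<phi>\<in>fourier_alg G. (\<exists>V. open V \<and> x0 \<in> V \<and> (\<forall>x\<in>V. \<phi> x = 0)) \<longrightarrow> X \<phi> = 0"
  proof (rule ccontr)
    assume neg: "\<not> ?thesis"
    have "\<forall>y\<in>fib u. \<exists>z. fst z \<in> fourier_alg G \<and> open (snd z) \<and> y \<in> snd z \<and> (\<forall>x\<in>snd z. fst z x = 0) \<and> X (fst z) \<noteq> 0"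
    proof
      fix y assume "y \<in> fib u"
      with neg obtain \<phi> V where "\<phi> \<in> fourier_alg G" "open V" "y \<in> V" "\<forall>x\<in>V. \<phi> x = 0" "X \<phi> \<noteq> 0" by blast
      then show "\<exists>z. fst z \<in> fourier_alg G \<and> open (snd z) \<and> y \<in> snd z \<and> (\<forall>x\<in>snd z. fst z x = 0) \<and> X (fst z) \<noteq> 0"
        by (intro exI[of _ "(\<phi>, V)"]) simp
    qed
    from bchoice[OF this] obtain z where
      "\<forall>y\<in>fib u. fst (z y) \<in> fourier_alg G \<and> open (snd (z y)) \<and> y \<in> snd (z y) \<and> (\<forall>x\<in>snd (z y). fst (z y) x = 0) \<and> X (fst (z y)) \<noteq> 0" ..
    note z = bspec[OF this]
    have cK: "compact (K \<inter> fib u)" by (intro compact_Int_closed K closed_fibre)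
    obtain Y where Y: "Y \<subseteq> K \<inter> fib u" "finite Y" "K \<inter> fib u \<subseteq> (\<Union>y\<in>Y. snd (z y))"
    proof (rule compactE_image[OF cK, of "K \<inter> fib u" "\<lambda>y. snd (z y)"])
      show "open (snd (z y))" if "y \<in> K \<inter> fib u" for y using z[OF IntD2[OF that]] by (elim conjE)
      show "K \<inter> fib u \<subseteq> (\<Union>y\<in>K \<inter> fib u. snd (z y))"
      proof
        fix y assume y: "y \<in> K \<inter> fib u"
        show "y \<in> (\<Union>y\<in>K \<inter> fib u. snd (z y))" using z[OF IntD2[OF y]] by (intro UN_I[OF y]) (elim conjE)
      qed
    qed (rule that)
    have "\<exists>h\<in>fourier_alg G. X h \<noteq> 0 \<and> (\<forall>x. x \<notin> K \<or> x \<in> (\<Union>y\<in>Y. snd (z y)) \<longrightarrow> h x = 0)"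
      using Y(2,1)
    proof (induction Y rule: finite_induct)
      case empty
      then show ?case using psi0 K(2) A_cf_alg_fa by (intro bexI[of _ \<psi>0]) auto
    next
      case (insert y Y)
      then obtain h where h: "h \<in> fourier_alg G" "X h \<noteq> 0" "\<And>x. x \<notin> K \<or> x \<in> (\<Union>y\<in>Y. snd (z y)) \<Longrightarrow> h x = 0" by auto
      have y: "y \<in> fib u" using insert by blast
      show ?case
      proof (intro bexI conjI allI impI)
        show "(\<lambda>x. h x * fst (z y) x) \<in> fourier_alg G" using fa_mult[OF h(1)] z[OF y] by blast
        show "X (\<lambda>x. h x * fst (z y) x) \<noteq> 0" using mult[OF h(1)] z[OF y] h(2) by simp
        fix x assume "x \<notin> K \<or> x \<in> (\<Union>y\<in>insert y Y. snd (z y))"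
        then show "h x * fst (z y) x = 0" using h(3) z[OF y] by auto
      qed
    qed
    then obtain h where h: "h \<in> fourier_alg G" "X h \<noteq> 0" "\<And>x. x \<notin> K \<or> x \<in> (\<Union>y\<in>Y. snd (z y)) \<Longrightarrow> h x = 0" by blast
    let ?O = "\<Union>y\<in>Y. snd (z y)"
    have "open ?O" using Y(1) z by blast
    then have cKO: "compact (K - ?O)" using K(1) by (rule compact_diff[rotated])
    have clS: "closed (rng G ` (K - ?O))"
      by (intro compact_imp_closed compact_continuous_image cont_rng' cKO)
    have uS: "u \<notin> rng G ` (K - ?O)" using Y(3) by blast
    \<comment> \<open>What is left of the support of h lies over a compact set of units that misses
      u. There b is 0, while b is 1 at u; so h times b is 0, although the module property gives it
      the nonzero value X h.\<close>
    obtain b where b: "b \<in> D G" "b u = 1" "\<And>w. w \<in> rng G ` (K - ?O) \<Longrightarrow> b w = 0"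
      by (rule D_bump[of "{u}", OF _ _ clS]) (use u uS in auto)
    have "(\<lambda>x. h x * b (rng G x)) = (\<lambda>x. 0)"
    proof
      fix x
      show "h x * b (rng G x) = 0" using h(3)[of x] b(3)[of "rng G x"] by (cases "x \<in> K - ?O") auto
    qed
    then show False using module[OF h(1) b(1)] b(2) h(2) X0 by simp
  qed
  then obtain x0 where "x0 \<in> fib u"
    and loc': "\<forall>\<phi>\<in>fourier_alg G. (\<exists>V. open V \<and> x0 \<in> V \<and> (\<forall>x\<in>V. \<phi> x = 0)) \<longrightarrow> X \<phi> = 0" by (rule bexE)
  then have x0: "rng G x0 = u" by simp
  have loc: "X \<phi> = 0" if "\<phi> \<in> fourier_alg G" "open V" "x0 \<in> V" "\<And>x. x \<in> V \<Longrightarrow> \<phi> x = 0" for \<phi> V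
    using loc' that by blast
  have gen: "X (coef f g) = coef f g x0" if f: "f \<in> Cc" and g: "g \<in> Cc" for f g
  proof -
    obtain a where a: "\<And>u. u \<in> units G \<Longrightarrow> L2_norm G u f \<le> a" by (rule L2_norm_bounded[OF f]) blast
    obtain b where b: "\<And>u. u \<in> units G \<Longrightarrow> L2_norm G u g \<le> b" by (rule L2_norm_bounded[OF g]) blast
    \<comment> \<open>\<open>L2_norm_bounded\<close> leaves the sign of the bound open, and
      \<open>peak_approx\<close> asks for a nonnegative one.\<close>
    have bb: "nsq w h \<le> (max c 0)\<^sup>2" if "L2_norm G w h \<le> c" for w h c
    proof -
      have "sqrt (nsq w h) \<le> max c 0" using that by (simp add: L2_norm_nsq)
      then show ?thesis using real_sqrt_le_iff[of "nsq w h" "(max c 0)\<^sup>2"] by simp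
    qed
    define M where "M = 16 * (max b 0 + max a 0 + 1)"
    have M: "M > 0" by (simp add: M_def)
    have "cmod (X (coef f g) - coef f g x0) \<le> e" if e: "e > 0" for e
    proof -
      define d where "d = e / ((\<bar>C\<bar> + 1) * M)"
      have d: "d > 0" "(\<bar>C\<bar> + 1) * (d * M) = e" using e M Cp by (simp_all add: d_def)
      obtain \<psi> V where psi: "\<psi> \<in> A_cf_alg G" "open V" "x0 \<in> V" "\<And>x. x \<in> V \<Longrightarrow> \<psi> x = 1"
        "B_norm G (\<lambda>x. coef f g x * \<psi> x - coef f g x0 * \<psi> x) \<le> d * (16 * (max b 0 + max a 0 + 1))"
        by (rule peak_approx[OF f g d(1) bb[OF a] _ bb[OF b], of x0]) auto
      note pf = A_cf_alg_fa[OF psi(1)] and cf = coef_fa[OF f g]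
      \<comment> \<open>The function vanishes near x0, where \<psi> = 1. As X is multiplicative and
        nonzero at \<phi>1, this forces X \<psi> = 1.\<close>
      have "X (\<lambda>x. \<phi>1 x * \<psi> x - \<phi>1 x) = 0"
        by (rule loc[OF fad[OF fa_mult[OF nonzero(1) pf] nonzero(1)] psi(2,3)]) (simp add: psi(4))
      then have "X \<phi>1 * X \<psi> = X \<phi>1"
        using diff[OF fa_mult[OF nonzero(1) pf] nonzero(1)] mult[OF nonzero(1) pf] by simp
      then have one: "X \<psi> = 1" using nonzero(2) by simp
      have "X (\<lambda>x. coef f g x * \<psi> x - coef f g x0 * \<psi> x) = X (coef f g) - coef f g x0"
        using diff[OF fa_mult[OF cf pf] fa_scale[OF pf]] mult[OF cf pf] scale[OF pf] one by simp
      then have "cmod (X (coef f g) - coef f g x0) \<le> \<bar>C\<bar> * B_norm G (\<lambda>x. coef f g x * \<psi> x - coef f g x0 * \<psi> x)"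
        using bound'[OF fad[OF fa_mult[OF cf pf] fa_scale[OF pf]]] by metis
      also have "\<dots> \<le> (\<bar>C\<bar> + 1) * (d * M)"
        using psi(5) d(1) M B_norm_nonneg[OF fa_B[OF fad[OF fa_mult[OF cf pf] fa_scale[OF pf, of "coef f g x0"]]]]
        unfolding M_def by (intro mult_mono) auto
      finally show ?thesis unfolding d(2) .
    qed
    then have "cmod (X (coef f g) - coef f g x0) \<le> 0" by (rule field_le_epsilon) simp
    then show ?thesis by simp
  qed
  have alg: "X \<phi> = \<phi> x0" if "\<phi> \<in> A_cf_alg G" for \<phi>
    using that
  proof (induction rule: A_cf_alg.induct)
    case (gen \<phi>)
    then obtain f g where "\<phi> = coef f g" "f \<in> Cc" "g \<in> Cc" by (auto simp: A_cf_coef)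
    then show ?case using \<open>\<And>g f. f \<in> Cc \<Longrightarrow> g \<in> Cc \<Longrightarrow> X (coef f g) = coef f g x0\<close> by simp
  next
    case (add \<phi> \<psi>)
    then show ?case using assms(2) A_cf_alg_fa by simp
  next
    case (scale \<phi> c)
    then show ?case using assms(3) A_cf_alg_fa by simp
  next
    case (mult \<phi> \<psi>)
    then show ?case using assms(4) A_cf_alg_fa by simp
  qed
  have "X \<phi> = \<phi> x0" if phi: "\<phi> \<in> fourier_alg G" for \<phi>
  proof -
    have "cmod (X \<phi> - \<phi> x0) \<le> e" if e: "e > 0" for e
    proof -
      have "e / (\<bar>C\<bar> + 1) > 0" using e Cp by simp
      then obtain \<psi> where psi: "\<psi> \<in> A_cf_alg G" "\<psi> \<in> B_alg G" "B_norm G (\<lambda>x. \<phi> x - \<psi> x) < e / (\<bar>C\<bar> + 1)"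
        using fa_approx[OF phi] by blast
      note pf = A_cf_alg_fa[OF psi(1)]
      note d = fad[OF phi pf]
      have "X \<phi> - \<phi> x0 = X (\<lambda>x. \<phi> x - \<psi> x) - (\<phi> x0 - \<psi> x0)" using diff[OF phi pf] alg[OF psi(1)] by simp
      then have "cmod (X \<phi> - \<phi> x0) \<le> cmod (X (\<lambda>x. \<phi> x - \<psi> x)) + cmod (\<phi> x0 - \<psi> x0)"
        by (simp only: norm_triangle_ineq4)
      also have "\<dots> \<le> \<bar>C\<bar> * B_norm G (\<lambda>x. \<phi> x - \<psi> x) + B_norm G (\<lambda>x. \<phi> x - \<psi> x)"
        by (intro add_mono bound'[OF d] B_sup[OF fa_B[OF d]])
      also have "\<dots> = (\<bar>C\<bar> + 1) * B_norm G (\<lambda>x. \<phi> x - \<psi> x)" by (simp add: algebra_simps)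
      also have "\<dots> \<le> e" using psi(3) Cp by (simp only: pos_less_divide_eq mult.commute less_imp_le)
      finally show ?thesis .
    qed
    then have "cmod (X \<phi> - \<phi> x0) \<le> 0" by (rule field_le_epsilon) simp
    then show ?thesis by simp
  qed
  then show ?thesis using x0 by blast
qed

end

section \<open>The Hilbert module of the regular bundle\<close>

context lcg
begin

text \<open>\<open>left_haar_system\<close> states invariance for integrals of \<open>Cc\<close>
  functions, while elements of \<open>E2 G\<close> are merely measurable. Inner regularity reduces
  an open set to its compact subsets K, and a bump between K and V is a function to which the given
  invariance applies.\<close>

lemma haar_le_shift_open:
  assumes V: "open V"
  shows "emeasure (haar G (rng G x)) (V \<inter> fib (rng G x)) \<le> emeasure (haar G (src G x)) {t. rng G t = src G x \<and> x \<cdot> t \<in> V}"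
proof -
  let ?M = "haar G (rng G x)" and ?N = "haar G (src G x)" and ?W = "{t. rng G t = src G x \<and> x \<cdot> t \<in> V}"
  have c: "continuous_on (fib (src G x)) (\<lambda>t. x \<cdot> t)" by (rule cont_mult) auto
  have "?W = fib (src G x) \<inter> (\<lambda>t. x \<cdot> t) -` V" by auto
  then have "openin (top_of_set (fib (src G x))) ?W" using continuous_openin_preimage_gen[OF c V] by simp
  then obtain W0 where "open W0" "?W = fib (src G x) \<inter> W0" by (auto simp: openin_open)
  then have Ws: "?W \<in> sets ?N" using haar_borel_sets[of "src G x" W0] by (simp add: Int_commute)
  have "openin (top_of_set (fib (rng G x))) (V \<inter> fib (rng G x))" using V by (auto simp: openin_open)
  note haar_open_SUP[OF rng_units this]
  also have "(SUP K\<in>{K. compactin (top_of_set (fib (rng G x))) K \<and> K \<subseteq> V \<inter> fib (rng G x)}. emeasure ?M K) \<le> emeasure ?N ?W"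
  proof (rule SUP_least)
    fix K assume "K \<in> {K. compactin (top_of_set (fib (rng G x))) K \<and> K \<subseteq> V \<inter> fib (rng G x)}"
    then have K: "compact K" "K \<subseteq> V" "K \<subseteq> fib (rng G x)" by (auto simp: compactin_subtopology)
    obtain h :: "'g \<Rightarrow> real" and M where h: "continuous_on UNIV h" "\<And>x. 0 \<le> h x" "\<And>x. h x \<le> 1" "\<And>x. x \<in> K \<Longrightarrow> h x = 1"
      "M \<subseteq> V" "\<And>x. x \<notin> M \<Longrightarrow> h x = 0" "(\<lambda>x. complex_of_real (h x)) \<in> Cc"
      by (rule lc_bump[OF lc K(1) V K(2)]) blast
    have i: "integrable ?M h" using integrable_Re[OF haar_integrable[OF rng_units h(7), of x]] by simp
    have "complex_of_real (\<integral>t. h (x \<cdot> t) \<partial>?N) = of_real (\<integral>t. h t \<partial>?M)"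
      unfolding I1_of_real[symmetric] by (rule H.I_shift[OF h(7)])
    then have e: "(\<integral>t. h (x \<cdot> t) \<partial>?N) = (\<integral>t. h t \<partial>?M)" by (simp only: of_real_eq_iff)
    have "emeasure ?M K = (\<integral>\<^sup>+t. indicator K t \<partial>?M)"
      using K by (intro nn_integral_indicator[symmetric]) (metis haar_closed_sets[OF rng_units compact_imp_closed] Int_absorb2)
    also have "\<dots> \<le> (\<integral>\<^sup>+t. ennreal (h t) \<partial>?M)"
      by (intro nn_integral_mono) (auto simp: indicator_def h(4))
    also have "\<dots> = ennreal (\<integral>t. h t \<partial>?M)" using i h(2) by (intro nn_integral_eq_integral) auto
    also have "\<dots> \<le> (\<integral>\<^sup>+t. ennreal (h (x \<cdot> t)) \<partial>?N)"
    proof (cases "integrable ?N (\<lambda>t. h (x \<cdot> t))")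
      case True
      then show ?thesis unfolding e[symmetric] using h(2) by (subst nn_integral_eq_integral) auto
    next
      \<comment> \<open>The integral of a non-integrable function is 0 by convention; by
        \<open>e\<close> the integral of h is then 0 as well, and the inequality is trivial.\<close>
      case False
      then have "(\<integral>t. h (x \<cdot> t) \<partial>?N) = 0" by (rule not_integrable_integral_eq)
      then show ?thesis unfolding e[symmetric] by simp
    qed
    also have "\<dots> \<le> (\<integral>\<^sup>+t. indicator ?W t \<partial>?N)"
    proof (intro nn_integral_mono)
      fix t assume "t \<in> space ?N"
      then have t: "rng G t = src G x" by (simp add: space_haar)
      show "ennreal (h (x \<cdot> t)) \<le> indicator ?W t"
      proof (cases "x \<cdot> t \<in> V")
        case True
        then show ?thesis using h(3) t by (simp add: indicator_def)
      next
        case False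
        then have "h (x \<cdot> t) = 0" using h(5,6) by blast
        then show ?thesis by simp
      qed
    qed
    also have "\<dots> = emeasure ?N ?W" using Ws by (rule nn_integral_indicator)
    finally show "emeasure ?M K \<le> emeasure ?N ?W" .
  qed
  finally show ?thesis .
qed

lemma shift_measurable: "(\<lambda>t. x \<cdot> t) \<in> measurable (haar G (src G x)) (haar G (rng G x))"
proof -
  have "(\<lambda>t. x \<cdot> t) \<in> borel_measurable (haar G (src G x))"
    by (intro haar_measurable src_units cont_mult) auto
  then have "(\<lambda>t. x \<cdot> t) \<in> measurable (haar G (src G x)) (restrict_space borel (fib (rng G x)))"
    by (rule measurable_restrict_space2[rotated]) (auto simp: space_haar rng_mult)
  then show ?thesis using measurable_cong_sets[OF refl sets_haar[OF rng_units]] by blast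
qed

text \<open>Outer regularity of the measure at the source reduces a measurable set to the open sets
  around it, for which the inequality is known.\<close>

lemma haar_le_shift:
  assumes A: "A \<in> sets (haar G (rng G x))"
  shows "emeasure (haar G (rng G x)) A \<le> emeasure (haar G (src G x)) {t. rng G t = src G x \<and> x \<cdot> t \<in> A}"
proof -
  let ?M = "haar G (rng G x)" and ?N = "haar G (src G x)" and ?A = "{t. rng G t = src G x \<and> x \<cdot> t \<in> A}"
  have "?A = (\<lambda>t. x \<cdot> t) -` A \<inter> space ?N" by (auto simp: space_haar)
  then have As: "?A \<in> sets ?N" using measurable_sets[OF shift_measurable A] by simp
  have "\<forall>A\<in>sets ?N. emeasure ?N A = (INF V\<in>{V. openin (top_of_set (fib (src G x))) V \<and> A \<subseteq> V}. emeasure ?N V)"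
    using haar_regular[OF src_units, of x] unfolding regular_borel_measure_def by (elim conjE)
  note bspec[OF this As]
  moreover have "emeasure ?M A \<le> (INF V\<in>{V. openin (top_of_set (fib (src G x))) V \<and> ?A \<subseteq> V}. emeasure ?N V)"
  proof (rule INF_greatest)
    fix V assume "V \<in> {V. openin (top_of_set (fib (src G x))) V \<and> ?A \<subseteq> V}"
    then obtain W where W: "open W" "V = fib (src G x) \<inter> W" and V: "?A \<subseteq> V" by (auto simp: openin_open)
    have c: "continuous_on (fib (rng G x)) (\<lambda>t. ginv G x \<cdot> t)" by (rule cont_mult) auto
    obtain W' where W': "open W'" "fib (rng G x) \<inter> (\<lambda>t. ginv G x \<cdot> t) -` W = fib (rng G x) \<inter> W'"
      using continuous_openin_preimage_gen[OF c W(1)] by (auto simp: openin_open)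
    have sub: "A \<subseteq> W' \<inter> fib (rng G x)"
    proof
      fix t assume t: "t \<in> A"
      then have r: "rng G t = rng G x" using sets.sets_into_space[OF A] by (auto simp: space_haar)
      then have "ginv G x \<cdot> t \<in> ?A" using t by (simp add: rng_mult inv_cancel2)
      then have "t \<in> fib (rng G x) \<inter> (\<lambda>t. ginv G x \<cdot> t) -` W" using V W(2) r by blast
      then show "t \<in> W' \<inter> fib (rng G x)" unfolding W'(2) by blast
    qed
    have "emeasure ?M A \<le> emeasure ?M (W' \<inter> fib (rng G x))"
      using sub W'(1) by (intro emeasure_mono haar_borel_sets rng_units) auto
    also have "\<dots> \<le> emeasure ?N {t. rng G t = src G x \<and> x \<cdot> t \<in> W'}" by (rule haar_le_shift_open[OF W'(1)])
    also have "\<dots> \<le> emeasure ?N V"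
    proof (rule emeasure_mono)
      show "V \<in> sets ?N" unfolding W(2) using haar_borel_sets[OF src_units, of W x] W(1) by (simp add: Int_commute)
      show "{t. rng G t = src G x \<and> x \<cdot> t \<in> W'} \<subseteq> V"
      proof
        fix t assume "t \<in> {t. rng G t = src G x \<and> x \<cdot> t \<in> W'}"
        then have t: "rng G t = src G x" "x \<cdot> t \<in> fib (rng G x) \<inter> W'" by (auto simp: rng_mult)
        have "ginv G x \<cdot> (x \<cdot> t) \<in> W" using t(2) unfolding W'(2)[symmetric] by blast
        then show "t \<in> V" using t(1) by (simp add: W(2) inv_cancel)
      qed
    qed
    finally show "emeasure ?M A \<le> emeasure ?N V" .
  qed
  ultimately show ?thesis by simp
qed

text \<open>The inequality for x and the one for its inverse together give equality.\<close>

lemma haar_shift: "distr (haar G (src G x)) (haar G (rng G x)) (\<lambda>t. x \<cdot> t) = haar G (rng G x)"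
proof (rule measure_eqI)
  fix A assume "A \<in> sets (distr (haar G (src G x)) (haar G (rng G x)) (\<lambda>t. x \<cdot> t))"
  then have A: "A \<in> sets (haar G (rng G x))" by simp
  let ?A = "{t. rng G t = src G x \<and> x \<cdot> t \<in> A}"
  have e: "?A = (\<lambda>t. x \<cdot> t) -` A \<inter> space (haar G (src G x))" by (auto simp: space_haar)
  have "?A \<in> sets (haar G (src G x))" unfolding e by (rule measurable_sets[OF shift_measurable A])
  then have "emeasure (haar G (src G x)) ?A \<le> emeasure (haar G (rng G x)) {t. rng G t = rng G x \<and> ginv G x \<cdot> t \<in> ?A}"
    using haar_le_shift[of ?A "ginv G x"] by simp
  also have "{t. rng G t = rng G x \<and> ginv G x \<cdot> t \<in> ?A} = A"
    using sets.sets_into_space[OF A] by (auto simp: space_haar rng_mult inv_cancel2)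
  finally have "emeasure (haar G (src G x)) ?A = emeasure (haar G (rng G x)) A" using haar_le_shift[OF A] by (rule order_antisym)
  then show "emeasure (distr (haar G (src G x)) (haar G (rng G x)) (\<lambda>t. x \<cdot> t)) A = emeasure (haar G (rng G x)) A"
    unfolding emeasure_distr[OF shift_measurable A] e .
qed simp

section \<open>Square integrable functions on the fibres and approximation in E^2\<close>

definition Lsq :: "'g \<Rightarrow> ('g \<Rightarrow> complex) set" where
  "Lsq u = {f. f \<in> borel_measurable (haar G u) \<and> integrable (haar G u) (\<lambda>t. (cmod (f t))\<^sup>2)}"

lemma Lsq_prod:
  assumes f: "f \<in> Lsq u" and g: "g \<in> Lsq u"
  shows "integrable (haar G u) (\<lambda>t. cnj (f t) * g t)"
proof (rule Bochner_Integration.integrable_bound)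
  show "integrable (haar G u) (\<lambda>t. (cmod (f t))\<^sup>2 + (cmod (g t))\<^sup>2)" using f g by (simp add: Lsq_def)
  have m: "f \<in> borel_measurable (haar G u)" "g \<in> borel_measurable (haar G u)" using f g by (simp_all add: Lsq_def)
  have "cnj \<in> borel_measurable borel" by (intro borel_measurable_continuous_onI continuous_intros)
  from measurable_compose[OF m(1) this]
  show "(\<lambda>t. cnj (f t) * g t) \<in> borel_measurable (haar G u)" by (intro borel_measurable_times m(2))
  have "cmod (f t) * cmod (g t) \<le> (cmod (f t))\<^sup>2 + (cmod (g t))\<^sup>2" for t
    using sum_squares_bound[of "cmod (f t)" "cmod (g t)"] mult_nonneg_nonneg[OF norm_ge_zero norm_ge_zero, of "f t" "g t"]
    by linarith
  then show "AE t in haar G u. norm (cnj (f t) * g t) \<le> norm ((cmod (f t))\<^sup>2 + (cmod (g t))\<^sup>2)"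
    by (intro AE_I2) (simp add: norm_mult)
qed

lemma L2_semi_ip: "semi_ip (Lsq u) (L2_inner G u)"
proof
  fix f g h c
  show "(\<lambda>i. 0) \<in> Lsq u" by (simp add: Lsq_def)
  show "(\<lambda>i. c * f i) \<in> Lsq u" if "f \<in> Lsq u"     using that by (simp add: Lsq_def norm_mult power_mult_distrib borel_measurable_times)
  show "(\<lambda>i. f i + g i) \<in> Lsq u" if fg: "f \<in> Lsq u" "g \<in> Lsq u"
  proof -
    have [measurable]: "f \<in> borel_measurable (haar G u)" "g \<in> borel_measurable (haar G u)" using fg by (simp_all add: Lsq_def)
    have "integrable (haar G u) (\<lambda>t. (cmod (f t + g t))\<^sup>2)"
    proof (rule Bochner_Integration.integrable_bound)
      show "integrable (haar G u) (\<lambda>t. 2 * (cmod (f t))\<^sup>2 + 2 * (cmod (g t))\<^sup>2)" using fg by (simp add: Lsq_def)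
      have "(cmod (f t + g t))\<^sup>2 \<le> 2 * (cmod (f t))\<^sup>2 + 2 * (cmod (g t))\<^sup>2" for t
      proof -
        have "(cmod (f t + g t))\<^sup>2 \<le> (cmod (f t) + cmod (g t))\<^sup>2" by (intro power_mono norm_triangle_ineq) simp
        also have "\<dots> \<le> 2 * (cmod (f t))\<^sup>2 + 2 * (cmod (g t))\<^sup>2"
          using sum_squares_bound[of "cmod (f t)" "cmod (g t)"] by (simp add: power2_sum)
        finally show ?thesis .
      qed
      then show "AE t in haar G u. norm ((cmod (f t + g t))\<^sup>2) \<le> norm (2 * (cmod (f t))\<^sup>2 + 2 * (cmod (g t))\<^sup>2)"
        by (intro AE_I2) simp
    qed measurable
    then show ?thesis by (simp add: Lsq_def)
  qed
  show "L2_inner G u f (\<lambda>i. g i + h i) = L2_inner G u f g + L2_inner G u f h" if "f \<in> Lsq u" "g \<in> Lsq u" "h \<in> Lsq u"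
    using that by (simp add: L2_inner_def distrib_left Lsq_prod)
  show "L2_inner G u f (\<lambda>i. c * g i) = c * L2_inner G u f g"
    by (simp add: L2_inner_def mult.left_commute)
  show "L2_inner G u g f = cnj (L2_inner G u f g)"
  proof -
    have "(\<lambda>t. cnj (g t) * f t) = (\<lambda>t. cnj (cnj (f t) * g t))" by (simp add: mult.commute)
    then show ?thesis unfolding L2_inner_def by (simp only: Bochner_Integration.integral_cnj)
  qed
  show "0 \<le> Re (L2_inner G u f f)"
    unfolding L2_inner_def complex_cnj_mult_cmod integral_complex_of_real by simp
qed

lemma L2_nrm: "semi_ip.nrm (L2_inner G u) = L2_norm G u"
  by (rule ext) (simp add: semi_ip.nrm_def[OF L2_semi_ip] L2_norm_def L2_inner_def complex_cnj_mult_cmod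
      integral_complex_of_real del: of_real_power)

lemmas Lsq_add = semi_ip.add_W[OF L2_semi_ip]
  and Lsq_scale = semi_ip.scale_W[OF L2_semi_ip] and Lsq_diff = semi_ip.diff_W[OF L2_semi_ip]
  and L2_add = semi_ip.ip_add[OF L2_semi_ip] and L2_scale = semi_ip.ip_scale[OF L2_semi_ip]
  and L2_add_left = semi_ip.ip_add_left[OF L2_semi_ip] and L2_scale_left = semi_ip.ip_scale_left[OF L2_semi_ip]
  and L2_norm_scale = semi_ip.nrm_scale[OF L2_semi_ip, unfolded L2_nrm]
  and L2_triangle = semi_ip.nrm_triangle[OF L2_semi_ip, unfolded L2_nrm]
  and L2_diff_commute = semi_ip.nrm_diff_commute[OF L2_semi_ip, unfolded L2_nrm]
  and L2_norm_nonneg = semi_ip.nrm_nonneg[OF L2_semi_ip, unfolded L2_nrm]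
  and L2_diff_bound = semi_ip.ip_diff_bound[OF L2_semi_ip, unfolded L2_nrm]

lemma Lsq_cong:
  assumes "u \<in> units G" "\<And>t. rng G t = u \<Longrightarrow> f t = g t"
  shows "L2_norm G u f = L2_norm G u g" "f \<in> Lsq u \<longleftrightarrow> g \<in> Lsq u"
proof -
  show "L2_norm G u f = L2_norm G u g" unfolding L2_norm_nsq using nsq_cong[OF assms] by simp
  have "f \<in> borel_measurable (haar G u) \<longleftrightarrow> g \<in> borel_measurable (haar G u)"
    using assms by (intro measurable_cong) (simp add: space_haar)
  moreover have "integrable (haar G u) (\<lambda>t. (cmod (f t))\<^sup>2) \<longleftrightarrow> integrable (haar G u) (\<lambda>t. (cmod (g t))\<^sup>2)"
    using assms by (intro Bochner_Integration.integrable_cong) (auto simp: space_haar)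
  ultimately show "f \<in> Lsq u \<longleftrightarrow> g \<in> Lsq u" by (simp add: Lsq_def)
qed

lemma Cc_Lsq: "u \<in> units G \<Longrightarrow> f \<in> Cc \<Longrightarrow> f \<in> Lsq u"
  by (simp add: Lsq_def cmod_sq_integrable haar_measurable Cc_cont)

lemma Lsq_shift:
  assumes f: "f \<in> Lsq (src G x)"
  shows "(\<lambda>t. f (ginv G x \<cdot> t)) \<in> Lsq (rng G x)" "L2_norm G (rng G x) (\<lambda>t. f (ginv G x \<cdot> t)) = L2_norm G (src G x) f"
proof -
  let ?M = "haar G (rng G x)" and ?N = "haar G (src G x)"
  have m: "(\<lambda>t. ginv G x \<cdot> t) \<in> measurable ?M ?N" and d: "distr ?M ?N (\<lambda>t. ginv G x \<cdot> t) = ?N"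
    using shift_measurable[of "ginv G x"] haar_shift[of "ginv G x"] by simp_all
  have f': "f \<in> borel_measurable ?N" "integrable ?N (\<lambda>t. (cmod (f t))\<^sup>2)" using f by (simp_all add: Lsq_def)
  have fm: "(\<lambda>t. (cmod (f t))\<^sup>2) \<in> borel_measurable ?N" using f'(1) by measurable
  show "(\<lambda>t. f (ginv G x \<cdot> t)) \<in> Lsq (rng G x)"
    unfolding Lsq_def using measurable_compose[OF m f'(1)] integrable_distr[OF m, of "\<lambda>t. (cmod (f t))\<^sup>2", unfolded d, OF f'(2)] by simp
  show "L2_norm G (rng G x) (\<lambda>t. f (ginv G x \<cdot> t)) = L2_norm G (src G x) f"
    unfolding L2_norm_def integral_distr[OF m fm, symmetric] d ..
qed

lemma E2_Lsq: "\<xi> \<in> E2 G \<Longrightarrow> u \<in> units G \<Longrightarrow> \<xi> \<in> Lsq u"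
  by (simp add: E2_def Lsq_def)

lemma E2_local_approx:
  assumes xi: "\<xi> \<in> E2 G" and e: "e > 0" and y: "y \<in> units G"
  shows "\<exists>f b W. f \<in> Cc \<and> continuous_on UNIV b \<and> (\<forall>v. 0 \<le> b v \<and> b v \<le> (1::real)) \<and> open W \<and> y \<in> W \<and>
    (\<forall>v\<in>W. b v = 1) \<and> (\<forall>v\<in>units G. b v \<noteq> 0 \<longrightarrow> L2_norm G v (\<lambda>t. \<xi> t - f t) \<le> e)"
proof -
  have "\<forall>u\<in>units G. \<forall>e>0. \<exists>f\<in>Cc. \<exists>V. open V \<and> u \<in> V \<and> (\<forall>v\<in>V \<inter> units G. L2_norm G v (\<lambda>t. \<xi> t - f t) \<le> e)"
    using xi unfolding E2_def by (elim CollectE conjE)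
  then obtain f V where f: "f \<in> Cc" "open V" "y \<in> V" "\<forall>v\<in>V \<inter> units G. L2_norm G v (\<lambda>t. \<xi> t - f t) \<le> e"
    using y e by meson
  obtain W where W: "open W" "{y} \<subseteq> W" "compact (closure W)" "closure W \<subseteq> V"
    by (rule lc_between[OF lc, of "{y}" V]) (use f in auto)
  obtain b :: "'g \<Rightarrow> real" and M where b: "continuous_on UNIV b" "\<And>v. 0 \<le> b v" "\<And>v. b v \<le> 1" "\<And>v. v \<in> closure W \<Longrightarrow> b v = 1"
    "M \<subseteq> V" "\<And>v. v \<notin> M \<Longrightarrow> b v = 0"
    by (rule lc_bump[OF lc W(3) f(2) W(4)]) blast
  show ?thesis
  proof (intro exI conjI allI ballI impI)
    show "b v = 1" if "v \<in> W" for v using b(4) closure_subset that by blast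
    show "L2_norm G v (\<lambda>t. \<xi> t - f t) \<le> e" if "v \<in> units G" "b v \<noteq> 0" for v using f(4) b(5,6) that by blast
  qed (use f W b in auto)
qed

text \<open>Local approximants around finitely many points of K are patched one at a time: b F + (1
  - b) f is at each unit a convex combination, so the error bound e is inherited. This takes the
  place of a partition of unity.\<close>

lemma E2_approx:
  assumes xi: "\<xi> \<in> E2 G" and e: "e > 0"
  obtains f where "f \<in> Cc" "\<And>u. u \<in> units G \<Longrightarrow> L2_norm G u (\<lambda>t. \<xi> t - f t) \<le> e"
proof -
  have "\<forall>e>0. \<exists>K. compact K \<and> K \<subseteq> units G \<and> (\<forall>u\<in>units G - K. L2_norm G u \<xi> < e)"
    using xi unfolding E2_def by (elim CollectE conjE)
  then obtain K where K: "compact K" "K \<subseteq> units G" "\<forall>u\<in>units G - K. L2_norm G u \<xi> < e" using e by meson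
  define good where "good y f b W \<longleftrightarrow> f \<in> Cc \<and> continuous_on UNIV b \<and> (\<forall>v. 0 \<le> b v \<and> b v \<le> (1::real)) \<and> open W \<and> y \<in> W \<and>
    (\<forall>v\<in>W. b v = 1) \<and> (\<forall>v\<in>units G. b v \<noteq> 0 \<longrightarrow> L2_norm G v (\<lambda>t. \<xi> t - f t) \<le> e)" for y f b and W :: "'g set"
  have "\<forall>y\<in>K. \<exists>f b W. good y f b W" unfolding good_def using E2_local_approx[OF xi e] K(2) by blast
  then obtain F B W where g: "\<And>y. y \<in> K \<Longrightarrow> good y (F y) (B y) (W y)" by metis
  obtain Y where Y: "Y \<subseteq> K" "finite Y" "K \<subseteq> (\<Union>y\<in>Y. W y)"
  proof (rule compactE_image[OF K(1), of K W])
    show "open (W y)" if "y \<in> K" for y using g[OF that] unfolding good_def by (elim conjE)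
    show "K \<subseteq> (\<Union>y\<in>K. W y)"
    proof
      fix y assume y: "y \<in> K"
      show "y \<in> (\<Union>y\<in>K. W y)" by (rule UN_I[OF y]) (use g[OF y] in \<open>unfold good_def, elim conjE\<close>)
    qed
  qed (rule that)
  have "\<exists>f\<in>Cc. \<forall>v\<in>units G. v \<in> (\<Union>y\<in>Y. W y) \<or> v \<notin> K \<longrightarrow> L2_norm G v (\<lambda>t. \<xi> t - f t) \<le> e"
    using Y(2,1)
  proof (induction Y rule: finite_induct)
    \<comment> \<open>Off K the zero function is close enough, by the choice of K.\<close>
    case empty
    show ?case using K(3) by (intro bexI[OF _ Cc_zero]) (auto intro: less_imp_le)
  next
    case (insert y Y)
    then obtain f where f: "f \<in> Cc" "\<And>v. v \<in> units G \<Longrightarrow> v \<in> (\<Union>y\<in>Y. W y) \<or> v \<notin> K \<Longrightarrow> L2_norm G v (\<lambda>t. \<xi> t - f t) \<le> e" by auto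
    have "good y (F y) (B y) (W y)" using g insert by blast
    then have G1: "F y \<in> Cc" "continuous_on UNIV (B y)" "\<And>v. 0 \<le> B y v" "\<And>v. B y v \<le> 1" "\<And>v. v \<in> W y \<Longrightarrow> B y v = 1"
      "\<And>v. v \<in> units G \<Longrightarrow> B y v \<noteq> 0 \<Longrightarrow> L2_norm G v (\<lambda>t. \<xi> t - F y t) \<le> e"
      unfolding good_def by simp_all
    let ?b = "\<lambda>t. complex_of_real (B y (rng G t))"
    have cb: "continuous_on UNIV ?b"
      by (intro continuous_on_of_real continuous_on_compose2[OF G1(2) cont_rng]) auto
    show ?case
    proof (intro bexI ballI impI)
      show "(\<lambda>t. ?b t * F y t + (1 - ?b t) * f t) \<in> Cc"
        by (intro Cc_add Cc_mult_cont(2) G1(1) f(1) continuous_on_diff continuous_on_const cb)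
      fix v assume v: "v \<in> units G" and c: "v \<in> (\<Union>y\<in>insert y Y. W y) \<or> v \<notin> K"
      let ?F = "\<lambda>t. \<xi> t - F y t" and ?f = "\<lambda>t. \<xi> t - f t"
      have L: "?F \<in> Lsq v" "?f \<in> Lsq v" by (intro Lsq_diff E2_Lsq[OF xi v] Cc_Lsq[OF v] G1(1) f(1))+
      have "L2_norm G v (\<lambda>t. \<xi> t - (?b t * F y t + (1 - ?b t) * f t)) =
          L2_norm G v (\<lambda>t. complex_of_real (B y v) * ?F t + complex_of_real (1 - B y v) * ?f t)"
        by (rule Lsq_cong(1)[OF v]) (simp add: algebra_simps)
      also have "\<dots> \<le> B y v * L2_norm G v ?F + (1 - B y v) * L2_norm G v ?f"
        using L2_triangle[OF Lsq_scale[OF L(1)] Lsq_scale[OF L(2)], of "of_real (B y v)" "of_real (1 - B y v)"]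
        unfolding L2_norm_scale[OF L(1)] L2_norm_scale[OF L(2)] norm_of_real using G1(3,4)[of v] by simp
      also have "\<dots> \<le> e"
      proof (cases "B y v = 1")
        case True
        then show ?thesis using G1(6)[OF v] by simp
      next
        case False
        then have f': "L2_norm G v ?f \<le> e" using f(2)[OF v] c G1(5) by blast
        have "B y v * L2_norm G v ?F \<le> B y v * e"
          using G1(6)[OF v] G1(3)[of v] by (cases "B y v = 0") (auto intro: mult_left_mono)
        moreover have "(1 - B y v) * L2_norm G v ?f \<le> (1 - B y v) * e" using f' G1(4)[of v] by (intro mult_left_mono) auto
        ultimately show ?thesis by (simp add: algebra_simps)
      qed
      finally show "L2_norm G v (\<lambda>t. \<xi> t - (?b t * F y t + (1 - ?b t) * f t)) \<le> e" .
    qed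
  qed
  then obtain f where f: "f \<in> Cc" "\<And>v. v \<in> units G \<Longrightarrow> v \<in> (\<Union>y\<in>Y. W y) \<or> v \<notin> K \<Longrightarrow> L2_norm G v (\<lambda>t. \<xi> t - f t) \<le> e" by auto
  show ?thesis by (rule that[OF f(1)], rule f(2)) (use Y(3) in auto)
qed

text \<open>Uniform approximation over all units implies both the local condition and vanishing at
  infinity. Together with \<open>E2_approx\<close> it describes \<open>E2 G\<close> in a form that
  is easy to check for products and conjugates.\<close>

lemma E2I:
  assumes L: "\<And>u. u \<in> units G \<Longrightarrow> \<xi> \<in> Lsq u"
    and ap: "\<And>e. e > 0 \<Longrightarrow> \<exists>f\<in>Cc. \<forall>u\<in>units G. L2_norm G u (\<lambda>t. \<xi> t - f t) \<le> e"
  shows "\<xi> \<in> E2 G"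
  unfolding E2_def
proof (intro CollectI conjI ballI allI impI)
  fix u assume "u \<in> units G"
  then show "\<xi> \<in> borel_measurable (haar G u)" "integrable (haar G u) (\<lambda>t. (cmod (\<xi> t))\<^sup>2)" using L by (simp_all add: Lsq_def)
next
  fix u and e :: real assume u: "u \<in> units G" and e: "e > 0"
  obtain f where f: "f \<in> Cc" "\<forall>u\<in>units G. L2_norm G u (\<lambda>t. \<xi> t - f t) \<le> e" using ap[OF e] by (rule bexE)
  show "\<exists>f\<in>Cc. \<exists>V. open V \<and> u \<in> V \<and> (\<forall>v\<in>V \<inter> units G. L2_norm G v (\<lambda>t. \<xi> t - f t) \<le> e)"
    by (rule bexI[OF _ f(1)], rule exI[of _ UNIV]) (simp add: f(2))
next
  fix e :: real assume e: "e > 0"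
  obtain f where f: "f \<in> Cc" "\<forall>u\<in>units G. L2_norm G u (\<lambda>t. \<xi> t - f t) \<le> e/2" using ap[OF half_gt_zero[OF e]] by (rule bexE)
  obtain K where K: "compact K" "\<And>x. x \<notin> K \<Longrightarrow> f x = 0" by (rule CcE[OF f(1)]) blast
  show "\<exists>K. compact K \<and> K \<subseteq> units G \<and> (\<forall>u\<in>units G - K. L2_norm G u \<xi> < e)"
  proof (intro exI conjI ballI)
    show "compact (rng G ` K)" by (intro compact_continuous_image cont_rng' K)
    show "rng G ` K \<subseteq> units G" by auto
    fix u assume u: "u \<in> units G - rng G ` K"
    have "L2_norm G u \<xi> = L2_norm G u (\<lambda>t. \<xi> t - f t)"
      using u K(2) by (intro Lsq_cong(1)) auto
    then show "L2_norm G u \<xi> < e" using f(2) u e by (metis DiffD1 field_sum_of_halves less_add_same_cancel1 half_gt_zero order_le_less_trans)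
  qed
qed

lemma Cc_E2: "f \<in> Cc \<Longrightarrow> f \<in> E2 G"
  by (rule E2I[OF Cc_Lsq], assumption+, rule bexI[of _ f]) (auto simp: L2_norm_def)

lemma E2_norm_ge:
  assumes xi: "\<xi> \<in> E2 G" and u: "u \<in> units G"
  shows "L2_norm G u \<xi> \<le> E2_norm G \<xi>"
proof -
  obtain f where f: "f \<in> Cc" "\<And>u. u \<in> units G \<Longrightarrow> L2_norm G u (\<lambda>t. \<xi> t - f t) \<le> 1"
    by (rule E2_approx[OF xi zero_less_one]) blast
  obtain a where a: "\<And>u. u \<in> units G \<Longrightarrow> L2_norm G u f \<le> a" by (rule L2_norm_bounded[OF f(1)]) blast
  have "L2_norm G v \<xi> \<le> 1 + a" if v: "v \<in> units G" for v
    using L2_triangle[OF Lsq_diff[OF E2_Lsq[OF xi v] Cc_Lsq[OF v f(1)]] Cc_Lsq[OF v f(1)]] f(2)[OF v] a[OF v] by simp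
  then have "bdd_above ((\<lambda>u. L2_norm G u \<xi>) ` units G)" by (intro bdd_aboveI2)
  then show ?thesis unfolding E2_norm_def using u by (intro cSUP_upper)
qed

lemma E2_norm_le: "(\<And>u. u \<in> units G \<Longrightarrow> L2_norm G u \<xi> \<le> c) \<Longrightarrow> E2_norm G \<xi> \<le> c"
  unfolding E2_norm_def by (rule cSUP_least[OF units_nonempty])

lemma E2_norm_nonneg: "\<xi> \<in> E2 G \<Longrightarrow> 0 \<le> E2_norm G \<xi>"
  using units_nonempty E2_norm_ge L2_norm_nonneg[OF E2_Lsq] by (meson ex_in_conv order_trans)

lemma E2_mult:
  assumes f: "f \<in> E2 G" and k: "continuous_on (units G) k" "\<And>u. u \<in> units G \<Longrightarrow> cmod (k u) \<le> C"
  shows "(\<lambda>t. f t * k (rng G t)) \<in> E2 G" "E2_norm G (\<lambda>t. f t * k (rng G t)) \<le> C * E2_norm G f"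
proof -
  have C: "0 \<le> C" using k(2) units_nonempty by (meson ex_in_conv norm_ge_zero order_trans)
  have L: "(\<lambda>t. h t * k (rng G t)) \<in> Lsq u" "L2_norm G u (\<lambda>t. h t * k (rng G t)) = cmod (k u) * L2_norm G u h"
    if u: "u \<in> units G" and h: "h \<in> Lsq u" for u h
    using Lsq_cong[OF u, of "\<lambda>t. h t * k (rng G t)" "\<lambda>t. k u * h t"] Lsq_scale[OF h, of "k u"] L2_norm_scale[OF h, of "k u"] by simp_all
  show "(\<lambda>t. f t * k (rng G t)) \<in> E2 G"
  proof (rule E2I[OF L(1)])
    show "f \<in> Lsq u" if "u \<in> units G" for u by (rule E2_Lsq[OF f that])
    fix e :: real assume e: "e > 0"
    then have "e / (C + 1) > 0" using C by simp
    then obtain p where p: "p \<in> Cc" "\<And>u. u \<in> units G \<Longrightarrow> L2_norm G u (\<lambda>t. f t - p t) \<le> e / (C + 1)"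
      by (rule E2_approx[OF f]) blast
    have "L2_norm G u (\<lambda>t. f t * k (rng G t) - p t * k (rng G t)) \<le> e" if u: "u \<in> units G" for u
    proof -
      have "L2_norm G u (\<lambda>t. (f t - p t) * k (rng G t)) = cmod (k u) * L2_norm G u (\<lambda>t. f t - p t)"
        by (intro L(2) u Lsq_diff E2_Lsq f Cc_Lsq p(1))
      also have "\<dots> \<le> (C + 1) * (e / (C + 1))" using k(2)[OF u] p(2)[OF u] C e by (intro mult_mono) (auto simp: L2_norm_def)
      finally show ?thesis using C by (simp add: left_diff_distrib)
    qed
    moreover have "(\<lambda>t. p t * k (rng G t)) \<in> Cc"
      by (intro Cc_mult_cont(1) p(1) continuous_on_compose2[OF k(1) cont_rng]) auto
    ultimately show "\<exists>h\<in>Cc. \<forall>u\<in>units G. L2_norm G u (\<lambda>t. f t * k (rng G t) - h t) \<le> e"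
      by (intro bexI[of _ "\<lambda>t. p t * k (rng G t)"] ballI)
  qed
  show "E2_norm G (\<lambda>t. f t * k (rng G t)) \<le> C * E2_norm G f"
    by (rule E2_norm_le, subst L(2)) (use C E2_Lsq[OF f] E2_norm_ge[OF f] k(2) in \<open>auto intro!: mult_mono simp: L2_norm_def\<close>)
qed

lemma E2_scale: "f \<in> E2 G \<Longrightarrow> (\<lambda>t. c * f t) \<in> E2 G"
  using E2_mult(1)[of f "\<lambda>_. c" "cmod c"] by (simp add: mult.commute)

lemma E2_cnj:
  assumes f: "f \<in> E2 G"
  shows "(\<lambda>t. cnj (f t)) \<in> E2 G"
proof (rule E2I)
  fix u assume "u \<in> units G"
  then have "f \<in> borel_measurable (haar G u)" "integrable (haar G u) (\<lambda>t. (cmod (f t))\<^sup>2)" using E2_Lsq[OF f] by (simp_all add: Lsq_def)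
  moreover have "cnj \<in> borel_measurable borel" by (intro borel_measurable_continuous_onI continuous_intros)
  ultimately show "(\<lambda>t. cnj (f t)) \<in> Lsq u" unfolding Lsq_def using measurable_compose by auto
next
  fix e :: real assume "e > 0"
  then obtain p where p: "p \<in> Cc" "\<And>u. u \<in> units G \<Longrightarrow> L2_norm G u (\<lambda>t. f t - p t) \<le> e" by (rule E2_approx[OF f]) blast
  have "L2_norm G u (\<lambda>t. cnj (f t) - cnj (p t)) = L2_norm G u (\<lambda>t. f t - p t)" for u
    unfolding L2_norm_def complex_cnj_diff[symmetric] complex_mod_cnj ..
  then show "\<exists>h\<in>Cc. \<forall>u\<in>units G. L2_norm G u (\<lambda>t. cnj (f t) - h t) \<le> e"
    by (intro bexI[OF _ Cc_cnj[OF p(1)]]) (simp add: p(2))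
qed

lemma E2_norm_cnj: "E2_norm G (\<lambda>t. cnj (f t)) = E2_norm G f"
  by (simp add: E2_norm_def L2_norm_def)

lemma coef_diff_B:
  assumes Cc: "p \<in> Cc" "q \<in> Cc" "p' \<in> Cc" "q' \<in> Cc"
    and b: "\<And>u. u \<in> units G \<Longrightarrow> L2_norm G u (\<lambda>t. p t - p' t) \<le> d" "\<And>u. u \<in> units G \<Longrightarrow> L2_norm G u q \<le> c"
      "\<And>u. u \<in> units G \<Longrightarrow> L2_norm G u p' \<le> c'" "\<And>u. u \<in> units G \<Longrightarrow> L2_norm G u (\<lambda>t. q t - q' t) \<le> d'"
  shows "B_norm G (\<lambda>x. coef p q x - coef p' q' x) \<le> d * c + c' * d'"
proof -
  have "(\<lambda>x. coef p q x - coef p' q' x) = (\<lambda>x. coef (\<lambda>t. p t - p' t) q x + coef p' (\<lambda>t. q t - q' t) x)"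
    using Cc by (simp add: coef_cf H.cf_diff_left H.cf_diff_right)
  moreover note 1 = coef_B[OF Cc_diff[OF Cc(1,3)] Cc(2) b(1,2)] and 2 = coef_B[OF Cc(3) Cc_diff[OF Cc(2,4)] b(3,4)]
  ultimately show ?thesis using B_add(2)[OF 1(1) 2(1)] 1(2) 2(2) by simp
qed

lemma E2_seq:
  assumes f: "f \<in> E2 G"
  obtains F where "\<And>n. F n \<in> Cc" "\<And>n u. u \<in> units G \<Longrightarrow> L2_norm G u (\<lambda>t. f t - F n t) \<le> inverse (real (Suc n))"
    "\<And>n u. u \<in> units G \<Longrightarrow> L2_norm G u (F n) \<le> E2_norm G f + inverse (real (Suc n))"
    "\<And>m n u. u \<in> units G \<Longrightarrow> L2_norm G u (\<lambda>t. F m t - F n t) \<le> inverse (real (Suc m)) + inverse (real (Suc n))"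
proof -
  have "\<exists>p. p \<in> Cc \<and> (\<forall>u\<in>units G. L2_norm G u (\<lambda>t. f t - p t) \<le> inverse (real (Suc n)))" for n
    by (rule E2_approx[OF f, of "inverse (real (Suc n))"]) auto
  then obtain F where F: "\<And>n. F n \<in> Cc" "\<And>n u. u \<in> units G \<Longrightarrow> L2_norm G u (\<lambda>t. f t - F n t) \<le> inverse (real (Suc n))"
    by metis
  note L = E2_Lsq[OF f] Cc_Lsq[OF _ F(1)]
  have c: "L2_norm G u (\<lambda>t. F n t - f t) \<le> inverse (real (Suc n))" if u: "u \<in> units G" for u n
    using F(2)[OF u] L2_diff_commute[OF L(1)[OF u] L(2)[OF u]] by simp
  show ?thesis
  proof (rule that[OF F])
    fix m n u assume u: "u \<in> units G"
    show "L2_norm G u (F n) \<le> E2_norm G f + inverse (real (Suc n))"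
      using L2_triangle[OF L(1)[OF u] Lsq_diff[OF L(2)[OF u] L(1)[OF u]]] c[OF u, of n] E2_norm_ge[OF f u] by (simp del: of_nat_Suc) (meson add_mono order_trans)
    show "L2_norm G u (\<lambda>t. F m t - F n t) \<le> inverse (real (Suc m)) + inverse (real (Suc n))"
      using L2_triangle[OF Lsq_diff[OF L(2)[OF u] L(1)[OF u]] Lsq_diff[OF L(1)[OF u] L(2)[OF u]]] c[OF u, of m] F(2)[OF u, of n] by (simp del: of_nat_Suc) (meson add_mono order_trans)
  qed
qed

text \<open>Approximants from \<open>Cc\<close> have coefficients that are Cauchy in the norm of
  B(G) and converge pointwise to \<open>coef f g\<close>. Completeness identifies the limit, in
  place of a bundle whose sections are the elements of \<open>E2 G\<close>.\<close>

lemma E2_coef: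
  assumes f: "f \<in> E2 G" and g: "g \<in> E2 G"
  shows "coef f g \<in> fourier_alg G" "B_norm G (coef f g) \<le> E2_norm G f * E2_norm G g"
proof -
  let ?e = "\<lambda>n. inverse (real (Suc n))"
  define a where "a = E2_norm G f"
  define b where "b = E2_norm G g"
  have ab: "0 \<le> a" "0 \<le> b" unfolding a_def b_def by (intro E2_norm_nonneg f g)+
  obtain F where F: "\<And>n. F n \<in> Cc" "\<And>n u. u \<in> units G \<Longrightarrow> L2_norm G u (\<lambda>t. f t - F n t) \<le> ?e n"
    "\<And>n u. u \<in> units G \<Longrightarrow> L2_norm G u (F n) \<le> a + ?e n"
    "\<And>m n u. u \<in> units G \<Longrightarrow> L2_norm G u (\<lambda>t. F m t - F n t) \<le> ?e m + ?e n"
    unfolding a_def by (rule E2_seq[OF f]) blast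
  obtain K where K: "\<And>n. K n \<in> Cc" "\<And>n u. u \<in> units G \<Longrightarrow> L2_norm G u (\<lambda>t. g t - K n t) \<le> ?e n"
    "\<And>n u. u \<in> units G \<Longrightarrow> L2_norm G u (K n) \<le> b + ?e n"
    "\<And>m n u. u \<in> units G \<Longrightarrow> L2_norm G u (\<lambda>t. K m t - K n t) \<le> ?e m + ?e n"
    unfolding b_def by (rule E2_seq[OF g]) blast
  let ?c = "\<lambda>n. coef (F n) (K n)"
  have cB: "?c n \<in> B_alg G" for n by (intro coef_in_B F(1) K(1))
  have e1: "?e n \<le> 1" for n using inverse_le_1_iff[of "real (Suc n)"] by simp
  have F1: "L2_norm G u (F n) \<le> a + 1" if "u \<in> units G" for u n using F(3)[OF that, of n] e1[of n] by simp
  have K1: "L2_norm G u (K n) \<le> b + 1" if "u \<in> units G" for u n using K(3)[OF that, of n] e1[of n] by simp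
  have cau: "\<exists>N. \<forall>m\<ge>N. \<forall>n\<ge>N. B_norm G (\<lambda>x. ?c m x - ?c n x) < e" if e: "e > 0" for e
  proof -
    have pos: "e / (2 * (a + b + 2)) > 0" using ab e by simp
    obtain N where N: "?e N < e / (2 * (a + b + 2))" using reals_Archimedean[OF pos] by blast
    have "B_norm G (\<lambda>x. ?c m x - ?c n x) < e" if mn: "N \<le> m" "N \<le> n" for m n
    proof -
      have le: "?e m \<le> ?e N" "?e n \<le> ?e N" using mn by (simp_all add: le_imp_inverse_le)
      have "B_norm G (\<lambda>x. ?c m x - ?c n x) \<le> (?e m + ?e n) * (b + 1) + (a + 1) * (?e m + ?e n)"
        by (rule coef_diff_B[OF F(1) K(1) F(1) K(1) F(4) K1 F1 K(4)])
      also have "\<dots> = (?e m + ?e n) * (a + b + 2)" by (simp add: algebra_simps)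
      also have "\<dots> \<le> (2 * ?e N) * (a + b + 2)"
        by (rule mult_right_mono) (use le ab in linarith)+
      also have "\<dots> = ?e N * (2 * (a + b + 2))" by simp
      also have "\<dots> < e" using N ab by (subst (asm) pos_less_divide_eq) auto
      finally show ?thesis .
    qed
    then show ?thesis by blast
  qed
  have lim: "(\<lambda>n. ?c n x) \<longlonglongrightarrow> coef f g x" for x
  proof (rule LIM_zero_cancel, rule tendsto_0_le[where K="a + b + 1"])
    show "?e \<longlonglongrightarrow> 0" by (rule LIMSEQ_inverse_real_of_nat)
    show "\<forall>\<^sub>F n in sequentially. norm (?c n x - coef f g x) \<le> norm (?e n) * (a + b + 1)"
    proof (intro always_eventually allI)
      fix n
      let ?S = "\<lambda>f t. f (ginv G x \<cdot> t)"
      have L: "f \<in> Lsq (src G x)" "g \<in> Lsq (rng G x)" "F n \<in> Lsq (src G x)" "K n \<in> Lsq (rng G x)"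
        using E2_Lsq f g Cc_Lsq F(1) K(1) by auto
      have "norm (?c n x - coef f g x) = cmod (coef f g x - ?c n x)" by (rule norm_minus_commute)
      also have "\<dots> \<le> L2_norm G (rng G x) (\<lambda>t. ?S f t - ?S (F n) t) * L2_norm G (rng G x) g
          + L2_norm G (rng G x) (?S (F n)) * L2_norm G (rng G x) (\<lambda>t. g t - K n t)"
        unfolding coef_def by (rule L2_diff_bound[OF Lsq_shift(1)[OF L(1)] Lsq_shift(1)[OF L(3)] L(2,4)])
      also have "\<dots> = L2_norm G (src G x) (\<lambda>t. f t - F n t) * L2_norm G (rng G x) g
          + L2_norm G (src G x) (F n) * L2_norm G (rng G x) (\<lambda>t. g t - K n t)"
        unfolding Lsq_shift(2)[OF L(3)] using Lsq_shift(2)[OF Lsq_diff[OF L(1,3)]] by simp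
      also have "\<dots> \<le> ?e n * b + (a + 1) * ?e n"
        using F(2)[OF src_units] F1[OF src_units] K(2)[OF rng_units] E2_norm_ge[OF g rng_units] ab
        by (intro add_mono mult_mono) (auto simp: b_def L2_norm_def)
      finally show "norm (?c n x - coef f g x) \<le> norm (?e n) * (a + b + 1)" by (simp add: algebra_simps)
    qed
  qed
  note comp = B_complete[OF cB cau lim]
  show fa: "coef f g \<in> fourier_alg G"
  proof (rule fa_closed[OF comp(1)])
    fix e :: real assume "e > 0"
    from order_tendstoD(2)[OF comp(2) this]
    obtain n where "B_norm G (\<lambda>x. coef f g x - ?c n x) < e" by (auto simp: eventually_sequentially)
    then show "\<exists>\<phi>\<in>fourier_alg G. B_norm G (\<lambda>x. coef f g x - \<phi> x) < e" by (intro bexI[OF _ coef_fa[OF F(1) K(1)]])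
  qed
  have "(\<lambda>n. B_norm G (\<lambda>x. coef f g x - ?c n x) + (a + ?e n) * (b + ?e n)) \<longlonglongrightarrow> 0 + (a + 0) * (b + 0)"
    by (intro tendsto_intros comp(2) LIMSEQ_inverse_real_of_nat)
  moreover have "B_norm G (coef f g) \<le> B_norm G (\<lambda>x. coef f g x - ?c n x) + (a + ?e n) * (b + ?e n)" for n
    using B_add(2)[OF B_diff(1)[OF fa_B[OF fa] cB] cB, of n n] coef_B(2)[OF F(1) K(1) F(3) K(3), of n n] by simp
  ultimately show "B_norm G (coef f g) \<le> E2_norm G f * E2_norm G g"
    unfolding a_def[symmetric] b_def[symmetric] by (intro LIMSEQ_le_const) auto
qed

end

section \<open>The projective tensor product\<close>

abbreviation tsum :: "(('a \<Rightarrow> complex) \<Rightarrow> ('a \<Rightarrow> complex) \<Rightarrow> complex) \<Rightarrow> 'a ftensor \<Rightarrow> complex" where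
  "tsum B zs \<equiv> (\<Sum>(x, y)\<leftarrow>zs. B x y)"

locale proj_space =
  fixes E :: "('a \<Rightarrow> complex) set" and nE :: "('a \<Rightarrow> complex) \<Rightarrow> real"
  assumes nE: "x \<in> E \<Longrightarrow> 0 \<le> nE x" and scaleE: "x \<in> E \<Longrightarrow> (\<lambda>t. c * x t) \<in> E"
begin

abbreviation pn where "pn \<equiv> proj_norm E nE"
abbreviation cost where "cost ws \<equiv> (\<Sum>(x, y)\<leftarrow>ws. nE x * nE y)"

lemma cost_nonneg: "set ws \<subseteq> E \<times> E \<Longrightarrow> 0 \<le> cost ws"
  by (rule sum_list_nonneg) (auto intro!: mult_nonneg_nonneg nE)

lemma pn_le:
  assumes "set ws \<subseteq> E \<times> E" "tensor_eq E nE ws zs"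
  shows "pn zs \<le> cost ws"
  unfolding proj_norm_def
proof (rule cInf_lower)
  show "bdd_below {cost ws |ws. set ws \<subseteq> E \<times> E \<and> tensor_eq E nE ws zs}"
    by (rule bdd_belowI[of _ 0]) (use cost_nonneg in blast)
qed (use assms in blast)

lemma pn_near:
  assumes "set zs \<subseteq> E \<times> E" "e > 0"
  obtains ws where "set ws \<subseteq> E \<times> E" "tensor_eq E nE ws zs" "cost ws < pn zs + e"
proof -
  have "cost zs \<in> {cost ws |ws. set ws \<subseteq> E \<times> E \<and> tensor_eq E nE ws zs}"
    using assms(1) by (auto simp: tensor_eq_def)
  moreover have "Inf {cost ws |ws. set ws \<subseteq> E \<times> E \<and> tensor_eq E nE ws zs} < pn zs + e"
    using assms(2) by (simp add: proj_norm_def)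
  ultimately have "\<exists>c\<in>{cost ws |ws. set ws \<subseteq> E \<times> E \<and> tensor_eq E nE ws zs}. c < pn zs + e"
    by (intro cInf_lessD) auto
  then show ?thesis using that by blast
qed

lemma pn_cong: "tensor_eq E nE a b \<Longrightarrow> pn a = pn b"
  by (simp add: proj_norm_def tensor_eq_def)

lemma pn_append:
  assumes "set a \<subseteq> E \<times> E" "set b \<subseteq> E \<times> E"
  shows "pn (a @ b) \<le> pn a + pn b"
proof (rule field_le_epsilon)
  fix e :: real assume e: "e > 0"
  obtain v where v: "set v \<subseteq> E \<times> E" "tensor_eq E nE v a" "cost v < pn a + e/2" by (rule pn_near[OF assms(1) half_gt_zero[OF e]])
  obtain w where w: "set w \<subseteq> E \<times> E" "tensor_eq E nE w b" "cost w < pn b + e/2" by (rule pn_near[OF assms(2) half_gt_zero[OF e]])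
  have "pn (a @ b) \<le> cost (v @ w)" using v w by (intro pn_le) (auto simp: tensor_eq_def)
  then show "pn (a @ b) \<le> pn a + pn b + e" using v w by simp
qed

lemma tsum_diff:
  assumes B: "bilinear_form E nE B" and b: "set b \<subseteq> E \<times> E"
  shows "tsum B (tensor_diff a b) = tsum B a - tsum B b"
proof -
  have "tsum B (map (\<lambda>(x, y). (\<lambda>t. - x t, y)) b) = - tsum B b" using b
  proof (induction b)
    case (Cons z b)
    obtain x y where z: "z = (x, y)" by (cases z)
    have "\<forall>c. \<forall>x\<in>E. \<forall>y\<in>E. B (\<lambda>t. c * x t) y = c * B x y \<and> B x (\<lambda>t. c * y t) = c * B x y"
      using B unfolding bilinear_form_def by (elim conjE)
    from this[rule_format, of x y "-1"] have "B (\<lambda>t. - x t) y = - B x y" using Cons.prems z by simp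
    then show ?case using Cons z by simp
  qed simp
  then show ?thesis by (simp add: tensor_diff_def)
qed

lemma tensor_diff_set: "set a \<subseteq> E \<times> E \<Longrightarrow> set b \<subseteq> E \<times> E \<Longrightarrow> set (tensor_diff a b) \<subseteq> E \<times> E"
  using scaleE[of _ "-1"] by (auto simp: tensor_diff_def)

text \<open>As lists, (a - b) + b and a differ; they are equal tensors in the sense of
  \<open>tensor_eq\<close>, which \<open>proj_norm\<close> respects.\<close>

lemma pn_triangle:
  assumes "set a \<subseteq> E \<times> E" "set b \<subseteq> E \<times> E"
  shows "pn a \<le> pn (tensor_diff a b) + pn b"
proof -
  have "tensor_eq E nE (tensor_diff a b @ b) a" unfolding tensor_eq_def by (simp add: tsum_diff assms)
  then have "pn a = pn (tensor_diff a b @ b)" using pn_cong by metis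
  also have "\<dots> \<le> pn (tensor_diff a b) + pn b" by (intro pn_append tensor_diff_set assms)
  finally show ?thesis .
qed

text \<open>This gives the \<open>lim\<close> in \<open>calA_norm\<close> its meaning. By the
  triangle inequality the norms of a Cauchy sequence of tensors are a Cauchy sequence of
  numbers.\<close>

lemma pn_convergent:
  assumes "proj_Cauchy E nE Z"
  shows "convergent (\<lambda>n. pn (Z n))"
proof -
  have Z: "set (Z n) \<subseteq> E \<times> E" for n using assms by (simp add: proj_Cauchy_def)
  have "Cauchy (\<lambda>n. pn (Z n))"
  proof (rule metric_CauchyI)
    fix e :: real assume "e > 0"
    then obtain N where N: "\<forall>m\<ge>N. \<forall>n\<ge>N. pn (tensor_diff (Z m) (Z n)) < e" using assms unfolding proj_Cauchy_def by blast
    have "dist (pn (Z m)) (pn (Z n)) < e" if mn: "m \<ge> N" "n \<ge> N" for m n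
      using pn_triangle[OF Z Z, of m n] pn_triangle[OF Z Z, of n m] N mn by (simp add: dist_real_def abs_less_iff) (smt (verit))
    then show "\<exists>N. \<forall>m\<ge>N. \<forall>n\<ge>N. dist (pn (Z m)) (pn (Z n)) < e" by blast
  qed
  then show ?thesis by (rule Cauchy_convergent)
qed

lemma proj_Cauchy_append:
  assumes "proj_Cauchy E nE Z" "proj_Cauchy E nE Z'"
  shows "proj_Cauchy E nE (\<lambda>n. Z n @ Z' n)"
proof -
  have Z: "set (Z n) \<subseteq> E \<times> E" "set (Z' n) \<subseteq> E \<times> E" for n using assms by (simp_all add: proj_Cauchy_def)
  have le: "pn (tensor_diff (Z m @ Z' m) (Z n @ Z' n)) \<le> pn (tensor_diff (Z m) (Z n)) + pn (tensor_diff (Z' m) (Z' n))" for m n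
  proof -
    have "tensor_eq E nE (tensor_diff (Z m @ Z' m) (Z n @ Z' n)) (tensor_diff (Z m) (Z n) @ tensor_diff (Z' m) (Z' n))"
      unfolding tensor_eq_def using Z by (simp add: tsum_diff)
    then show ?thesis using pn_cong pn_append[OF tensor_diff_set[OF Z(1) Z(1)] tensor_diff_set[OF Z(2) Z(2)]] by metis
  qed
  show ?thesis
    unfolding proj_Cauchy_def
  proof (intro conjI allI impI)
    show "set (Z n @ Z' n) \<subseteq> E \<times> E" for n using Z by simp
    fix e :: real assume "e > 0"
    then have e2: "e/2 > 0" by simp
    obtain N where N: "\<forall>m\<ge>N. \<forall>n\<ge>N. pn (tensor_diff (Z m) (Z n)) < e/2" using assms(1) e2 unfolding proj_Cauchy_def by blast
    obtain N' where N': "\<forall>m\<ge>N'. \<forall>n\<ge>N'. pn (tensor_diff (Z' m) (Z' n)) < e/2" using assms(2) e2 unfolding proj_Cauchy_def by blast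
    have "pn (tensor_diff (Z m @ Z' m) (Z n @ Z' n)) < e" if mn: "m \<ge> max N N'" "n \<ge> max N N'" for m n
    proof -
      have "pn (tensor_diff (Z m) (Z n)) < e/2" "pn (tensor_diff (Z' m) (Z' n)) < e/2" using N N' mn by auto
      then show ?thesis using le[of m n] by linarith
    qed
    then show "\<exists>N. \<forall>m\<ge>N. \<forall>n\<ge>N. pn (tensor_diff (Z m @ Z' m) (Z n @ Z' n)) < e" by blast
  qed
qed

text \<open>A bilinear form composed with T in the second place is again bilinear, and it respects
  null vectors because T does. Hence T preserves equality of tensors, and it multiplies costs by at
  most C. This yields the module structure of \<open>calA G\<close>.\<close>

lemma proj_Cauchy_map:
  assumes Z: "proj_Cauchy E nE Z"
    and T: "\<And>x. x \<in> E \<Longrightarrow> T x \<in> E" "\<And>x. x \<in> E \<Longrightarrow> nE (T x) \<le> C * nE x" "0 \<le> C"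
      "\<And>x y. T (\<lambda>t. x t + y t) = (\<lambda>t. T x t + T y t)" "\<And>c x. T (\<lambda>t. c * x t) = (\<lambda>t. c * T x t)"
  shows "proj_Cauchy E nE (\<lambda>n. map (\<lambda>(x, y). (x, T y)) (Z n))"
proof -
  let ?T = "map (\<lambda>(x, y). (x, T y))"
  have ts: "tsum B (?T zs) = tsum (\<lambda>x y. B x (T y)) zs" for B :: "('a \<Rightarrow> complex) \<Rightarrow> ('a \<Rightarrow> complex) \<Rightarrow> complex" and zs by (induction zs) auto
  have set: "set (?T zs) \<subseteq> E \<times> E" if "set zs \<subseteq> E \<times> E" for zs using that T(1) by auto
  have bil: "bilinear_form E nE (\<lambda>x y. B x (T y))" if B: "bilinear_form E nE B" for B
  proof -
    have 1: "nE (T y) = 0" if "y \<in> E" "nE y = 0" for y using T(2)[OF that(1)] nE[OF T(1)[OF that(1)]] that(2) by simp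
    show ?thesis using B unfolding bilinear_form_def T(4,5) by (simp add: T(1) 1)
  qed
  have le: "pn (?T zs) \<le> C * pn zs" if zs: "set zs \<subseteq> E \<times> E" for zs
  proof (rule field_le_epsilon)
    fix e :: real assume "e > 0"
    then have "e / (C + 1) > 0" using T(3) by simp
    then obtain ws where ws: "set ws \<subseteq> E \<times> E" "tensor_eq E nE ws zs" "cost ws < pn zs + e / (C + 1)" by (rule pn_near[OF zs])
    have "tensor_eq E nE (?T ws) (?T zs)" using ws(2) bil unfolding tensor_eq_def ts by blast
    then have "pn (?T zs) \<le> cost (?T ws)" by (intro pn_le set ws(1))
    also have "\<dots> \<le> C * cost ws" using ws(1)
    proof (induction ws)
      case (Cons z ws)
      obtain x y where z: "z = (x, y)" by (cases z)
      have "nE x * nE (T y) \<le> nE x * (C * nE y)" using Cons.prems z by (intro mult_left_mono T(2) nE) auto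
      then show ?case using Cons z by (simp add: algebra_simps)
    qed simp
    also have "\<dots> \<le> C * (pn zs + e / (C + 1))" using ws(3) T(3) by (intro mult_left_mono) auto
    also have "\<dots> \<le> C * pn zs + e" using T(3) \<open>e > 0\<close> by (simp add: distrib_left field_simps)
    finally show "pn (?T zs) \<le> C * pn zs + e" .
  qed
  have d: "tensor_diff (?T a) (?T b) = ?T (tensor_diff a b)" for a b by (auto simp: tensor_diff_def)
  have Zs: "set (Z n) \<subseteq> E \<times> E" for n using Z by (simp add: proj_Cauchy_def)
  show ?thesis
    unfolding proj_Cauchy_def d
  proof (intro conjI allI impI)
    show "set (?T (Z n)) \<subseteq> E \<times> E" for n by (rule set[OF Zs])
    fix e :: real assume e: "e > 0"
    then have pos: "e / (C + 1) > 0" using T(3) by simp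
    then obtain N where N: "\<forall>m\<ge>N. \<forall>n\<ge>N. pn (tensor_diff (Z m) (Z n)) < e / (C + 1)" using Z unfolding proj_Cauchy_def by blast
    have "pn (?T (tensor_diff (Z m) (Z n))) < e" if mn: "m \<ge> N" "n \<ge> N" for m n
    proof -
      have "pn (?T (tensor_diff (Z m) (Z n))) \<le> C * pn (tensor_diff (Z m) (Z n))" by (rule le[OF tensor_diff_set[OF Zs Zs]])
      also have "\<dots> \<le> C * (e / (C + 1))" using N mn T(3) by (intro mult_left_mono) (auto intro: less_imp_le)
      also have "\<dots> < e" using e T(3) by (simp add: field_simps)
      finally show ?thesis .
    qed
    then show "\<exists>N. \<forall>m\<ge>N. \<forall>n\<ge>N. pn (?T (tensor_diff (Z m) (Z n))) < e" by blast
  qed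
qed

end

section \<open>The map \<theta> and the inclusion of \<open>calA G\<close> in the Fourier
  algebra\<close>

context lcg
begin

interpretation E: proj_space "E2 G" "E2_norm G"
  by standard (auto intro: E2_norm_nonneg E2_scale)

text \<open>The inverse of t^-1 x is x^-1 t. Conjugating f makes the sesquilinear coefficient
  bilinear, as a map on tensor products must be.\<close>

lemma conv_coef: "conv G g (check G f) = coef (\<lambda>t. cnj (f t)) g"
proof
  fix x
  have "ginv G (ginv G t \<cdot> x) = ginv G x \<cdot> t" if "rng G t = rng G x" for t using inv_mult[of "ginv G t" x] that by simp
  then show "conv G g (check G f) x = coef (\<lambda>t. cnj (f t)) g x"
    unfolding conv_def coef_def L2_inner_def check_def by (intro Bochner_Integration.integral_cong) (auto simp: space_haar)
qed

lemma theta_append: "theta G (a @ b) x = theta G a x + theta G b x"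
  by (simp add: theta_def)

lemma theta_diff: "theta G (tensor_diff a b) x = theta G a x - theta G b x"
proof -
  have "conv G g (check G (\<lambda>t. - f t)) x = - conv G g (check G f) x" for f g by (simp add: conv_def check_def)
  then have "theta G (map (\<lambda>(x, y). (\<lambda>t. - x t, y)) b) x = - theta G b x" by (induction b) (auto simp: theta_def)
  then show ?thesis by (simp add: tensor_diff_def theta_append)
qed

lemma theta_B:
  assumes "set zs \<subseteq> E2 G \<times> E2 G"
  shows "theta G zs \<in> fourier_alg G" "B_norm G (theta G zs) \<le> E.cost zs"
proof -
  have "theta G zs \<in> fourier_alg G \<and> B_norm G (theta G zs) \<le> E.cost zs" using assms
  proof (induction zs)
    case Nil
    have "(\<lambda>x. 0) \<in> fourier_alg G" using fa_scale[OF coef_fa[OF Cc_zero Cc_zero], of 0] by simp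
    then show ?case by (simp add: theta_def B_zero(2))
  next
    case (Cons z zs)
    obtain f g where z: "z = (f, g)" by (cases z)
    have fg: "f \<in> E2 G" "g \<in> E2 G" using Cons.prems z by auto
    note c = E2_coef[OF E2_cnj[OF fg(1)] fg(2), unfolded E2_norm_cnj]
    have IH: "theta G zs \<in> fourier_alg G" "B_norm G (theta G zs) \<le> E.cost zs" using Cons by auto
    have e: "theta G (z # zs) = (\<lambda>x. coef (\<lambda>t. cnj (f t)) g x + theta G zs x)" by (simp add: theta_def z conv_coef)
    show ?case unfolding e using fa_add[OF c(1) IH(1)] B_add(2)[OF fa_B[OF c(1)] fa_B[OF IH(1)]] c(2) IH(2) z by simp
  qed
  then show "theta G zs \<in> fourier_alg G" "B_norm G (theta G zs) \<le> E.cost zs" by blast+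
qed

text \<open>Equality of tensors is tested by bilinear forms. Evaluation of \<theta> at x is one of
  them, so \<theta> depends on the tensor and not on the list.\<close>

lemma theta_bilinear: "bilinear_form (E2 G) (E2_norm G) (\<lambda>f g. conv G g (check G f) x)"
proof -
  let ?S = "\<lambda>f t. cnj (f (ginv G x \<cdot> t))"
  have e: "conv G g (check G f) x = L2_inner G (rng G x) (?S f) g" for f g by (simp add: conv_coef coef_def)
  have L: "?S f \<in> Lsq (rng G x)" "f \<in> Lsq (rng G x)" if "f \<in> E2 G" for f
    using Lsq_shift(1)[OF E2_Lsq[OF E2_cnj[OF that] src_units]] E2_Lsq[OF that] by simp_all
  show ?thesis
    unfolding bilinear_form_def
  proof (intro conjI allI ballI impI)
    fix f g assume fg: "f \<in> E2 G" "g \<in> E2 G" and z: "E2_norm G f = 0 \<or> E2_norm G g = 0"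
    have "cmod (conv G g (check G f) x) \<le> E2_norm G f * E2_norm G g"
      unfolding conv_coef using E2_coef[OF E2_cnj[OF fg(1)] fg(2), unfolded E2_norm_cnj] B_sup[OF fa_B] order_trans by blast
    then show "conv G g (check G f) x = 0" using z by auto
  qed (simp_all add: e L L2_add L2_scale L2_add_left[of "?S _" _ "?S _"] L2_scale_left[of "?S _"])
qed

lemma theta_pn:
  assumes zs: "set zs \<subseteq> E2 G \<times> E2 G"
  shows "B_norm G (theta G zs) \<le> E.pn zs"
proof (rule field_le_epsilon)
  fix e :: real assume "e > 0"
  then obtain ws where ws: "set ws \<subseteq> E2 G \<times> E2 G" "tensor_eq (E2 G) (E2_norm G) ws zs" "E.cost ws < E.pn zs + e"
    by (rule E.pn_near[OF zs])
  have "theta G ws = theta G zs" unfolding theta_def using ws(2) theta_bilinear unfolding tensor_eq_def by (intro ext) blast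
  then show "B_norm G (theta G zs) \<le> E.pn zs + e" using theta_B(2)[OF ws(1)] ws(3) by simp
qed

text \<open>\<theta> decreases norms into B(G), so a Cauchy sequence of tensors has a Cauchy image.
  The uniform limit \<phi> supplies the pointwise limit that \<open>B_complete\<close> asks
  for.\<close>

lemma theta_preimage_fa:
  assumes Z: "Z \<in> theta_preimage G \<phi>"
  shows "\<phi> \<in> fourier_alg G" "B_norm G \<phi> \<le> lim (\<lambda>n. E.pn (Z n))"
proof -
  have C: "proj_Cauchy (E2 G) (E2_norm G) Z" and u: "uniform_limit UNIV (\<lambda>n. theta G (Z n)) \<phi> sequentially"
    using Z by (simp_all add: theta_preimage_def)
  have Zs: "set (Z n) \<subseteq> E2 G \<times> E2 G" for n using C by (simp add: proj_Cauchy_def)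
  note fa = theta_B(1)[OF Zs] note B = fa_B[OF fa]
  have cau: "\<exists>N. \<forall>m\<ge>N. \<forall>n\<ge>N. B_norm G (\<lambda>x. theta G (Z m) x - theta G (Z n) x) < e" if e: "e > 0" for e
  proof -
    obtain N where N: "\<forall>m\<ge>N. \<forall>n\<ge>N. E.pn (tensor_diff (Z m) (Z n)) < e" using C e unfolding proj_Cauchy_def by blast
    have "B_norm G (\<lambda>x. theta G (Z m) x - theta G (Z n) x) < e" if "m \<ge> N" "n \<ge> N" for m n
      using theta_pn[OF E.tensor_diff_set[OF Zs Zs], of m n] N that unfolding theta_diff[abs_def] by (meson order_le_less_trans)
    then show ?thesis by blast
  qed
  have lim: "(\<lambda>n. theta G (Z n) x) \<longlonglongrightarrow> \<phi> x" for x by (rule tendsto_uniform_limitI[OF u]) simp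
  note comp = B_complete[OF B cau lim]
  show phi: "\<phi> \<in> fourier_alg G"
  proof (rule fa_closed[OF comp(1)])
    fix e :: real assume "e > 0"
    from order_tendstoD(2)[OF comp(2) this]
    obtain n where "B_norm G (\<lambda>x. \<phi> x - theta G (Z n) x) < e" by (auto simp: eventually_sequentially)
    then show "\<exists>\<psi>\<in>fourier_alg G. B_norm G (\<lambda>x. \<phi> x - \<psi> x) < e" by (intro bexI[OF _ fa])
  qed
  have "(\<lambda>n. B_norm G (\<lambda>x. \<phi> x - theta G (Z n) x) + E.pn (Z n)) \<longlonglongrightarrow> 0 + lim (\<lambda>n. E.pn (Z n))"
    by (intro tendsto_add comp(2) convergent_LIMSEQ_iff[THEN iffD1] E.pn_convergent[OF C])
  moreover have "B_norm G \<phi> \<le> B_norm G (\<lambda>x. \<phi> x - theta G (Z n) x) + E.pn (Z n)" for n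
    using B_add(2)[OF B_diff(1)[OF comp(1) B] B, of n n] theta_pn[OF Zs, of n] by simp
  ultimately show "B_norm G \<phi> \<le> lim (\<lambda>n. E.pn (Z n))" by (intro LIMSEQ_le_const[of _ "lim (\<lambda>n. E.pn (Z n))"]) auto
qed

lemma calA_fa: "\<phi> \<in> calA G \<Longrightarrow> \<phi> \<in> fourier_alg G"
  using theta_preimage_fa(1) by (auto simp: calA_def)

lemma calA_norm_ge: "\<phi> \<in> calA G \<Longrightarrow> B_norm G \<phi> \<le> calA_norm G \<phi>"
  unfolding calA_norm_def calA_def by (rule cInf_greatest) (auto intro: theta_preimage_fa(2))

lemma calA_add:
  assumes "\<phi> \<in> calA G" "\<psi> \<in> calA G"
  shows "(\<lambda>x. \<phi> x + \<psi> x) \<in> calA G"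
proof -
  obtain Z W where "Z \<in> theta_preimage G \<phi>" "W \<in> theta_preimage G \<psi>" using assms by (auto simp: calA_def)
  then have "(\<lambda>n. Z n @ W n) \<in> theta_preimage G (\<lambda>x. \<phi> x + \<psi> x)"
    by (simp add: theta_preimage_def E.proj_Cauchy_append theta_append[abs_def] uniform_limit_add)
  then show ?thesis by (auto simp: calA_def)
qed

lemma calA_mult:
  assumes phi: "\<phi> \<in> calA G" and k: "continuous_on (units G) k" "\<And>u. u \<in> units G \<Longrightarrow> cmod (k u) \<le> C"
  shows "(\<lambda>x. \<phi> x * k (rng G x)) \<in> calA G"
proof -
  obtain Z where Z: "proj_Cauchy (E2 G) (E2_norm G) Z" "uniform_limit UNIV (\<lambda>n. theta G (Z n)) \<phi> sequentially"
    using phi by (auto simp: calA_def theta_preimage_def)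
  let ?T = "\<lambda>f t. f t * k (rng G t)"
  have C: "0 \<le> C" using k(2) units_nonempty by (meson ex_in_conv norm_ge_zero order_trans)
  have c: "proj_Cauchy (E2 G) (E2_norm G) (\<lambda>n. map (\<lambda>(x, y). (x, ?T y)) (Z n))"
    by (rule E.proj_Cauchy_map[OF Z(1) E2_mult(1) E2_mult(2) C]) (use k in \<open>auto simp: algebra_simps\<close>)
  have "theta G (map (\<lambda>(x, y). (x, ?T y)) zs) x = theta G zs x * k (rng G x)" for zs x
    by (induction zs) (auto simp: theta_def conv_coef coef_right algebra_simps)
  then have m: "theta G (map (\<lambda>(x, y). (x, ?T y)) zs) = (\<lambda>x. theta G zs x * k (rng G x))" for zs by blast
  have "uniform_limit UNIV (\<lambda>n x. theta G (Z n) x * k (rng G x)) (\<lambda>x. \<phi> x * k (rng G x)) sequentially"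
  proof (rule uniform_limitI)
    fix e :: real assume e: "e > 0"
    then have "e / (C + 1) > 0" using C by simp
    from uniform_limitD[OF Z(2) this]
    show "\<forall>\<^sub>F n in sequentially. \<forall>x\<in>UNIV. dist (theta G (Z n) x * k (rng G x)) (\<phi> x * k (rng G x)) < e"
    proof (eventually_elim, intro ballI)
      fix n x assume "\<forall>x\<in>UNIV. dist (theta G (Z n) x) (\<phi> x) < e / (C + 1)"
      then have a: "dist (theta G (Z n) x) (\<phi> x) < e / (C + 1)" by simp
      have "dist (theta G (Z n) x * k (rng G x)) (\<phi> x * k (rng G x)) = dist (theta G (Z n) x) (\<phi> x) * cmod (k (rng G x))"
        unfolding dist_norm left_diff_distrib[symmetric] by (rule norm_mult)
      also have "\<dots> \<le> dist (theta G (Z n) x) (\<phi> x) * (C + 1)" using k(2)[OF rng_units, of x] by (intro mult_left_mono) auto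
      also have "\<dots> < e" using a C by (simp add: pos_less_divide_eq)
      finally show "dist (theta G (Z n) x * k (rng G x)) (\<phi> x * k (rng G x)) < e" .
    qed
  qed
  then have "(\<lambda>n. map (\<lambda>(x, y). (x, ?T y)) (Z n)) \<in> theta_preimage G (\<lambda>x. \<phi> x * k (rng G x))"
    using c by (simp add: theta_preimage_def m)
  then show ?thesis by (auto simp: calA_def)
qed

lemma calA_scale: "\<phi> \<in> calA G \<Longrightarrow> (\<lambda>x. c * \<phi> x) \<in> calA G"
  using calA_mult[of \<phi> "\<lambda>_. c" "cmod c"] by (simp add: mult.commute)

lemma check_check: "check G (check G f) = f"
  by (simp add: check_def)

lemma check_Cc:
  assumes "f \<in> Cc"
  shows "check G f \<in> Cc"
proof -
  obtain K where K: "compact K" "\<And>x. x \<notin> K \<Longrightarrow> f x = 0" by (rule CcE[OF assms]) blast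
  show ?thesis
    unfolding check_def
  proof (rule CcI)
    show "continuous_on UNIV (\<lambda>x. f (ginv G x))" by (rule continuous_on_compose2[OF Cc_cont[OF assms, of UNIV] cont_inv]) simp
    show "compact (ginv G ` K)" by (intro compact_continuous_image cont_inv K)
    show "f (ginv G x) = 0" if "x \<notin> ginv G ` K" for x using K(2) that by (metis image_eqI inv_inv)
  qed
qed

lemma conv_fa:
  assumes "f \<in> Cc" "g \<in> E2 G"
  shows "conv G g f \<in> fourier_alg G" "B_norm G (conv G g f) \<le> E2_norm G (check G f) * E2_norm G g"
  using E2_coef[OF E2_cnj[OF Cc_E2[OF check_Cc[OF assms(1)]]] assms(2)] conv_coef[of g "check G f"]
  unfolding check_check E2_norm_cnj by simp_all

lemma conv_calA:
  assumes f: "f \<in> Cc" and g: "g \<in> Cc"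
  shows "conv G g f \<in> calA G"
proof -
  let ?z = "[(check G f, g)]"
  have s: "set ?z \<subseteq> E2 G \<times> E2 G" using f g by (simp add: Cc_E2 check_Cc)
  have "E.pn (tensor_diff ?z ?z) \<le> E.cost []"
    by (rule E.pn_le) (simp_all add: tensor_eq_def E.tsum_diff[OF _ s])
  then have "proj_Cauchy (E2 G) (E2_norm G) (\<lambda>n. ?z)" unfolding proj_Cauchy_def using s by auto
  then have "(\<lambda>n. ?z) \<in> theta_preimage G (conv G g f)"
    by (simp add: theta_preimage_def theta_def check_check uniform_limit_const)
  then show ?thesis by (auto simp: calA_def)
qed

end

section \<open>Bisections and multiplicative module maps\<close>

text \<open>Here g is the inverse homeomorphism of p, written with \<open>THE\<close> so that it
  folds to \<open>at_rng\<close> and \<open>at_src\<close>.\<close>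

lemma homeomorphic_map_section:
  fixes p :: "'a::topological_space \<Rightarrow> 'b::topological_space"
  assumes h: "homeomorphic_map (top_of_set a) (top_of_set U) p"
  defines "g \<equiv> \<lambda>u. THE x. x \<in> a \<and> p x = u"
  shows "u \<in> U \<Longrightarrow> g u \<in> a" "u \<in> U \<Longrightarrow> p (g u) = u" "x \<in> a \<Longrightarrow> p x \<in> U" "x \<in> a \<Longrightarrow> g (p x) = x"
    "continuous_on U g" "homeomorphic_map (top_of_set U) (top_of_set a) g"
proof -
  have inj: "inj_on p a" and im: "p ` a = U"
    using homeomorphic_imp_injective_map[OF h] homeomorphic_imp_surjective_map[OF h] by simp_all
  show px: "p x \<in> U" if "x \<in> a" for x using im that by blast
  show gp: "g (p x) = x" if "x \<in> a" for x
    unfolding g_def using inj that by (intro the_equality) (auto dest: inj_onD)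
  show gu: "g u \<in> a" "p (g u) = u" if u: "u \<in> U" for u
  proof -
    obtain x where "x \<in> a" "u = p x" using im u by blast
    then show "g u \<in> a" "p (g u) = u" using gp by simp_all
  qed
  obtain q where q: "homeomorphic_maps (top_of_set a) (top_of_set U) p q" using h homeomorphic_map_maps by blast
  then have qg: "q u = g u" if "u \<in> U" for u using gp gu that unfolding homeomorphic_maps_def by (metis topspace_euclidean_subtopology)
  have "continuous_map (top_of_set U) (top_of_set a) q" using q by (simp add: homeomorphic_maps_def)
  then have c: "continuous_map (top_of_set U) (top_of_set a) g" by (rule continuous_map_eq) (simp add: qg)
  then show "continuous_on U g" by simp
  have "homeomorphic_maps (top_of_set U) (top_of_set a) g p"
    using c homeomorphic_imp_continuous_map[OF h] gp gu by (simp add: homeomorphic_maps_def)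
  then show "homeomorphic_map (top_of_set U) (top_of_set a) g" by (rule homeomorphic_maps_imp_map)
qed

context lcg
begin

lemmas at_rng = homeomorphic_map_section[where p="rng G" and U="units G", folded at_rng_def]
lemmas at_src = homeomorphic_map_section[where p="src G" and U="units G", folded at_src_def]

text \<open>By continuity of (t, w) \<mapsto> t w^-1 at x0 and its source there are neighbourhoods
  whose products stay in N. A nonzero integrand at t writes x as such a product, so a peak function
  for these neighbourhoods vanishes off N.\<close>

lemma fa_bump:
  assumes N: "open N" "x0 \<in> N"
  obtains \<phi> where "\<phi> \<in> A_cf_alg G" "\<phi> x0 = 1" "\<And>x. x \<notin> N \<Longrightarrow> \<phi> x = 0"
proof -
  let ?Q = "{p\<in>UNIV. src G (fst p) = src G (snd p)}"
  have "continuous_on ?Q (\<lambda>p. fst p \<cdot> ginv G (snd p))"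
    by (intro cont_mult continuous_on_compose2[OF cont_inv[of UNIV]] continuous_on_fst continuous_on_snd continuous_on_id) auto
  from continuous_openin_preimage_gen[OF this N(1)]
  obtain W where W: "open W" "?Q \<inter> (\<lambda>p. fst p \<cdot> ginv G (snd p)) -` N = ?Q \<inter> W" by (auto simp: openin_open)
  have "x0 \<cdot> ginv G (src G x0) = x0" by (simp add: inv_unit)
  then have "(x0, src G x0) \<in> ?Q \<inter> (\<lambda>p. fst p \<cdot> ginv G (snd p)) -` N" using N(2) by (simp add: unit_src)
  then have "(x0, src G x0) \<in> W" unfolding W(2) by blast
  then obtain N2 N1 where N': "open N2" "open N1" "x0 \<in> N2" "src G x0 \<in> N1" "N2 \<times> N1 \<subseteq> W"
    using W(1) by (auto elim!: open_prod_elim)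
  obtain p q V where p: "p \<in> Cc" "q \<in> Cc" "x0 \<in> V" "\<And>x. x \<in> V \<Longrightarrow> coef p q x = 1"
    "\<And>w. p w \<noteq> 0 \<Longrightarrow> w \<in> N1" "\<And>t. q t \<noteq> 0 \<Longrightarrow> t \<in> N2"
    by (rule peak[OF N'(2,4,1,3)]) blast
  have "coef p q x = 0" if x: "x \<notin> N" for x
  proof -
    have "cnj (p (ginv G x \<cdot> t)) * q t = 0" if t: "rng G t = rng G x" for t
    proof (rule ccontr)
      assume "cnj (p (ginv G x \<cdot> t)) * q t \<noteq> 0"
      then have "(t, ginv G x \<cdot> t) \<in> ?Q \<inter> W" using p(5,6) N'(5) t by (auto simp: src_mult)
      then have "t \<cdot> ginv G (ginv G x \<cdot> t) \<in> N" unfolding W(2)[symmetric] by simp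
      moreover have "t \<cdot> ginv G (ginv G x \<cdot> t) = x" using t by (simp add: inv_mult inv_cancel2)
      ultimately show False using x by simp
    qed
    then have "coef p q x = I1 (rng G x) (\<lambda>t. 0)" unfolding coef_I1 by (intro H.I_cong) auto
    then show ?thesis by (simp add: I1_def)
  qed
  then show ?thesis using that coef_alg[OF p(1,2)] p(4)[OF p(3)] by blast
qed

definition ev :: "('g \<Rightarrow> 'g) \<Rightarrow> ('g \<Rightarrow> complex) \<Rightarrow> 'g \<Rightarrow> complex" where
  "ev g \<phi> = (\<lambda>u. if u \<in> units G then \<phi> (g u) else 0)"

text \<open>In the applications p is the range or the source map and g the section of it given by a
  bisection. The units that g sends into a compact K form a closed subset of the compact image of K
  under p, which gives decay at infinity.\<close>

lemma ev_D:
  assumes g: "continuous_on (units G) g" and p: "continuous_on UNIV p" "\<And>u. u \<in> units G \<Longrightarrow> p (g u) = u"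
    and phi: "\<phi> \<in> fourier_alg G"
  shows "ev g \<phi> \<in> D G" "D_norm G (ev g \<phi>) \<le> B_norm G \<phi>"
proof -
  have c: "continuous_on (units G) (\<lambda>u. \<phi> (g u))" by (rule continuous_on_compose2[OF fa_cont[OF phi, of UNIV] g]) simp
  show "ev g \<phi> \<in> D G"
    unfolding C0_def
  proof (intro CollectI conjI allI impI)
    show "continuous_on (units G) (ev g \<phi>)" using c by (rule continuous_on_eq) (simp add: ev_def)
    fix e :: real assume "e > 0"
    then obtain K where K: "compact K" "\<And>x. x \<notin> K \<Longrightarrow> cmod (\<phi> x) < e" by (rule fa_vanish[OF phi]) blast
    have "closed (units G \<inter> g -` K)" by (rule continuous_closed_preimage[OF g closed_units compact_imp_closed[OF K(1)]])
    then have "compact (p ` K \<inter> (units G \<inter> g -` K))"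
      by (intro compact_Int_closed compact_continuous_image K continuous_on_subset[OF p(1)]) auto
    moreover have "\<forall>u\<in>units G - p ` K \<inter> (units G \<inter> g -` K). cmod (ev g \<phi> u) < e"
    proof
      fix u assume u: "u \<in> units G - p ` K \<inter> (units G \<inter> g -` K)"
      have "g u \<notin> K"
      proof
        assume "g u \<in> K"
        then have "u \<in> p ` K" using p(2)[of u] u by (intro image_eqI[of _ _ "g u"]) auto
        then show False using u \<open>g u \<in> K\<close> by blast
      qed
      then show "cmod (ev g \<phi> u) < e" using K(2) u by (simp add: ev_def)
    qed
    ultimately show "\<exists>K. compact K \<and> K \<subseteq> units G \<and> (\<forall>u\<in>units G - K. cmod (ev g \<phi> u) < e)"
      by (intro exI[of _ "p ` K \<inter> (units G \<inter> g -` K)"] conjI) auto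
  qed (simp add: ev_def)
  show "D_norm G (ev g \<phi>) \<le> B_norm G \<phi>"
    unfolding sup_norm_def by (rule cSUP_least[OF units_nonempty]) (simp add: ev_def B_sup[OF fa_B[OF phi]])
qed

lemma ev_bounded_linear:
  assumes g: "continuous_on (units G) g" and p: "continuous_on UNIV p" "\<And>u. u \<in> units G \<Longrightarrow> p (g u) = u"
  shows "bounded_linear_map (fourier_alg G) (B_norm G) (D G) (D_norm G) (restrict (ev g) (fourier_alg G))"
  unfolding bounded_linear_map_def
proof (intro conjI ballI allI exI[of _ 1])
  show "restrict (ev g) (fourier_alg G) \<phi> \<in> D G" if "\<phi> \<in> fourier_alg G" for \<phi> using ev_D(1)[OF g p] that by simp
  show "D_norm G (restrict (ev g) (fourier_alg G) \<phi>) \<le> 1 * B_norm G \<phi>" if "\<phi> \<in> fourier_alg G" for \<phi>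
    using ev_D(2)[OF g p] that by simp
qed (auto simp: fa_add fa_scale ev_def fun_eq_iff)

lemma zeta_ev: "zeta G a = (restrict (ev (at_rng G a)) (fourier_alg G), restrict (ev (at_src G a)) (fourier_alg G))"
  by (simp add: zeta_def ev_def[abs_def])

lemma ev_calA_K_dual:
  assumes a: "a \<in> bisections G"
  shows "restrict (ev (at_rng G a)) (calA G) \<in> calA_K_dual G"
proof -
  have ar: "homeomorphic_map (top_of_set a) (top_of_set (units G)) (rng G)"
    and as: "homeomorphic_map (top_of_set a) (top_of_set (units G)) (src G)" using a by (simp_all add: bisections_def)
  let ?g = "at_rng G a"
  note R = at_rng[OF ar] and S = at_src[OF as]
  note evD = ev_D[OF R(5) cont_rng R(2)]
  have "bounded_linear_map (calA G) (calA_norm G) (D G) (D_norm G) (restrict (ev ?g) (calA G))"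
    unfolding bounded_linear_map_def
  proof (intro conjI ballI allI exI[of _ 1])
    show "restrict (ev ?g) (calA G) \<phi> \<in> D G" if "\<phi> \<in> calA G" for \<phi> using evD(1)[OF _ calA_fa] that by simp
    show "D_norm G (restrict (ev ?g) (calA G) \<phi>) \<le> 1 * calA_norm G \<phi>" if "\<phi> \<in> calA G" for \<phi>
      using order_trans[OF evD(2)[OF _ calA_fa] calA_norm_ge] that by simp
  qed (auto simp: calA_add calA_scale ev_def fun_eq_iff)
  moreover have "right_module_map G (calA G) (restrict (ev ?g) (calA G))"
    unfolding right_module_map_def
  proof (intro ballI)
    fix F b assume F: "F \<in> calA G" and b: "b \<in> D G"
    obtain C where "\<And>u. u \<in> units G \<Longrightarrow> cmod (b u) \<le> C" by (rule D_bounded[OF b]) blast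
    then have "(\<lambda>x. F x * b (rng G x)) \<in> calA G" by (rule calA_mult[OF F D_cont[OF b]])
    then show "restrict (ev ?g) (calA G) (\<lambda>x. F x * b (rng G x)) = (\<lambda>u. restrict (ev ?g) (calA G) F u * b u)"
      using F R(2) by (auto simp: ev_def)
  qed
  moreover have "\<exists>T. compact_module_map G T \<and> (\<forall>g\<in>Cc. T g = restrict (ev ?g) (calA G) (conv G g f))" if f: "f \<in> Cc" for f
  proof (intro exI conjI ballI)
    let ?T = "\<lambda>\<eta>. ev ?g (conv G \<eta> f)"
    show "?T g = restrict (ev ?g) (calA G) (conv G g f)" if "g \<in> Cc" for g using conv_calA[OF f that] by simp
    define h where "h = (\<lambda>t. cnj (check G f t))"
    have h: "h \<in> Cc" unfolding h_def by (intro Cc_cnj check_Cc f)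
    have ch: "conv G \<eta> f = coef h \<eta>" for \<eta> unfolding h_def using conv_coef[of \<eta> "check G f"] by (simp only: check_check)
    have L: "(\<lambda>t. h (ginv G x \<cdot> t)) \<in> Lsq (rng G x)" for x by (intro Lsq_shift Cc_Lsq src_units h)
    obtain K where K: "compact K" "\<And>x. x \<notin> K \<Longrightarrow> h x = 0" by (rule CcE[OF h]) blast
    \<comment> \<open>One function for all units: on the fibre over u it is the translate of h by
      the element x of the bisection over u. If w = x^-1 t lies in K, then t = x w, and x is also
      the element of the bisection whose source is the range of w; this confines the
      support.\<close>
    let ?F = "\<lambda>t. h (ginv G (?g (rng G t)) \<cdot> t)"
    let ?k = "\<lambda>k. at_src G a (rng G k) \<cdot> k"
    have M: "compact (?k ` K)"
      by (intro compact_continuous_image K cont_mult continuous_on_compose2[OF S(5) cont_rng'] continuous_on_id) (auto simp: S(2))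
    have F0: "?F t = 0" if t: "t \<notin> ?k ` K" for t
    proof (rule ccontr)
      assume n: "?F t \<noteq> 0"
      let ?w = "ginv G (?g (rng G t)) \<cdot> t"
      have w: "?w \<in> K" using n K(2) by blast
      have "at_src G a (rng G ?w) = ?g (rng G t)" using S(4)[OF R(1)[OF rng_units]] by (simp add: rng_mult R(2))
      then have "t = ?k ?w" by (simp add: inv_cancel2 R(2))
      then have "t \<in> ?k ` K" using w by (rule image_eqI)
      then show False using t by contradiction
    qed
    have F: "?F \<in> Cc"
    proof (rule CcI[OF _ M F0])
      show "continuous_on UNIV ?F"
        by (intro continuous_on_compose2[OF Cc_cont[OF h, of UNIV]] cont_mult continuous_on_compose2[OF cont_inv[of UNIV]]
            continuous_on_compose2[OF R(5) cont_rng'] continuous_on_id) (auto simp: R(2))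
    qed
    \<comment> \<open>The compact operators are spanned by the maps b <F, .> with b in D. Taking b =
      1 over the support of F, where alone the inner product can be nonzero, makes T equal to a
      single such map.\<close>
    obtain b where b: "b \<in> D G" "\<And>u. u \<in> rng G ` ?k ` K \<Longrightarrow> b u = 1"
      by (rule D_bump[of "rng G ` ?k ` K" "{}"]) (auto intro!: compact_continuous_image[OF cont_rng' M])
    have Tb: "?T \<eta> u = b u * L2_inner G u ?F \<eta>" if u: "u \<in> units G" for u \<eta>
    proof -
      have "?T \<eta> u = L2_inner G u (\<lambda>t. h (ginv G (?g u) \<cdot> t)) \<eta>" using u R(2)[OF u] by (simp add: ev_def ch coef_def)
      also have "\<dots> = L2_inner G u ?F \<eta>"
        unfolding L2_inner_def using u by (intro Bochner_Integration.integral_cong) (auto simp: space_haar)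
      also have "\<dots> = b u * L2_inner G u ?F \<eta>"
      proof (cases "u \<in> rng G ` ?k ` K")
        case False
        have "?F t = 0" if "rng G t = u" for t
        proof (rule F0)
          show "t \<notin> ?k ` K" using False that by blast
        qed
        then have "(\<integral>t. cnj (?F t) * \<eta> t \<partial>haar G u) = (\<integral>t. 0 \<partial>haar G u)"
          using u by (intro Bochner_Integration.integral_cong refl) (simp add: space_haar)
        then show ?thesis by (simp add: L2_inner_def)
      qed (simp add: b(2))
      finally show ?thesis .
    qed
    have bl: "bounded_linear_map (E2 G) (E2_norm G) (D G) (D_norm G) ?T"
      unfolding bounded_linear_map_def
    proof (intro conjI ballI allI exI[of _ "E2_norm G (check G f)"])
      show "?T \<eta> \<in> D G" if "\<eta> \<in> E2 G" for \<eta> by (rule evD(1)[OF _ conv_fa(1)[OF f that]])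
      show "D_norm G (?T \<eta>) \<le> E2_norm G (check G f) * E2_norm G \<eta>" if "\<eta> \<in> E2 G" for \<eta>
        by (rule order_trans[OF evD(2)[OF _ conv_fa(1)[OF f that]] conv_fa(2)[OF f that]])
    qed (auto simp: ev_def ch coef_def L2_add[OF L] L2_scale[OF L] E2_Lsq fun_eq_iff)
    have rm: "right_module_map G (E2 G) ?T"
      unfolding right_module_map_def by (auto simp: ev_def ch coef_right R(2))
    have "\<exists>(n::nat) b \<xi>. (\<forall>i<n. b i \<in> D G \<and> \<xi> i \<in> E2 G) \<and>
        (\<forall>\<eta>\<in>E2 G. D_norm G (\<lambda>u. ?T \<eta> u - (\<Sum>i<n. b i u * L2_inner G u (\<xi> i) \<eta>)) \<le> e * E2_norm G \<eta>)" if "e > 0" for e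
    proof (rule exI[of _ 1], rule exI[of _ "\<lambda>_. b"], rule exI[of _ "\<lambda>_. ?F"], intro conjI ballI)
      show "\<forall>i<(1::nat). b \<in> D G \<and> ?F \<in> E2 G" using b(1) Cc_E2[OF F] by simp
      fix \<eta> assume eta: "\<eta> \<in> E2 G"
      have "D_norm G (\<lambda>u. ?T \<eta> u - (\<Sum>i<(1::nat). b u * L2_inner G u ?F \<eta>)) \<le> 0"
        unfolding sup_norm_def by (rule cSUP_least[OF units_nonempty]) (simp add: Tb)
      then show "D_norm G (\<lambda>u. ?T \<eta> u - (\<Sum>i<(1::nat). b u * L2_inner G u ?F \<eta>)) \<le> e * E2_norm G \<eta>"
        by (rule order_trans) (use \<open>e > 0\<close> E2_norm_nonneg[OF eta] in simp)
    qed
    then show "compact_module_map G ?T" unfolding compact_module_map_def using bl rm by blast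
  qed
  ultimately show ?thesis unfolding calA_K_dual_def by blast
qed

lemma zeta_mult_module_maps:
  assumes a: "a \<in> bisections G"
  shows "zeta G a \<in> mult_module_maps G"
proof -
  have ar: "homeomorphic_map (top_of_set a) (top_of_set (units G)) (rng G)"
    and as: "homeomorphic_map (top_of_set a) (top_of_set (units G)) (src G)" using a by (simp_all add: bisections_def)
  note R = at_rng[OF ar] and S = at_src[OF as]
  let ?A = "restrict (ev (at_rng G a)) (fourier_alg G)" and ?B = "restrict (ev (at_src G a)) (fourier_alg G)"
  have nz: "\<exists>\<phi>\<in>fourier_alg G. ?A \<phi> u \<noteq> 0" if u: "u \<in> units G" for u
  proof -
    obtain \<phi> where "\<phi> \<in> A_cf_alg G" "\<phi> (at_rng G a u) = 1" by (rule fa_bump[of UNIV "at_rng G a u"]) auto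
    then show ?thesis using u A_cf_alg_fa by (intro bexI[of _ \<phi>]) (auto simp: ev_def)
  qed
  have J: "\<exists>J. homeomorphic_map (top_of_set (units G)) (top_of_set (units G)) J \<and>
      (\<forall>\<phi>\<in>fourier_alg G. \<forall>u\<in>units G. ?B \<phi> (J u) = ?A \<phi> u)"
  proof (intro exI conjI ballI)
    \<comment> \<open>J sends the range of an element of the bisection to its source.\<close>
    show "homeomorphic_map (top_of_set (units G)) (top_of_set (units G)) (src G \<circ> at_rng G a)"
      by (rule homeomorphic_map_compose[OF R(6) as])
    show "?B \<phi> ((src G \<circ> at_rng G a) u) = ?A \<phi> u" if "\<phi> \<in> fourier_alg G" "u \<in> units G" for \<phi> u
      using that S(4)[OF R(1)[OF that(2)]] by (simp add: ev_def)
  qed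
  have rest: "restrict ?A (calA G) = restrict (ev (at_rng G a)) (calA G)" using calA_fa by (auto simp: fun_eq_iff)
  have rm: "right_module_map G (fourier_alg G) ?A"
    unfolding right_module_map_def using fa_right by (auto simp: ev_def R(2))
  have lm: "left_module_map G (fourier_alg G) ?B"
    unfolding left_module_map_def using fa_left by (auto simp: ev_def S(2))
  have mu: "\<forall>\<phi>\<in>fourier_alg G. \<forall>\<psi>\<in>fourier_alg G. ?A (\<lambda>x. \<phi> x * \<psi> x) = (\<lambda>u. ?A \<phi> u * ?A \<psi> u)"
    using fa_mult by (auto simp: ev_def)
  note 1 = ev_bounded_linear[OF R(5) cont_rng R(2)] and 2 = ev_bounded_linear[OF S(5) cont_src S(2)]
  show ?thesis
    unfolding zeta_ev mult_module_maps_def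
    by (intro CollectI case_prodI conjI 1 2 rm lm J mu ballI nz restrict_extensional ev_calA_K_dual[OF a, folded rest])
qed

end

section \<open>Topologies of pointwise convergence\<close>

text \<open>Both topologies of the theorem are initial topologies for a family of evaluations. This
  common form lets continuity into either of them be tested by \<open>ptwiseI\<close>.\<close>

definition ptwise :: "'a set \<Rightarrow> ('a \<Rightarrow> 'i \<Rightarrow> 'b::topological_space) \<Rightarrow> 'i set \<Rightarrow> 'a topology" where
  "ptwise A F I = pullback_topology A (\<lambda>a. restrict (F a) I) (product_topology (\<lambda>_. euclidean) I)"

lemma topspace_ptwise: "topspace (ptwise A F I) = A"
  by (auto simp: ptwise_def topspace_pullback_topology)

lemma ptwise_eval:
  assumes "i \<in> I"
  shows "continuous_map (ptwise A F I) euclidean (\<lambda>a. F a i)"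
proof -
  have "continuous_map (product_topology (\<lambda>_. euclidean) I) euclidean (\<lambda>x. x i)"
    using assms by (rule continuous_map_product_projection)
  from continuous_map_pullback[OF this]
  have "continuous_map (ptwise A F I) euclidean ((\<lambda>x. x i) \<circ> (\<lambda>a. restrict (F a) I))" unfolding ptwise_def .
  moreover have "(\<lambda>x. x i) \<circ> (\<lambda>a. restrict (F a) I) = (\<lambda>a. F a i)" using assms by auto
  ultimately show ?thesis by simp
qed

lemma ptwiseI:
  assumes "\<And>i. i \<in> I \<Longrightarrow> continuous_map T euclidean (\<lambda>t. F (g t) i)" "\<And>t. t \<in> topspace T \<Longrightarrow> g t \<in> A"
  shows "continuous_map T (ptwise A F I) g"
  unfolding ptwise_def
proof (rule continuous_map_pullback')
  show "continuous_map T (product_topology (\<lambda>_. euclidean) I) ((\<lambda>a. restrict (F a) I) \<circ> g)"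
    unfolding continuous_map_componentwise by (auto simp: assms(1))
qed (use assms(2) in blast)

lemma continuous_map_Pair_euclidean:
  assumes "continuous_map X euclidean f" "continuous_map X euclidean g"
  shows "continuous_map X euclidean (\<lambda>x. (f x, g x))"
proof -
  have "continuous_map X (prod_topology euclidean euclidean) (\<lambda>x. (f x, g x))"
    unfolding continuous_map_pairwise using assms by (simp add: comp_def)
  then show ?thesis by simp
qed

lemma continuous_map_comp_euclidean:
  assumes "continuous_map X euclidean f" "continuous_on UNIV h"
  shows "continuous_map X euclidean (\<lambda>x. h (f x))"
  using continuous_map_compose[OF assms(1), of euclidean h] assms(2) by (simp add: comp_def)

context lcg
begin

lemma fa_separates:
  assumes "\<And>\<phi>. \<phi> \<in> fourier_alg G \<Longrightarrow> \<phi> x = \<phi> y"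
  shows "x = y"
proof (rule ccontr)
  assume n: "x \<noteq> y"
  obtain \<phi> where "\<phi> \<in> A_cf_alg G" "\<phi> x = 1" "\<And>z. z \<notin> - {y} \<Longrightarrow> \<phi> z = 0"
    by (rule fa_bump[of "- {y}" x]) (use n in auto)
  then show False using assms[OF A_cf_alg_fa, of \<phi>] by simp
qed

text \<open>Around each point the Fourier algebra has functions that are 1 at the point and 0 off a
  given neighbourhood, so the topology of the groupoid is the initial one for this algebra. It gives
  continuity of the bisection attached to a pair of maps and of the inverse of
  \<open>zeta\<close>.\<close>

lemma fa_continuous_map:
  assumes "\<And>\<phi>. \<phi> \<in> fourier_alg G \<Longrightarrow> continuous_map X euclidean (\<lambda>m. \<phi> (x m))"
  shows "continuous_map X euclidean x"
  unfolding continuous_map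
proof (intro conjI allI impI)
  fix N :: "'g set" assume "openin euclidean N"
  then have N: "open N" by simp
  show "openin X {m \<in> topspace X. x m \<in> N}"
  proof (subst openin_subopen, intro ballI)
    fix m assume m: "m \<in> {m \<in> topspace X. x m \<in> N}"
    obtain \<phi> where phi: "\<phi> \<in> A_cf_alg G" "\<phi> (x m) = 1" "\<And>y. y \<notin> N \<Longrightarrow> \<phi> y = 0"
      by (rule fa_bump[OF N, of "x m"]) (use m in auto)
    have "openin X {m \<in> topspace X. \<phi> (x m) \<in> - {0}}"
      by (rule openin_continuous_map_preimage[OF assms[OF A_cf_alg_fa[OF phi(1)]]]) auto
    then show "\<exists>T. openin X T \<and> m \<in> T \<and> T \<subseteq> {m \<in> topspace X. x m \<in> N}"
      by (intro exI[of _ "{m \<in> topspace X. \<phi> (x m) \<in> - {0}}"] conjI) (use m phi(2,3) in auto)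
  qed
qed simp

lemma zeta_inj: "inj_on (zeta G) (bisections G)"
proof (rule inj_onI)
  fix a b assume a: "a \<in> bisections G" and b: "b \<in> bisections G" and eq: "zeta G a = zeta G b"
  have h: "homeomorphic_map (top_of_set a) (top_of_set (units G)) (rng G)"
    "homeomorphic_map (top_of_set b) (top_of_set (units G)) (rng G)" using a b by (simp_all add: bisections_def)
  have "at_rng G a u = at_rng G b u" if u: "u \<in> units G" for u
  proof (rule fa_separates)
    fix \<phi> assume phi: "\<phi> \<in> fourier_alg G"
    have "fst (zeta G a) \<phi> u = fst (zeta G b) \<phi> u" using eq by simp
    then show "\<phi> (at_rng G a u) = \<phi> (at_rng G b u)" using phi u by (simp add: zeta_def)
  qed
  then have "at_rng G a ` units G = at_rng G b ` units G" by (rule image_cong[OF refl])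
  moreover have "at_rng G c ` units G = c" if "homeomorphic_map (top_of_set c) (top_of_set (units G)) (rng G)" for c
    using homeomorphic_imp_surjective_map[OF at_rng(6)[OF that]] by simp
  ultimately show "a = b" using h by simp
qed

lemma zeta_surj:
  assumes m: "(\<alpha>, \<beta>) \<in> mult_module_maps G"
  shows "\<exists>a\<in>bisections G. zeta G a = (\<alpha>, \<beta>)"
proof -
  have ext: "\<alpha> \<in> extensional (fourier_alg G)" "\<beta> \<in> extensional (fourier_alg G)"
    and bl: "bounded_linear_map (fourier_alg G) (B_norm G) (D G) (D_norm G) \<alpha>"
      "bounded_linear_map (fourier_alg G) (B_norm G) (D G) (D_norm G) \<beta>"
    and rm: "right_module_map G (fourier_alg G) \<alpha>" and lm: "left_module_map G (fourier_alg G) \<beta>"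
    and nz: "\<forall>u\<in>units G. \<exists>\<phi>\<in>fourier_alg G. \<alpha> \<phi> u \<noteq> 0"
    and Jex: "\<exists>J. homeomorphic_map (top_of_set (units G)) (top_of_set (units G)) J \<and>
        (\<forall>\<phi>\<in>fourier_alg G. \<forall>u\<in>units G. \<beta> \<phi> (J u) = \<alpha> \<phi> u)"
    and mu: "\<forall>\<phi>\<in>fourier_alg G. \<forall>\<psi>\<in>fourier_alg G. \<alpha> (\<lambda>x. \<phi> x * \<psi> x) = (\<lambda>u. \<alpha> \<phi> u * \<alpha> \<psi> u)"
    using m unfolding mult_module_maps_def mem_Collect_eq prod.case by - (elim conjE, assumption)+
  obtain J where J: "homeomorphic_map (top_of_set (units G)) (top_of_set (units G)) J"
    and JE: "\<And>\<phi> u. \<phi> \<in> fourier_alg G \<Longrightarrow> u \<in> units G \<Longrightarrow> \<beta> \<phi> (J u) = \<alpha> \<phi> u" using Jex by blast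
  have Ju: "J ` units G = units G" using homeomorphic_imp_surjective_map[OF J] by simp
  have D: "\<alpha> \<phi> \<in> D G" "\<beta> \<phi> \<in> D G" if "\<phi> \<in> fourier_alg G" for \<phi> using bl that by (simp_all add: bounded_linear_map_def)
  obtain C where C: "\<And>\<phi>. \<phi> \<in> fourier_alg G \<Longrightarrow> D_norm G (\<alpha> \<phi>) \<le> C * B_norm G \<phi>"
    using bl(1) unfolding bounded_linear_map_def by blast
  have "\<exists>x0. rng G x0 = u \<and> (\<forall>\<phi>\<in>fourier_alg G. \<alpha> \<phi> u = \<phi> x0)" if u: "u \<in> units G" for u
  proof -
    obtain \<phi>1 where "\<phi>1 \<in> fourier_alg G" "\<alpha> \<phi>1 u \<noteq> 0" using nz u by blast
    then show ?thesis
    proof (rule char_eval[OF u, rotated 5])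
      fix \<phi> \<psi> c b assume phi: "\<phi> \<in> fourier_alg G"
      show "\<alpha> (\<lambda>x. c * \<phi> x) u = c * \<alpha> \<phi> u" using bl(1) phi by (simp add: bounded_linear_map_def)
      show "\<alpha> (\<lambda>x. \<phi> x * b (rng G x)) u = \<alpha> \<phi> u * b u" if "b \<in> D G" using rm phi that by (simp add: right_module_map_def)
      obtain M where "\<And>u. u \<in> units G \<Longrightarrow> cmod (\<alpha> \<phi> u) \<le> M" by (rule D_bounded[OF D(1)[OF phi]]) blast
      then have "bdd_above ((\<lambda>u. cmod (\<alpha> \<phi> u)) ` units G)" by (intro bdd_aboveI2)
      then have "cmod (\<alpha> \<phi> u) \<le> D_norm G (\<alpha> \<phi>)" unfolding sup_norm_def using u by (intro cSUP_upper)
      then show "cmod (\<alpha> \<phi> u) \<le> C * B_norm G \<phi>" using C[OF phi] by (rule order_trans)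
      assume psi: "\<psi> \<in> fourier_alg G"
      show "\<alpha> (\<lambda>x. \<phi> x + \<psi> x) u = \<alpha> \<phi> u + \<alpha> \<psi> u" using bl(1) phi psi by (simp add: bounded_linear_map_def)
      show "\<alpha> (\<lambda>x. \<phi> x * \<psi> x) u = \<alpha> \<phi> u * \<alpha> \<psi> u" using mu phi psi by simp
    qed
  qed
  then have "\<forall>u\<in>units G. \<exists>x0. rng G x0 = u \<and> (\<forall>\<phi>\<in>fourier_alg G. \<alpha> \<phi> u = \<phi> x0)" ..
  from bchoice[OF this] obtain x where
    "\<forall>u\<in>units G. rng G (x u) = u \<and> (\<forall>\<phi>\<in>fourier_alg G. \<alpha> \<phi> u = \<phi> (x u))" ..
  then have x: "rng G (x u) = u" "\<And>\<phi>. \<phi> \<in> fourier_alg G \<Longrightarrow> \<alpha> \<phi> u = \<phi> (x u)" if "u \<in> units G" for u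
    using that by blast+
  have cx: "continuous_map (top_of_set (units G)) euclidean x"
  proof (rule fa_continuous_map)
    fix \<phi> assume phi: "\<phi> \<in> fourier_alg G"
    have "continuous_on (units G) (\<lambda>u. \<phi> (x u))"
      using D_cont[OF D(1)[OF phi]] by (rule continuous_on_eq) (simp add: x(2) phi)
    then show "continuous_map (top_of_set (units G)) euclidean (\<lambda>u. \<phi> (x u))" by simp
  qed
  \<comment> \<open>If the source differed from J u, some b in D would be 1 at the source and 0 at J
    u. Multiplying \<phi> by b at the source would make \<beta> vanish at J u, and so \<alpha> at u,
    although the value of \<phi> at x u is unchanged.\<close>
  have sx: "src G (x u) = J u" if u: "u \<in> units G" for u
  proof (rule ccontr)
    assume n: "src G (x u) \<noteq> J u"
    obtain b where b: "b \<in> D G" "b (src G (x u)) = 1" "b (J u) = 0"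
      by (rule D_bump[of "{src G (x u)}" "{J u}"]) (use n in auto)
    obtain \<phi> where phi: "\<phi> \<in> fourier_alg G" "\<alpha> \<phi> u \<noteq> 0" using nz u by blast
    note bphi = fa_left[OF phi(1) b(1)]
    have "\<beta> (\<lambda>x. b (src G x) * \<phi> x) (J u) = b (J u) * \<beta> \<phi> (J u)" using lm phi(1) b(1) by (simp add: left_module_map_def)
    then have "b (src G (x u)) * \<phi> (x u) = 0" using JE[OF bphi u] x(2)[OF u bphi] b(3) by simp
    then show False using b(2) phi x(2)[OF u] by simp
  qed
  define a where "a = x ` units G"
  have "homeomorphic_maps (top_of_set a) (top_of_set (units G)) (rng G) x"
    unfolding homeomorphic_maps_def using cx x(1) cont_rng'
    by (auto simp: a_def continuous_map_in_subtopology)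
  then have ar: "homeomorphic_map (top_of_set a) (top_of_set (units G)) (rng G)" by (rule homeomorphic_maps_imp_map)
  \<comment> \<open>On these points the source map is J composed with the range map, by
    \<open>sx\<close>, and both are homeomorphisms.\<close>
  have "homeomorphic_map (top_of_set a) (top_of_set (units G)) (src G)"
    using homeomorphic_map_compose[OF ar J] by (rule homeomorphic_map_eq) (auto simp: a_def x(1) sx)
  note as = this
  have atr: "at_rng G a u = x u" if u: "u \<in> units G" for u
    using at_rng(4)[OF ar, of "x u"] u by (simp add: a_def x(1))
  have ats: "at_src G a (J u) = x u" if u: "u \<in> units G" for u
    using at_src(4)[OF as, of "x u"] u by (simp add: a_def sx)
  have "zeta G a = (\<alpha>, \<beta>)"
    unfolding zeta_ev
  proof (intro prod_eqI; simp; intro extensionalityI[OF restrict_extensional])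
    show "\<alpha> \<in> extensional (fourier_alg G)" "\<beta> \<in> extensional (fourier_alg G)" by (rule ext)+
    fix \<phi> assume phi: "\<phi> \<in> fourier_alg G"
    have "ev (at_rng G a) \<phi> u = \<alpha> \<phi> u" for u
      using D_zero[OF D(1)[OF phi], of u] phi by (cases "u \<in> units G") (simp_all add: ev_def atr x(2))
    then show "restrict (ev (at_rng G a)) (fourier_alg G) \<phi> = \<alpha> \<phi>" using phi by auto
    have "ev (at_src G a) \<phi> u = \<beta> \<phi> u" for u
    proof (cases "u \<in> units G")
      case True
      then obtain v where "v \<in> units G" "u = J v" using Ju by blast
      then show ?thesis using True JE[OF phi] x(2)[OF _ phi] by (simp add: ev_def ats)
    next
      case False
      then show ?thesis using D_zero[OF D(2)[OF phi] False] by (simp add: ev_def)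
    qed
    then show "restrict (ev (at_src G a)) (fourier_alg G) \<phi> = \<beta> \<phi>" using phi by auto
  qed
  then show ?thesis using ar as by (auto simp: bisections_def)
qed

lemma bisections_topology_ptwise:
  "bisections_topology G = ptwise (bisections G) (\<lambda>a u. (at_src G a u, at_rng G a u)) (units G)"
  by (simp add: bisections_topology_def ptwise_def)

lemma mult_module_maps_topology_ptwise:
  "mult_module_maps_topology G =
    ptwise (mult_module_maps G) (\<lambda>m (\<phi>, u). (fst m \<phi> u, snd m \<phi> u)) (fourier_alg G \<times> units G)"
  by (simp add: mult_module_maps_topology_def ptwise_def case_prod_unfold)

theorem zeta_homeomorphic: "homeomorphic_map (bisections_topology G) (mult_module_maps_topology G) (zeta G)"
proof -
  let ?X = "bisections_topology G" and ?Y = "mult_module_maps_topology G"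
  have bij: "bij_betw (zeta G) (bisections G) (mult_module_maps G)"
    unfolding bij_betw_def using zeta_inj zeta_mult_module_maps zeta_surj by (auto simp: image_iff) metis
  define h where "h = inv_into (bisections G) (zeta G)"
  have h: "h m \<in> bisections G" "zeta G (h m) = m" if "m \<in> mult_module_maps G" for m
    using that bij bij_betw_inv_into_right[OF bij] bij_betw_apply[OF bij_betw_inv_into[OF bij]] unfolding h_def by auto
  have hz: "h (zeta G a) = a" if "a \<in> bisections G" for a
    unfolding h_def by (rule bij_betw_inv_into_left[OF bij that])
  have tX: "topspace ?X = bisections G" and tY: "topspace ?Y = mult_module_maps G"
    by (simp_all add: bisections_topology_ptwise mult_module_maps_topology_ptwise topspace_ptwise)
  have "continuous_map ?X ?Y (zeta G)"
    unfolding mult_module_maps_topology_ptwise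
  proof (rule ptwiseI)
    fix i assume "i \<in> fourier_alg G \<times> units G"
    then obtain \<phi> u where i: "i = (\<phi>, u)" "\<phi> \<in> fourier_alg G" "u \<in> units G" by blast
    have e: "continuous_map ?X euclidean (\<lambda>a. (at_src G a u, at_rng G a u))"
      unfolding bisections_topology_ptwise by (rule ptwise_eval[OF i(3)])
    \<comment> \<open>The pair of arrows lists the one given by its source first, whereas \<alpha>,
      which evaluates along the range, is the first map; hence the exchanged projections.\<close>
    have "continuous_on UNIV (\<lambda>p. (\<phi> (snd p), \<phi> (fst p)))"
      by (intro continuous_on_Pair continuous_on_compose2[OF fa_cont[OF i(2), of UNIV]] continuous_on_fst continuous_on_snd continuous_on_id) auto
    from continuous_map_comp_euclidean[OF e this]
    show "continuous_map ?X euclidean (\<lambda>a. case i of (\<phi>, u) \<Rightarrow> (fst (zeta G a) \<phi> u, snd (zeta G a) \<phi> u))"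
      using i by (simp add: zeta_def)
  qed (simp add: tX zeta_mult_module_maps)
  moreover have "continuous_map ?Y ?X h"
    unfolding bisections_topology_ptwise
  proof (rule ptwiseI)
    fix u assume u: "u \<in> units G"
    have c: "continuous_map ?Y euclidean (\<lambda>m. fst m \<phi> u)" "continuous_map ?Y euclidean (\<lambda>m. snd m \<phi> u)" if phi: "\<phi> \<in> fourier_alg G" for \<phi>
    proof -
      have "continuous_map ?Y euclidean (\<lambda>m. case (\<phi>, u) of (\<phi>, u) \<Rightarrow> (fst m \<phi> u, snd m \<phi> u))"
        unfolding mult_module_maps_topology_ptwise by (rule ptwise_eval) (use phi u in blast)
      then have e: "continuous_map ?Y euclidean (\<lambda>m. (fst m \<phi> u, snd m \<phi> u))" by simp
      show "continuous_map ?Y euclidean (\<lambda>m. fst m \<phi> u)" "continuous_map ?Y euclidean (\<lambda>m. snd m \<phi> u)"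
        using continuous_map_comp_euclidean[OF e continuous_on_fst[OF continuous_on_id]]
          continuous_map_comp_euclidean[OF e continuous_on_snd[OF continuous_on_id]] by simp_all
    qed
    have ev: "fst m \<phi> u = \<phi> (at_rng G (h m) u)" "snd m \<phi> u = \<phi> (at_src G (h m) u)" if "m \<in> topspace ?Y" "\<phi> \<in> fourier_alg G" for m \<phi>
    proof -
      have "fst (zeta G (h m)) \<phi> u = \<phi> (at_rng G (h m) u)" "snd (zeta G (h m)) \<phi> u = \<phi> (at_src G (h m) u)"
        using u that(2) by (simp_all add: zeta_def)
      then show "fst m \<phi> u = \<phi> (at_rng G (h m) u)" "snd m \<phi> u = \<phi> (at_src G (h m) u)" using h(2) that(1) by (simp_all add: tY)
    qed
    have "continuous_map ?Y euclidean (\<lambda>m. at_src G (h m) u)"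
      by (rule fa_continuous_map, rule continuous_map_eq[OF c(2)], assumption, rule ev(2))
    moreover have "continuous_map ?Y euclidean (\<lambda>m. at_rng G (h m) u)"
      by (rule fa_continuous_map, rule continuous_map_eq[OF c(1)], assumption, rule ev(1))
    ultimately show "continuous_map ?Y euclidean (\<lambda>m. (at_src G (h m) u, at_rng G (h m) u))"
      by (rule continuous_map_Pair_euclidean)
  qed (simp add: tY h)
  ultimately have "homeomorphic_maps ?X ?Y (zeta G) h" using h(2) hz by (simp add: homeomorphic_maps_def tX tY)
  then show ?thesis by (rule homeomorphic_maps_imp_map)
qed

end

theorem theorem5:
  fixes G :: "'g::{second_countable_topology, t2_space} haar_groupoid"
  assumes "lc_haar_groupoid G"
    and "locally_a_product G"
    and "\<forall>x. \<exists>a\<in>bisections G. x \<in> a"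
  shows "homeomorphic_map (bisections_topology G) (mult_module_maps_topology G) (zeta G)"
proof -
  interpret lcg G by standard (rule assms(1))
  show ?thesis by (rule zeta_homeomorphic)
qed

end
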